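(* Let $\mathcal U$ be an $n$-dimensional manifold ($n\ge 2$), in the holomorphic or in the real analytic category, equipped with an $(n+1)$-web of curves in general position, locally defined by foliations $\mathcal F_1,\dots,\mathcal F_{n+1}$. Let $E=\ker\big(\mathrm{Tr}:\bigoplus_{\lambda=1}^{n+1}T(\mathcal F_\lambda)\to T\mathcal U\big)$ be the associated line bundle. For every nowhere vanishing local section $\sigma=(V_\lambda)_{1\le\lambda\le n+1}$ of $E$, let $A_1,\dots,A_n$ be the $(n-1)$-forms, $\omega$ the $1$-form and $\Omega=d\omega$ the $2$-form attached to $\sigma$ as defined in the context, and let $\widehat\sigma$ be the local section of $E^*$ dual to $\sigma$. Then: (i) The non-zero local abelian relations of the web are identified with the nowhere vanishing functions $f$ such that $$d(\log f)=-\omega$$ (that is, $df=-f\omega$), the function $f$ corresponding to the abelian relation $(fA_1,\dots,fA_n,-\sum_{i=1}^n fA_i)$. Consequently the web has rank $1$ if $\Omega=0$ and rank $0$ if $\Omega\ne0$ (i.e. $\Omega$ not identically zero). (ii) The connection $\nabla$ defined locally on $\bigotimes^{n-1}E^*$ by $$\nabla\big(\widehat\sigma^{\otimes(n-1)}\big)=\omega\cdot\widehat\sigma^{\otimes(n-1)}$$ depends neither on the order of the vector fields $V_\lambda$ nor on the local section $\sigma=(V_\lambda)_\lambda$ of $E$; the connections thus defined locally glue together and define a global connection on $\bigotimes^{n-1}E^*$. The abelian relations of the web are thereby identified with the sections of $\bigotimes^{n-1}E^*$ with zero covariant derivative (the relation given by $f$ corresponding to $f\,\widehat\sigma^{\otimes(n-1)}$),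 and the web has rank $1$ or $0$ according to whether the curvature $\Omega$ of this connection is zero or not. (iii) For $n=2$, the curvature $\Omega$ is the Blaschke curvature of the $3$-web.
   Context: Everything is holomorphic, or everything is real analytic. The manifold $\mathcal U$ is connected, and local sections are taken over connected open sets. Web: an $(n+1)$-web of curves on the $n$-dimensional manifold $\mathcal U$ is locally defined by $n+1$ one-dimensional foliations $\mathcal F_1,\dots,\mathcal F_{n+1}$ with tangent line bundles $T(\mathcal F_\lambda)\subset T\mathcal U$. General position: if $V_\lambda$ is a local vector field generating $T(\mathcal F_\lambda)$, any $n$ of the $n+1$ vector fields $V_\lambda$ are linearly independent at every point. Abelian relations and rank: a $p$-form $\eta$ is $\mathcal F$-basic if $\iota_v\eta=0$ and $L_v\eta=0$ for every vector field $v$ tangent to $\mathcal F$. A (local) abelian relation is a family $(\eta_\lambda)_{1\le\lambda\le n+1}$ of $(n-1)$-forms on an open set such that $\sum_\lambda\eta_\lambda=0$ and each $\eta_\lambda$ is $\mathcal F_\lambda$-basic. The rank of the web is the maximal dimension of the vector space of germs of abelian relations at a point; it is known to be $0$ or $1$. The line bundle $E$: the map $\mathrm{Tr}:(V_1,\dots,V_{n+1})\mapsto V_1+\dots+V_{n+1}$ from $\bigoplus_{\lambda}T(\mathcal F_\lambda)$ to $T\mathcal U$ has rank $n$ at every point, so its kernel $E$ is a line bundle. A nowhere vanishing local section of $E$ is a family $\sigma=(V_\lambda)_\lambda$ with $V_\lambda$ a nowhere vanishing section of $T(\mathcal F_\lambda)$ and $\sum_{\lambda=1}^{n+1}V_\lambda=0$.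 The section $\widehat\sigma$ of $E^*$ is the one taking the value $1$ on $\sigma$. Forms attached to $\sigma$: $(V_1,\dots,V_n)$ is a local frame of $T\mathcal U$; let $(\alpha_1,\dots,\alpha_n)$ be the dual coframe of $1$-forms. Write $[V_i,V_j]=\sum_k C_{ij}^kV_k$ for $1\le i,j\le n$. For $1\le i\le n$ set $$A_i=(-1)^{i+1}\bigwedge_{j\ne i}\alpha_j\quad(\text{indices } j \text{ in increasing order}),\qquad \varphi_i=\sum_{j<i}C_{ji}^j-\sum_{j>i}C_{ij}^j,$$ so that $dA_i=\varphi_i\,\alpha_1\wedge\dots\wedge\alpha_n$. Set $\omega=\sum_{i=1}^n\varphi_i\alpha_i$ and $\Omega=d\omega$. Blaschke curvature ($n=2$): for a $3$-web on a surface in general position, choose locally $1$-forms $\theta_1,\theta_2,\theta_3$ with $\ker\theta_\lambda=T(\mathcal F_\lambda)$ and $\theta_1+\theta_2+\theta_3=0$; there is a unique $1$-form $\gamma$ with $d\theta_\lambda=\gamma\wedge\theta_\lambda$ for $\lambda=1,2,3$, and the $2$-form $d\gamma$, which does not depend on the choices, is the Blaschke curvature. *)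

theory Defs
  imports "HOL-Analysis.Analysis" "HOL-Library.Function_Algebras"
begin

text \<open>
  The scalar field is a type of sort \<open>{real_normed_field, euclidean_space}\<close>.  Its instances are
  \<open>real\<close> (real analytic category) and \<open>complex\<close> (holomorphic category); up to isomorphism there are no
  others, since a finite-dimensional real commutative division algebra is the reals or the complex
  numbers.

  Tangent vectors, forms and sections are functions, added pointwise by the instances of
  \<open>Function_Algebras\<close>; the two scalar multiplications by the field are written out.

  Functions, forms and sections over an open set \<open>N\<close> that have to be compared by \<open>=\<close> are extended
  by zero outside \<open>N\<close>.
\<close>

definition fscale :: "'k::times \<Rightarrow> ('x \<Rightarrow> 'k) \<Rightarrow> 'x \<Rightarrow> 'k" where
  "fscale c g = (\<lambda>x. c * g x)"

definition fscale2 :: "'k::times \<Rightarrow> ('y \<Rightarrow> 'x \<Rightarrow> 'k) \<Rightarrow> 'y \<Rightarrow> 'x \<Rightarrow> 'k" where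
  "fscale2 c g = (\<lambda>y. fscale c (g y))"


section \<open>Analytic manifolds\<close>

definition power_series_at ::
  "('k::{real_normed_field,euclidean_space}^'n \<Rightarrow> 'k) \<Rightarrow> 'k^'n \<Rightarrow> bool" where
  "power_series_at f a \<longleftrightarrow>
     (\<exists>(c :: ('n \<Rightarrow> nat) \<Rightarrow> 'k) r. r > 0 \<and>
        (\<forall>x. (\<forall>i. norm (x $ i - a $ i) < r) \<longrightarrow>
           ((\<lambda>m. c m * (\<Prod>i\<in>UNIV. (x $ i - a $ i) ^ m i)) has_sum f x) UNIV))"

type_synonym ('a, 'k, 'n) atlas = "('a set \<times> ('a \<Rightarrow> 'k^'n)) set"

definition analytic_manifold ::
  "('a::{t2_space,second_countable_topology}, 'k::{real_normed_field,euclidean_space}, 'n::finite) atlas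
     \<Rightarrow> bool" where
  "analytic_manifold \<A> \<longleftrightarrow>
     (\<Union>(D, \<phi>)\<in>\<A>. D) = UNIV \<and>
     (\<forall>(D, \<phi>)\<in>\<A>. open D \<and> open (\<phi> ` D) \<and> homeomorphism D (\<phi> ` D) \<phi> (inv_into D \<phi>)) \<and>
     (\<forall>(D, \<phi>)\<in>\<A>. \<forall>(D', \<phi>')\<in>\<A>. \<forall>p\<in>D \<inter> D'. \<forall>i.
        power_series_at (\<lambda>x. \<phi>' (inv_into D \<phi> x) $ i) (\<phi> p))"

definition mdim :: "('a, 'k, 'n::finite) atlas \<Rightarrow> nat" where
  "mdim \<A> = CARD('n)"

definition mfd_analytic_at ::
  "('a::topological_space, 'k::{real_normed_field,euclidean_space}, 'n::finite) atlas \<Rightarrow> 'a \<Rightarrow> ('a \<Rightarrow> 'k) \<Rightarrow> bool" where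
  "mfd_analytic_at \<A> p f \<longleftrightarrow>
     (\<exists>(D, \<phi>)\<in>\<A>. p \<in> D \<and> power_series_at (\<lambda>x. f (inv_into D \<phi> x)) (\<phi> p))"

definition mfd_analytic ::
  "('a::topological_space, 'k::{real_normed_field,euclidean_space}, 'n::finite) atlas \<Rightarrow> 'a set \<Rightarrow> ('a \<Rightarrow> 'k) \<Rightarrow> bool" where
  "mfd_analytic \<A> N f \<longleftrightarrow> (\<forall>p\<in>N. mfd_analytic_at \<A> p f)"


section \<open>Tangent vectors and vector fields\<close>

type_synonym ('a, 'k) tvec = "('a \<Rightarrow> 'k) \<Rightarrow> 'k"

text \<open>
  Tangent vectors at \<open>p\<close> are the derivations of the algebra of germs at \<open>p\<close> of analytic functions.  A
  derivation is stored as a functional on all functions, with the value 0 on those that are not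
  analytic at \<open>p\<close>.
\<close>

definition tangent_space ::
  "('a::topological_space, 'k::{real_normed_field,euclidean_space}, 'n::finite) atlas \<Rightarrow> 'a \<Rightarrow> ('a, 'k) tvec set" where
  "tangent_space \<A> p = {v.
     (\<forall>f g. mfd_analytic_at \<A> p f \<longrightarrow> (\<forall>\<^sub>F x in nhds p. f x = g x) \<longrightarrow> v f = v g) \<and>
     (\<forall>f g. mfd_analytic_at \<A> p f \<longrightarrow> mfd_analytic_at \<A> p g \<longrightarrow> v (\<lambda>x. f x + g x) = v f + v g) \<and>
     (\<forall>c f. mfd_analytic_at \<A> p f \<longrightarrow> v (\<lambda>x. c * f x) = c * v f) \<and>
     (\<forall>f g. mfd_analytic_at \<A> p f \<longrightarrow> mfd_analytic_at \<A> p g \<longrightarrow> v (\<lambda>x. f x * g x) = f p * v g + g p * v f) \<and>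
     (\<forall>f. \<not> mfd_analytic_at \<A> p f \<longrightarrow> v f = 0)}"

definition vector_field ::
  "('a::topological_space, 'k::{real_normed_field,euclidean_space}, 'n::finite) atlas \<Rightarrow> 'a set \<Rightarrow> ('a \<Rightarrow> ('a, 'k) tvec) \<Rightarrow> bool" where
  "vector_field \<A> N X \<longleftrightarrow>
     (\<forall>p\<in>N. X p \<in> tangent_space \<A> p) \<and>
     (\<forall>O' f. open O' \<longrightarrow> O' \<subseteq> N \<longrightarrow> mfd_analytic \<A> O' f \<longrightarrow> mfd_analytic \<A> O' (\<lambda>p. X p f))"

definition lie_bracket ::
  "('a::topological_space, 'k::{real_normed_field,euclidean_space}, 'n::finite) atlas \<Rightarrow>
   ('a \<Rightarrow> ('a, 'k) tvec) \<Rightarrow> ('a \<Rightarrow> ('a, 'k) tvec) \<Rightarrow> 'a \<Rightarrow> ('a, 'k) tvec" where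
  "lie_bracket \<A> X Y p = (\<lambda>f. if mfd_analytic_at \<A> p f
                               then X p (\<lambda>q. Y q f) - Y p (\<lambda>q. X q f) else 0)"


section \<open>Differential forms\<close>

definition multilinear_on ::
  "('k \<Rightarrow> 'v \<Rightarrow> 'v) \<Rightarrow> nat \<Rightarrow> 'v::plus set \<Rightarrow> ('v list \<Rightarrow> 'k::comm_ring_1) set" where
  "multilinear_on scl k S = {h.
     (\<forall>vs i x y c. length vs = k \<longrightarrow> set vs \<subseteq> S \<longrightarrow> i < k \<longrightarrow> x \<in> S \<longrightarrow> y \<in> S \<longrightarrow>
        h (vs[i := x + y]) = h (vs[i := x]) + h (vs[i := y]) \<and>
        h (vs[i := scl c x]) = c * h (vs[i := x])) \<and>
     (\<forall>vs. \<not> (length vs = k \<and> set vs \<subseteq> S) \<longrightarrow> h vs = 0)}"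

definition alternating_forms ::
  "('a::topological_space, 'k::{real_normed_field,euclidean_space}, 'n::finite) atlas \<Rightarrow> nat \<Rightarrow> 'a \<Rightarrow> (('a, 'k) tvec list \<Rightarrow> 'k) set" where
  "alternating_forms \<A> k p = {h \<in> multilinear_on fscale k (tangent_space \<A> p).
     \<forall>vs i j. i < j \<longrightarrow> j < length vs \<longrightarrow> vs ! i = vs ! j \<longrightarrow> h vs = 0}"

type_synonym ('a, 'k) dform = "'a \<Rightarrow> ('a, 'k) tvec list \<Rightarrow> 'k"

definition form_on ::
  "('a::topological_space, 'k::{real_normed_field,euclidean_space}, 'n::finite) atlas \<Rightarrow> nat \<Rightarrow> 'a set \<Rightarrow> ('a, 'k) dform \<Rightarrow> bool" where
  "form_on \<A> k N \<eta> \<longleftrightarrow>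
     (\<forall>p\<in>N. \<eta> p \<in> alternating_forms \<A> k p) \<and> (\<forall>p. p \<notin> N \<longrightarrow> \<eta> p = 0) \<and>
     (\<forall>O' Xs. open O' \<longrightarrow> O' \<subseteq> N \<longrightarrow> length Xs = k \<longrightarrow> (\<forall>X\<in>set Xs. vector_field \<A> O' X) \<longrightarrow>
        mfd_analytic \<A> O' (\<lambda>p. \<eta> p (map (\<lambda>X. X p) Xs)))"

text \<open>Normalization: the wedge of one-forms evaluates to a determinant, without factorials.\<close>

definition wedge :: "('a, 'k::comm_ring_1) dform list \<Rightarrow> ('a, 'k) dform" where
  "wedge \<alpha>s p vs = (if length vs = length \<alpha>s
     then \<Sum>\<pi> | \<pi> permutes {..<length \<alpha>s}.
            of_int (sign \<pi>) * (\<Prod>a<length \<alpha>s. (\<alpha>s ! a) p [vs ! \<pi> a])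
     else 0)"

text \<open>The exterior derivative of a one-form over \<open>N\<close>, by Cartan's formula.\<close>

definition ext_deriv ::
  "('a::topological_space, 'k::{real_normed_field,euclidean_space}, 'n::finite) atlas \<Rightarrow> 'a set \<Rightarrow> ('a, 'k) dform \<Rightarrow> ('a, 'k) dform" where
  "ext_deriv \<A> N \<gamma> = (THE \<Gamma>. form_on \<A> 2 N \<Gamma> \<and>
     (\<forall>O' X Y. open O' \<longrightarrow> O' \<subseteq> N \<longrightarrow> vector_field \<A> O' X \<longrightarrow> vector_field \<A> O' Y \<longrightarrow>
        (\<forall>p\<in>O'. \<Gamma> p [X p, Y p] =
           X p (\<lambda>q. \<gamma> q [Y q]) - Y p (\<lambda>q. \<gamma> q [X q]) - \<gamma> p [lie_bracket \<A> X Y p])))"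

text \<open>The value of the Lie derivative of the form \<open>\<eta>\<close> along \<open>X\<close> on the vector fields \<open>Ys\<close>.\<close>

definition lie_derivative ::
  "('a::topological_space, 'k::{real_normed_field,euclidean_space}, 'n::finite) atlas \<Rightarrow> ('a \<Rightarrow> ('a, 'k) tvec) \<Rightarrow>
   ('a, 'k) dform \<Rightarrow> ('a \<Rightarrow> ('a, 'k) tvec) list \<Rightarrow> 'a \<Rightarrow> 'k" where
  "lie_derivative \<A> X \<eta> Ys p =
     X p (\<lambda>q. \<eta> q (map (\<lambda>Y. Y q) Ys)) -
     (\<Sum>i<length Ys. \<eta> p ((map (\<lambda>Y. Y p) Ys)[i := lie_bracket \<A> X (Ys ! i) p]))"


section \<open>Webs of curves\<close>

text \<open>
  A one-dimensional foliation is given by its tangent line bundle; rank-one distributions are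
  automatically involutive.
\<close>

definition foliation ::
  "('a::topological_space, 'k::{real_normed_field,euclidean_space}, 'n::finite) atlas \<Rightarrow> 'a set \<Rightarrow> ('a \<Rightarrow> ('a, 'k) tvec set) \<Rightarrow> bool" where
  "foliation \<A> N L \<longleftrightarrow>
     (\<forall>p\<in>N. \<exists>O' V. open O' \<and> p \<in> O' \<and> O' \<subseteq> N \<and> vector_field \<A> O' V \<and>
        (\<forall>q\<in>O'. V q \<noteq> 0 \<and> L q = range (\<lambda>c. fscale c (V q))))"

definition general_position ::
  "('a::topological_space, 'k::{real_normed_field,euclidean_space}, 'n::finite) atlas \<Rightarrow> 'a set \<Rightarrow> (nat \<Rightarrow> 'a \<Rightarrow> ('a, 'k) tvec set) \<Rightarrow> bool" where
  "general_position \<A> N F \<longleftrightarrow>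
     (\<forall>p\<in>N. \<forall>v. (\<forall>\<mu>\<in>{1..mdim \<A> + 1}. F \<mu> p = range (\<lambda>c. fscale c (v \<mu>))) \<longrightarrow>
        (\<forall>I \<subseteq> {1..mdim \<A> + 1}. card I = mdim \<A> \<longrightarrow>
           (\<forall>c. (\<Sum>\<mu>\<in>I. fscale (c \<mu>) (v \<mu>)) = 0 \<longrightarrow> (\<forall>\<mu>\<in>I. c \<mu> = 0))))"

text \<open>
  A web assigns to every point an unordered set of tangent lines; only locally can the lines be
  ordered consistently into foliations \<open>F 1, \<dots>, F (n + 1)\<close>.
\<close>

definition local_ordering ::
  "('a::topological_space, 'k::{real_normed_field,euclidean_space}, 'n::finite) atlas \<Rightarrow> ('a \<Rightarrow> ('a, 'k) tvec set set) \<Rightarrow>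
   'a set \<Rightarrow> (nat \<Rightarrow> 'a \<Rightarrow> ('a, 'k) tvec set) \<Rightarrow> bool" where
  "local_ordering \<A> W N F \<longleftrightarrow>
     open N \<and> (\<forall>\<mu>\<in>{1..mdim \<A> + 1}. foliation \<A> N (F \<mu>)) \<and> general_position \<A> N F \<and>
     (\<forall>p\<in>N. W p = (\<lambda>\<mu>. F \<mu> p) ` {1..mdim \<A> + 1})"

definition web_of_curves ::
  "('a::topological_space, 'k::{real_normed_field,euclidean_space}, 'n::finite) atlas \<Rightarrow> ('a \<Rightarrow> ('a, 'k) tvec set set) \<Rightarrow> bool" where
  "web_of_curves \<A> W \<longleftrightarrow> (\<forall>p. \<exists>N F. p \<in> N \<and> local_ordering \<A> W N F)"


section \<open>Abelian relations and rank\<close>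

definition basic_form ::
  "('a::topological_space, 'k::{real_normed_field,euclidean_space}, 'n::finite) atlas \<Rightarrow> nat \<Rightarrow> 'a set \<Rightarrow>
   ('a \<Rightarrow> ('a, 'k) tvec set) \<Rightarrow> ('a, 'k) dform \<Rightarrow> bool" where
  "basic_form \<A> k N L \<eta> \<longleftrightarrow>
     (\<forall>O' v. open O' \<longrightarrow> O' \<subseteq> N \<longrightarrow> vector_field \<A> O' v \<longrightarrow> (\<forall>p\<in>O'. v p \<in> L p) \<longrightarrow>
        (\<forall>p\<in>O'. \<forall>us. \<eta> p (v p # us) = 0) \<and>
        (\<forall>Ys. length Ys = k \<longrightarrow> (\<forall>Y\<in>set Ys. vector_field \<A> O' Y) \<longrightarrow>
           (\<forall>p\<in>O'. lie_derivative \<A> v \<eta> Ys p = 0)))"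

definition abelian_relations ::
  "('a::topological_space, 'k::{real_normed_field,euclidean_space}, 'n::finite) atlas \<Rightarrow> 'a set \<Rightarrow>
   (nat \<Rightarrow> 'a \<Rightarrow> ('a, 'k) tvec set) \<Rightarrow> (nat \<Rightarrow> ('a, 'k) dform) set" where
  "abelian_relations \<A> N F = {\<eta>.
     (\<forall>\<mu>\<in>{1..mdim \<A> + 1}. form_on \<A> (mdim \<A> - 1) N (\<eta> \<mu>) \<and> basic_form \<A> (mdim \<A> - 1) N (F \<mu>) (\<eta> \<mu>)) \<and>
     (\<forall>\<mu>. \<mu> \<notin> {1..mdim \<A> + 1} \<longrightarrow> \<eta> \<mu> = 0) \<and>
     (\<Sum>\<mu>=1..mdim \<A> + 1. \<eta> \<mu>) = 0}"

text \<open>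
  The dimension of the space of germs at \<open>p\<close>, as the supremum of the sizes of linearly independent
  families of germs; finitely many germs have representatives over a common neighbourhood.
\<close>

definition germ_dim ::
  "('a::topological_space, 'k::{real_normed_field,euclidean_space}, 'n::finite) atlas \<Rightarrow> ('a \<Rightarrow> ('a, 'k) tvec set set) \<Rightarrow> 'a \<Rightarrow> enat" where
  "germ_dim \<A> W p = Sup {enat m | m.
     \<exists>N F \<eta>. p \<in> N \<and> local_ordering \<A> W N F \<and> (\<forall>i<m. \<eta> i \<in> abelian_relations \<A> N F) \<and>
       (\<forall>c. (\<forall>\<^sub>F q in nhds p. \<forall>\<mu>. (\<Sum>i<m. fscale (c i) (\<eta> i \<mu> q)) = 0) \<longrightarrow> (\<forall>i<m. c i = 0))}"

definition web_rank ::
  "('a::topological_space, 'k::{real_normed_field,euclidean_space}, 'n::finite) atlas \<Rightarrow> ('a \<Rightarrow> ('a, 'k) tvec set set) \<Rightarrow> enat" where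
  "web_rank \<A> W = (SUP p. germ_dim \<A> W p)"


section \<open>The line bundle \<open>E\<close> and the tensor powers of its dual\<close>

text \<open>
  An element of the direct sum of the lines \<open>L \<in> W p\<close> is a function choosing a vector in each of
  them; this makes no use of an ordering of the lines.
\<close>

type_synonym ('a, 'k) evec = "('a, 'k) tvec set \<Rightarrow> ('a, 'k) tvec"

definition E_fibre :: "('a \<Rightarrow> ('a, 'k::comm_ring_1) tvec set set) \<Rightarrow> 'a \<Rightarrow> ('a, 'k) evec set" where
  "E_fibre W p = {s. (\<forall>L\<in>W p. s L \<in> L) \<and> (\<forall>L. L \<notin> W p \<longrightarrow> s L = 0) \<and> (\<Sum>L\<in>W p. s L) = 0}"

definition component_fields ::
  "(nat \<Rightarrow> 'a \<Rightarrow> ('a, 'k) tvec set) \<Rightarrow> ('a \<Rightarrow> ('a, 'k) evec) \<Rightarrow> nat \<Rightarrow> 'a \<Rightarrow> ('a, 'k) tvec" where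
  "component_fields F \<sigma> \<mu> p = \<sigma> p (F \<mu> p)"

definition E_section ::
  "('a::topological_space, 'k::{real_normed_field,euclidean_space}, 'n::finite) atlas \<Rightarrow> ('a \<Rightarrow> ('a, 'k) tvec set set) \<Rightarrow>
   'a set \<Rightarrow> ('a \<Rightarrow> ('a, 'k) evec) \<Rightarrow> bool" where
  "E_section \<A> W N \<sigma> \<longleftrightarrow>
     (\<forall>p\<in>N. \<sigma> p \<in> E_fibre W p) \<and>
     (\<forall>O' F. O' \<subseteq> N \<longrightarrow> local_ordering \<A> W O' F \<longrightarrow>
        (\<forall>\<mu>\<in>{1..mdim \<A> + 1}. vector_field \<A> O' (component_fields F \<sigma> \<mu>)))"

text \<open>
  A nowhere vanishing local section of \<open>E\<close> together with an ordering of the foliations, that is, a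
  family \<open>(V \<mu>)\<close> with \<open>V = component_fields F \<sigma>\<close>.
\<close>

definition local_frame ::
  "('a::topological_space, 'k::{real_normed_field,euclidean_space}, 'n::finite) atlas \<Rightarrow> ('a \<Rightarrow> ('a, 'k) tvec set set) \<Rightarrow>
   'a set \<Rightarrow> (nat \<Rightarrow> 'a \<Rightarrow> ('a, 'k) tvec set) \<Rightarrow> ('a \<Rightarrow> ('a, 'k) evec) \<Rightarrow> bool" where
  "local_frame \<A> W N F \<sigma> \<longleftrightarrow>
     open N \<and> connected N \<and> N \<noteq> {} \<and> local_ordering \<A> W N F \<and>
     E_section \<A> W N \<sigma> \<and> (\<forall>p\<in>N. \<sigma> p \<noteq> 0)"

text \<open>
  The \<open>k\<close>-th tensor power of the dual of the finite-dimensional space \<open>E_fibre W p\<close> is realized as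
  the space of \<open>k\<close>-linear forms on it; \<open>k = 1\<close> gives the dual itself.
\<close>

definition tensor_fibre ::
  "('a \<Rightarrow> ('a, 'k::comm_ring_1) tvec set set) \<Rightarrow> nat \<Rightarrow> 'a \<Rightarrow> (('a, 'k) evec list \<Rightarrow> 'k) set" where
  "tensor_fibre W k p = multilinear_on fscale2 k (E_fibre W p)"

type_synonym ('a, 'k) tsection = "'a \<Rightarrow> ('a, 'k) evec list \<Rightarrow> 'k"

definition tensor_section ::
  "('a::topological_space, 'k::{real_normed_field,euclidean_space}, 'n::finite) atlas \<Rightarrow> ('a \<Rightarrow> ('a, 'k) tvec set set) \<Rightarrow>
   nat \<Rightarrow> 'a set \<Rightarrow> ('a, 'k) tsection \<Rightarrow> bool" where
  "tensor_section \<A> W k N h \<longleftrightarrow>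
     (\<forall>p\<in>N. h p \<in> tensor_fibre W k p) \<and> (\<forall>p. p \<notin> N \<longrightarrow> h p = 0) \<and>
     (\<forall>O' ss. open O' \<longrightarrow> O' \<subseteq> N \<longrightarrow> length ss = k \<longrightarrow> (\<forall>s\<in>set ss. E_section \<A> W O' s) \<longrightarrow>
        mfd_analytic \<A> O' (\<lambda>p. h p (map (\<lambda>s. s p) ss)))"

definition dual_section ::
  "('a \<Rightarrow> ('a, 'k::comm_ring_1) tvec set set) \<Rightarrow> ('a \<Rightarrow> ('a, 'k) evec) \<Rightarrow> ('a, 'k) tsection" where
  "dual_section W \<sigma> p = (THE h. h \<in> tensor_fibre W 1 p \<and> h [\<sigma> p] = 1)"

definition dual_power ::
  "('a \<Rightarrow> ('a, 'k::comm_ring_1) tvec set set) \<Rightarrow> nat \<Rightarrow> 'a set \<Rightarrow> ('a \<Rightarrow> ('a, 'k) evec) \<Rightarrow> ('a, 'k) tsection" where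
  "dual_power W k N \<sigma> p xs =
     (if p \<in> N \<and> length xs = k \<and> set xs \<subseteq> E_fibre W p
      then (\<Prod>x\<leftarrow>xs. dual_section W \<sigma> p [x]) else 0)"


section \<open>Connections\<close>

text \<open>
  \<open>D p v h\<close> is the covariant derivative at \<open>p\<close>, in the direction \<open>v\<close>, of a section \<open>h\<close> defined near \<open>p\<close>.
\<close>

type_synonym ('a, 'k) conn =
  "'a \<Rightarrow> ('a, 'k) tvec \<Rightarrow> ('a, 'k) tsection \<Rightarrow> ('a, 'k) evec list \<Rightarrow> 'k"

definition covariant ::
  "('a, 'k::zero) conn \<Rightarrow> 'a set \<Rightarrow> ('a \<Rightarrow> ('a, 'k) tvec) \<Rightarrow> ('a, 'k) tsection \<Rightarrow> ('a, 'k) tsection" where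
  "covariant D N X h = (\<lambda>p. if p \<in> N then D p (X p) h else 0)"

definition connection_on ::
  "('a::topological_space, 'k::{real_normed_field,euclidean_space}, 'n::finite) atlas \<Rightarrow> ('a \<Rightarrow> ('a, 'k) tvec set set) \<Rightarrow>
   nat \<Rightarrow> 'a set \<Rightarrow> ('a, 'k) conn \<Rightarrow> bool" where
  "connection_on \<A> W k N D \<longleftrightarrow>
     (\<forall>O' h. open O' \<longrightarrow> O' \<subseteq> N \<longrightarrow> tensor_section \<A> W k O' h \<longrightarrow>
        (\<forall>p\<in>O'. \<forall>v\<in>tangent_space \<A> p.
           D p v h \<in> tensor_fibre W k p \<and>
           (\<forall>u\<in>tangent_space \<A> p. D p (u + v) h = D p u h + D p v h) \<and>
           (\<forall>c. D p (fscale c v) h = fscale c (D p v h)) \<and>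
           (\<forall>h'. tensor_section \<A> W k O' h' \<longrightarrow> D p v (h + h') = D p v h + D p v h') \<and>
           (\<forall>f. mfd_analytic \<A> O' f \<longrightarrow>
              D p v (\<lambda>q. fscale (f q) (h q)) = fscale (v f) (h p) + fscale (f p) (D p v h)) \<and>
           (\<forall>O'' h''. open O'' \<longrightarrow> p \<in> O'' \<longrightarrow> O'' \<subseteq> O' \<longrightarrow> tensor_section \<A> W k O'' h'' \<longrightarrow>
              (\<forall>q\<in>O''. h'' q = h q) \<longrightarrow> D p v h'' = D p v h)) \<and>
        (\<forall>X. vector_field \<A> O' X \<longrightarrow> tensor_section \<A> W k O' (covariant D O' X h)))"

definition connections_agree ::
  "('a::topological_space, 'k::{real_normed_field,euclidean_space}, 'n::finite) atlas \<Rightarrow> ('a \<Rightarrow> ('a, 'k) tvec set set) \<Rightarrow>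
   nat \<Rightarrow> 'a set \<Rightarrow> ('a, 'k) conn \<Rightarrow> ('a, 'k) conn \<Rightarrow> bool" where
  "connections_agree \<A> W k N D D' \<longleftrightarrow>
     (\<forall>O' h. open O' \<longrightarrow> O' \<subseteq> N \<longrightarrow> tensor_section \<A> W k O' h \<longrightarrow>
        (\<forall>p\<in>O'. \<forall>v\<in>tangent_space \<A> p. D p v h = D' p v h))"

definition flat_sections ::
  "('a::topological_space, 'k::{real_normed_field,euclidean_space}, 'n::finite) atlas \<Rightarrow> ('a \<Rightarrow> ('a, 'k) tvec set set) \<Rightarrow>
   nat \<Rightarrow> 'a set \<Rightarrow> ('a, 'k) conn \<Rightarrow> ('a, 'k) tsection set" where
  "flat_sections \<A> W k N D =
     {h. tensor_section \<A> W k N h \<and> (\<forall>p\<in>N. \<forall>v\<in>tangent_space \<A> p. D p v h = 0)}"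

definition curvature_form ::
  "('a::topological_space, 'k::{real_normed_field,euclidean_space}, 'n::finite) atlas \<Rightarrow> ('a \<Rightarrow> ('a, 'k) tvec set set) \<Rightarrow>
   nat \<Rightarrow> 'a set \<Rightarrow> ('a, 'k) conn \<Rightarrow> ('a, 'k) dform \<Rightarrow> bool" where
  "curvature_form \<A> W k N D K \<longleftrightarrow> form_on \<A> 2 N K \<and>
     (\<forall>O' X Y h. open O' \<longrightarrow> O' \<subseteq> N \<longrightarrow> vector_field \<A> O' X \<longrightarrow> vector_field \<A> O' Y \<longrightarrow>
        tensor_section \<A> W k O' h \<longrightarrow>
        (\<forall>p\<in>O'. D p (X p) (covariant D O' Y h) - D p (Y p) (covariant D O' X h)
                  - D p (lie_bracket \<A> X Y p) h
                = fscale (K p [X p, Y p]) (h p)))"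


section \<open>Forms attached to a local section of \<open>E\<close>\<close>

definition frame_coeff ::
  "('a, 'k::comm_ring_1, 'n::finite) atlas \<Rightarrow> (nat \<Rightarrow> 'a \<Rightarrow> ('a, 'k) tvec) \<Rightarrow> 'a \<Rightarrow> ('a, 'k) tvec \<Rightarrow> nat \<Rightarrow> 'k" where
  "frame_coeff \<A> V p v =
     (THE c. (\<forall>k. k \<notin> {1..mdim \<A>} \<longrightarrow> c k = 0) \<and> v = (\<Sum>k=1..mdim \<A>. fscale (c k) (V k p)))"

definition coframe ::
  "('a::topological_space, 'k::{real_normed_field,euclidean_space}, 'n::finite) atlas \<Rightarrow> 'a set \<Rightarrow>
   (nat \<Rightarrow> 'a \<Rightarrow> ('a, 'k) tvec) \<Rightarrow> nat \<Rightarrow> ('a, 'k) dform" where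
  "coframe \<A> N V i p vs =
     (if p \<in> N \<and> length vs = 1 \<and> set vs \<subseteq> tangent_space \<A> p then frame_coeff \<A> V p (hd vs) i else 0)"

definition structure_coeff ::
  "('a::topological_space, 'k::{real_normed_field,euclidean_space}, 'n::finite) atlas \<Rightarrow>
   (nat \<Rightarrow> 'a \<Rightarrow> ('a, 'k) tvec) \<Rightarrow> nat \<Rightarrow> nat \<Rightarrow> nat \<Rightarrow> 'a \<Rightarrow> 'k" where
  "structure_coeff \<A> V i j k p = frame_coeff \<A> V p (lie_bracket \<A> (V i) (V j) p) k"

definition A_form ::
  "('a::topological_space, 'k::{real_normed_field,euclidean_space}, 'n::finite) atlas \<Rightarrow> 'a set \<Rightarrow>
   (nat \<Rightarrow> 'a \<Rightarrow> ('a, 'k) tvec) \<Rightarrow> nat \<Rightarrow> ('a, 'k) dform" where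
  "A_form \<A> N V i p =
     fscale ((- 1) ^ (i + 1)) (wedge [coframe \<A> N V j. j \<leftarrow> [1..<mdim \<A> + 1], j \<noteq> i] p)"

definition phi_coeff ::
  "('a::topological_space, 'k::{real_normed_field,euclidean_space}, 'n::finite) atlas \<Rightarrow>
   (nat \<Rightarrow> 'a \<Rightarrow> ('a, 'k) tvec) \<Rightarrow> nat \<Rightarrow> 'a \<Rightarrow> 'k" where
  "phi_coeff \<A> V i p =
     (\<Sum>j\<in>{1..<i}. structure_coeff \<A> V j i j p) - (\<Sum>j\<in>{i<..mdim \<A>}. structure_coeff \<A> V i j j p)"

definition omega_form ::
  "('a::topological_space, 'k::{real_normed_field,euclidean_space}, 'n::finite) atlas \<Rightarrow> 'a set \<Rightarrow>
   (nat \<Rightarrow> 'a \<Rightarrow> ('a, 'k) tvec) \<Rightarrow> ('a, 'k) dform" where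
  "omega_form \<A> N V p = (\<Sum>i=1..mdim \<A>. fscale (phi_coeff \<A> V i p) (coframe \<A> N V i p))"

definition Omega_form ::
  "('a::topological_space, 'k::{real_normed_field,euclidean_space}, 'n::finite) atlas \<Rightarrow> 'a set \<Rightarrow>
   (nat \<Rightarrow> 'a \<Rightarrow> ('a, 'k) tvec) \<Rightarrow> ('a, 'k) dform" where
  "Omega_form \<A> N V = ext_deriv \<A> N (omega_form \<A> N V)"

definition abelian_relation_of ::
  "('a::topological_space, 'k::{real_normed_field,euclidean_space}, 'n::finite) atlas \<Rightarrow> 'a set \<Rightarrow>
   (nat \<Rightarrow> 'a \<Rightarrow> ('a, 'k) tvec) \<Rightarrow> ('a \<Rightarrow> 'k) \<Rightarrow> nat \<Rightarrow> ('a, 'k) dform" where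
  "abelian_relation_of \<A> N V f \<mu> =
     (if \<mu> \<in> {1..mdim \<A>} then \<lambda>p. fscale (f p) (A_form \<A> N V \<mu> p)
      else if \<mu> = mdim \<A> + 1 then \<lambda>p. - (\<Sum>i=1..mdim \<A>. fscale (f p) (A_form \<A> N V i p))
      else 0)"

text \<open>
  The nowhere vanishing functions over \<open>N\<close> with \<open>df = - f \<omega>\<close>; recall that \<open>df\<close> is \<open>v \<mapsto> v f\<close>.
\<close>

definition potentials ::
  "('a::topological_space, 'k::{real_normed_field,euclidean_space}, 'n::finite) atlas \<Rightarrow> 'a set \<Rightarrow>
   (nat \<Rightarrow> 'a \<Rightarrow> ('a, 'k) tvec) \<Rightarrow> ('a \<Rightarrow> 'k) set" where
  "potentials \<A> N V = {f. mfd_analytic \<A> N f \<and> (\<forall>p\<in>N. f p \<noteq> 0) \<and> (\<forall>p. p \<notin> N \<longrightarrow> f p = 0) \<and>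
     (\<forall>p\<in>N. \<forall>v\<in>tangent_space \<A> p. v f = - f p * omega_form \<A> N V p [v])}"


section \<open>The connection of a web\<close>

definition local_connection ::
  "('a::topological_space, 'k::{real_normed_field,euclidean_space}, 'n::finite) atlas \<Rightarrow> ('a \<Rightarrow> ('a, 'k) tvec set set) \<Rightarrow>
   'a set \<Rightarrow> (nat \<Rightarrow> 'a \<Rightarrow> ('a, 'k) tvec set) \<Rightarrow> ('a \<Rightarrow> ('a, 'k) evec) \<Rightarrow> ('a, 'k) conn \<Rightarrow> bool" where
  "local_connection \<A> W N F \<sigma> D \<longleftrightarrow>
     connection_on \<A> W (mdim \<A> - 1) N D \<and>
     (\<forall>p\<in>N. \<forall>v\<in>tangent_space \<A> p.
        D p v (dual_power W (mdim \<A> - 1) N \<sigma>) =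
        fscale (omega_form \<A> N (component_fields F \<sigma>) p [v]) (dual_power W (mdim \<A> - 1) N \<sigma> p))"

definition global_connection ::
  "('a::topological_space, 'k::{real_normed_field,euclidean_space}, 'n::finite) atlas \<Rightarrow> ('a \<Rightarrow> ('a, 'k) tvec set set) \<Rightarrow>
   ('a, 'k) conn \<Rightarrow> bool" where
  "global_connection \<A> W D \<longleftrightarrow>
     connection_on \<A> W (mdim \<A> - 1) UNIV D \<and>
     (\<forall>N F \<sigma>. local_frame \<A> W N F \<sigma> \<longrightarrow> local_connection \<A> W N F \<sigma> D)"


section \<open>Blaschke curvature of a 3-web on a surface\<close>

definition blaschke_coframe ::
  "('a::topological_space, 'k::{real_normed_field,euclidean_space}, 'n::finite) atlas \<Rightarrow> ('a \<Rightarrow> ('a, 'k) tvec set set) \<Rightarrow>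
   'a set \<Rightarrow> (nat \<Rightarrow> ('a, 'k) dform) \<Rightarrow> bool" where
  "blaschke_coframe \<A> W N \<theta> \<longleftrightarrow>
     (\<exists>F. local_ordering \<A> W N F \<and>
        (\<forall>\<mu>\<in>{1..3}. form_on \<A> 1 N (\<theta> \<mu>) \<and>
           (\<forall>p\<in>N. {v \<in> tangent_space \<A> p. \<theta> \<mu> p [v] = 0} = F \<mu> p))) \<and>
     (\<Sum>\<mu>=1..3. \<theta> \<mu>) = 0"

definition blaschke_form ::
  "('a::topological_space, 'k::{real_normed_field,euclidean_space}, 'n::finite) atlas \<Rightarrow>
   'a set \<Rightarrow> (nat \<Rightarrow> ('a, 'k) dform) \<Rightarrow> ('a, 'k) dform" where
  "blaschke_form \<A> N \<theta> =
     (THE \<gamma>. form_on \<A> 1 N \<gamma> \<and> (\<forall>\<mu>\<in>{1..3}. ext_deriv \<A> N (\<theta> \<mu>) = wedge [\<gamma>, \<theta> \<mu>]))"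

definition blaschke_curvature ::
  "('a::topological_space, 'k::{real_normed_field,euclidean_space}, 'n::finite) atlas \<Rightarrow> ('a \<Rightarrow> ('a, 'k) tvec set set) \<Rightarrow>
   ('a, 'k) dform \<Rightarrow> bool" where
  "blaschke_curvature \<A> W B \<longleftrightarrow> form_on \<A> 2 UNIV B \<and>
     (\<forall>p. \<exists>N \<theta>. p \<in> N \<and> blaschke_coframe \<A> W N \<theta>) \<and>
     (\<forall>N \<theta>. blaschke_coframe \<A> W N \<theta> \<longrightarrow>
        (\<forall>p\<in>N. B p = ext_deriv \<A> N (blaschke_form \<A> N \<theta>) p))"

end

theory Submission
  imports Defs
begin

text \<open>
  Let \<open>\<sigma> = (V\<^sub>1, \<dots>, V\<^sub>n\<^sub>+\<^sub>1)\<close> be a local frame of \<open>E\<close> and let \<open>vol\<close> be the volume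
  form with \<open>vol (V\<^sub>1, \<dots>, V\<^sub>n) = 1\<close>.  Each \<open>A\<^sub>i\<close> is the contraction of \<open>vol\<close> with \<open>V\<^sub>i\<close>
  (\<open>A_form_contract\<close>), and \<open>- (A\<^sub>1 + \<dots> + A\<^sub>n)\<close> is its contraction with \<open>V\<^sub>n\<^sub>+\<^sub>1\<close>, since the
  \<open>V\<^sub>\<mu>\<close> have sum zero.  So the last foliation plays the same role as the others.  The coefficient \<open>\<phi>\<^sub>i\<close> is the divergence of \<open>V\<^sub>i\<close> with respect to \<open>vol\<close>, and
  \<open>\<omega> (V\<^sub>\<mu>) = div V\<^sub>\<mu>\<close> for all \<open>n + 1\<close> indices (\<open>om_wframe\<close>).

  A family of \<open>(n - 1)\<close>-forms with sum zero, the \<open>\<mu>\<close>-th one annihilated by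
  \<open>V\<^sub>\<mu>\<close>, consists by linear algebra of the multiples \<open>f \<iota>(V\<^sub>\<mu>) vol\<close> with one common function \<open>f\<close>
  (\<open>relation_at_point\<close>).  The Lie derivative along \<open>V\<^sub>\<mu>\<close> of such a form is
  \<open>(V\<^sub>\<mu> f + f div V\<^sub>\<mu>) \<iota>(V\<^sub>\<mu>) vol\<close> (\<open>lie_derivative_relation\<close>), so the relation is abelian if and only if
  \<open>df = - f \<omega>\<close>.  A solution of this equation that vanishes at a point has all its derivatives zero there,
  hence vanishes identically on a connected set (\<open>solution_dichotomy\<close>).  A nowhere vanishing solution forces
  \<open>\<Omega> = d\<omega> = 0\<close> (\<open>solution_flat\<close>); conversely, if \<open>\<Omega> = 0\<close> then \<open>\<omega>\<close> has a local primitive \<open>h\<close>,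
  and \<open>exp (- h)\<close> is a solution (\<open>flat_solution\<close>).

  If \<open>\<sigma>\<close> is replaced by \<open>g \<sigma>\<close> and the foliations are reordered, \<open>vol\<close> is
  multiplied by a constant times \<open>g\<close> to the power \<open>- n\<close>, and \<open>\<omega>\<close> becomes \<open>\<omega> - (n - 1) dg / g\<close>
  (\<open>om_change\<close>).  This is the rule for the connection form of \<open>\<sigma>\<^sup>*\<close> to the power \<open>n - 1\<close>, so the local
  connections agree (\<open>covD_independent\<close>), and their common curvature is \<open>\<Omega>\<close> (\<open>curvature_compute\<close>).
  The equation \<open>df = - f \<omega>\<close> says that \<open>f\<close> times this power of \<open>\<sigma>\<^sup>*\<close> is flat.  Its value on
  \<open>\<sigma>, \<dots>, \<sigma>\<close> is \<open>\<eta>\<^sub>1 (V\<^sub>2, \<dots>, V\<^sub>n)\<close>, an expression that makes sense without a choice of \<open>\<sigma>\<close>; this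
  defines the identification of relations with flat sections (\<open>relation_section_bij\<close>).  Since the curvature is
  analytic and \<open>\<U>\<close> is connected, it vanishes identically as soon as it vanishes on a nonempty open set
  (\<open>form_identity\<close>); hence the rank can be read off in any one frame.

  For \<open>n = 2\<close> a triple of one-forms \<open>\<theta>\<^sub>\<mu>\<close> with sum zero that defines the web is, for the local
  frame normalized by \<open>\<theta>\<^sub>1 (V\<^sub>2) = 1\<close>, the triple \<open>\<iota>(V\<^sub>\<mu>) vol\<close> (\<open>normal_frame\<close>).  The formula for the
  divergence gives \<open>d\<theta>\<^sub>\<mu> = \<omega> \<and> \<theta>\<^sub>\<mu>\<close> (\<open>standard_coframe_deriv\<close>), so \<open>\<gamma> = \<omega>\<close> and \<open>d\<gamma> = \<Omega>\<close>.

  Both categories are treated at once, with convergent power series over a normed field.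
  Three facts about them carry the rest: a function with all derivatives zero at a point vanishes near it
  (\<open>deriv_closed_eventually_0\<close>), a closed one-form has a local primitive (\<open>closed_form_exact\<close>), and a
  derivation is determined by its values on the coordinates, by Hadamard's lemma (\<open>tv_coords\<close>).
\<close>


section \<open>Convergent power series in several variables\<close>

definition mpow :: "'k::comm_monoid_mult^'n::finite => ('n => nat) => 'k" where
 "mpow x m = (\<Prod>i\<in>UNIV. x $ i ^ m i)"

definition deg :: "('n::finite => nat) => nat" where
 "deg m = (\<Sum>i\<in>UNIV. m i)"

definition munit :: "'n => 'n => nat" where
 "munit i = (%j. if j = i then 1 else 0)"

definition pdisc :: "'k::real_normed_field^'n::finite => real => ('k^'n) set" where
 "pdisc a r = {x. \<forall>i. norm (x $ i - a $ i) \<le> r}"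

definition has_ps ::
 "('k::{real_normed_field,euclidean_space}^'n::finite => 'k) => 'k^'n => real => (('n => nat) => 'k) => bool" where
 "has_ps f a r c \<longleftrightarrow> (%m. norm (c m) * r ^ deg m) summable_on UNIV \<and>
  (\<forall>x\<in>pdisc a r. ((%m. c m * mpow (x - a) m) has_sum f x) UNIV)"

text \<open>A bound for the sum of the absolute values is all that products and substitutions need to know about
 the coefficients.\<close>

definition majorized ::
 "('k::{real_normed_field,euclidean_space}^'n::finite => 'k) => 'k^'n => real => real => bool" where
 "majorized f a r B \<longleftrightarrow> (\<exists>c. has_ps f a r c & (\<Sum>\<^sub>\<infinity>m. norm (c m) * r ^ deg m) \<le> B)"

lemma deg_0 [simp]: "deg 0 = 0" and deg_munit [simp]: "deg (munit i) = 1"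
 by (auto simp: deg_def munit_def)

lemma deg_add: "deg (m + m') = deg m + deg m'"
 by (simp add: deg_def sum.distrib)

lemma mpow_0 [simp]: "mpow x 0 = 1"
 by (simp add: mpow_def)

lemma mpow_munit [simp]: "mpow x (munit i) = x $ i"
proof -
 have "mpow x (munit i) = (\<Prod>j\<in>UNIV. if j = i then x $ j else 1)"
  unfolding mpow_def munit_def by (intro prod.cong) auto
 then show ?thesis by simp
qed

lemma mpow_add: "mpow x (m + m') = mpow x m * mpow x m'"
 by (simp add: mpow_def power_add prod.distrib)

lemma mpow_at_0: "m ~= 0 ==> mpow (0::'k::comm_semiring_1^'n::finite) m = 0"
proof -
 assume "m ~= 0"
 then obtain i where "m i ~= 0" by (auto simp: fun_eq_iff)
 then show ?thesis unfolding mpow_def by (intro prod_zero bexI[of _ i]) (auto simp: zero_power)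
qed

lemma norm_mpow_le:
 fixes x :: "'k::real_normed_field^'n::finite"
 assumes "!!i. norm (x $ i) \<le> r"
 shows "norm (mpow x m) \<le> r ^ deg m"
proof -
 have "norm (mpow x m) = (\<Prod>i\<in>UNIV. norm (x $ i) ^ m i)"
  by (simp add: mpow_def norm_power flip: prod_norm)
 also have "... \<le> (\<Prod>i\<in>UNIV. r ^ m i)"
  by (intro prod_mono) (auto intro!: power_mono assms)
 also have "... = r ^ deg m"
  by (simp add: deg_def power_sum)
 finally show ?thesis .
qed

lemma norm_mpow_diff_le: "x : pdisc a r ==> norm (mpow (x - a) m) \<le> r ^ deg m"
 by (rule norm_mpow_le) (auto simp: pdisc_def)

lemma center_in_pdisc: "r \<ge> 0 ==> a : pdisc a r"
 by (simp add: pdisc_def)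

lemma pdisc_mono: "s \<le> r ==> pdisc a s \<subseteq> pdisc a r"
 by (auto simp: pdisc_def intro: order_trans)

lemma pdisc_nhd:
 fixes a :: "'k::real_normed_field^'n::finite"
 assumes "r > 0"
 shows "\<forall>\<^sub>F x in nhds a. x : pdisc a r"
proof -
 have "\<forall>\<^sub>F x in nhds a. dist x a < r"
  using assms by (auto simp: eventually_nhds_metric)
 then show ?thesis
 proof eventually_elim
  case (elim x)
  have "norm (x $ i - a $ i) \<le> r" for i
   using dist_vec_nth_le[of x i a] elim by (simp add: dist_norm)
  then show ?case by (simp add: pdisc_def)
 qed
qed

lemma pdisc_in_nhd:
 fixes a :: "'k::real_normed_field^'n::finite"
 assumes "\<forall>\<^sub>F x in nhds a. P x"
 obtains r where "r > 0" "!!x. x : pdisc a r ==> P x"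
proof -
 obtain e where e: "e > 0" "!!x. dist x a < e ==> P x"
  using assms by (auto simp: eventually_nhds_metric)
 define r where "r = e / (2 * real CARD('n))"
 have r: "r > 0" using e by (simp add: r_def)
 have "P x" if "x : pdisc a r" for x
 proof (rule e(2))
  have "dist x a \<le> (\<Sum>i\<in>UNIV. norm ((x - a) $ i))"
   unfolding dist_norm norm_vec_def by (rule L2_set_le_sum) simp
  also have "... \<le> (\<Sum>i\<in>(UNIV::'n set). r)"
   using that by (intro sum_mono) (auto simp: pdisc_def)
  also have "... < e" using e by (simp add: r_def)
  finally show "dist x a < e" .
 qed
 with r that show thesis by blast
qed

text \<open>In finite dimension unconditional and absolute convergence agree.\<close>

lemma summable_on_imp_abs_summable:
 fixes f :: "'j => 'k::euclidean_space"
 assumes "f summable_on A"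
 shows "(%x. norm (f x)) summable_on A"
proof -
 have "(%x. \<bar>f x \<bullet> b\<bar>) summable_on A" for b
  using summable_on_bounded_linear[OF bounded_linear_inner_left assms, of b]
   summable_on_iff_abs_summable_on_real[of "%x. f x \<bullet> b" A]
  by simp
 then have "(%x. \<Sum>b\<in>Basis. \<bar>f x \<bullet> b\<bar>) summable_on A"
  by (induction rule: finite_induct[OF finite_Basis]) (auto intro: summable_on_add)
 then show ?thesis
  by (rule Infinite_Sum.abs_summable_on_comparison_test') (rule norm_le_l1)
qed

lemma has_ps_summable: "has_ps f a r c ==> (%m. norm (c m) * r ^ deg m) summable_on UNIV"
 by (simp add: has_ps_def)

lemma has_ps_has_sum:
 "has_ps f a r c ==> x : pdisc a r ==> ((%m. c m * mpow (x - a) m) has_sum f x) UNIV"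
 by (simp add: has_ps_def)

lemma has_ps_majorized: "has_ps f a r c ==> majorized f a r (\<Sum>\<^sub>\<infinity>m. norm (c m) * r ^ deg m)"
 by (auto simp: majorized_def)

lemma majorized_nonneg: "majorized f a r B ==> r \<ge> 0 ==> B \<ge> 0"
proof -
 assume "majorized f a r B" "r \<ge> 0"
 then obtain c where "has_ps f a r c" and c: "(\<Sum>\<^sub>\<infinity>m. norm (c m) * r ^ deg m) \<le> B"
  unfolding majorized_def by blast
 have "0 \<le> (\<Sum>\<^sub>\<infinity>m. norm (c m) * r ^ deg m)" using \<open>r \<ge> 0\<close> by (intro infsum_nonneg) auto
 with c show ?thesis by linarith
qed

lemma majorized_mono: "majorized f a r B ==> B \<le> B' ==> majorized f a r B'"
 unfolding majorized_def by (meson order_trans)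

lemma has_ps_cong:
 "has_ps f a r c ==> (!!x. x : pdisc a r ==> f x = g x) ==> has_ps g a r c"
 by (auto simp: has_ps_def)

lemma majorized_cong:
 "majorized f a r B ==> (!!x. x : pdisc a r ==> f x = g x) ==> majorized g a r B"
 unfolding majorized_def using has_ps_cong[of f a r _ g] by blast

lemma majorized_bound:
 assumes "majorized f a r B" "x : pdisc a r"
 shows "norm (f x) \<le> B"
proof -
 obtain c where c: "has_ps f a r c" "(\<Sum>\<^sub>\<infinity>m. norm (c m) * r ^ deg m) \<le> B"
  using assms by (auto simp: majorized_def)
 have "norm (f x) \<le> (\<Sum>\<^sub>\<infinity>m. norm (c m) * r ^ deg m)"
 proof (rule norm_infsum_le[OF has_ps_has_sum[OF c(1) assms(2)]])
  show "((%m. norm (c m) * r ^ deg m) has_sum (\<Sum>\<^sub>\<infinity>m. norm (c m) * r ^ deg m)) UNIV"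
   using has_ps_summable[OF c(1)] by simp
  show "norm (c m * mpow (x - a) m) \<le> norm (c m) * r ^ deg m" for m
   using norm_mpow_diff_le[OF assms(2), of m] by (simp add: norm_mult mult_left_mono)
 qed
 with c(2) show ?thesis by simp
qed

text \<open>Every rearrangement of a power series below is an instance of this lemma: an absolutely
 convergent family of monomials, indexed arbitrarily, may be collected according to exponents.\<close>

lemma majorized_regroup:
 fixes f :: "'k::{real_normed_field,euclidean_space}^'n::finite => 'k"
  and b :: "'j => 'k" and \<kappa> :: "'j => 'n => nat"
 assumes r: "r > 0" and S: "(%j. norm (b j) * r ^ deg (\<kappa> j)) summable_on J"
  and B: "(\<Sum>\<^sub>\<infinity>j\<in>J. norm (b j) * r ^ deg (\<kappa> j)) \<le> B"
  and f: "!!x. x : pdisc a r ==> ((%j. b j * mpow (x - a) (\<kappa> j)) has_sum f x) J"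
 shows "majorized f a r B"
proof -
 define Q where "Q m = {j\<in>J. \<kappa> j = m}" for m
 define P where "P = (SIGMA m:UNIV. Q m)"
 define c where "c m = infsum b (Q m)" for m
 have bij: "bij_betw snd P J"
  by (rule bij_betwI[of _ _ _ "%j. (\<kappa> j, j)"]) (auto simp: P_def Q_def)
 have SP: "(%(m, j). norm (b j) * r ^ deg m) summable_on P"
 proof -
  have "(%p. norm (b (snd p)) * r ^ deg (\<kappa> (snd p))) summable_on P"
   using summable_on_reindex_bij_betw[OF bij, of "%j. norm (b j) * r ^ deg (\<kappa> j)"] S by simp
  then show ?thesis
   by (rule summable_on_cong[THEN iffD1, rotated]) (auto simp: P_def Q_def)
 qed
 have BP: "infsum (%(m, j). norm (b j) * r ^ deg m) P \<le> B"
 proof -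
  have "infsum (%(m, j). norm (b j) * r ^ deg m) P
    = infsum (%p. norm (b (snd p)) * r ^ deg (\<kappa> (snd p))) P"
   by (rule infsum_cong) (auto simp: P_def Q_def)
  also have "... = (\<Sum>\<^sub>\<infinity>j\<in>J. norm (b j) * r ^ deg (\<kappa> j))"
   by (rule infsum_reindex_bij_betw[OF bij, of "%j. norm (b j) * r ^ deg (\<kappa> j)"])
  finally show ?thesis using B by simp
 qed
 have Q1: "(%j. norm (b j) * r ^ deg m) summable_on Q m" for m
  using summable_on_SigmaD1[OF SP[unfolded P_def], of m] by simp
 have Q2: "(%j. norm (b j)) summable_on Q m" for m
  using Q1[of m] r summable_on_cmult_left'[of "r ^ deg m" "%j. norm (b j)" "Q m"] by simp
 have c: "norm (c m) * r ^ deg m \<le> (\<Sum>\<^sub>\<infinity>j\<in>Q m. norm (b j) * r ^ deg m)" for m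
  unfolding c_def using norm_infsum_bound[OF Q2[of m]] r
  by (simp add: infsum_cmult_left' mult_right_mono)
 have S2: "(%m. \<Sum>\<^sub>\<infinity>j\<in>Q m. norm (b j) * r ^ deg m) summable_on UNIV"
  using summable_on_Sigma_banach[OF SP[unfolded P_def]] .
 have S3: "(%m. norm (c m) * r ^ deg m) summable_on UNIV"
  by (rule summable_on_comparison_test[OF S2]) (use c r in auto)
 have "(\<Sum>\<^sub>\<infinity>m. norm (c m) * r ^ deg m) \<le> (\<Sum>\<^sub>\<infinity>m. \<Sum>\<^sub>\<infinity>j\<in>Q m. norm (b j) * r ^ deg m)"
  by (rule infsum_mono[OF S3 S2 c])
 also have "... \<le> B"
  using infsum_Sigma'_banach[OF SP[unfolded P_def]] BP by (simp add: P_def)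
 finally have bound: "(\<Sum>\<^sub>\<infinity>m. norm (c m) * r ^ deg m) \<le> B" .
 have "((%m. c m * mpow (x - a) m) has_sum f x) UNIV" if x: "x : pdisc a r" for x
 proof (rule has_sum_SigmaD)
  show "((%(m, j). b j * mpow (x - a) m) has_sum f x) (Sigma UNIV Q)"
  proof -
   have "((%p. b (snd p) * mpow (x - a) (\<kappa> (snd p))) has_sum f x) P"
    using has_sum_reindex_bij_betw[OF bij, of "%j. b j * mpow (x - a) (\<kappa> j)"] f[OF x] by simp
   then show ?thesis
    unfolding P_def[symmetric]
    by (rule has_sum_cong[THEN iffD1, rotated]) (auto simp: P_def Q_def)
  qed
  show "((%j. case (m, j) of (m, j) => b j * mpow (x - a) m) has_sum c m * mpow (x - a) m) (Q m)" for m
   using has_sum_cmult_left[OF has_sum_infsum[OF abs_summable_summable[OF Q2[of m]]]]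
   by (simp add: c_def)
 qed
 with S3 bound show ?thesis by (auto simp: majorized_def has_ps_def)
qed

lemma majorized_monomial:
 fixes c :: "'k::{real_normed_field,euclidean_space}"
 assumes "r > 0"
 shows "majorized (%x. c * mpow (x - a) m) a r (norm c * r ^ deg m)"
 by (rule majorized_regroup[where J = "{()}" and b = "%_. c" and \<kappa> = "%_. m"])
  (use assms in \<open>auto intro: has_sum_finiteI\<close>)

lemma majorized_const:
 fixes c :: "'k::{real_normed_field,euclidean_space}"
 shows "r > 0 ==> majorized (%x. c) a r (norm c)"
 using majorized_monomial[of r c a 0] by simp

lemma majorized_coord: "r > 0 ==> majorized (%x. x $ i - a $ i) a r r"
 using majorized_monomial[of r 1 a "munit i"] by simp

text \<open>Infinite sums are regrouped as a double series, with the bounds of the summands as a majorant.\<close>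

lemma majorized_has_sum:
 fixes f :: "'l => 'k::{real_normed_field,euclidean_space}^'n::finite => 'k"
 assumes r: "r > 0" and f: "!!l. l : L ==> majorized (f l) a r (B l)"
  and B: "B summable_on L" "infsum B L \<le> C"
  and g: "!!x. x : pdisc a r ==> ((%l. f l x) has_sum g x) L"
 shows "majorized g a r C"
proof -
 have "\<exists>c. \<forall>l\<in>L. has_ps (f l) a r (c l) & (\<Sum>\<^sub>\<infinity>m. norm (c l m) * r ^ deg m) \<le> B l"
  using f unfolding majorized_def by (intro bchoice) auto
 then obtain c where c: "!!l. l : L ==> has_ps (f l) a r (c l)"
   "!!l. l : L ==> (\<Sum>\<^sub>\<infinity>m. norm (c l m) * r ^ deg m) \<le> B l" by blast
 define T where "T l = (\<Sum>\<^sub>\<infinity>m. norm (c l m) * r ^ deg m)" for l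
 have T0: "T l \<ge> 0" for l
  unfolding T_def using r by (intro infsum_nonneg) auto
 have TS: "T summable_on L"
  by (rule summable_on_comparison_test[OF B(1)]) (use c T0 in \<open>auto simp: T_def\<close>)
 have 1: "(%p. norm (case_prod c p) * r ^ deg (snd p)) summable_on L \<times> UNIV"
 proof (rule summable_on_SigmaI[OF _ TS])
  show "((%m. norm (case_prod c (l, m)) * r ^ deg (snd (l, m))) has_sum T l) UNIV" if "l : L" for l
   unfolding T_def using has_ps_summable[OF c(1)[OF that]] by simp
 qed (use r in auto)
 show ?thesis
 proof (rule majorized_regroup[OF r 1])
  have "(\<Sum>\<^sub>\<infinity>p\<in>L \<times> UNIV. norm (case_prod c p) * r ^ deg (snd p)) = infsum T L"
   using infsum_Sigma_banach[OF 1] unfolding T_def by (metis (mono_tags, lifting) case_prod_conv snd_conv infsum_cong)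
  also have "... \<le> infsum B L"
   by (rule infsum_mono[OF TS B(1)]) (use c in \<open>auto simp: T_def\<close>)
  finally show "(\<Sum>\<^sub>\<infinity>p\<in>L \<times> UNIV. norm (case_prod c p) * r ^ deg (snd p)) \<le> C"
   using B(2) by simp
  fix x assume x: "x : pdisc a r"
  show "((%p. case_prod c p * mpow (x - a) (snd p)) has_sum g x) (L \<times> UNIV)"
  proof (rule has_sum_SigmaI)
   show "((%m. case_prod c (l, m) * mpow (x - a) (snd (l, m))) has_sum f l x) UNIV" if "l : L" for l
    using has_ps_has_sum[OF c(1)[OF that] x] by simp
   show "((%l. f l x) has_sum g x) L" using g[OF x] .
   show "(%p. case_prod c p * mpow (x - a) (snd p)) summable_on L \<times> UNIV"
    by (rule abs_summable_summable, rule Infinite_Sum.abs_summable_on_comparison_test'[OF 1])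
     (auto simp: norm_mult intro!: mult_left_mono norm_mpow_diff_le[OF x])
  qed
 qed
qed

lemma majorized_add:
 assumes "r > 0" "majorized f a r B" "majorized g a r C"
 shows "majorized (%x. f x + g x) a r (B + C)"
 by (rule majorized_has_sum[where L = "UNIV::bool set" and f = "%b. if b then f else g"
    and B = "%b. if b then B else C"])
  (use assms in \<open>auto simp: UNIV_bool intro!: has_sum_finiteI\<close>)

lemma majorized_cmult:
 assumes r: "r > 0" and f: "majorized f a r B"
 shows "majorized (%x. c * f x) a r (norm c * B)"
proof -
 obtain d where d: "has_ps f a r d" "(\<Sum>\<^sub>\<infinity>m. norm (d m) * r ^ deg m) \<le> B"
  using f by (auto simp: majorized_def)
 show ?thesis
 proof (rule majorized_regroup[OF r, where J = UNIV and b = "%m. c * d m" and \<kappa> = "%m. m"])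
  show "(%m. norm (c * d m) * r ^ deg m) summable_on UNIV"
   using summable_on_cmult_right[OF has_ps_summable[OF d(1)], of "norm c"]
   by (simp add: norm_mult mult.assoc)
  show "(\<Sum>\<^sub>\<infinity>m. norm (c * d m) * r ^ deg m) \<le> norm c * B"
   using d(2) by (simp add: norm_mult mult.assoc infsum_cmult_right' mult_left_mono)
  show "((%m. c * d m * mpow (x - a) m) has_sum c * f x) UNIV" if "x : pdisc a r" for x
   using has_sum_cmult_right[OF has_ps_has_sum[OF d(1) that], of c] by (simp add: mult.assoc)
 qed
qed

lemma majorized_mpow_mult:
 assumes r: "r > 0" and f: "majorized f a r B"
 shows "majorized (%x. mpow (x - a) k * f x) a r (r ^ deg k * B)"
proof -
 obtain d where d: "has_ps f a r d" "(\<Sum>\<^sub>\<infinity>m. norm (d m) * r ^ deg m) \<le> B"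
  using f by (auto simp: majorized_def)
 show ?thesis
 proof (rule majorized_regroup[OF r, where J = UNIV and b = d and \<kappa> = "%m. k + m"])
  show "(%m. norm (d m) * r ^ deg (k + m)) summable_on UNIV"
   using summable_on_cmult_right[OF has_ps_summable[OF d(1)], of "r ^ deg k"]
   by (simp add: deg_add power_add mult_ac)
  have "(\<Sum>\<^sub>\<infinity>m. norm (d m) * r ^ deg (k + m)) = r ^ deg k * (\<Sum>\<^sub>\<infinity>m. norm (d m) * r ^ deg m)"
   by (subst infsum_cmult_right'[symmetric]) (simp add: deg_add power_add mult_ac)
  then show "(\<Sum>\<^sub>\<infinity>m. norm (d m) * r ^ deg (k + m)) \<le> r ^ deg k * B"
   using d(2) r by (simp add: mult_left_mono)
  show "((%m. d m * mpow (x - a) (k + m)) has_sum mpow (x - a) k * f x) UNIV" if "x : pdisc a r" for x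
   using has_sum_cmult_right[OF has_ps_has_sum[OF d(1) that], of "mpow (x - a) k"]
   by (simp add: mpow_add mult_ac)
 qed
qed

lemma majorized_mult:
 assumes r: "r > 0" and f: "majorized f a r B" and g: "majorized g a r C"
 shows "majorized (%x. f x * g x) a r (B * C)"
proof -
 obtain d where d: "has_ps f a r d" "(\<Sum>\<^sub>\<infinity>m. norm (d m) * r ^ deg m) \<le> B"
  using f by (auto simp: majorized_def)
 have C: "C \<ge> 0" using majorized_nonneg[OF g] r by simp
 show ?thesis
 proof (rule majorized_has_sum[OF r, where L = UNIV and B = "%m. norm (d m) * r ^ deg m * C"
    and f = "%m x. d m * (mpow (x - a) m * g x)"])
  show "majorized (%x. d m * (mpow (x - a) m * g x)) a r (norm (d m) * r ^ deg m * C)" for m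
   using majorized_cmult[OF r majorized_mpow_mult[OF r g], of "d m" m] by (simp add: mult.assoc)
  show "(%m. norm (d m) * r ^ deg m * C) summable_on UNIV"
   by (rule summable_on_cmult_left[OF has_ps_summable[OF d(1)]])
  show "(\<Sum>\<^sub>\<infinity>m. norm (d m) * r ^ deg m * C) \<le> B * C"
   using d(2) C by (simp add: infsum_cmult_left' mult_right_mono)
  show "((%m. d m * (mpow (x - a) m * g x)) has_sum f x * g x) UNIV" if "x : pdisc a r" for x
   using has_sum_cmult_left[OF has_ps_has_sum[OF d(1) that], of "g x"] by (simp add: mult.assoc)
 qed
qed

lemma majorized_power:
 assumes r: "r > 0" and f: "majorized f a r B"
 shows "majorized (%x. f x ^ k) a r (B ^ k)"
proof (induction k)
 case 0
 show ?case using majorized_const[OF r, of 1 a] by simp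
next
 case (Suc k)
 show ?case using majorized_mult[OF r f Suc] by simp
qed

lemma majorized_prod:
 assumes r: "r > 0" and f: "!!i. i : I ==> majorized (f i) a r (B i)"
 shows "majorized (%x. \<Prod>i\<in>I. f i x) a r (\<Prod>i\<in>I. B i)"
 using f
proof (induction I rule: infinite_finite_induct)
 case (insert i I)
 then show ?case using majorized_mult[OF r, of "f i" a "B i"] by simp
qed (use majorized_const[OF r, of 1 a] in auto)

lemma majorized_shrink:
 assumes f: "majorized f a r B" and s: "0 < s" "s \<le> r"
 shows "majorized f a s B"
proof -
 obtain d where d: "has_ps f a r d" "(\<Sum>\<^sub>\<infinity>m. norm (d m) * r ^ deg m) \<le> B"
  using f by (auto simp: majorized_def)
 have le: "norm (d m) * s ^ deg m \<le> norm (d m) * r ^ deg m" for m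
  using s by (intro mult_left_mono power_mono) auto
 have S: "(%m. norm (d m) * s ^ deg m) summable_on UNIV"
  by (rule summable_on_comparison_test[OF has_ps_summable[OF d(1)]]) (use s le in auto)
 have "(\<Sum>\<^sub>\<infinity>m. norm (d m) * s ^ deg m) \<le> B"
  using infsum_mono[OF S has_ps_summable[OF d(1)] le] d(2) by simp
 moreover have "has_ps f a s d"
  using d(1) S pdisc_mono[OF s(2), of a] by (auto simp: has_ps_def)
 ultimately show ?thesis by (auto simp: majorized_def)
qed

lemma has_ps_center:
 assumes f: "has_ps f a r c" and r: "r \<ge> 0"
 shows "f a = c 0"
proof -
 have "((%m. c m * mpow (a - a) m) has_sum c 0) UNIV"
  by (rule has_sum_finite_neutralI[of "{0}"]) (auto simp: mpow_at_0)
 then show ?thesis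
  using has_ps_has_sum[OF f center_in_pdisc[OF r]] has_sum_unique by blast
qed

text \<open>The constant term is missing, so a majorant decreases at least linearly with the radius.\<close>

lemma majorized_vanishing:
 assumes f: "majorized f a r B" and s: "0 < s" "s \<le> r" and 0: "f a = 0"
 shows "majorized f a s (B * s / r)"
proof -
 obtain d where d: "has_ps f a r d" "(\<Sum>\<^sub>\<infinity>m. norm (d m) * r ^ deg m) \<le> B"
  using f by (auto simp: majorized_def)
 have d0: "d 0 = 0" using has_ps_center[OF d(1)] 0 s by simp
 have le: "norm (d m) * s ^ deg m \<le> norm (d m) * r ^ deg m * (s / r)" for m
 proof (cases "m = 0")
  case False
  then have "deg m > 0" by (fastforce simp: deg_def fun_eq_iff intro: sum_pos2)
  then obtain k where k: "deg m = Suc k" by (cases "deg m") auto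
  have "s ^ deg m \<le> r ^ k * s" unfolding k using s by (auto simp: mult.commute intro!: mult_left_mono power_mono)
  also have "... = r ^ deg m * (s / r)" using s k by simp
  finally show ?thesis
   using mult_left_mono[of "s ^ deg m" "r ^ deg m * (s / r)" "norm (d m)"] by (simp only: mult.assoc norm_ge_zero)
 qed (use d0 in auto)
 have S': "(%m. norm (d m) * r ^ deg m * (s / r)) summable_on UNIV"
  by (rule summable_on_cmult_left[OF has_ps_summable[OF d(1)]])
 have S: "(%m. norm (d m) * s ^ deg m) summable_on UNIV"
  by (rule summable_on_comparison_test[OF S']) (use s le in auto)
 have "(\<Sum>\<^sub>\<infinity>m. norm (d m) * s ^ deg m) \<le> (\<Sum>\<^sub>\<infinity>m. norm (d m) * r ^ deg m) * (s / r)"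
  using infsum_mono[OF S S' le] unfolding infsum_cmult_left' .
 also have "... \<le> B * (s / r)" using d(2) s by (intro mult_right_mono) auto
 finally have "(\<Sum>\<^sub>\<infinity>m. norm (d m) * s ^ deg m) \<le> B * s / r" by simp
 moreover have "has_ps f a s d"
  using d(1) S pdisc_mono[OF s(2), of a] by (auto simp: has_ps_def)
 ultimately show ?thesis by (auto simp: majorized_def)
qed

text \<open>Composition: substitute majorized series into the monomials and sum.\<close>

lemma majorized_compose:
 fixes f :: "'k::{real_normed_field,euclidean_space}^'n::finite => 'k" and g :: "'k^'m::finite => 'k^'n"
 assumes f: "has_ps f a R c" and s: "s > 0"
  and g: "!!i. majorized (%x. g x $ i - a $ i) b s R"
 shows "majorized (%x. f (g x)) b s (\<Sum>\<^sub>\<infinity>m. norm (c m) * R ^ deg m)"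
proof (rule majorized_has_sum[OF s, where L = UNIV and B = "%m. norm (c m) * R ^ deg m"
    and f = "%m x. c m * mpow (g x - a) m"])
 show "majorized (%x. c m * mpow (g x - a) m) b s (norm (c m) * R ^ deg m)" for m
 proof (rule majorized_cmult[OF s])
  have "majorized (%x. \<Prod>i\<in>UNIV. (g x $ i - a $ i) ^ m i) b s (\<Prod>i\<in>(UNIV::'n set). R ^ m i)"
   by (intro majorized_prod majorized_power s g)
  then show "majorized (%x. mpow (g x - a) m) b s (R ^ deg m)"
   by (simp add: mpow_def deg_def power_sum)
 qed
 show "((%m. c m * mpow (g x - a) m) has_sum f (g x)) UNIV" if "x : pdisc b s" for x
  by (rule has_ps_has_sum[OF f]) (use majorized_bound[OF g that] in \<open>auto simp: pdisc_def\<close>)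
qed (use has_ps_summable[OF f] in auto)

section \<open>Analytic functions of several variables\<close>

lemma power_series_atI:
 assumes "majorized f a r B" "r > 0"
 shows "power_series_at f a"
proof -
 obtain c where "has_ps f a r c" using assms(1) by (auto simp: majorized_def)
 then show ?thesis
  unfolding power_series_at_def has_ps_def pdisc_def mpow_def using assms(2)
  by (intro exI[of _ c] exI[of _ r]) (auto intro: less_imp_le)
qed

lemma power_series_atE_ps:
 assumes "power_series_at f a"
 obtains c r where "r > 0" "has_ps f a r c"
proof -
 obtain c r where r: "r > 0" and c: "!!x. (!!i. norm (x $ i - a $ i) < r) ==>
   ((%m. c m * (\<Prod>i\<in>UNIV. (x $ i - a $ i) ^ m i)) has_sum f x) UNIV"
  using assms unfolding power_series_at_def by blast
 define s where "s = r / 2"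
 have s: "s > 0" "s < r" using r by (auto simp: s_def)
 have "((%m. c m * (of_real s) ^ deg m) has_sum f (\<chi> i. a $ i + of_real s)) UNIV"
  using c[of "\<chi> i. a $ i + of_real s"] s by (simp add: deg_def power_sum)
 then have "(%m. norm (c m * (of_real s) ^ deg m)) summable_on UNIV"
  by (intro summable_on_imp_abs_summable has_sum_imp_summable)
 then have "(%m. norm (c m) * s ^ deg m) summable_on UNIV"
  using s by (simp add: norm_mult norm_power)
 moreover have "((%m. c m * mpow (x - a) m) has_sum f x) UNIV" if "x : pdisc a s" for x
  using c[of x] that s unfolding mpow_def pdisc_def by (fastforce intro: le_less_trans)
 ultimately have "has_ps f a s c" by (auto simp: has_ps_def)
 with s that show thesis by blast
qed

lemma power_series_atE:
 assumes "power_series_at f a"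
 obtains r B where "r > 0" "majorized f a r B"
 by (rule power_series_atE_ps[OF assms]) (auto dest: has_ps_majorized intro: that)

lemma power_series_at_cong:
 assumes f: "power_series_at f a" and eq: "\<forall>\<^sub>F x in nhds a. f x = g x"
 shows "power_series_at g a"
proof -
 obtain r B where r: "r > 0" "majorized f a r B" using power_series_atE[OF f] .
 obtain s where s: "s > 0" "!!x. x : pdisc a s ==> f x = g x" using pdisc_in_nhd[OF eq] by blast
 have "majorized f a (min r s) B" by (rule majorized_shrink[OF r(2)]) (use r s in auto)
 then have "majorized g a (min r s) B"
  by (rule majorized_cong) (use s pdisc_mono[of "min r s" s a] in auto)
 then show ?thesis by (rule power_series_atI) (use r s in auto)
qed

lemma power_series_at_const: "power_series_at (%x. c) a"
 using power_series_atI[OF majorized_const[of 1 c a]] by simp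

lemma power_series_at_shifted_coord: "power_series_at (%x. x $ i - a $ i) a"
 using power_series_atI[OF majorized_coord[of 1 i a]] by simp

lemma power_series_at_common_radius:
 assumes "power_series_at f a" "power_series_at g a"
 obtains r B C where "r > 0" "majorized f a r B" "majorized g a r C"
proof -
 obtain r B where r: "r > 0" "majorized f a r B" using power_series_atE[OF assms(1)] .
 obtain s C where s: "s > 0" "majorized g a s C" using power_series_atE[OF assms(2)] .
 show thesis
  by (rule that[of "min r s" B C]) (use r s in \<open>auto intro: majorized_shrink\<close>)
qed

lemma power_series_at_add:
 assumes "power_series_at f a" "power_series_at g a"
 shows "power_series_at (%x. f x + g x) a"
 by (rule power_series_at_common_radius[OF assms]) (auto intro: majorized_add power_series_atI)

lemma power_series_at_mult:
 assumes "power_series_at f a" "power_series_at g a"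
 shows "power_series_at (%x. f x * g x) a"
 by (rule power_series_at_common_radius[OF assms]) (auto intro: majorized_mult power_series_atI)

lemma power_series_at_coord: "power_series_at (%x. x $ i) a"
 using power_series_at_add[OF power_series_at_shifted_coord[of i a] power_series_at_const[of "a $ i"]]
 by simp

lemma majorized_small:
 assumes g: "power_series_at g b" "g b = 0" and R: "R > 0"
 shows "\<exists>s>0. majorized g b s R"
proof -
 obtain r B where r: "r > 0" "majorized g b r B"
  using power_series_atE[OF g(1)] by blast
 have B: "B \<ge> 0" using majorized_nonneg[OF r(2)] r by simp
 define s where "s = min r (R * r / (B + 1))"
 have s: "0 < s" "s \<le> r" using r R B by (auto simp: s_def)
 have "B * s / r \<le> B * (R * r / (B + 1)) / r"
  using B r by (intro divide_right_mono mult_left_mono) (auto simp: s_def)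
 also have "... = (B / (B + 1)) * R"
 proof -
  have "B * (R * r / D) / r = (B / D) * R" for D using r by simp
  then show ?thesis .
 qed
 also have "... \<le> 1 * R" using R B by (intro mult_right_mono) auto
 finally have *: "B * s / r \<le> R" by simp
 show ?thesis
  using majorized_mono[OF majorized_vanishing[OF r(2) s g(2)] *] s by blast
qed

lemma power_series_at_diff_const:
 "power_series_at f a ==> power_series_at (%x. f x - c) a"
 using power_series_at_add[OF _ power_series_at_const[of "- c"], of f a] by simp

lemma power_series_at_tendsto:
 assumes f: "power_series_at f a"
 shows "(f \<longlongrightarrow> f a) (nhds a)"
proof (rule tendstoI)
 fix e :: real assume e: "e > 0"
 obtain s where s: "s > 0" "majorized (%x. f x - f a) a s (e / 2)"
  using majorized_small[OF power_series_at_diff_const[OF f, of "f a"], of "e / 2"] e by auto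
 show "\<forall>\<^sub>F x in nhds a. dist (f x) (f a) < e"
  using pdisc_nhd[OF s(1), of a]
 proof eventually_elim
  case (elim x)
  then show ?case using majorized_bound[OF s(2) elim] e by (simp add: dist_norm)
 qed
qed

text \<open>The inner functions minus their values at the centre have small majorants on small polydiscs.\<close>

lemma power_series_at_compose:
 fixes g :: "'k::{real_normed_field,euclidean_space}^'m::finite => 'k^'n::finite"
 assumes f: "power_series_at f (g b)" and g: "!!i. power_series_at (%x. g x $ i) b"
 shows "power_series_at (%x. f (g x)) b"
proof -
 obtain c R where R: "R > 0" "has_ps f (g b) R c" using power_series_atE_ps[OF f] .
 have "\<exists>s>0. majorized (%x. g x $ i - g b $ i) b s R" for i
  by (rule majorized_small[OF power_series_at_diff_const[OF g] _ R(1)]) simp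
 then obtain s where s: "!!i. s i > 0" "!!i. majorized (%x. g x $ i - g b $ i) b (s i) R" by metis
 define t where "t = Min (range s)"
 have t: "t > 0" "!!i. t \<le> s i" using s by (auto simp: t_def)
 show ?thesis
  by (rule power_series_atI[OF majorized_compose[OF R(2) t(1) majorized_shrink[OF s(2) t]] t(1)])
qed

text \<open>Recentering is the composition with the identity, expanded at the new centre.\<close>

lemma has_ps_recenter:
 assumes f: "has_ps f a R c" and s: "s > 0" and b: "b : pdisc a (R - s)"
 shows "power_series_at f b"
proof -
 have "majorized (%x. x $ i - a $ i) b s R" for i
 proof (rule majorized_mono)
  show "majorized (%x. x $ i - a $ i) b s (s + norm (b $ i - a $ i))"
   using majorized_add[OF s majorized_coord[OF s, of i b] majorized_const[OF s, of "b $ i - a $ i" b]]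
   by simp
  show "s + norm (b $ i - a $ i) \<le> R"
   using b by (auto simp: pdisc_def algebra_simps dest!: spec[of _ i])
 qed
 from majorized_compose[OF f s this] show ?thesis
  by (rule power_series_atI[OF _ s])
qed

text \<open>Analyticity at a point is an open condition, by recentering.\<close>

lemma power_series_at_eventually:
 assumes "power_series_at f a"
 shows "\<forall>\<^sub>F x in nhds a. power_series_at f x"
proof -
 obtain c R where R: "R > 0" "has_ps f a R c" using power_series_atE_ps[OF assms] .
 show ?thesis
  by (rule eventually_mono[OF pdisc_nhd[of "R/2" a]])
   (use R has_ps_recenter[OF R(2), of "R/2"] in auto)
qed

section \<open>Partial derivatives of power series\<close>

text \<open>A one-variable derivative along the coordinate axis, taken over the scalar field: complex in the
 holomorphic category, real in the real analytic one.\<close>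

definition pd :: "'n => ('k::real_normed_field^'n::finite => 'k) => 'k^'n => 'k" where
 "pd i f x = deriv (%t. f (x + axis i t)) 0"

definition dcoeff :: "'n => (('n => nat) => 'k::semiring_1) => ('n => nat) => 'k" where
 "dcoeff i c m = of_nat (m i + 1) * c (m + munit i)"

lemma axis_0 [simp]: "axis i (0::'a::zero) = 0"
 by (simp add: axis_def vec_eq_iff)

lemma munit_split:
 assumes "m i > 0"
 shows "m = (m - munit i) + munit i"
 using assms by (auto simp: fun_eq_iff munit_def)

lemma has_ps_shrink: "has_ps f a r c ==> 0 < s ==> s \<le> r ==> has_ps f a s c"
 unfolding has_ps_def
proof (intro conjI ballI)
 assume f: "(%m. norm (c m) * r ^ deg m) summable_on UNIV \<and>
  (\<forall>x\<in>pdisc a r. ((%m. c m * mpow (x - a) m) has_sum f x) UNIV)" and s: "0 < s" "s \<le> r"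
 show "(%m. norm (c m) * s ^ deg m) summable_on UNIV"
  by (rule summable_on_comparison_test[OF conjunct1[OF f]])
   (use s in \<open>auto intro!: mult_left_mono power_mono\<close>)
 show "((%m. c m * mpow (x - a) m) has_sum f x) UNIV" if "x : pdisc a s" for x
  using f that pdisc_mono[OF s(2), of a] by blast
qed

lemma infinite_multiindices: "infinite (UNIV :: ('n::finite => nat) set)"
proof
 assume "finite (UNIV :: ('n => nat) set)"
 then have "finite (range (%k (i::'n). k :: nat))" by (rule finite_subset[rotated]) simp
 then have "finite (UNIV :: nat set)"
  by (rule finite_imageD) (auto simp: inj_on_def fun_eq_iff)
 then show False by simp
qed

lemma linear_times_power_le:
 fixes q R :: real
 assumes "0 < q" "q < R"
 shows "real k * q ^ (k - 1) \<le> R ^ k / (R - q)"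
proof (cases k)
 case (Suc l)
 have "1 + real k * (R / q - 1) \<le> (1 + (R / q - 1)) ^ k"
  by (rule Bernoulli_inequality) (use assms in auto)
 then have "real k * (R / q - 1) \<le> (R / q) ^ k" by simp
 then have "real k * (R / q - 1) * q ^ k \<le> (R / q) ^ k * q ^ k"
  using assms by (intro mult_right_mono) auto
 also have "... = R ^ k" using assms by (simp flip: power_mult_distrib)
 also have "real k * (R / q - 1) * q ^ k = real k * q ^ (k - 1) * (R - q)"
  using assms by (simp add: Suc field_simps)
 finally show ?thesis using assms by (simp add: pos_le_divide_eq)
qed (use assms in auto)

text \<open>Termwise differentiation: on a smaller polydisc the differentiated monomials are dominated,
 uniformly in the moving coordinate, by a summable family.\<close>

lemma has_ps_pd:
 fixes f :: "'k::{real_normed_field,euclidean_space}^'n::finite => 'k"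
 assumes f: "has_ps f a R c" and s: "0 < s" "s < R"
 shows "has_ps (pd i f) a s (dcoeff i c)"
  and "!!x. x : pdisc a s ==> ((%t. f (x + axis i t)) has_field_derivative pd i f x) (at 0)"
proof -
 define q where "q = (s + R) / 2"
 have q: "s < q" "q < R" "0 < q" using s by (auto simp: q_def)
 define M where "M m = norm (c m) * (real (m i) * q ^ (deg m - 1))" for m
 have M0: "M m \<ge> 0" for m using q by (auto simp: M_def)
 have MS: "M summable_on UNIV"
 proof (rule summable_on_comparison_test)
  show "(%m. norm (c m) * R ^ deg m * (1 / (R - q))) summable_on UNIV"
   by (rule summable_on_cmult_left[OF has_ps_summable[OF f]])
  fix m
  have "m i \<le> deg m" unfolding deg_def by (rule member_le_sum) auto
  then have "real (m i) * q ^ (deg m - 1) \<le> real (deg m) * q ^ (deg m - 1)"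
   using q by (intro mult_right_mono) auto
  also have "... \<le> R ^ deg m / (R - q)" by (rule linear_times_power_le) (use q in auto)
  finally have "M m \<le> norm (c m) * (R ^ deg m / (R - q))"
   unfolding M_def by (intro mult_left_mono) auto
  then show "M m \<le> norm (c m) * R ^ deg m * (1 / (R - q))" by simp
 qed (rule M0)
 have inj: "inj (%m. m + munit i)" by (auto simp: inj_on_def)
 have range: "range (%m. m + munit i) = {m. m i > 0}"
 proof (intro set_eqI iffI)
  fix m :: "'n => nat" assume "m : {m. m i > 0}"
  then show "m : range (%m. m + munit i)" using munit_split[of m i] by blast
 qed (auto simp: munit_def)
 have summ: "(%m. norm (dcoeff i c m) * s ^ deg m) summable_on UNIV"
 proof (rule summable_on_comparison_test)
  have "M summable_on range (%m. m + munit i)"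
   by (rule summable_on_subset_banach[OF MS]) simp
  then show "(M \<circ> (%m. m + munit i)) summable_on UNIV"
   by (rule summable_on_reindex[OF inj, THEN iffD1])
  show "norm (dcoeff i c m) * s ^ deg m \<le> (M \<circ> (%m. m + munit i)) m" for m
  proof -
   have "norm (dcoeff i c m) = norm (c (m + munit i)) * real (m i + 1)"
    by (simp only: dcoeff_def norm_mult norm_of_nat mult.commute)
   moreover have "s ^ deg m \<le> q ^ deg m" using s q by (intro power_mono) auto
   ultimately have "norm (dcoeff i c m) * s ^ deg m \<le> norm (c (m + munit i)) * real (m i + 1) * q ^ deg m"
    by (metis mult_left_mono mult_nonneg_nonneg norm_ge_zero)
   moreover have "(m + munit i) i = m i + 1" "deg (m + munit i) - 1 = deg m"
    by (simp_all add: deg_add) (simp add: munit_def)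
   ultimately show ?thesis unfolding M_def o_def by (simp only: mult.assoc)
  qed
 qed (use s in auto)
 have main: "((%m. dcoeff i c m * mpow (x - a) m) has_sum pd i f x) UNIV \<and>
   ((%t. f (x + axis i t)) has_field_derivative pd i f x) (at 0)" if x: "x : pdisc a s" for x
 proof -
  define u where "u = x - a"
  have u: "norm (u $ j) \<le> s" for j using x by (simp add: u_def pdisc_def)
  define p where "p m = (\<Prod>j\<in>UNIV - {i}. u $ j ^ m j)" for m
  have split: "mpow (u + axis i t) m = p m * (u $ i + t) ^ m i" for m t
  proof -
   have "mpow (u + axis i t) m = ((u + axis i t) $ i) ^ m i * (\<Prod>j\<in>UNIV - {i}. ((u + axis i t) $ j) ^ m j)"
    unfolding mpow_def by (rule prod.remove) auto
   also have "(\<Prod>j\<in>UNIV - {i}. ((u + axis i t) $ j) ^ m j) = p m"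
    unfolding p_def by (rule prod.cong) (auto simp: axis_def)
   finally show ?thesis by (simp add: axis_def mult.commute)
  qed
  define T where "T m t = c m * (p m * (u $ i + t) ^ m i)" for m t
  define T' where "T' m t = c m * (p m * (of_nat (m i) * (u $ i + t) ^ (m i - 1)))" for m t
  define S where "S = ball (0::'k) (q - s)"
  have S: "norm (u $ i + t) \<le> q" if "t : S" for t
   using norm_triangle_ineq[of "u $ i" t] u[of i] that by (auto simp: S_def)
  have bound: "norm (T' m t) \<le> M m" if "t : S" for m t
  proof (cases "m i = 0")
   case False
   have "norm (p m) \<le> (\<Prod>j\<in>UNIV - {i}. q ^ m j)"
    unfolding p_def using u q order_trans[OF u, of q]
    by (auto simp: norm_power simp flip: prod_norm intro!: prod_mono power_mono)
   moreover have "norm ((u $ i + t) ^ (m i - 1)) \<le> q ^ (m i - 1)"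
    unfolding norm_power by (rule power_mono[OF S[OF that]]) simp
   ultimately have "norm (p m) * norm ((u $ i + t) ^ (m i - 1)) \<le> (\<Prod>j\<in>UNIV - {i}. q ^ m j) * q ^ (m i - 1)"
    by (intro mult_mono) (use q in \<open>auto intro!: prod_nonneg\<close>)
   also have "... = q ^ (deg m - 1)"
   proof -
    have "deg m = m i + (\<Sum>j\<in>UNIV - {i}. m j)"
     unfolding deg_def by (rule sum.remove) auto
    then have "deg m - 1 = (\<Sum>j\<in>UNIV - {i}. m j) + (m i - 1)" using False by simp
    then show ?thesis by (simp add: power_add power_sum)
   qed
   finally have "real (m i) * (norm (p m) * norm ((u $ i + t) ^ (m i - 1))) \<le> real (m i) * q ^ (deg m - 1)"
    by (rule mult_left_mono) simp
   then have "norm (c m) * (real (m i) * (norm (p m) * norm ((u $ i + t) ^ (m i - 1)))) \<le> M m"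
    unfolding M_def by (rule mult_left_mono) simp
   then show ?thesis by (simp add: T'_def norm_mult mult_ac)
  qed (simp add: T'_def M_def)
  have deriv_T: "(T m has_field_derivative T' m t) (at t within S)" for m t
   unfolding T_def[abs_def] T'_def by (auto intro!: derivative_eq_intros)
  have sum_T: "((%m. T m t) has_sum f (x + axis i t)) UNIV" if "t : S" for t
  proof -
   have "x + axis i t : pdisc a R"
   proof -
    have "norm ((x + axis i t) $ j - a $ j) \<le> R" for j
     using S[OF that] u[of j] q s by (cases "j = i") (auto simp: axis_def u_def algebra_simps)
    then show ?thesis by (simp add: pdisc_def)
   qed
   from has_ps_has_sum[OF f this] have "((%m. c m * mpow (u + axis i t) m) has_sum f (x + axis i t)) UNIV"
    by (simp add: u_def algebra_simps)
   then show ?thesis by (simp add: T_def split)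
  qed
  have sum_T': "((%m. T' m 0) has_sum (\<Sum>\<^sub>\<infinity>m. T' m 0)) UNIV"
   by (rule has_sum_infsum, rule abs_summable_summable, rule summable_on_comparison_test[OF MS])
    (use bound[of 0] q in \<open>auto simp: S_def\<close>)
  define e where "e = from_nat_into (UNIV :: ('n => nat) set)"
  have e: "bij_betw e UNIV UNIV"
   unfolding e_def by (rule bij_betw_from_nat_into) (auto simp: infinite_multiindices)
  have sums_e: "(%k. F (e k)) sums z" if "(F has_sum z) UNIV" for F :: "('n => nat) => 'k" and z
   using that has_sum_reindex_bij_betw[OF e, of F z] by (intro has_sum_imp_sums) simp
  have Me: "summable (%k. M (e k))"
   using MS summable_on_reindex_bij_betw[OF e, of M] by (intro summable_on_imp_summable) simp
  have "0 : S" using q by (simp add: S_def)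
  have "((%t. \<Sum>k. T (e k) t) has_field_derivative (\<Sum>k. T' (e k) 0)) (at 0)"
  proof (rule has_field_derivative_series'(2)[of S])
   show "uniformly_convergent_on S (%n t. \<Sum>k<n. T' (e k) t)"
    by (rule Weierstrass_m_test'[OF bound Me])
   show "summable (%k. T (e k) 0)"
    using sums_e[OF sum_T[OF \<open>0 : S\<close>]] by (rule sums_summable)
   show "0 : interior S" using \<open>0 : S\<close> by (simp add: S_def)
  qed (use \<open>0 : S\<close> deriv_T in \<open>auto simp: S_def\<close>)
  also have "(\<Sum>k. T' (e k) 0) = (\<Sum>\<^sub>\<infinity>m. T' m 0)"
   using sums_e[OF sum_T'] by (simp add: sums_iff)
  finally have "((%t. f (x + axis i t)) has_field_derivative (\<Sum>\<^sub>\<infinity>m. T' m 0)) (at 0)"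
  proof (rule has_field_derivative_transform_within_open[of _ _ _ S])
   show "(\<Sum>k. T (e k) t) = f (x + axis i t)" if "t : S" for t
    using sums_e[OF sum_T[OF that]] by (simp add: sums_iff)
  qed (use \<open>0 : S\<close> in \<open>auto simp: S_def\<close>)
  moreover from this have pd: "pd i f x = (\<Sum>\<^sub>\<infinity>m. T' m 0)"
   unfolding pd_def by (rule DERIV_imp_deriv)
  moreover have "((%m. dcoeff i c m * mpow u m) has_sum (\<Sum>\<^sub>\<infinity>m. T' m 0)) UNIV"
  proof -
   have "((%m. T' m 0) has_sum (\<Sum>\<^sub>\<infinity>m. T' m 0)) (range (%m. m + munit i))"
    using sum_T' by (rule has_sum_cong_neutral[THEN iffD1, rotated -1])
     (auto simp: range T'_def)
   then have "(((%m. T' m 0) \<circ> (%m. m + munit i)) has_sum (\<Sum>\<^sub>\<infinity>m. T' m 0)) UNIV"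
    by (rule has_sum_reindex[OF inj, THEN iffD1])
   moreover have "T' (m + munit i) 0 = dcoeff i c m * mpow u m" for m
   proof -
    have "p (m + munit i) = p m" unfolding p_def by (intro prod.cong) (auto simp: munit_def)
    then show ?thesis using split[of 0 m] by (simp add: T'_def dcoeff_def munit_def mult_ac)
   qed
   ultimately show ?thesis by (simp add: o_def)
  qed
  ultimately show ?thesis by (simp add: u_def)
 qed
 show "has_ps (pd i f) a s (dcoeff i c)"
  using summ main by (auto simp: has_ps_def)
 show "((%t. f (x + axis i t)) has_field_derivative pd i f x) (at 0)" if "x : pdisc a s" for x
  using main[OF that] by blast
qed

lemma power_series_at_has_pd:
 assumes "power_series_at f a"
 shows "((%t. f (a + axis i t)) has_field_derivative pd i f a) (at 0)"
proof -
 obtain c r where r: "r > 0" "has_ps f a r c" using power_series_atE_ps[OF assms] .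
 show ?thesis
  by (rule has_ps_pd(2)[OF r(2), of "r/2"]) (use r in \<open>auto intro: center_in_pdisc\<close>)
qed

lemma power_series_at_pd:
 assumes "power_series_at f a"
 shows "power_series_at (pd i f) a"
proof -
 obtain c r where r: "r > 0" "has_ps f a r c" using power_series_atE_ps[OF assms] .
 have "has_ps (pd i f) a (r/2) (dcoeff i c)"
  by (rule has_ps_pd(1)[OF r(2)]) (use r in auto)
 from power_series_atI[OF has_ps_majorized[OF this]] show ?thesis using r by simp
qed

lemma pd_eqI:
 "((%t. f (a + axis i t)) has_field_derivative D) (at 0) ==> pd i f a = D"
 unfolding pd_def by (rule DERIV_imp_deriv)

lemma pd_const [simp]: "pd i (%x. c) a = 0"
 by (rule pd_eqI) simp

lemma pd_coord: "pd i (%x. x $ j) a = (if i = j then 1 else 0)"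
 by (rule pd_eqI) (auto simp: axis_def intro!: derivative_eq_intros)

lemma pd_add:
 assumes "power_series_at f a" "power_series_at g a"
 shows "pd i (%x. f x + g x) a = pd i f a + pd i g a"
 by (intro pd_eqI derivative_intros power_series_at_has_pd assms)

lemma pd_mult:
 assumes "power_series_at f a" "power_series_at g a"
 shows "pd i (%x. f x * g x) a = f a * pd i g a + g a * pd i f a"
 by (rule pd_eqI) (auto intro!: derivative_eq_intros power_series_at_has_pd assms simp: mult_ac)

lemma axis_tendsto_0:
 fixes x :: "'k::real_normed_field^'n::finite"
 shows "filterlim (%t. x + axis i t) (nhds x) (nhds 0)"
proof (rule vec_tendstoI)
 fix j
 have "((%t. x $ j + (if j = i then t else 0)) \<longlongrightarrow> x $ j + (if j = i then 0 else 0)) (nhds 0)"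
  by (cases "j = i") (auto intro!: tendsto_add tendsto_const filterlim_ident simp del: add_0_right)
 then show "((%t. (x + axis i t) $ j) \<longlongrightarrow> x $ j) (nhds 0)" by (simp add: axis_def)
qed

lemma pd_cong_ev:
 assumes "\<forall>\<^sub>F x in nhds a. f x = g x"
 shows "pd i f a = pd i g a"
 unfolding pd_def
 by (rule deriv_cong_ev) (use eventually_compose_filterlim[OF assms axis_tendsto_0] in auto)

lemma pd_cong_ev':
 assumes "\<forall>\<^sub>F x in nhds a. f x = g x"
 shows "\<forall>\<^sub>F x in nhds a. pd i f x = pd i g x"
proof -
 have "\<forall>\<^sub>F y in nhds a. \<forall>\<^sub>F x in nhds y. f x = g x"
  using assms by (simp only: eventually_eventually)
 then show ?thesis by (rule eventually_mono) (rule pd_cong_ev)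
qed

text \<open>This criterion serves both as the identity theorem for power series and as the uniqueness theorem for
 differential equations: the Taylor coefficients at \<open>a\<close> are values of iterated derivatives, all of
 which lie in \<open>S\<close>.\<close>

lemma pd_closed_coeff_0:
 assumes S: "!!f. f : S ==> f a = 0"
   "!!f i. f : S ==> \<exists>g\<in>S. \<forall>\<^sub>F x in nhds a. pd i f x = g x"
  and f: "f : S" "has_ps f a r c" "r > 0"
 shows "c m = 0"
 using f
proof (induction "deg m" arbitrary: f r c m)
 case 0
 then have "m = 0" by (auto simp: deg_def fun_eq_iff)
 then show ?case using has_ps_center[OF 0(3)] S(1)[OF 0(2)] 0 by simp
next
 case (Suc d)
 then have "\<exists>i. m i > 0" unfolding deg_def by (metis gr0I sum.neutral Zero_not_Suc)
 then obtain i where i: "m i > 0" ..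
 define m' where "m' = m - munit i"
 have m: "m = m' + munit i" unfolding m'_def by (rule munit_split[of m i, OF i])
 obtain g where g: "g : S" "\<forall>\<^sub>F x in nhds a. pd i f x = g x" using S(2)[OF Suc(3)] by blast
 obtain s where s: "s > 0" "!!x. x : pdisc a s ==> pd i f x = g x" using pdisc_in_nhd[OF g(2)] by blast
 define t where "t = min s (r / 2)"
 have t: "0 < t" "t < r" "t \<le> s" using s Suc by (auto simp: t_def)
 have "has_ps (pd i f) a t (dcoeff i c)" by (rule has_ps_pd(1)[OF Suc(4) t(1,2)])
 then have "has_ps g a t (dcoeff i c)"
  by (rule has_ps_cong) (use s pdisc_mono[OF t(3), of a] in auto)
 moreover have "d = deg m'" using Suc(2) m by (simp add: deg_add)
 ultimately have "dcoeff i c m' = 0" using Suc(1)[of m' g t] g t by blast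
 then show ?case using m by (simp add: dcoeff_def del: of_nat_add of_nat_Suc)
qed

lemma pd_closed_eventually_0:
 assumes S: "!!f. f : S ==> f a = 0"
   "!!f i. f : S ==> \<exists>g\<in>S. \<forall>\<^sub>F x in nhds a. pd i f x = g x"
  and f: "f : S" "power_series_at f a"
 shows "\<forall>\<^sub>F x in nhds a. f x = 0"
proof -
 obtain c r where r: "r > 0" "has_ps f a r c" using power_series_atE_ps[OF f(2)] .
 have "c m = 0" for m
  by (rule pd_closed_coeff_0[of S a f r c]) (use S f r in blast)+
 then have c: "c = (%m. 0)" by auto
 show ?thesis
  using pdisc_nhd[OF r(1), of a]
 proof eventually_elim
  case (elim x)
  have "((%m::'b => nat. 0) has_sum f x) UNIV" using has_ps_has_sum[OF r(2) elim] by (simp add: c)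
  then show ?case by (rule has_sum_unique) simp
 qed
qed

text \<open>The coefficients are determined by iterated derivatives at the centre.\<close>

lemma has_ps_unique:
 assumes f: "has_ps f a r c" and g: "has_ps g a r d" and r: "r > 0"
  and eq: "\<forall>\<^sub>F x in nhds a. f x = g x"
 shows "c = d"
proof
 fix m
 define S where "S = {h. \<forall>\<^sub>F x in nhds a. h x = (0::'a)}"
 have "has_ps (%x. f x - g x) a r (%m. c m - d m)"
  unfolding has_ps_def
 proof (intro conjI ballI)
  show "(%m. norm (c m - d m) * r ^ deg m) summable_on UNIV"
  proof (rule summable_on_comparison_test[OF summable_on_add[OF has_ps_summable[OF f] has_ps_summable[OF g]]])
   show "norm (c m - d m) * r ^ deg m \<le> norm (c m) * r ^ deg m + norm (d m) * r ^ deg m" for m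
    using r by (simp add: norm_triangle_ineq4 mult_right_mono flip: distrib_right)
  qed (use r in auto)
  show "((%m. (c m - d m) * mpow (x - a) m) has_sum f x - g x) UNIV" if "x : pdisc a r" for x
   using has_sum_add[OF has_ps_has_sum[OF f that] has_sum_uminusI[OF has_ps_has_sum[OF g that]]]
   by (simp add: algebra_simps)
 qed
 then have "c m - d m = 0"
 proof (rule pd_closed_coeff_0[of S, rotated 3])
  show "(%x. f x - g x) : S" unfolding S_def using eq by (auto elim: eventually_mono)
  show "h a = 0" if "h : S" for h using that eventually_nhds_x_imp_x unfolding S_def by blast
  show "\<exists>g\<in>S. \<forall>\<^sub>F x in nhds a. pd i h x = g x" if "h : S" for h i
   using pd_cong_ev'[of h "%x. 0" a i] that by (intro bexI[of _ "%x. 0"]) (auto simp: S_def)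
 qed (rule r)
 then show "c m = d m" by simp
qed

section \<open>Hadamard's lemma, composition with the exponential, and primitives\<close>

lemma has_sum_finite_sum:
 fixes f :: "'i => 'j => 'b::topological_comm_monoid_add"
 assumes "!!i. i : I ==> (f i has_sum s i) A"
 shows "((%x. \<Sum>i\<in>I. f i x) has_sum (\<Sum>i\<in>I. s i)) A"
 using assms by (induction I rule: infinite_finite_induct) (auto intro: has_sum_add)

text \<open>Collect the monomials divisible by a coordinate according to one coordinate dividing them.\<close>

lemma hadamard:
 fixes f :: "'k::{real_normed_field,euclidean_space}^'n::finite => 'k"
 assumes "power_series_at f a"
 obtains h where "!!i. power_series_at (h i) a"
  "\<forall>\<^sub>F x in nhds a. f x = f a + (\<Sum>i\<in>UNIV. (x $ i - a $ i) * h i x)"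
proof -
 obtain c r where r: "r > 0" and f: "has_ps f a r c" using power_series_atE_ps[OF assms] .
 define sel where "sel m = (SOME i. m i > 0)" for m :: "'n => nat"
 have sel: "m (sel m) > 0" if "m ~= 0" for m
 proof -
  have "\<exists>i. m i > 0" using that by (auto simp: fun_eq_iff)
  then show ?thesis unfolding sel_def by (rule someI_ex)
 qed
 define J where "J i = {m. m ~= 0 & sel m = i}" for i
 define \<kappa> where "\<kappa> i m = m - munit i" for i and m :: "'n => nat"
 have split: "m = \<kappa> i m + munit i" if "m : J i" for i m
  unfolding \<kappa>_def by (rule munit_split[of m i]) (use that sel in \<open>auto simp: J_def\<close>)
 have degJ: "deg m = Suc (deg (\<kappa> i m))" if "m : J i" for i m
  using deg_add[of "\<kappa> i m" "munit i"] split[OF that] by simp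
 define h where "h i x = (\<Sum>\<^sub>\<infinity>m\<in>J i. c m * mpow (x - a) (\<kappa> i m))" for i x
 have S: "(%m. norm (c m) * r ^ deg (\<kappa> i m)) summable_on J i" for i
 proof -
  have "(%m. norm (c m) * r ^ deg m * (1 / r)) summable_on J i"
   by (rule summable_on_cmult_left[OF summable_on_subset_banach[OF has_ps_summable[OF f]]]) simp
  then show ?thesis
   by (rule summable_on_cong[THEN iffD1, rotated]) (use r in \<open>auto simp: degJ\<close>)
 qed
 have h: "((%m. c m * mpow (x - a) (\<kappa> i m)) has_sum h i x) (J i)" if x: "x : pdisc a r" for i x
  unfolding h_def
  by (rule has_sum_infsum, rule abs_summable_summable, rule summable_on_comparison_test[OF S])
   (auto simp: norm_mult intro!: mult_left_mono norm_mpow_diff_le[OF x])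
 have ps: "power_series_at (h i) a" for i
  by (rule power_series_atI[OF majorized_regroup[OF r S order_refl h] r])
 have eq: "f x = f a + (\<Sum>i\<in>UNIV. (x $ i - a $ i) * h i x)" if x: "x : pdisc a r" for x
 proof -
  have 1: "((%m. if m : J i then c m * mpow (x - a) m else 0) has_sum (x $ i - a $ i) * h i x) UNIV" for i
  proof -
   have "((%m. (x $ i - a $ i) * (c m * mpow (x - a) (\<kappa> i m))) has_sum (x $ i - a $ i) * h i x) (J i)"
    by (rule has_sum_cmult_right[OF h[OF x]])
   moreover have "c m * mpow (x - a) m = (x $ i - a $ i) * (c m * mpow (x - a) (\<kappa> i m))" if "m : J i" for m
    using mpow_add[of "x - a" "\<kappa> i m" "munit i"] split[OF that] by (simp add: mult_ac)
   ultimately show ?thesis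
    by (elim has_sum_cong_neutral[THEN iffD1, rotated -1]) (simp_all, metis)
  qed
  have 2: "((%m. if m = 0 then c m else 0) has_sum f a) UNIV"
   using has_ps_center[OF f] r by (intro has_sum_finite_neutralI[of "{0}"]) auto
  have "((%m. (if m = 0 then c m else 0) + (\<Sum>i\<in>UNIV. if m : J i then c m * mpow (x - a) m else 0))
    has_sum f a + (\<Sum>i\<in>UNIV. (x $ i - a $ i) * h i x)) UNIV"
   by (rule has_sum_add[OF 2 has_sum_finite_sum[OF 1]])
  also have "(%m. (if m = 0 then c m else 0) + (\<Sum>i\<in>UNIV. if m : J i then c m * mpow (x - a) m else 0))
    = (%m. c m * mpow (x - a) m)"
  proof
   show "(if m = 0 then c m else 0) + (\<Sum>i\<in>UNIV. if m : J i then c m * mpow (x - a) m else 0)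
     = c m * mpow (x - a) m" for m
    by (cases "m = 0") (auto simp: J_def)
  qed
  finally show ?thesis by (rule has_sum_unique[OF has_ps_has_sum[OF f x]])
 qed
 show thesis
  by (rule that[of h, OF ps]) (use pdisc_nhd[OF r, of a] eq in \<open>auto elim: eventually_mono\<close>)
qed

lemma power_series_at_powser:
 fixes g :: "'k::{real_normed_field,euclidean_space}^'n::finite => 'k"
 assumes g: "power_series_at g a" "g a = 0" and e: "!!k. norm (e k) \<le> 1"
 shows "power_series_at (%x. \<Sum>k. e k * g x ^ k) a"
proof -
 obtain s where s: "s > 0" and gs: "majorized g a s (1/2)"
  using majorized_small[OF g, of "1/2"] by auto
 have half: "summable (%k. (1/2::real) ^ k)" by simp
 show ?thesis
 proof (rule power_series_atI[OF majorized_has_sum[OF s, where L = UNIV and B = "%k. (1/2) ^ k"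
    and C = "\<Sum>\<^sub>\<infinity>k. (1/2) ^ k"] s])
  show "majorized (%x. e k * g x ^ k) a s ((1/2) ^ k)" for k
   by (rule majorized_mono[OF majorized_cmult[OF s majorized_power[OF s gs]]])
    (use e[of k] in \<open>auto intro: mult_left_le_one_le\<close>)
  show "(%k. (1/2::real) ^ k) summable_on UNIV"
   by (rule summable_nonneg_imp_summable_on[OF half]) simp
  show "((%k. e k * g x ^ k) has_sum (\<Sum>k. e k * g x ^ k)) UNIV" if "x : pdisc a s" for x
  proof -
   have "norm (e k * g x ^ k) \<le> (1/2) ^ k" for k
    using mult_mono[OF e[of k] power_mono[OF majorized_bound[OF gs that], of k]]
    by (simp add: norm_mult norm_power)
   then have "summable (%k. norm (e k * g x ^ k))"
    by (intro summable_comparison_test[OF _ half]) auto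
   from norm_summable_imp_has_sum[OF this summable_sums[OF summable_norm_cancel[OF this]]]
   show ?thesis .
  qed
 qed simp
qed

text \<open>Compose with the geometric series.\<close>

lemma power_series_at_inverse:
 assumes f: "power_series_at f a" and "f a ~= 0"
 shows "power_series_at (%x. inverse (f x)) a"
proof -
 define g where "g = (%x. 1 - inverse (f a) * f x)"
 have g: "power_series_at g a"
  using power_series_at_add[OF power_series_at_const[of 1] power_series_at_mult[OF power_series_at_const[of "- inverse (f a)"] f]]
  by (simp add: g_def)
 have ga: "g a = 0" using assms by (simp add: g_def)
 have "power_series_at (%x. inverse (f a) * (\<Sum>k. 1 * g x ^ k)) a"
  by (intro power_series_at_mult power_series_at_const power_series_at_powser g ga) simp
 then show ?thesis
 proof (rule power_series_at_cong)
  have "\<forall>\<^sub>F x in nhds a. dist (g x) (g a) < 1"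
   using tendstoD[OF power_series_at_tendsto[OF g], of 1] by simp
  then show "\<forall>\<^sub>F x in nhds a. inverse (f a) * (\<Sum>k. 1 * g x ^ k) = inverse (f x)"
  proof eventually_elim
   case (elim x)
   then have "norm (g x) < 1" using ga by simp
   then show ?case using suminf_geometric[of "g x"] assms(2) by (simp add: g_def field_simps)
  qed
 qed
qed

text \<open>\<open>exp t = 1 + t E(t)\<close> with \<open>E(0) = 1\<close>: the factorization makes the exponential accessible to
 derivations, which only see products.\<close>

lemma exp_factor:
 fixes h :: "'k::{real_normed_field,euclidean_space}^'n::finite => 'k"
 assumes "power_series_at h a" "h a = 0"
 obtains E where "power_series_at E a" "E a = 1" "!!x. exp (h x) = 1 + h x * E x"
proof
 define E where "E x = (\<Sum>k. of_real (1 / fact (Suc k)) * h x ^ k)" for x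
 show "power_series_at E a"
  unfolding E_def[abs_def]
 proof (intro power_series_at_powser assms)
  show "norm (of_real (1 / fact (Suc k)) :: 'k) \<le> 1" for k
   using fact_ge_1[of "Suc k", where 'a = real] by (simp only: norm_of_real) (simp add: divide_le_eq_1)
 qed
 have s: "summable (%k. of_real (1 / fact k) * t ^ k)" for t :: 'k
  using summable_exp_generic[of t] by (simp add: scaleR_conv_of_real divide_inverse)
 have *: "exp t = 1 + t * (\<Sum>k. of_real (1 / fact (Suc k)) * t ^ k)" for t :: 'k
 proof -
  have "exp t = (\<Sum>k. of_real (1 / fact k) * t ^ k)"
   by (simp add: exp_def scaleR_conv_of_real divide_inverse)
  also have "... = (\<Sum>k. of_real (1 / fact (Suc k)) * t ^ Suc k) + 1"
   using suminf_split_head[OF s[of t]] by simp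
  also have "(\<Sum>k. of_real (1 / fact (Suc k)) * t ^ Suc k) = t * (\<Sum>k. of_real (1 / fact (Suc k)) * t ^ k)"
  proof (cases "t = 0")
   case False
   define e :: "nat => 'k" where "e k = of_real (1 / fact (Suc k))" for k
   have "summable (%k. e k * t ^ Suc k)"
    using s[of t] unfolding e_def by (subst summable_Suc_iff)
   then have "summable (%k. e k * t ^ Suc k * inverse t)" by (rule summable_mult2)
   moreover have "e k * t ^ Suc k * inverse t = e k * t ^ k" for k using False by simp
   ultimately have "summable (%k. e k * t ^ k)" by (simp only:)
   then have "(\<Sum>k. t * (e k * t ^ k)) = t * (\<Sum>k. e k * t ^ k)" by (rule suminf_mult)
   then show ?thesis unfolding e_def[symmetric] by (simp add: mult_ac)
  qed simp
  finally show ?thesis by simp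
 qed
 show "exp (h x) = 1 + h x * E x" for x unfolding E_def by (rule *)
 have "(%k. of_real (1 / fact (Suc k)) * (0::'k) ^ k) sums (\<Sum>k\<in>{0}. of_real (1 / fact (Suc k)) * 0 ^ k)"
  by (rule sums_finite) auto
 then show "E a = 1" by (simp add: E_def assms sums_iff)
qed

text \<open>A closed system of first-order coefficients has a primitive: on coefficients, closedness says
 that the candidates obtained by integrating along different coordinates coincide.\<close>

lemma closed_has_primitive:
 fixes g :: "'n::finite => 'k::{real_normed_field,euclidean_space}^'n => 'k"
 assumes g: "!!i. power_series_at (g i) a"
  and closed: "!!i j. \<forall>\<^sub>F x in nhds a. pd i (g j) x = pd j (g i) x"
 obtains h where "power_series_at h a" "!!i. \<forall>\<^sub>F x in nhds a. pd i h x = g i x"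
proof -
 have "\<exists>r c. r > 0 & has_ps (g i) a r c" for i using power_series_atE_ps[OF g] by metis
 then obtain ra ca where ra: "!!i. ra i > 0" "!!i. has_ps (g i) a (ra i) (ca i)" by metis
 define r where "r = Min (range ra)"
 have r: "r > 0" "r \<le> ra i" for i using ra by (auto simp: r_def)
 have c: "has_ps (g i) a r (ca i)" for i by (rule has_ps_shrink[OF ra(2)]) (use r in auto)
 have sym: "dcoeff i (ca j) = dcoeff j (ca i)" for i j
  by (rule has_ps_unique[OF has_ps_pd(1)[OF c] has_ps_pd(1)[OF c] _ closed, of "r/2"]) (use r in auto)
 define sel where "sel m = (SOME i. m i > 0)" for m :: "'n => nat"
 define d where "d m = (if m = 0 then 0 else ca (sel m) (m - munit (sel m)) / of_nat (m (sel m)))" for m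
 have d: "of_nat (m i) * d m = ca i (m - munit i)" if i: "m i > 0" for m i
 proof -
  define j where "j = sel m"
  have j: "m j > 0" unfolding j_def sel_def by (rule someI[of "%i. m i > 0", OF i])
  have m0: "m ~= 0" using i by auto
  show ?thesis
  proof (cases "i = j")
   case True
   then show ?thesis using m0 i by (simp add: d_def j_def)
  next
   case False
   define k where "k = m - munit i - munit j"
   have k: "k + munit i = m - munit j" "k + munit j = m - munit i"
    using i j False by (auto simp: k_def munit_def fun_eq_iff)
   have kk: "m i = k i + 1" "m j = k j + 1"
    using i j False by (auto simp: k_def munit_def)
   have "of_nat (m i) * ca j (m - munit j) = of_nat (m j) * ca i (m - munit i)"
    using fun_cong[OF sym[of i j], of k] unfolding dcoeff_def k kk by simp
   moreover have "d m = ca j (m - munit j) / of_nat (m j)" using m0 by (simp add: d_def j_def)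
   ultimately show ?thesis using j by simp
  qed
 qed
 have S: "(%m. norm (d m) * r ^ deg m) summable_on UNIV"
 proof (rule summable_on_comparison_test)
  define b where "b i m = (if m i > 0 then norm (ca i (m - munit i)) * r ^ deg m else 0)" for i m
  have "b i summable_on UNIV" for i
  proof -
   have inj: "inj (%m. m + munit i)" by (auto simp: inj_on_def)
   have "(b i \<circ> (%m. m + munit i)) summable_on UNIV"
   proof -
    have "(b i \<circ> (%m. m + munit i)) = (%m. norm (ca i m) * r ^ deg m * r)"
     by (auto simp: b_def fun_eq_iff munit_def deg_add[of _ "munit i", unfolded munit_def] deg_munit[unfolded munit_def])
    then show ?thesis using summable_on_cmult_left[OF has_ps_summable[OF c]] by metis
   qed
   then have "b i summable_on range (%m. m + munit i)"
    by (rule summable_on_reindex[OF inj, THEN iffD2])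
   then show ?thesis
   proof (rule summable_on_cong_neutral[THEN iffD1, rotated -1])
    fix m assume "m : UNIV - range (%m. m + munit i)"
    then show "b i m = 0" using munit_split[of m i] by (auto simp: b_def)
   qed auto
  qed
  then show "(%m. \<Sum>i\<in>UNIV. b i m) summable_on UNIV"
   using has_sum_finite_sum[where I = UNIV and f = b and s = "%i. infsum (b i) UNIV" and A = UNIV]
   by (auto intro: has_sum_imp_summable)
  show "norm (d m) * r ^ deg m \<le> (\<Sum>i\<in>UNIV. b i m)" for m
  proof (cases "m = 0")
   case True
   then show ?thesis by (simp add: d_def b_def)
  next
   case False
   then obtain i where i: "m i > 0" by (auto simp: fun_eq_iff)
   have "norm (d m) \<le> real (m i) * norm (d m)" using i by (simp add: mult_le_cancel_right1)
   also have "... = norm (ca i (m - munit i))" using d[of m i, OF i] by (metis norm_mult norm_of_nat)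
   finally have "norm (d m) * r ^ deg m \<le> b i m" using i r by (simp add: b_def mult_right_mono)
   also have "... \<le> (\<Sum>i\<in>UNIV. b i m)"
    by (rule member_le_sum) (use r in \<open>auto simp: b_def\<close>)
   finally show ?thesis .
  qed
 qed (use r in auto)
 define h where "h x = (\<Sum>\<^sub>\<infinity>m. d m * mpow (x - a) m)" for x
 have h: "has_ps h a r d"
  unfolding has_ps_def h_def
 proof (intro conjI ballI S)
  fix x assume x: "x : pdisc a r"
  show "((%m. d m * mpow (x - a) m) has_sum (\<Sum>\<^sub>\<infinity>m. d m * mpow (x - a) m)) UNIV"
   by (rule has_sum_infsum, rule abs_summable_summable, rule summable_on_comparison_test[OF S])
    (auto simp: norm_mult intro!: mult_left_mono norm_mpow_diff_le[OF x])
 qed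
 have eq: "pd i h x = g i x" if x: "x : pdisc a (r/2)" for i x
 proof -
  have "dcoeff i d = ca i"
  proof
   show "dcoeff i d m = ca i m" for m
    using d[of "m + munit i" i] by (simp add: dcoeff_def munit_def)
  qed
  then have "has_ps (pd i h) a (r/2) (ca i)"
   using has_ps_pd(1)[OF h, of "r/2" i] r by simp
  moreover have "x : pdisc a r" using x pdisc_mono[of "r/2" r a] r by auto
  ultimately show ?thesis
   using has_ps_has_sum[OF c, of x i] has_ps_has_sum[of "pd i h" a "r/2" "ca i" x] x has_sum_unique by blast
 qed
 show thesis
 proof (rule that[of h])
  show "power_series_at h a" by (rule power_series_atI[OF has_ps_majorized[OF h] r(1)])
  show "\<forall>\<^sub>F x in nhds a. pd i h x = g i x" for i
   using pdisc_nhd[of "r/2" a] r eq by (auto elim: eventually_mono)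
 qed
qed

section \<open>Analytic functions on a manifold\<close>

lemma sum_fun_apply: "(\<Sum>i\<in>I. f i) x = (\<Sum>i\<in>I. f i x)"
 by (induction I rule: infinite_finite_induct) auto

lemma fscale_apply [simp]: "fscale c g x = c * g x"
 by (simp add: fscale_def)

lemma pd_commute:
 fixes f :: "'k::{real_normed_field,euclidean_space}^'n::finite => 'k"
 assumes "power_series_at f a"
 shows "pd i (pd j f) a = pd j (pd i f) a"
proof -
 obtain c r where r: "r > 0" "has_ps f a r c" using power_series_atE_ps[OF assms] .
 have "has_ps (pd i (pd j f)) a (r/4) (dcoeff i (dcoeff j c))" for i j
  by (rule has_ps_pd(1)[OF has_ps_pd(1)[OF r(2), of "r/2"]]) (use r in auto)
 then have "pd i (pd j f) a = dcoeff i (dcoeff j c) 0" for i j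
  by (rule has_ps_center) (use r in auto)
 then show ?thesis by (simp add: dcoeff_def munit_def add.commute)
qed

locale manifold =
 fixes \<A> :: "('a::{t2_space,second_countable_topology}, 'k::{real_normed_field,euclidean_space}, 'n::finite) atlas"
 assumes manifold: "analytic_manifold \<A>"
begin

abbreviation "fon \<equiv> form_on \<A>"
abbreviation "lie \<equiv> lie_bracket \<A>"
abbreviation "lieD \<equiv> lie_derivative \<A>"
abbreviation "fco \<equiv> frame_coeff \<A>"
abbreviation "arel \<equiv> abelian_relation_of \<A>"
abbreviation "Arels \<equiv> abelian_relations \<A>"
abbreviation "extd \<equiv> ext_deriv \<A>"
abbreviation "Omf \<equiv> Omega_form \<A>"
abbreviation "cfs \<equiv> component_fields"
abbreviation "cofr \<equiv> coframe \<A>"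
abbreviation "phic \<equiv> phi_coeff \<A>"
abbreviation "pots \<equiv> potentials \<A>"

abbreviation an :: "'a => ('a => 'k) => bool" where
 "an \<equiv> mfd_analytic_at \<A>"

abbreviation rep :: "'a set => ('a => 'k^'n) => ('a => 'k) => 'k^'n => 'k" where
 "rep D ph f \<equiv> (%x. f (inv_into D ph x))"

lemma chart_exists: obtains D ph where "(D, ph) : \<A>" "p : D"
proof -
 have "p : (\<Union>(D, ph)\<in>\<A>. D)" using manifold unfolding analytic_manifold_def by simp
 then show thesis using that by blast
qed

context
 fixes D ph assumes chart: "(D, ph) : \<A>"
begin

lemma chart_open: "open D" "open (ph ` D)"
 and chart_homeo: "homeomorphism D (ph ` D) ph (inv_into D ph)"
 using manifold chart unfolding analytic_manifold_def by blast+

lemma chart_inv [simp]: "p : D ==> inv_into D ph (ph p) = p"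
 using chart_homeo by (rule homeomorphism_apply1)

lemma chart_tendsto:
 assumes "p : D" shows "filterlim ph (nhds (ph p)) (nhds p)"
 using chart_homeo chart_open assms
 by (auto simp: homeomorphism_def continuous_on_eq_continuous_at isCont_def tendsto_at_iff_tendsto_nhds)

lemma chart_inv_tendsto:
 assumes "p : D" shows "filterlim (inv_into D ph) (nhds p) (nhds (ph p))"
proof -
 have "isCont (inv_into D ph) (ph p)"
  using chart_homeo chart_open assms
  by (auto simp: homeomorphism_def continuous_on_eq_continuous_at)
 then have "(inv_into D ph \<longlongrightarrow> inv_into D ph (ph p)) (nhds (ph p))"
  unfolding isCont_def tendsto_at_iff_tendsto_nhds .
 then show ?thesis using assms by simp
qed

lemma eventually_chart_rep:
 "p : D ==> \<forall>\<^sub>F x in nhds p. P x ==> \<forall>\<^sub>F x in nhds (ph p). P (inv_into D ph x)"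
 using eventually_compose_filterlim chart_inv_tendsto by blast

lemma eventually_chart:
 "p : D ==> \<forall>\<^sub>F x in nhds (ph p). P x ==> \<forall>\<^sub>F x in nhds p. P (ph x)"
 using eventually_compose_filterlim chart_tendsto by blast

lemma eventually_in_chart: "p : D ==> \<forall>\<^sub>F x in nhds p. x : D"
 using chart_open(1) by (rule eventually_nhds_in_open)

lemma eventually_chart_inv: "p : D ==> \<forall>\<^sub>F x in nhds (ph p). ph (inv_into D ph x) = x"
 using eventually_nhds_in_open[OF chart_open(2), of "ph p"]
 by (auto elim!: eventually_mono intro: f_inv_into_f)

lemma analytic_rep:
 assumes p: "p : D"
 shows "an p f \<longleftrightarrow> power_series_at (rep D ph f) (ph p)"
proof
 assume "power_series_at (rep D ph f) (ph p)"
 then show "an p f" using chart p unfolding mfd_analytic_at_def by blast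
next
 assume "an p f"
 then obtain D' ph' where c': "(D', ph') : \<A>" "p : D'"
  and ps: "power_series_at (rep D' ph' f) (ph' p)"
  unfolding mfd_analytic_at_def by blast
 define g where "g x = ph' (inv_into D ph x)" for x
 have "power_series_at (%x. g x $ i) (ph p)" for i
  using manifold chart c' p unfolding analytic_manifold_def g_def by blast
 moreover have "g (ph p) = ph' p" using p by (simp add: g_def)
 ultimately have "power_series_at (%x. rep D' ph' f (g x)) (ph p)"
  using power_series_at_compose[of "rep D' ph' f" g "ph p"] ps by simp
 then show "power_series_at (rep D ph f) (ph p)"
 proof (rule power_series_at_cong)
  have "\<forall>\<^sub>F x in nhds p. inv_into D' ph' (ph' x) = x"
  proof -
   have "homeomorphism D' (ph' ` D') ph' (inv_into D' ph')" "open D'"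
    using manifold c' unfolding analytic_manifold_def by blast+
   then show ?thesis
    using eventually_nhds_in_open[of D' p] c'(2)
    by (auto elim!: eventually_mono intro: homeomorphism_apply1)
  qed
  from eventually_chart_rep[OF p this]
  show "\<forall>\<^sub>F x in nhds (ph p). rep D' ph' f (g x) = rep D ph f x"
   by eventually_elim (simp add: g_def)
 qed
qed

lemma analytic_of_rep:
 assumes p: "p : D" and F: "power_series_at F (ph p)"
 shows "an p (%q. F (ph q))"
 unfolding analytic_rep[OF p]
 by (rule power_series_at_cong[OF F], rule eventually_mono[OF eventually_chart_inv[OF p]]) simp

lemma analytic_coord: "p : D ==> an p (%q. ph q $ i)"
 by (rule analytic_of_rep[OF _ power_series_at_coord])

end

lemma an_cong:
 assumes "an p f" "\<forall>\<^sub>F q in nhds p. f q = g q"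
 shows "an p g"
proof -
 obtain D ph where c: "(D, ph) : \<A>" "p : D" by (rule chart_exists)
 show ?thesis
  using assms(1) eventually_chart_rep[OF c assms(2)]
  unfolding analytic_rep[OF c] by (rule power_series_at_cong)
qed

lemma an_const [simp, intro]: "an p (%q. c)"
 by (rule chart_exists[of p]) (simp add: analytic_rep power_series_at_const)

lemma an_add [intro]: "an p f ==> an p g ==> an p (%q. f q + g q)"
 by (rule chart_exists[of p]) (simp add: analytic_rep power_series_at_add)

lemma an_mult [intro]: "an p f ==> an p g ==> an p (%q. f q * g q)"
 by (rule chart_exists[of p]) (simp add: analytic_rep power_series_at_mult)

lemma an_inverse [intro]: "an p f ==> f p ~= 0 ==> an p (%q. inverse (f q))"
 by (rule chart_exists[of p]) (simp add: analytic_rep power_series_at_inverse)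

lemma an_uminus [intro]: "an p f ==> an p (%q. - f q)"
 using an_mult[OF an_const[of p "- 1"], of f] by simp

lemma an_diff [intro]: "an p f ==> an p g ==> an p (%q. f q - g q)"
 using an_add[OF _ an_uminus, of p f g] by simp

lemma an_divide [intro]: "an p f ==> an p g ==> g p ~= 0 ==> an p (%q. f q / g q)"
 using an_mult[OF _ an_inverse, of p f g] by (simp add: divide_inverse)

lemma an_sum [intro]: "(!!i. i : I ==> an p (f i)) ==> an p (%q. \<Sum>i\<in>I. f i q)"
 by (induction I rule: infinite_finite_induct) auto

lemma an_prod [intro]: "(!!i. i : I ==> an p (f i)) ==> an p (%q. \<Prod>i\<in>I. f i q)"
 by (induction I rule: infinite_finite_induct) auto

lemma an_power [intro]: "an p f ==> an p (%q. f q ^ k)"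
 by (induction k) auto

lemma an_eventually: "an p f ==> \<forall>\<^sub>F q in nhds p. an q f"
proof -
 assume f: "an p f"
 obtain D ph where c: "(D, ph) : \<A>" "p : D" by (rule chart_exists)
 have "\<forall>\<^sub>F x in nhds (ph p). power_series_at (rep D ph f) x"
  using f unfolding analytic_rep[OF c] by (rule power_series_at_eventually)
 from eventually_conj[OF eventually_chart[OF c this] eventually_in_chart[OF c]]
 show ?thesis by eventually_elim (simp add: analytic_rep[OF c(1)])
qed

lemma an_tendsto: "an p f ==> (f \<longlongrightarrow> f p) (nhds p)"
proof -
 assume f: "an p f"
 obtain D ph where c: "(D, ph) : \<A>" "p : D" by (rule chart_exists)
 have "(rep D ph f \<longlongrightarrow> f p) (nhds (ph p))"
  using power_series_at_tendsto[of "rep D ph f" "ph p"] f c by (simp add: analytic_rep[OF c])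
 from filterlim_compose[OF this chart_tendsto[OF c]]
 have "((%q. rep D ph f (ph q)) \<longlongrightarrow> f p) (nhds p)" .
 then show ?thesis
  by (rule tendsto_cong[THEN iffD1, rotated])
   (use eventually_in_chart[OF c] c in \<open>auto elim!: eventually_mono\<close>)
qed

lemma an_eventually_nonzero: "an p f ==> f p ~= 0 ==> \<forall>\<^sub>F q in nhds p. f q ~= 0"
 by (rule tendsto_imp_eventually_ne[OF an_tendsto])

lemma an_limit_0:
 assumes "an p f" "!!O'. open O' ==> p : O' ==> \<exists>q\<in>O'. f q = 0"
 shows "f p = 0"
proof (rule ccontr)
 assume "f p ~= 0"
 from an_eventually_nonzero[OF assms(1) this] obtain S where "open S" "p : S" "\<forall>q\<in>S. f q ~= 0"
  unfolding eventually_nhds by blast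
 then show False using assms(2) by blast
qed

lemma mfd_analyticD: "mfd_analytic \<A> N f ==> p : N ==> an p f"
 by (simp add: mfd_analytic_def)

lemma an_nhd:
 assumes "an p f" "open N" "p : N"
 obtains O' where "open O'" "p : O'" "O' \<subseteq> N" "mfd_analytic \<A> O' f"
proof -
 obtain S where S: "open S" "p : S" "\<forall>q\<in>S. an q f"
  using an_eventually[OF assms(1)] unfolding eventually_nhds by blast
 show thesis by (rule that[of "S \<inter> N"]) (use S assms in \<open>auto simp: mfd_analytic_def\<close>)
qed

lemma connected_nhd:
 fixes p :: 'a
 assumes "open N" "p : N"
 obtains O' where "open O'" "connected O'" "p : O'" "O' \<subseteq> N"
proof -
 obtain D ph where c: "(D, ph) : \<A>" "p : D" by (rule chart_exists)
 have "\<forall>\<^sub>F x in nhds p. x : N" using assms by (intro eventually_nhds_in_open)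
 from eventually_conj[OF eventually_chart_rep[OF c this]
   eventually_nhds_in_open[OF chart_open(2)[OF c(1)], of "ph p"]]
 obtain e where e: "e > 0" "!!x. dist x (ph p) < e ==> inv_into D ph x : N & x : ph ` D"
  using c(2) unfolding eventually_nhds_metric by auto
 define B where "B = ball (ph p) e"
 have B: "B \<subseteq> ph ` D" using e by (auto simp: B_def dist_commute)
 have h: "homeomorphism D (ph ` D) ph (inv_into D ph)" by (rule chart_homeo[OF c(1)])
 have eq: "inv_into D ph ` B = D \<inter> ph -` B"
 proof (intro set_eqI iffI)
  fix q assume "q : D \<inter> ph -` B"
  then show "q : inv_into D ph ` B" using chart_inv[OF c(1), of q] by (metis IntD1 IntD2 image_eqI vimage_eq)
 next
  fix q assume "q : inv_into D ph ` B"
  then obtain x where "q = inv_into D ph x" "x : B" by blast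
  then show "q : D \<inter> ph -` B" using B f_inv_into_f[of x ph D] inv_into_into[of x ph D] by auto
 qed
 show thesis
 proof (rule that)
  show "open (inv_into D ph ` B)"
   unfolding eq using h chart_open[OF c(1)]
   by (intro continuous_open_preimage) (auto simp: homeomorphism_def B_def)
  show "connected (inv_into D ph ` B)"
  proof (rule connected_continuous_image)
   show "continuous_on B (inv_into D ph)"
    using h B by (auto simp: homeomorphism_def intro: continuous_on_subset)
   show "connected B" unfolding B_def by (rule convex_connected[OF convex_ball])
  qed
  show "p : inv_into D ph ` B"
   using chart_inv[OF c] e(1) unfolding B_def by (metis centre_in_ball image_eqI)
  show "inv_into D ph ` B \<subseteq> N" using e by (auto simp: B_def dist_commute)
 qed
qed

section \<open>Tangent vectors\<close>

abbreviation TS :: "'a => ('a, 'k) tvec set" where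
 "TS \<equiv> tangent_space \<A>"

lemma tangent_spaceD:
 assumes "v : TS p"
 shows "(\<forall>f g. an p f --> (\<forall>\<^sub>F x in nhds p. f x = g x) --> v f = v g) \<and>
  (\<forall>f g. an p f --> an p g --> v (%x. f x + g x) = v f + v g) \<and>
  (\<forall>c f. an p f --> v (%x. c * f x) = c * v f) \<and>
  (\<forall>f g. an p f --> an p g --> v (%x. f x * g x) = f p * v g + g p * v f) \<and>
  (\<forall>f. \<not> an p f --> v f = 0)"
 using assms by (simp only: tangent_space_def mem_Collect_eq)

lemmas tv_cong = tangent_spaceD[THEN conjunct1, rule_format]
lemmas tv_add = tangent_spaceD[THEN conjunct2, THEN conjunct1, rule_format]
lemmas tv_cmult = tangent_spaceD[THEN conjunct2, THEN conjunct2, THEN conjunct1, rule_format]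
lemmas tv_mult = tangent_spaceD[THEN conjunct2, THEN conjunct2, THEN conjunct2, THEN conjunct1, rule_format]
lemmas tv_non_analytic =
 tangent_spaceD[THEN conjunct2, THEN conjunct2, THEN conjunct2, THEN conjunct2, rule_format]

lemma tv_const [simp]: "v : TS p ==> v (%x. c) = 0"
proof -
 assume v: "v : TS p"
 have "v (%x. 1 * 1) = 1 * v (%x. 1) + 1 * v (%x. 1)"
  by (rule tv_mult[OF v an_const an_const])
 then have "v (%x. 1) = 0" by simp
 then show ?thesis using tv_cmult[OF v an_const[of p 1], of c] by simp
qed

lemma tv_uminus: "v : TS p ==> an p f ==> v (%x. - f x) = - v f"
 using tv_cmult[of v p f "- 1"] by simp

lemma tv_diff: "v : TS p ==> an p f ==> an p g ==> v (%x. f x - g x) = v f - v g"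
 using tv_add[OF _ _ an_uminus, of v p f g] tv_uminus[of v p g] by simp

lemma tv_sum:
 "v : TS p ==> (!!i. i : I ==> an p (f i)) ==> v (%x. \<Sum>i\<in>I. f i x) = (\<Sum>i\<in>I. v (f i))"
proof (induction I rule: infinite_finite_induct)
 case (insert i I)
 have "v (%x. f i x + (\<Sum>i\<in>I. f i x)) = v (f i) + v (%x. \<Sum>i\<in>I. f i x)"
  using insert.prems by (intro tv_add) auto
 then show ?case using insert by simp
qed simp_all

lemma tv_power:
 "v : TS p ==> an p f ==> v (%x. f x ^ Suc k) = of_nat (Suc k) * f p ^ k * v f"
proof (induction k)
 case (Suc k)
 have "v (%x. f x * f x ^ Suc k) = f p * v (%x. f x ^ Suc k) + f p ^ Suc k * v f"
  by (rule tv_mult[OF Suc(2,3) an_power[OF Suc(3)]])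
 then show ?case using Suc by (simp add: algebra_simps)
qed simp

lemma ts_I:
 assumes "!!f g. an p f ==> \<forall>\<^sub>F x in nhds p. f x = g x ==> v f = v g"
  "!!f g. an p f ==> an p g ==> v (%x. f x + g x) = v f + v g"
  "!!c f. an p f ==> v (%x. c * f x) = c * v f"
  "!!f g. an p f ==> an p g ==> v (%x. f x * g x) = f p * v g + g p * v f"
  "!!f. \<not> an p f ==> v f = 0"
 shows "v : TS p"
 unfolding tangent_space_def mem_Collect_eq
 by (intro conjI allI impI) (fact assms)+

lemma ts_add [intro]: "u : TS p ==> v : TS p ==> u + v : TS p"
 by (rule ts_I) (simp_all add: tv_add tv_cmult tv_mult tv_non_analytic algebra_simps, metis tv_cong)

lemma ts_fscale [intro]: "v : TS p ==> fscale c v : TS p"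
 by (rule ts_I) (simp_all add: tv_add tv_cmult tv_mult tv_non_analytic algebra_simps, metis tv_cong)

lemma ts_0 [simp, intro]: "0 : TS p"
 by (rule ts_I) simp_all

lemma ts_sum [intro]: "(!!i. i : I ==> f i : TS p) ==> (\<Sum>i\<in>I. f i) : TS p"
 by (induction I rule: infinite_finite_induct) auto

lemma fscale_minus_1: "fscale (- 1) v = - (v :: ('a, 'k) tvec)"
 by (simp add: fun_eq_iff)

lemma ts_uminus [intro]: "v : TS p ==> - v : TS p"
 using ts_fscale[of v p "- 1"] by (simp add: fscale_minus_1)

lemma ts_diff [intro]: "u : TS p ==> v : TS p ==> u - v : TS p"
 using ts_add[OF _ ts_uminus, of u p v] by simp

definition coord_field :: "'a set => ('a => 'k^'n) => 'n => 'a => ('a, 'k) tvec" where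
 "coord_field D ph i p = (%f. if an p f then pd i (rep D ph f) (ph p) else 0)"

context
 fixes D ph assumes chart: "(D, ph) : \<A>"
begin

lemma coord_field_ts: "p : D ==> coord_field D ph i p : TS p"
proof (rule ts_I)
 assume p: "p : D"
 note r = analytic_rep[OF chart p]
 show "coord_field D ph i p f = coord_field D ph i p g" if "an p f" "\<forall>\<^sub>F x in nhds p. f x = g x" for f g
  using that an_cong[OF that] pd_cong_ev[OF eventually_chart_rep[OF chart p that(2)]]
  by (simp add: coord_field_def)
 show "coord_field D ph i p (%x. f x + g x) = coord_field D ph i p f + coord_field D ph i p g"
  if "an p f" "an p g" for f g
  using that an_add[OF that] pd_add[of "rep D ph f" "ph p" "rep D ph g"] by (simp add: coord_field_def r)
 show mult: "coord_field D ph i p (%x. f x * g x) = f p * coord_field D ph i p g + g p * coord_field D ph i p f"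
  if "an p f" "an p g" for f g
  using that an_mult[OF that] pd_mult[of "rep D ph f" "ph p" "rep D ph g"] p
  by (simp add: coord_field_def r chart_inv[OF chart])
 show "coord_field D ph i p (%x. c * f x) = c * coord_field D ph i p f" if "an p f" for c f
  using mult[OF an_const that, of c] by (simp add: coord_field_def)
qed (simp add: coord_field_def)

lemma coord_field_coord:
 assumes p: "p : D" shows "coord_field D ph i p (%q. ph q $ j) = (if i = j then 1 else 0)"
proof -
 have "pd i (rep D ph (%q. ph q $ j)) (ph p) = pd i (%x. x $ j) (ph p)"
  by (rule pd_cong_ev, rule eventually_mono[OF eventually_chart_inv[OF chart p]]) simp
 then show ?thesis using analytic_coord[OF chart p, of j] by (simp add: coord_field_def pd_coord)
qed

text \<open>By Hadamard's lemma a derivation is determined by its values on the coordinates.\<close>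

lemma tv_coords:
 assumes p: "p : D" and f: "an p f" and v: "v : TS p"
 shows "v f = (\<Sum>i\<in>UNIV. v (%q. ph q $ i) * coord_field D ph i p f)"
proof -
 obtain h where h: "!!i. power_series_at (h i) (ph p)"
  "\<forall>\<^sub>F x in nhds (ph p). rep D ph f x = rep D ph f (ph p) + (\<Sum>i\<in>UNIV. (x $ i - ph p $ i) * h i x)"
  by (rule hadamard[OF f[unfolded analytic_rep[OF chart p]]]) blast
 have hp: "an p (%q. h i (ph q))" for i by (rule analytic_of_rep[OF chart p h(1)])
 have xp: "an p (%q. ph q $ i - ph p $ i)" for i
  by (intro an_diff analytic_coord[OF chart p] an_const)
 have prod: "an p (%q. (ph q $ i - ph p $ i) * h i (ph q))" for i by (rule an_mult[OF xp hp])
 have sp: "an p (%q. \<Sum>i\<in>UNIV. (ph q $ i - ph p $ i) * h i (ph q))" by (rule an_sum[OF prod])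
 have ev: "\<forall>\<^sub>F q in nhds p. f q = f p + (\<Sum>i\<in>UNIV. (ph q $ i - ph p $ i) * h i (ph q))"
  using eventually_conj[OF eventually_chart[OF chart p h(2)] eventually_in_chart[OF chart p]]
  by eventually_elim (auto simp: p chart_inv[OF chart])
 have *: "w f = (\<Sum>i\<in>UNIV. w (%q. ph q $ i) * h i (ph p))" if w: "w : TS p" for w
 proof -
  have "w f = w (%q. f p + (\<Sum>i\<in>UNIV. (ph q $ i - ph p $ i) * h i (ph q)))"
   by (rule tv_cong[OF w f ev])
  also have "... = (\<Sum>i\<in>UNIV. w (%q. (ph q $ i - ph p $ i) * h i (ph q)))"
   using w tv_add[OF w an_const sp] tv_sum[OF w prod] by simp
  also have "... = (\<Sum>i\<in>UNIV. w (%q. ph q $ i) * h i (ph p))"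
   using tv_mult[OF w xp hp] tv_diff[OF w analytic_coord[OF chart p] an_const] tv_const[OF w]
   by (simp add: mult.commute)
  finally show ?thesis .
 qed
 have "coord_field D ph i p f = h i (ph p)" for i
  using *[OF coord_field_ts[OF p, of i]] by (simp add: coord_field_coord[OF p] sum.delta if_distrib[of "%x. x * _"] cong: if_cong)
 then show ?thesis using *[OF v] by simp
qed

lemma tv_eq_coords:
 assumes p: "p : D" and v: "v : TS p"
 shows "v = (\<Sum>i\<in>UNIV. fscale (v (%q. ph q $ i)) (coord_field D ph i p))"
proof
 fix f
 show "v f = (\<Sum>i\<in>UNIV. fscale (v (%q. ph q $ i)) (coord_field D ph i p)) f"
  using tv_coords[OF p _ v, of f] tv_non_analytic[OF v, of f]
  by (cases "an p f") (auto simp: sum_fun_apply coord_field_def)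
qed

lemma coord_field_vf: "vector_field \<A> D (coord_field D ph i)"
 unfolding vector_field_def mfd_analytic_def
proof (intro conjI ballI allI impI)
 show "coord_field D ph i p : TS p" if "p : D" for p by (rule coord_field_ts[OF that])
 fix O' f p assume O': "open O'" "O' \<subseteq> D" "\<forall>p\<in>O'. an p f" "p : O'"
 then have p: "p : D" "an p f" by auto
 have "an p (%q. pd i (rep D ph f) (ph q))"
  by (rule analytic_of_rep[OF chart p(1) power_series_at_pd]) (use p in \<open>simp add: analytic_rep[OF chart]\<close>)
 then show "an p (%q. coord_field D ph i q f)"
  by (rule an_cong) (use an_eventually[OF p(2)] in \<open>auto elim!: eventually_mono simp: coord_field_def\<close>)
qed

end

section \<open>Vector fields and the Lie bracket\<close>

abbreviation vf :: "'a set => ('a => ('a, 'k) tvec) => bool" where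
 "vf \<equiv> vector_field \<A>"

lemma vf_ts: "vf N X ==> p : N ==> X p : TS p"
 by (simp add: vector_field_def)

lemma vf_an:
 assumes X: "vf N X" and N: "open N" "p : N" and f: "an p f"
 shows "an p (%q. X q f)"
proof -
 obtain O' where O': "open O'" "p : O'" "O' \<subseteq> N" "mfd_analytic \<A> O' f" using an_nhd[OF f N] .
 then have "mfd_analytic \<A> O' (%q. X q f)" using X unfolding vector_field_def by blast
 then show ?thesis using O' by (simp add: mfd_analytic_def)
qed

lemma vfI:
 assumes "!!p. p : N ==> X p : TS p" "!!p f. p : N ==> an p f ==> an p (%q. X q f)"
 shows "vf N X"
 unfolding vector_field_def mfd_analytic_def
 using assms by (metis subsetD)

lemma vf_subset: "vf N X ==> O' \<subseteq> N ==> vf O' X"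
 by (simp add: vector_field_def subset_iff)

lemma vf_local:
 assumes "!!p. p : N ==> \<exists>O' Y. open O' & p : O' & vf O' Y & (\<forall>q\<in>O'. X q = Y q)"
 shows "vf N X"
proof (rule vfI)
 fix p assume p: "p : N"
 obtain O' Y where O': "open O'" "p : O'" "vf O' Y" "\<forall>q\<in>O'. X q = Y q" using assms[OF p] by blast
 then show "X p : TS p" using vf_ts by metis
 fix f assume "an p f"
 then have "an p (%q. Y q f)" by (rule vf_an[OF O'(3,1,2)])
 then show "an p (%q. X q f)"
  by (rule an_cong) (use O' eventually_nhds_in_open[OF O'(1,2)] in \<open>auto elim!: eventually_mono\<close>)
qed

lemma vf_fscale:
 assumes "open N" "vf N X" "!!p. p : N ==> an p g"
 shows "vf N (%q. fscale (g q) (X q))"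
proof (rule vfI)
 show "fscale (g p) (X p) : TS p" if "p : N" for p by (rule ts_fscale[OF vf_ts[OF assms(2) that]])
 show "an p (%q. fscale (g q) (X q) f)" if "p : N" "an p f" for p f
  unfolding fscale_apply by (rule an_mult[OF assms(3)[OF that(1)] vf_an[OF assms(2,1) that]])
qed

lemma vf_0: "vf N (%q. 0)"
 by (rule vfI) simp_all

lemma vf_add:
 assumes "open N" "vf N X" "vf N Y"
 shows "vf N (%q. X q + Y q)"
proof (rule vfI)
 show "X p + Y p : TS p" if "p : N" for p
  by (rule ts_add[OF vf_ts[OF assms(2) that] vf_ts[OF assms(3) that]])
 show "an p (%q. (X q + Y q) f)" if "p : N" "an p f" for p f
  unfolding plus_fun_apply by (rule an_add[OF vf_an[OF assms(2,1) that] vf_an[OF assms(3,1) that]])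
qed

lemma vf_sum: "open N ==> (!!i. i : I ==> vf N (X i)) ==> vf N (%q. \<Sum>i\<in>I. X i q)"
 by (induction I rule: infinite_finite_induct) (simp_all add: vf_0 vf_add)

lemma vf_extend:
 assumes v: "v : TS p" and N: "open N" "p : N"
 obtains O' X where "open O'" "p : O'" "O' \<subseteq> N" "vf O' X" "X p = v"
proof -
 obtain D ph where c: "(D, ph) : \<A>" "p : D" by (rule chart_exists)
 define X where "X q = (\<Sum>i\<in>UNIV. fscale (v (%q. ph q $ i)) (coord_field D ph i q))" for q
 have o: "open (D \<inter> N)" using N chart_open[OF c(1)] by auto
 show thesis
 proof (rule that[of "D \<inter> N" X])
  show "vf (D \<inter> N) X" unfolding X_def
   by (intro vf_sum vf_fscale o vf_subset[OF coord_field_vf[OF c(1)]]) auto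
  show "X p = v" unfolding X_def using tv_eq_coords[OF c v] by simp
 qed (use o N c in auto)
qed

lemma lie_apply: "an p f ==> lie X Y p f = X p (%q. Y q f) - Y p (%q. X q f)"
 by (simp add: lie_bracket_def)

lemma vf_fun_cong:
 assumes "vf N X" "open N" "p : N" "an p f" "\<forall>\<^sub>F x in nhds p. f x = g x"
 shows "\<forall>\<^sub>F q in nhds p. X q f = X q g"
proof -
 have "\<forall>\<^sub>F y in nhds p. \<forall>\<^sub>F x in nhds y. f x = g x"
  using assms(5) by (simp only: eventually_eventually)
 from eventually_conj[OF this eventually_conj[OF an_eventually[OF assms(4)] eventually_nhds_in_open[OF assms(2,3)]]]
 show ?thesis by eventually_elim (use vf_ts[OF assms(1)] tv_cong in blast)
qed

text \<open>The second-order terms of the two composites agree, so that the commutator satisfies the product rule.\<close>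

lemma lie_ts:
 assumes X: "vf N X" and Y: "vf N Y" and N: "open N" "p : N"
 shows "lie X Y p : TS p"
proof (rule ts_I)
 note x = vf_ts[OF X N(2)] and y = vf_ts[OF Y N(2)] and ax = vf_an[OF X N] and ay = vf_an[OF Y N]
 have ev: "\<forall>\<^sub>F q in nhds p. q : N" by (rule eventually_nhds_in_open[OF N])
 have evX: "\<forall>\<^sub>F q in nhds p. X q : TS q" and evY: "\<forall>\<^sub>F q in nhds p. Y q : TS q"
  using ev X Y by (auto elim!: eventually_mono dest: vf_ts)
 show "lie X Y p f = lie X Y p g" if f: "an p f" "\<forall>\<^sub>F x in nhds p. f x = g x" for f g
  using tv_cong[OF x ay[OF f(1)] vf_fun_cong[OF Y N f]] tv_cong[OF y ax[OF f(1)] vf_fun_cong[OF X N f]]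
  by (simp add: lie_apply f an_cong[OF f])
 show "lie X Y p (%x. f x + g x) = lie X Y p f + lie X Y p g"
  if f: "an p f" and g: "an p g" for f g
 proof -
  have *: "w (%q. Z q (%x. f x + g x)) = w (%q. Z q f) + w (%q. Z q g)"
   if w: "w : TS p" and Z: "vf N Z" for w Z
  proof -
   have "w (%q. Z q (%x. f x + g x)) = w (%q. Z q f + Z q g)"
   proof (rule tv_cong[OF w vf_an[OF Z N an_add[OF f g]]])
    show "\<forall>\<^sub>F q in nhds p. Z q (%x. f x + g x) = Z q f + Z q g"
     using eventually_conj[OF ev eventually_conj[OF an_eventually[OF f] an_eventually[OF g]]]
     by eventually_elim (auto intro: tv_add vf_ts[OF Z])
   qed
   then show ?thesis using tv_add[OF w vf_an[OF Z N f] vf_an[OF Z N g]] by simp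
  qed
  show ?thesis using *[OF x Y] *[OF y X] by (simp add: lie_apply f g an_add[OF f g])
 qed
 show mult: "lie X Y p (%x. f x * g x) = f p * lie X Y p g + g p * lie X Y p f"
  if f: "an p f" and g: "an p g" for f g
 proof -
  have *: "w (%q. Z q (%x. f x * g x)) = f p * w (%q. Z q g) + Z p g * w f + (g p * w (%q. Z q f) + Z p f * w g)"
   if w: "w : TS p" and Z: "vf N Z" for w Z
  proof -
   have "w (%q. Z q (%x. f x * g x)) = w (%q. f q * Z q g + g q * Z q f)"
   proof (rule tv_cong[OF w vf_an[OF Z N an_mult[OF f g]]])
    show "\<forall>\<^sub>F q in nhds p. Z q (%x. f x * g x) = f q * Z q g + g q * Z q f"
     using eventually_conj[OF ev eventually_conj[OF an_eventually[OF f] an_eventually[OF g]]]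
     by eventually_elim (auto intro: tv_mult vf_ts[OF Z])
   qed
   then show ?thesis
    using tv_add[OF w an_mult[OF f vf_an[OF Z N g]] an_mult[OF g vf_an[OF Z N f]]]
     tv_mult[OF w f vf_an[OF Z N g]] tv_mult[OF w g vf_an[OF Z N f]] by simp
  qed
  show ?thesis using *[OF x Y] *[OF y X] by (simp add: lie_apply f g an_mult[OF f g] algebra_simps)
 qed
 show "lie X Y p (%x. c * f x) = c * lie X Y p f" if f: "an p f" for c f
 proof -
  have "lie X Y p (%x. c) = 0"
  proof -
   have *: "w (%q. Z q (%x. c)) = 0" if w: "w : TS p" and Z: "vf N Z" for w Z
   proof -
    have "w (%q. Z q (%x. c)) = w (%q. 0)"
     by (rule tv_cong[OF w vf_an[OF Z N an_const]])
      (use ev Z in \<open>auto elim!: eventually_mono intro: tv_const dest: vf_ts\<close>)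
    then show ?thesis using w by simp
   qed
   show ?thesis using *[OF x Y] *[OF y X] by (simp add: lie_apply)
  qed
  then show ?thesis using mult[OF an_const f, of c] by simp
 qed
qed (simp add: lie_bracket_def)

lemma lie_cong:
 assumes X: "vf N X" and Y: "vf N Y" and N: "open N" "p : N"
  and eq: "\<forall>\<^sub>F q in nhds p. X q = X' q" "\<forall>\<^sub>F q in nhds p. Y q = Y' q"
 shows "lie X Y p = lie X' Y' p"
proof
 fix f
 note x = vf_ts[OF X N(2)] and y = vf_ts[OF Y N(2)]
 have p: "X p = X' p" "Y p = Y' p" using eq eventually_nhds_x_imp_x by fastforce+
 show "lie X Y p f = lie X' Y' p f"
 proof (cases "an p f")
  case True
  have "X p (%q. Y q f) = X p (%q. Y' q f)"
   by (rule tv_cong[OF x vf_an[OF Y N True]]) (use eq in \<open>auto elim: eventually_mono\<close>)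
  moreover have "Y p (%q. X q f) = Y p (%q. X' q f)"
   by (rule tv_cong[OF y vf_an[OF X N True]]) (use eq in \<open>auto elim: eventually_mono\<close>)
  ultimately show ?thesis using p by (simp add: lie_apply True)
 qed (simp add: lie_bracket_def)
qed

lemma lie_vf:
 assumes X: "vf N X" and Y: "vf N Y" and N: "open N"
 shows "vf N (lie X Y)"
proof (rule vfI)
 fix p f assume p: "p : N" and f: "an p f"
 have "an p (%q. X q (%q. Y q f) - Y q (%q. X q f))"
  by (intro an_diff vf_an[OF X N p] vf_an[OF Y N p] f)
 then show "an p (%q. lie X Y q f)"
  by (rule an_cong) (use an_eventually[OF f] in \<open>auto elim!: eventually_mono simp: lie_apply\<close>)
qed (rule lie_ts[OF X Y N])

lemma lie_antisym: "lie Y X p = - lie X Y p"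
 by (simp add: lie_bracket_def fun_eq_iff)

lemma lie_self [simp]: "lie X X p = 0"
 by (simp add: lie_bracket_def fun_eq_iff)

lemma lie_fscale_right:
 assumes X: "vf N X" and Y: "vf N Y" and N: "open N" "p : N" and g: "an p g"
 shows "lie X (%q. fscale (g q) (Y q)) p
   = fscale (g p) (lie X Y p) + fscale (X p g) (Y p)"
proof
 fix f
 note x = vf_ts[OF X N(2)] and y = vf_ts[OF Y N(2)] and ax = vf_an[OF X N] and ay = vf_an[OF Y N]
 show "lie X (%q. fscale (g q) (Y q)) p f
  = (fscale (g p) (lie X Y p) + fscale (X p g) (Y p)) f"
 proof (cases "an p f")
  case True
  then show ?thesis using tv_mult[OF x g ay[OF True]] by (simp add: lie_apply algebra_simps)
 next
  case False
  then show ?thesis using tv_non_analytic[OF y False] by (simp add: lie_bracket_def)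
 qed
qed

lemma lie_fscale_left:
 assumes X: "vf N X" and Y: "vf N Y" and N: "open N" "p : N" and g: "an p g"
 shows "lie (%q. fscale (g q) (X q)) Y p
   = fscale (g p) (lie X Y p) - fscale (Y p g) (X p)"
proof -
 have "lie (%q. fscale (g q) (X q)) Y p = - lie Y (%q. fscale (g q) (X q)) p"
  by (rule lie_antisym)
 also have "... = - (fscale (g p) (- lie X Y p) + fscale (Y p g) (X p))"
  by (simp only: lie_fscale_right[OF Y X N g] lie_antisym[of Y X])
 finally show ?thesis by (simp add: fun_eq_iff)
qed

lemma lie_sum_right:
 assumes X: "vf N X" and Y: "!!i. i : I ==> vf N (Y i)" and N: "open N" "p : N"
 shows "lie X (%q. \<Sum>i\<in>I. Y i q) p = (\<Sum>i\<in>I. lie X (Y i) p)"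
proof
 fix f
 show "lie X (%q. \<Sum>i\<in>I. Y i q) p f = (\<Sum>i\<in>I. lie X (Y i) p) f"
 proof (cases "an p f")
  case True
  have "X p (%q. \<Sum>i\<in>I. Y i q f) = (\<Sum>i\<in>I. X p (%q. Y i q f))"
   by (rule tv_sum[OF vf_ts[OF X N(2)]]) (rule vf_an[OF Y N True])
  then show ?thesis using True by (simp add: lie_apply sum_fun_apply sum_subtractf)
 qed (simp add: lie_bracket_def sum_fun_apply)
qed

section \<open>Flatness and primitives on a manifold\<close>

text \<open>The flatness criterion in a chart; germs suffice, because only derivatives at the point enter.\<close>

lemma deriv_closed_eventually_0:
 assumes c: "(D, ph) : \<A>" "p : D"
  and S: "!!f. f : S ==> an p f" "!!f. f : S ==> f p = 0"
   "!!f i. f : S ==> \<exists>g\<in>S. \<forall>\<^sub>F q in nhds p. coord_field D ph i q f = g q"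
  and f: "f : S"
 shows "\<forall>\<^sub>F q in nhds p. f q = 0"
proof -
 have "\<forall>\<^sub>F x in nhds (ph p). rep D ph f x = 0"
 proof (rule pd_closed_eventually_0[of "rep D ph ` S"])
  show "F (ph p) = 0" if "F : rep D ph ` S" for F using that c S(2) by (auto simp: chart_inv)
  show "\<exists>G\<in>rep D ph ` S. \<forall>\<^sub>F x in nhds (ph p). pd i F x = G x" if F: "F : rep D ph ` S" for F i
  proof -
   obtain h where h: "h : S" "F = rep D ph h" using F by blast
   obtain g where g: "g : S" "\<forall>\<^sub>F q in nhds p. coord_field D ph i q h = g q" using S(3)[OF h(1)] by blast
   have "\<forall>\<^sub>F q in nhds p. an q h" by (rule an_eventually[OF S(1)[OF h(1)]])
   from eventually_conj[OF eventually_chart_rep[OF c eventually_conj[OF g(2) this]] eventually_chart_inv[OF c]]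
   have "\<forall>\<^sub>F x in nhds (ph p). pd i F x = rep D ph g x"
    by eventually_elim (auto simp: h coord_field_def)
   then show ?thesis using g(1) by (intro bexI[of _ "rep D ph g"]) auto
  qed
  show "power_series_at (rep D ph f) (ph p)" using S(1)[OF f] by (simp add: analytic_rep[OF c])
 qed (use f in auto)
 from eventually_conj[OF eventually_chart[OF c this] eventually_in_chart[OF c]]
 show ?thesis by eventually_elim (auto simp: chart_inv[OF c(1)])
qed

lemma lie_coord_fields:
 assumes c: "(D, ph) : \<A>" "p : D"
 shows "lie (coord_field D ph i) (coord_field D ph j) p = 0"
proof
 fix f
 have *: "coord_field D ph i p (%q. coord_field D ph j q f) = pd i (pd j (rep D ph f)) (ph p)" if f: "an p f" for i j
 proof -
  have "an p (%q. coord_field D ph j q f)"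
   by (rule vf_an[OF coord_field_vf[OF c(1)] chart_open(1)[OF c(1)] c(2) f])
  moreover have "pd i (rep D ph (%q. coord_field D ph j q f)) (ph p) = pd i (pd j (rep D ph f)) (ph p)"
  proof (rule pd_cong_ev)
   show "\<forall>\<^sub>F x in nhds (ph p). rep D ph (%q. coord_field D ph j q f) x = pd j (rep D ph f) x"
    using eventually_conj[OF eventually_chart_rep[OF c an_eventually[OF f]] eventually_chart_inv[OF c]]
    by eventually_elim (simp add: coord_field_def)
  qed
  ultimately show ?thesis by (simp add: coord_field_def[of D ph i p])
 qed
 show "lie (coord_field D ph i) (coord_field D ph j) p f = 0 f"
 proof (cases "an p f")
  case True
  then show ?thesis
   using pd_commute[of "rep D ph f" "ph p" i j] by (simp add: lie_apply * analytic_rep[OF c])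
 qed (simp add: lie_bracket_def)
qed

text \<open>The analytic Poincare lemma for one-forms.\<close>

lemma closed_form_exact:
 assumes N: "open N" "p : N"
  and an: "!!O' X q. open O' ==> O' \<subseteq> N ==> vf O' X ==> q : O' ==> an q (%q. \<gamma> q (X q))"
  and lin: "!!q u v. q : N ==> u : TS q ==> v : TS q ==> \<gamma> q (u + v) = \<gamma> q u + \<gamma> q v"
   "!!q c v. q : N ==> v : TS q ==> \<gamma> q (fscale c v) = c * \<gamma> q v"
  and closed: "!!O' X Y q. open O' ==> O' \<subseteq> N ==> vf O' X ==> vf O' Y ==> q : O' ==>
    X q (%q. \<gamma> q (Y q)) - Y q (%q. \<gamma> q (X q)) - \<gamma> q (lie X Y q) = 0"
 obtains h where "an p h" "\<forall>\<^sub>F q in nhds p. \<forall>v\<in>TS q. v h = \<gamma> q v"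
proof -
 obtain D ph where c: "(D, ph) : \<A>" "p : D" by (rule chart_exists)
 have o: "open (D \<inter> N)" "p : D \<inter> N" using N c chart_open[OF c(1)] by auto
 note ev = eventually_nhds_in_open[OF o]
 define X where "X = coord_field D ph"
 have X: "vf (D \<inter> N) (X i)" for i
  unfolding X_def by (rule vf_subset[OF coord_field_vf[OF c(1)]]) auto
 have g: "an q (%q. \<gamma> q (X i q))" if "q : D \<inter> N" for i q
  by (rule an[OF o(1) _ X that]) auto
 have lin0: "\<gamma> q 0 = 0" if "q : N" for q
  using lin(2)[OF that ts_0, of 0] by (simp add: fscale_def zero_fun_def)
 have sum: "\<gamma> q (\<Sum>i\<in>I. fscale (z i) (w i)) = (\<Sum>i\<in>I. z i * \<gamma> q (w i))"
  if "q : N" "!!i. i : I ==> w i : TS q" for q and z :: "'n => 'k" and w I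
  using that by (induction I rule: infinite_finite_induct)
   (auto simp: lin0 lin(1)[OF that(1) ts_fscale ts_sum] lin(2) ts_fscale)
 define G where "G i = rep D ph (%q. \<gamma> q (X i q))" for i
 have "pd i (G j) (ph q) = pd j (G i) (ph q)" if q: "q : D \<inter> N" for i j q
 proof -
  have "X i q (%q. \<gamma> q (X j q)) - X j q (%q. \<gamma> q (X i q)) - \<gamma> q (lie (X i) (X j) q) = 0"
   by (rule closed[OF o(1) _ X X q]) auto
  moreover have "lie (X i) (X j) q = 0"
   unfolding X_def using q by (intro lie_coord_fields c) auto
  moreover have "X i q (%q. \<gamma> q (X j q)) = pd i (G j) (ph q)" for i j
   using g[OF q, of j] by (simp add: X_def[of] coord_field_def[of D ph i] G_def)
  ultimately show ?thesis using q lin0[of q] by simp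
 qed
 then have "\<forall>\<^sub>F q in nhds p. pd i (G j) (ph q) = pd j (G i) (ph q)" for i j
  using ev by (auto elim!: eventually_mono)
 from eventually_conj[OF eventually_chart_rep[OF c this] eventually_chart_inv[OF c]]
 have "\<forall>\<^sub>F x in nhds (ph p). pd i (G j) x = pd j (G i) x" for i j
  by (rule eventually_mono) auto
 moreover have "power_series_at (G i) (ph p)" for i
  using g[OF o(2), of i] unfolding G_def analytic_rep[OF c] .
 ultimately obtain H where H: "power_series_at H (ph p)" "!!i. \<forall>\<^sub>F x in nhds (ph p). pd i H x = G i x"
  using closed_has_primitive[of G "ph p"] by blast
 define h where "h q = H (ph q)" for q
 have h: "an p h" unfolding h_def[abs_def] by (rule analytic_of_rep[OF c H(1)])
 have Hrep: "\<forall>\<^sub>F x in nhds (ph p). rep D ph h x = H x"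
  by (rule eventually_mono[OF eventually_chart_inv[OF c]]) (simp add: h_def)
 have "\<forall>\<^sub>F x in nhds (ph p). pd i (rep D ph h) x = G i x" for i
  using eventually_conj[OF pd_cong_ev'[OF Hrep, of i] H(2)[of i]] by eventually_elim simp
 then have "\<forall>\<^sub>F x in nhds (ph p). \<forall>i. pd i (rep D ph h) x = G i x"
  by (intro eventually_all_finite)
 from eventually_conj[OF eventually_chart[OF c this] eventually_conj[OF an_eventually[OF h] ev]]
 have "\<forall>\<^sub>F q in nhds p. \<forall>v\<in>TS q. v h = \<gamma> q v"
 proof eventually_elim
  case (elim q)
  have q: "q : D" "q : N" "an q h" using elim by auto
  have cf: "coord_field D ph i q h = \<gamma> q (X i q)" for i
   using elim by (simp add: coord_field_def G_def chart_inv[OF c(1)])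
  show ?case
  proof
   fix v assume v: "v : TS q"
   have "v h = (\<Sum>i\<in>UNIV. v (%q. ph q $ i) * \<gamma> q (X i q))"
    using tv_coords[OF c(1) q(1,3) v] by (simp add: cf)
   also have "... = \<gamma> q (\<Sum>i\<in>UNIV. fscale (v (%q. ph q $ i)) (X i q))"
    by (rule sum[symmetric]) (use q coord_field_ts[OF c(1)] in \<open>auto simp: X_def\<close>)
   also have "... = \<gamma> q v" using tv_eq_coords[OF c(1) q(1) v] by (simp add: X_def)
   finally show "v h = \<gamma> q v" .
  qed
 qed
 with h that show thesis by blast
qed

lemma an_exp:
 assumes h: "an p h"
 shows "an p (%q. exp (h q))" and "v : TS p ==> v (%q. exp (h q)) = exp (h p) * v h"
proof -
 obtain D ph where c: "(D, ph) : \<A>" "p : D" by (rule chart_exists)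
 have k: "an p (%q. h q - h p)" using h by auto
 obtain E where E: "power_series_at E (ph p)" "E (ph p) = 1"
  "!!x. exp (rep D ph h x - h p) = 1 + (rep D ph h x - h p) * E x"
  using exp_factor[of "rep D ph (%q. h q - h p)" "ph p"] k c by (auto simp: analytic_rep chart_inv)
 have e: "an p (%q. E (ph q))" by (rule analytic_of_rep[OF c E(1)])
 have eq: "\<forall>\<^sub>F q in nhds p. exp (h p) * (1 + (h q - h p) * E (ph q)) = exp (h q)"
  using eventually_in_chart[OF c]
 proof eventually_elim
  case (elim q)
  have "exp (h q - h p) = 1 + (h q - h p) * E (ph q)"
   using E(3)[of "ph q"] chart_inv[OF c(1) elim] by simp
  moreover have "exp (h q) = exp (h p) * exp (h q - h p)" by (simp flip: exp_add)
  ultimately show ?case by simp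
 qed
 have a: "an p (%q. exp (h p) * (1 + (h q - h p) * E (ph q)))"
  by (intro an_mult an_add an_const k e)
 show "an p (%q. exp (h q))" by (rule an_cong[OF a eq])
 assume v: "v : TS p"
 have "v (%q. exp (h q)) = v (%q. exp (h p) * (1 + (h q - h p) * E (ph q)))"
  using tv_cong[OF v a eq] by simp
 also have "... = exp (h p) * v (%q. 1 + (h q - h p) * E (ph q))"
  using k e by (intro tv_cmult[OF v]) auto
 also have "v (%q. 1 + (h q - h p) * E (ph q)) = v (%q. (h q - h p) * E (ph q))"
  using tv_add[OF v an_const an_mult[OF k e], of 1] v by simp
 also have "... = v h"
  using tv_mult[OF v k e] tv_diff[OF v h an_const, of "h p"] v E(2) by simp
 finally show "v (%q. exp (h q)) = exp (h p) * v h" .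
qed

end

section \<open>Frames\<close>

context manifold
begin

abbreviation nn :: nat where "nn \<equiv> mdim \<A>"

definition idx :: "'n => nat" where
 "idx = (SOME f. bij_betw f UNIV {1..nn})"

lemma idx: "bij_betw idx UNIV {1..nn}"
proof -
 have "\<exists>f. bij_betw f (UNIV :: 'n set) {1..CARD('n)}"
  using ex_bij_betw_finite_nat[of "UNIV :: 'n set"] ex_bij_betw_nat_finite_1[of "UNIV :: 'n set"]
  by (metis bij_betw_inv finite_class.finite_UNIV)
 then show ?thesis unfolding idx_def mdim_def by (rule someI_ex)
qed

lemma idx_in: "idx i : {1..nn}"
 using idx bij_betw_apply by fastforce

lemma inv_idx [simp]: "inv idx (idx i) = i"
 using idx by (simp add: bij_betw_def)

lemma idx_inv: "k : {1..nn} ==> idx (inv idx k) = k"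
 using idx by (metis bij_betw_def f_inv_into_f)

lemma sum_idx: "(\<Sum>k=1..nn. g k) = (\<Sum>i\<in>UNIV. g (idx i))"
 using sum.reindex_bij_betw[OF idx, of g] by simp

definition basis_at :: "(nat => 'a => ('a, 'k) tvec) => 'a => bool" where
 "basis_at V p \<longleftrightarrow> (\<forall>k\<in>{1..nn}. V k p : TS p) \<and>
  (\<forall>c. (\<Sum>k=1..nn. fscale (c k) (V k p)) = 0 --> (\<forall>k\<in>{1..nn}. c k = 0))"

definition coord_matrix :: "('a => 'k^'n) => (nat => ('a, 'k) tvec) => 'k^'n^'n" where
 "coord_matrix ph b = (\<chi> i j. b (idx j) (%q. ph q $ i))"

definition cramer_coeff :: "('a => 'k^'n) => (nat => ('a, 'k) tvec) => ('a, 'k) tvec => 'n => 'k" where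
 "cramer_coeff ph b v k =
  det (\<chi> i j. if j = k then v (%q. ph q $ i) else coord_matrix ph b $ i $ j) / det (coord_matrix ph b)"

lemma ts_eqI_coords:
 assumes c: "(D, ph) : \<A>" "p : D" and v: "v : TS p" "w : TS p"
  and eq: "!!i. v (%q. ph q $ i) = w (%q. ph q $ i)"
 shows "v = w"
 using tv_eq_coords[OF c v(1)] tv_eq_coords[OF c v(2)] eq by simp

text \<open>By Hadamard's lemma the tangent space has dimension at most \<open>n\<close>, so \<open>n\<close> independent vectors
 form a basis, and the coefficients are given by Cramer's rule in a chart.\<close>

lemma basis_cramer:
 assumes c: "(D, ph) : \<A>" "p : D" and b: "basis_at V p"
 shows "det (coord_matrix ph (%k. V k p)) ~= 0"
  and "v : TS p ==> v = (\<Sum>k=1..nn. fscale (cramer_coeff ph (%k. V k p) v (inv idx k)) (V k p))"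
proof -
 define M where "M = coord_matrix ph (%k. V k p)"
 have bt: "V k p : TS p" if "k : {1..nn}" for k using b that by (simp add: basis_at_def)
 have wt: "(\<Sum>k=1..nn. fscale (x (inv idx k)) (V k p)) : TS p" for x
  by (intro ts_sum ts_fscale bt)
 have wc: "(\<Sum>k=1..nn. fscale (x (inv idx k)) (V k p)) (%q. ph q $ i) = (\<Sum>j\<in>UNIV. M $ i $ j * x j)" for x i
  unfolding sum_idx by (simp add: sum_fun_apply M_def coord_matrix_def mult.commute)
 have "\<exists>B. B ** M = mat 1"
  unfolding matrix_left_invertible_independent_columns
 proof (intro allI impI)
  fix x i assume 0: "(\<Sum>j\<in>UNIV. x j *s column j M) = 0"
  have "(\<Sum>k=1..nn. fscale (x (inv idx k)) (V k p)) = 0"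
  proof (rule ts_eqI_coords[OF c wt ts_0])
   fix i
   have "(\<Sum>j\<in>UNIV. M $ i $ j * x j) = (\<Sum>j\<in>UNIV. x j *s column j M) $ i"
    by (simp add: column_def mult.commute)
   then show "(\<Sum>k=1..nn. fscale (x (inv idx k)) (V k p)) (%q. ph q $ i) = 0 (%q. ph q $ i)"
    unfolding wc 0 by simp
  qed
  then have "\<forall>k\<in>{1..nn}. x (inv idx k) = 0"
   using b unfolding basis_at_def by (elim conjE allE[of _ "%k. x (inv idx k)"]) simp
  then show "x i = 0" using idx_in[of i] by force
 qed
 then have det: "det M ~= 0"
  by (simp flip: invertible_det_nz add: invertible_left_inverse)
 then show "det (coord_matrix ph (%k. V k p)) ~= 0" by (simp add: M_def)
 assume v: "v : TS p"
 define x where "x = (\<chi> k. cramer_coeff ph (%k. V k p) v k)"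
 have "M *v x = (\<chi> i. v (%q. ph q $ i))"
  unfolding cramer[OF det] by (simp add: x_def cramer_coeff_def M_def cong: if_cong)
 then have "(\<Sum>j\<in>UNIV. M $ i $ j * x $ j) = v (%q. ph q $ i)" for i
  by (simp add: matrix_vector_mult_def vec_eq_iff)
 then have "v = (\<Sum>k=1..nn. fscale (x $ inv idx k) (V k p))"
  using ts_eqI_coords[OF c v wt[of "%k. x $ k"]] wc[of "%k. x $ k"] by simp
 then show "v = (\<Sum>k=1..nn. fscale (cramer_coeff ph (%k. V k p) v (inv idx k)) (V k p))" by (simp add: x_def)
qed

lemma basis_atD: "basis_at V p ==> k : {1..nn} ==> V k p : TS p"
 by (simp add: basis_at_def)

lemma basis_unique:
 assumes b: "basis_at V p" and eq: "(\<Sum>k=1..nn. fscale (c k) (V k p)) = (\<Sum>k=1..nn. fscale (d k) (V k p))"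
  and k: "k : {1..nn}"
 shows "c k = d k"
proof -
 have "(\<Sum>k=1..nn. fscale (c k - d k) (V k p))
   = (\<Sum>k=1..nn. fscale (c k) (V k p)) - (\<Sum>k=1..nn. fscale (d k) (V k p))"
  by (simp add: fun_eq_iff sum_fun_apply sum_subtractf left_diff_distrib)
 then have "(\<Sum>k=1..nn. fscale (c k - d k) (V k p)) = 0" using eq by simp
 then have "c k - d k = 0" using b k unfolding basis_at_def by (elim conjE allE[of _ "%k. c k - d k"]) auto
 then show ?thesis by simp
qed

lemma frame_coeff_eqI:
 assumes b: "basis_at V p" and v: "v = (\<Sum>k=1..nn. fscale (c k) (V k p))"
 shows "fco V p v = (%k. if k : {1..nn} then c k else 0)"
 unfolding frame_coeff_def
proof (rule the_equality)
 show "(\<forall>k. k \<notin> {1..nn} --> (if k : {1..nn} then c k else 0) = 0) \<and>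
  v = (\<Sum>k = 1..nn. fscale (if k : {1..nn} then c k else 0) (V k p))"
  unfolding v by (intro conjI allI impI sum.cong) auto
 fix d assume d: "(\<forall>k. k \<notin> {1..nn} --> d k = 0) & v = (\<Sum>k = 1..nn. fscale (d k) (V k p))"
 show "d = (%k. if k : {1..nn} then c k else 0)"
 proof
  fix k
  show "d k = (if k : {1..nn} then c k else 0)"
   using basis_unique[OF b, of d c k] d v by auto
 qed
qed

lemma frame_coeff_cramer:
 assumes c: "(D, ph) : \<A>" "p : D" and b: "basis_at V p" and v: "v : TS p"
 shows "fco V p v k = (if k : {1..nn} then cramer_coeff ph (%k. V k p) v (inv idx k) else 0)"
 using frame_coeff_eqI[OF b basis_cramer(2)[OF c b v]] by simp

lemma frame_coeff_expand:
 assumes b: "basis_at V p" and v: "v : TS p"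
 shows "v = (\<Sum>k=1..nn. fscale (fco V p v k) (V k p))"
proof -
 obtain D ph where c: "(D, ph) : \<A>" "p : D" by (rule chart_exists)
 note e = basis_cramer(2)[OF c b v]
 have "(\<Sum>k=1..nn. fscale (fco V p v k) (V k p))
   = (\<Sum>k=1..nn. fscale (cramer_coeff ph (%k. V k p) v (inv idx k)) (V k p))"
  by (rule sum.cong) (simp_all only: frame_coeff_eqI[OF b e] if_True)
 with e show ?thesis by (rule trans[OF _ sym])
qed

lemma frame_coeff_outside:
 assumes "k \<notin> {1..nn}" and b: "basis_at V p" and v: "v : TS p"
 shows "fco V p v k = 0"
 using fun_cong[OF frame_coeff_eqI[OF b frame_coeff_expand[OF b v]], of k] assms(1) by (simp only: if_False)

lemma frame_coeff_add:
 assumes b: "basis_at V p" and uv: "u : TS p" "v : TS p"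
 shows "fco V p (u + v) k = fco V p u k + fco V p v k"
proof -
 have "u + v = (\<Sum>k=1..nn. fscale (fco V p u k) (V k p))
   + (\<Sum>k=1..nn. fscale (fco V p v k) (V k p))"
  by (rule arg_cong2[where f = "(+)", OF frame_coeff_expand[OF b uv(1)] frame_coeff_expand[OF b uv(2)]])
 also have "... = (\<Sum>k=1..nn. fscale (fco V p u k + fco V p v k) (V k p))"
  by (simp add: fun_eq_iff sum_fun_apply sum.distrib distrib_right)
 finally have "fco V p (u + v)
   = (%k. if k : {1..nn} then fco V p u k + fco V p v k else 0)"
  by (rule frame_coeff_eqI[OF b])
 then show ?thesis using frame_coeff_outside[OF _ b] uv by (cases "k : {1..nn}") auto
qed

lemma frame_coeff_fscale:
 assumes b: "basis_at V p" and v: "v : TS p"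
 shows "fco V p (fscale c v) k = c * fco V p v k"
proof -
 have "fscale c v = fscale c (\<Sum>k=1..nn. fscale (fco V p v k) (V k p))"
  by (rule arg_cong[where f = "fscale c", OF frame_coeff_expand[OF b v]])
 also have "... = (\<Sum>k=1..nn. fscale (c * fco V p v k) (V k p))"
  by (simp add: fun_eq_iff sum_fun_apply sum_distrib_left mult.assoc)
 finally have "fco V p (fscale c v)
   = (%k. if k : {1..nn} then c * fco V p v k else 0)"
  by (rule frame_coeff_eqI[OF b])
 then show ?thesis using frame_coeff_outside[OF _ b v] by (cases "k : {1..nn}") auto
qed

lemma frame_coeff_frame:
 assumes b: "basis_at V p" and j: "j : {1..nn}"
 shows "fco V p (V j p) k = (if k = j then 1 else 0)"
proof -
 have "V j p = (\<Sum>k=1..nn. fscale (if k = j then 1 else 0) (V k p))"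
  using j by (simp add: fun_eq_iff sum_fun_apply if_distrib[of "%x. x * _"] sum.delta cong: if_cong)
 from frame_coeff_eqI[OF b this] show ?thesis using j by auto
qed

lemma frame_coeff_sum:
 assumes b: "basis_at V p" and "!!i. i : I ==> v i : TS p"
 shows "fco V p (\<Sum>i\<in>I. v i) k = (\<Sum>i\<in>I. fco V p (v i) k)"
proof -
 have 0: "fco V p 0 k = 0"
  using frame_coeff_fscale[OF b ts_0, of 0 k] by (simp add: fscale_def zero_fun_def)
 show ?thesis
  using assms(2) by (induction I rule: infinite_finite_induct) (simp_all add: 0 frame_coeff_add[OF b] ts_sum)
qed

definition frame :: "'a set => (nat => 'a => ('a, 'k) tvec) => bool" where
 "frame N V \<longleftrightarrow> open N & (\<forall>k\<in>{1..nn}. vf N (V k)) & (\<forall>p\<in>N. basis_at V p)"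

lemma frame_open: "frame N V ==> open N"
 and frame_vf: "frame N V ==> k : {1..nn} ==> vf N (V k)"
 and frame_basis: "frame N V ==> p : N ==> basis_at V p"
 by (simp_all add: frame_def)

lemma frame_subset: "frame N V ==> open O' ==> O' \<subseteq> N ==> frame O' V"
 unfolding frame_def using vf_subset by blast

lemma frame_exists:
 fixes p :: 'a
 assumes N: "open N" "p : N"
 obtains O' V where "p : O'" "O' \<subseteq> N" "frame O' V"
proof -
 obtain D ph where c: "(D, ph) : \<A>" "p : D" by (rule chart_exists)
 have o: "open (D \<inter> N)" using N chart_open[OF c(1)] by auto
 define V where "V k = coord_field D ph (inv idx k)" for k
 have "frame (D \<inter> N) V"
  unfolding frame_def basis_at_def
 proof (intro conjI ballI allI impI o)
  show "vf (D \<inter> N) (V k)" for k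
   unfolding V_def by (rule vf_subset[OF coord_field_vf[OF c(1)]]) auto
  show "V k q : TS q" if "q : D \<inter> N" for k q
   unfolding V_def using that by (intro coord_field_ts[OF c(1)]) auto
  fix q c' k assume q: "q : D \<inter> N" and 0: "(\<Sum>k = 1..nn. fscale (c' k) (V k q)) = 0" and k: "k : {1..nn}"
  have "0 = (\<Sum>k = 1..nn. fscale (c' k) (V k q)) (%q. ph q $ inv idx k)" using 0 by simp
  also have "... = (\<Sum>i\<in>UNIV. c' (idx i) * (if i = inv idx k then 1 else 0))"
   unfolding sum_idx using q coord_field_coord[OF c(1)] by (simp add: sum_fun_apply V_def)
  also have "... = c' k" using idx_inv[OF k] by (simp add: if_distrib[of "%x. _ * x"] sum.delta cong: if_cong)
  finally show "c' k = 0" by simp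
 qed
 with that show thesis using N c by blast
qed

lemma an_det: "(!!i j. an p (%q. M q $ i $ j)) ==> an p (%q. det (M q :: 'k^'n^'n))"
 unfolding det_def by (intro an_sum an_mult an_prod an_const)

text \<open>The coefficients are quotients of determinants of analytic functions.\<close>

lemma frame_coeff_an:
 assumes V: "frame N V" and X: "vf O' X" and O': "open O'" "O' \<subseteq> N" "p : O'"
 shows "an p (%q. fco V q (X q) k)"
proof (cases "k : {1..nn}")
 case True
 obtain D ph where c: "(D, ph) : \<A>" "p : D" by (rule chart_exists)
 have V': "an p (%q. V (idx j) q (%q. ph q $ i))" for i j
  by (rule vf_an[OF frame_vf[OF V idx_in] frame_open[OF V] _ analytic_coord[OF c]]) (use O' in auto)
 have X': "an p (%q. X q (%q. ph q $ i))" for i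
  by (rule vf_an[OF X O'(1,3) analytic_coord[OF c]])
 have b: "basis_at V q" if "q : O'" for q using frame_basis[OF V] O' that by blast
 have e: "an p (%q. if j = l then X q (%q. ph q $ i) else coord_matrix ph (%k. V k q) $ i $ j)" for i j l
  using V' X' by (cases "j = l") (simp_all add: coord_matrix_def)
 have "an p (%q. cramer_coeff ph (%k. V k q) (X q) (inv idx k))"
  unfolding cramer_coeff_def
 proof (intro an_divide an_det)
  show "an p (%q. coord_matrix ph (%k. V k q) $ i $ j)" for i j
   using V' by (simp add: coord_matrix_def)
  show "det (coord_matrix ph (%k. V k p)) ~= 0" by (rule basis_cramer(1)[OF c b[OF O'(3)]])
 qed (use e in simp)
 then show ?thesis
 proof (rule an_cong)
  show "\<forall>\<^sub>F q in nhds p. cramer_coeff ph (%k. V k q) (X q) (inv idx k) = fco V q (X q) k"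
   using eventually_conj[OF eventually_nhds_in_open[OF O'(1,3)] eventually_in_chart[OF c]]
   by eventually_elim (use frame_coeff_cramer[OF c(1) _ b vf_ts[OF X]] True in auto)
 qed
next
 case False
 have "\<forall>\<^sub>F q in nhds p. 0 = fco V q (X q) k"
  using eventually_nhds_in_open[OF O'(1,3)]
  by eventually_elim (use frame_coeff_outside[OF False frame_basis[OF V] vf_ts[OF X]] O' in auto)
 with an_const show ?thesis by (rule an_cong)
qed

section \<open>Alternating forms\<close>

abbreviation alt :: "nat => 'a => (('a, 'k) tvec list => 'k) set" where
 "alt \<equiv> alternating_forms \<A>"

lemma alt_multi:
 assumes "h : alt k p"
 shows "(\<forall>vs i x y c. length vs = k --> set vs \<subseteq> TS p --> i < k --> x : TS p --> y : TS p -->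
    h (vs[i := x + y]) = h (vs[i := x]) + h (vs[i := y]) \<and>
    h (vs[i := fscale c x]) = c * h (vs[i := x])) \<and>
  (\<forall>vs. \<not> (length vs = k & set vs \<subseteq> TS p) --> h vs = 0) \<and>
  (\<forall>vs i j. i < j --> j < length vs --> vs ! i = vs ! j --> h vs = 0)"
 using assms unfolding alternating_forms_def multilinear_on_def by simp

lemmas alt_slot = alt_multi[THEN conjunct1, rule_format]
lemmas alt_outside = alt_multi[THEN conjunct2, THEN conjunct1, rule_format]
lemmas alt_equal = alt_multi[THEN conjunct2, THEN conjunct2, rule_format]

lemma altI:
 assumes "!!vs i x y. length vs = k ==> set vs \<subseteq> TS p ==> i < k ==> x : TS p ==> y : TS p ==>
    h (vs[i := x + y]) = h (vs[i := x]) + h (vs[i := y])"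
  and "!!vs i x c. length vs = k ==> set vs \<subseteq> TS p ==> i < k ==> x : TS p ==>
    h (vs[i := fscale c x]) = c * h (vs[i := x])"
  and "!!vs. \<not> (length vs = k & set vs \<subseteq> TS p) ==> h vs = 0"
  and "!!vs i j. length vs = k ==> set vs \<subseteq> TS p ==> i < j ==> j < k ==> vs ! i = vs ! j ==> h vs = 0"
 shows "h : alt k p"
proof -
 have "h vs = 0" if "i < j" "j < length vs" "vs ! i = vs ! j" for vs i j
  using assms(3)[of vs] assms(4)[of vs i j] that by (cases "length vs = k & set vs \<subseteq> TS p") auto
 then show ?thesis
  unfolding alternating_forms_def multilinear_on_def mem_Collect_eq using assms(1-3) by blast
qed

lemma alt_sum_slot:
 assumes h: "h : alt k p" and vs: "length vs = k" "set vs \<subseteq> TS p" "i < k"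
  and w: "!!m. m : I ==> w m : TS p"
 shows "h (vs[i := \<Sum>m\<in>I. fscale (c m) (w m)]) = (\<Sum>m\<in>I. c m * h (vs[i := w m]))"
proof -
 have 0: "h (vs[i := 0]) = 0"
  using conjunct2[OF alt_slot[OF h vs ts_0 ts_0, of 0]] by (simp add: fscale_def zero_fun_def)
 show ?thesis
  using w
 proof (induction I rule: infinite_finite_induct)
  case (insert m I)
  have w: "w m : TS p" and s: "(\<Sum>m\<in>I. fscale (c m) (w m)) : TS p"
   using insert.prems by (auto intro!: ts_sum ts_fscale)
  have "h (vs[i := \<Sum>m\<in>insert m I. fscale (c m) (w m)])
    = h (vs[i := fscale (c m) (w m) + (\<Sum>m\<in>I. fscale (c m) (w m))])"
   by (simp only: sum.insert[OF insert.hyps])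
  also have "... = h (vs[i := fscale (c m) (w m)]) + h (vs[i := \<Sum>m\<in>I. fscale (c m) (w m)])"
   by (rule conjunct1[OF alt_slot[OF h vs ts_fscale[OF w] s]])
  also have "h (vs[i := fscale (c m) (w m)]) = c m * h (vs[i := w m])"
   by (rule conjunct2[OF alt_slot[OF h vs w w]])
  also have "h (vs[i := \<Sum>m\<in>I. fscale (c m) (w m)]) = (\<Sum>m\<in>I. c m * h (vs[i := w m]))"
   by (rule insert.IH) (rule insert.prems, simp)
  finally show ?case by (simp only: sum.insert[OF insert.hyps])
 qed (use 0 in simp_all)
qed

lemma alt_swap:
 assumes h: "h : alt k p" and vs: "length vs = k" "set vs \<subseteq> TS p" and ij: "i < j" "j < k"
  and xy: "x : TS p" "y : TS p"
 shows "h (vs[i := x, j := y]) = - h (vs[i := y, j := x])"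
proof -
 define L where "L a b = h (vs[i := a, j := b])" for a b
 have up: "length (vs[l := z]) = k" "z : TS p ==> set (vs[l := z]) \<subseteq> TS p" for l z
  using vs set_update_subset_insert[of vs l z] by auto
 have L1: "L (a + b) c = L a c + L b c" if "a : TS p" "b : TS p" "c : TS p" for a b c
  using conjunct1[OF alt_slot[OF h up(1) up(2)[OF that(3)] _ that(1,2), of i j]] ij
  unfolding L_def by (simp add: list_update_swap[of i j])
 have L2: "L c (a + b) = L c a + L c b" if "a : TS p" "b : TS p" "c : TS p" for a b c
  using conjunct1[OF alt_slot[OF h up(1) up(2)[OF that(3)] _ that(1,2), of j i]] ij
  unfolding L_def by simp
 have L0: "L a a = 0" for a
  unfolding L_def using ij vs by (intro alt_equal[OF h, of i j]) auto
 have s: "x + y : TS p" by (rule ts_add[OF xy])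
 have "L (x + y) (x + y) = L x x + L x y + (L y x + L y y)"
  by (simp only: L1[OF xy s] L2[OF xy xy(1)] L2[OF xy xy(2)])
 then have "L x y + L y x = 0" unfolding L0 by simp
 then show ?thesis by (simp add: L_def add_eq_0_iff2)
qed

lemma alt_adjacent:
 assumes h: "h : alt k p"
 shows "h (pre @ x # y # post) = - h (pre @ y # x # post)"
proof (cases "length pre + length post + 2 = k & set (pre @ x # y # post) \<subseteq> TS p")
 case True
 then show ?thesis
  using alt_swap[OF h, of "pre @ x # y # post" "length pre" "Suc (length pre)" x y]
  by (simp add: list_update_append)
next
 case False
 then have "h (pre @ x # y # post) = 0" "h (pre @ y # x # post) = 0"
  by (intro alt_outside[OF h]; force)+
 then show ?thesis by simp
qed

lemma alt_move:
 assumes h: "h : alt k p"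
 shows "h (pre @ x # post) = (- 1) ^ length pre * h (x # pre @ post)"
proof (induction pre arbitrary: post rule: rev_induct)
 case (snoc y pre)
 have "h ((pre @ [y]) @ x # post) = - h (pre @ x # y # post)"
  using alt_adjacent[OF h, of pre y x post] by simp
 then show ?case using snoc[of "y # post"] by simp
qed simp

lemma alt_add:
 assumes "h : alt k p" "h' : alt k p" shows "(%vs. h vs + h' vs) : alt k p"
 by (rule altI) (use alt_slot[OF assms(1)] alt_slot[OF assms(2)] alt_outside[OF assms(1)]
   alt_outside[OF assms(2)] alt_equal[OF assms(1)] alt_equal[OF assms(2)] in \<open>auto simp: algebra_simps\<close>)

lemma alt_cmult:
 assumes "h : alt k p" shows "(%vs. c * h vs) : alt k p"
 by (rule altI) (use alt_slot[OF assms(1)] alt_outside[OF assms(1)] alt_equal[OF assms(1)] in \<open>auto simp: algebra_simps\<close>)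

lemma alt_0: "(%vs. 0) : alt k p"
 by (rule altI) auto

lemma alt_contract:
 assumes h: "h : alt (Suc k) p" and v: "v : TS p"
 shows "(%us. h (v # us)) : alt k p"
proof (rule altI)
 show "h (v # us[i := x + y]) = h (v # us[i := x]) + h (v # us[i := y])"
  if "length us = k" "set us \<subseteq> TS p" "i < k" "x : TS p" "y : TS p" for us i x y
  using conjunct1[OF alt_slot[OF h, of "v # us" "Suc i" x y]] that v by simp
 show "h (v # us[i := fscale c x]) = c * h (v # us[i := x])"
  if "length us = k" "set us \<subseteq> TS p" "i < k" "x : TS p" for us i x c
  using conjunct2[OF alt_slot[OF h, of "v # us" "Suc i" x x]] that v by simp
 show "h (v # us) = 0" if "\<not> (length us = k & set us \<subseteq> TS p)" for us
  using that by (intro alt_outside[OF h]) auto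
 show "h (v # us) = 0" if "length us = k" "set us \<subseteq> TS p" "i < j" "j < k" "us ! i = us ! j" for us i j
  using that by (intro alt_equal[OF h, of "Suc i" "Suc j"]) auto
qed

lemma alt_basis_ext:
 assumes h: "h : alt k p" and b: "basis_at V p"
  and 0: "!!is. length is = k ==> set is \<subseteq> {1..nn} ==> h (map (%k. V k p) is) = 0"
 shows "h = (%vs. 0)"
proof
 have "h (us @ map (%k. V k p) is) = 0" if "set us \<subseteq> TS p" "length us + length is = k" "set is \<subseteq> {1..nn}" for us "is"
  using that
 proof (induction us arbitrary: "is" rule: rev_induct)
  case (snoc u us)
  define vs where "vs = us @ u # map (%k. V k p) is"
  have vs: "length vs = k" "set vs \<subseteq> TS p" "length us < k"
   using snoc.prems basis_atD[OF b] by (auto simp: vs_def)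
  have u: "u = (\<Sum>m=1..nn. fscale (fco V p u m) (V m p))"
   by (rule frame_coeff_expand[OF b]) (use snoc.prems in simp)
  have "h vs = h (vs[length us := u])" by (simp add: vs_def)
  also have "... = h (vs[length us := \<Sum>m=1..nn. fscale (fco V p u m) (V m p)])"
   by (rule arg_cong[where f = "%z. h (vs[length us := z])", OF u])
  also have "... = (\<Sum>m=1..nn. fco V p u m * h (vs[length us := V m p]))"
   by (rule alt_sum_slot[OF h vs]) (rule basis_atD[OF b])
  also have "... = 0"
  proof (rule sum.neutral, rule ballI)
   fix m assume "m : {1..nn}"
   then have "h (us @ map (%k. V k p) (m # is)) = 0"
    using snoc.prems by (intro snoc.IH) auto
   then show "fco V p u m * h (vs[length us := V m p]) = 0"
    by (simp add: vs_def)
  qed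
  finally show ?case by (simp add: vs_def)
 qed (use 0 in simp)
 from this[of _ "[]"] show "h vs = 0" for vs
  using alt_outside[OF h, of vs] by (cases "length vs = k & set vs \<subseteq> TS p") auto
qed

lemma alt_insort: "h : alt k p ==> h (pre @ map b (insort x ys)) = 0 \<longleftrightarrow> h (pre @ b x # map b ys) = 0"
proof (induction ys arbitrary: pre)
 case (Cons y ys)
 show ?case
 proof (cases "x \<le> y")
  case False
  have "h (pre @ map b (insort x (y # ys))) = 0 \<longleftrightarrow> h ((pre @ [b y]) @ map b (insort x ys)) = 0"
   using False by simp
  also have "... \<longleftrightarrow> h ((pre @ [b y]) @ b x # map b ys) = 0" by (rule Cons.IH[OF Cons.prems])
  also have "... \<longleftrightarrow> h (pre @ b x # map b (y # ys)) = 0"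
   using alt_adjacent[OF Cons.prems, of pre "b y" "b x" "map b ys"] by simp
  finally show ?thesis .
 qed simp
qed simp

lemma alt_sort: "h : alt k p ==> h (pre @ map b (sort is)) = 0 \<longleftrightarrow> h (pre @ map b is) = 0"
proof (induction "is" arbitrary: pre)
 case (Cons x xs)
 have "h (pre @ map b (sort (x # xs))) = 0 \<longleftrightarrow> h ((pre @ [b x]) @ map b (sort xs)) = 0"
  using alt_insort[OF Cons.prems, of pre b x "sort xs"] by simp
 also have "... \<longleftrightarrow> h ((pre @ [b x]) @ map b xs) = 0" by (rule Cons.IH[OF Cons.prems])
 finally show ?case by simp
qed simp

lemma alt_non_distinct: "h : alt k p ==> \<not> distinct is ==> h (map b is) = 0"
proof -
 assume h: "h : alt k p" and "\<not> distinct is"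
 then obtain i j where "i < j" "j < length is" "is ! i = is ! j"
  unfolding distinct_conv_nth by (metis linorder_neqE_nat)
 then show ?thesis by (intro alt_equal[OF h, of i j]) auto
qed

lemma sort_eq_upt: "distinct is ==> set is = {1..nn} ==> sort is = [1..<nn + 1]"
 by (rule sorted_distinct_set_unique) (simp_all add: atLeastLessThanSuc_atLeastAtMost del: upt_Suc)

lemma alt_top_0:
 assumes h: "h : alt nn p" and b: "basis_at V p" and 0: "h (map (%k. V k p) [1..<nn + 1]) = 0"
 shows "h = (%vs. 0)"
proof (rule alt_basis_ext[OF h b])
 fix "is" assume l: "length is = nn" "set is \<subseteq> {1..nn}"
 show "h (map (%k. V k p) is) = 0"
 proof (cases "distinct is")
  case True
  then have "card (set is) = card {1..nn}" using l distinct_card[of "is"] by simp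
  then have "set is = {1..nn}" using l by (intro card_subset_eq) auto
  from sort_eq_upt[OF True this] show ?thesis using alt_sort[OF h, of "[]" "%k. V k p" "is"] 0 by simp
 qed (rule alt_non_distinct[OF h])
qed

text \<open>A form of degree \<open>n - 1\<close> annihilated by a basis vector is determined by its value on the others.\<close>

lemma alt_codim_1_0:
 assumes h: "h : alt (nn - 1) p" and b: "basis_at V p" and i: "i : {1..nn}"
  and kill: "!!us. h (V i p # us) = 0" and 0: "h (map (%k. V k p) (filter (%j. j ~= i) [1..<nn + 1])) = 0"
 shows "h = (%vs. 0)"
proof (rule alt_basis_ext[OF h b])
 fix "is" assume l: "length is = nn - 1" "set is \<subseteq> {1..nn}"
 show "h (map (%k. V k p) is) = 0"
 proof (cases "i : set is")
  case True
  then obtain pre post where "is = pre @ i # post" by (meson split_list)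
  then show ?thesis using alt_move[OF h, of "map (%k. V k p) pre" "V i p" "map (%k. V k p) post"] kill by simp
 next
  case ni: False
  show ?thesis
  proof (cases "distinct is")
   case True
   have "card (set is) = card ({1..nn} - {i})" using l i distinct_card[OF True] by simp
   have s: "set is = {1..nn} - {i}"
    by (rule card_subset_eq[OF _ _ \<open>card (set is) = card ({1..nn} - {i})\<close>]) (use l ni in auto)
   have "sort is = filter (%j. j ~= i) [1..<nn + 1]"
   proof (rule sorted_distinct_set_unique)
    show "sorted (filter (%j. j ~= i) [1..<nn + 1])" by (rule sorted_wrt_filter[OF sorted_upt])
    show "set (sort is) = set (filter (%j. j ~= i) [1..<nn + 1])"
    proof -
     have "set [1..<nn + 1] = {1..nn}" by (simp add: atLeastLessThanSuc_atLeastAtMost del: upt_Suc)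
     then show ?thesis unfolding set_sort s set_filter by blast
    qed
   qed (use True in \<open>simp_all del: upt_Suc\<close>)
   then show ?thesis using alt_sort[OF h, of "[]" "%k. V k p" "is"] 0 by simp
  qed (rule alt_non_distinct[OF h])
 qed
qed

lemma wedge_alt:
 assumes \<alpha>: "!!\<alpha>. \<alpha> : set \<alpha>s ==> \<alpha> p : alt 1 p"
 shows "wedge \<alpha>s p : alt (length \<alpha>s) p"
proof (rule altI)
 define k where "k = length \<alpha>s"
 have a1: "(\<alpha>s ! a) p [x + y] = (\<alpha>s ! a) p [x] + (\<alpha>s ! a) p [y]"
  and a2: "(\<alpha>s ! a) p [fscale c x] = c * (\<alpha>s ! a) p [x]" if "a < k" "x : TS p" "y : TS p" for a x y c
  using alt_slot[OF \<alpha>[OF nth_mem[of a \<alpha>s]], of "[x]" 0 x y c] that by (simp_all add: k_def)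
 have a3: "(\<alpha>s ! a) p [x] = 0" if "a < k" "x \<notin> TS p" for a x
  using alt_outside[OF \<alpha>[OF nth_mem[of a \<alpha>s]], of "[x]"] that by (simp add: k_def)
 have slot: "(\<Prod>a<k. (\<alpha>s ! a) p [vs[i := x] ! \<pi> a])
   = (\<alpha>s ! inv \<pi> i) p [x] * (\<Prod>a\<in>{..<k} - {inv \<pi> i}. (\<alpha>s ! a) p [vs ! \<pi> a])"
  if "\<pi> permutes {..<k}" "i < k" "length vs = k" for \<pi> vs i x
 proof -
  have i: "inv \<pi> i < k" using permutes_in_image[OF permutes_inv[OF that(1)], of i] that by simp
  have "(\<Prod>a<k. (\<alpha>s ! a) p [vs[i := x] ! \<pi> a])
   = (\<alpha>s ! inv \<pi> i) p [vs[i := x] ! \<pi> (inv \<pi> i)] * (\<Prod>a\<in>{..<k} - {inv \<pi> i}. (\<alpha>s ! a) p [vs[i := x] ! \<pi> a])"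
   by (rule prod.remove) (use i in auto)
  also have "(\<Prod>a\<in>{..<k} - {inv \<pi> i}. (\<alpha>s ! a) p [vs[i := x] ! \<pi> a])
    = (\<Prod>a\<in>{..<k} - {inv \<pi> i}. (\<alpha>s ! a) p [vs ! \<pi> a])"
  proof (rule prod.cong[OF refl])
   fix a assume "a : {..<k} - {inv \<pi> i}"
   then have "\<pi> a ~= i" using permutes_inverses(2)[OF that(1), of a] by auto
   then show "(\<alpha>s ! a) p [vs[i := x] ! \<pi> a] = (\<alpha>s ! a) p [vs ! \<pi> a]" by simp
  qed
  finally show ?thesis using that permutes_inverses(1)[OF that(1), of i] by simp
 qed
 have ik: "inv \<pi> i < k" if "\<pi> permutes {..<k}" "i < k" for \<pi> i
  using permutes_in_image[OF permutes_inv[OF that(1)], of i] that by simp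
 show "wedge \<alpha>s p (vs[i := x + y]) = wedge \<alpha>s p (vs[i := x]) + wedge \<alpha>s p (vs[i := y])"
  if "length vs = length \<alpha>s" "i < length \<alpha>s" "x : TS p" "y : TS p" for vs i x y
  using that unfolding wedge_def k_def[symmetric]
  by (simp add: slot a1 ik algebra_simps flip: sum.distrib)
 show "wedge \<alpha>s p (vs[i := fscale c x]) = c * wedge \<alpha>s p (vs[i := x])"
  if "length vs = length \<alpha>s" "i < length \<alpha>s" "x : TS p" for vs i x c
  using that unfolding wedge_def k_def[symmetric]
  by (simp add: slot a2 ik sum_distrib_left algebra_simps)
 show "wedge \<alpha>s p vs = 0" if "\<not> (length vs = length \<alpha>s & set vs \<subseteq> TS p)" for vs
 proof (cases "length vs = k")
  case True
  then have "\<not> set vs \<subseteq> TS p" using that by (simp add: k_def)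
  then obtain x where "x : set vs" "x \<notin> TS p" by blast
  then obtain j where j: "j < k" "vs ! j \<notin> TS p" using True by (metis in_set_conv_nth)
  have "(\<Prod>a<k. (\<alpha>s ! a) p [vs ! \<pi> a]) = 0" if "\<pi> permutes {..<k}" for \<pi>
   using ik[OF that j(1)] j a3 permutes_inverses(1)[OF that, of j]
   by (intro prod_zero bexI[of _ "inv \<pi> j"]) auto
  then have "(\<Sum>\<pi> | \<pi> permutes {..<k}. of_int (sign \<pi>) * (\<Prod>a<k. (\<alpha>s ! a) p [vs ! \<pi> a])) = 0"
   by (intro sum.neutral) simp
  then show ?thesis by (simp add: wedge_def k_def)
 qed (simp add: wedge_def k_def)
 show "wedge \<alpha>s p vs = 0"
  if vs: "length vs = length \<alpha>s" and ij: "i < j" "j < length \<alpha>s" "vs ! i = vs ! j" for vs i j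
 proof -
  define F where "F \<pi> = of_int (sign \<pi>) * (\<Prod>a<k. (\<alpha>s ! a) p [vs ! \<pi> a])" for \<pi>
  define t where "t = Transposition.transpose i j"
  have t: "t permutes {..<k}" unfolding t_def using ij by (intro permutes_swap_id) (auto simp: k_def)
  have vt: "vs ! t a = vs ! a" for a using ij by (auto simp: t_def Transposition.transpose_def)
  have "sum F {\<pi>. \<pi> permutes {..<k}} = (\<Sum>\<pi> | \<pi> permutes {..<k}. F (t \<circ> \<pi>))"
   by (rule setum_permutations_compose_left[OF t])
  also have "... = (\<Sum>\<pi> | \<pi> permutes {..<k}. - F \<pi>)"
  proof (rule sum.cong[OF refl])
   fix \<pi> assume "\<pi> : {\<pi>. \<pi> permutes {..<k}}"
   then have "sign (t \<circ> \<pi>) = - sign \<pi>"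
    using sign_compose[OF permutes_imp_permutation[OF _ t] permutes_imp_permutation[of "{..<k}" \<pi>]] ij
    by (simp add: t_def sign_swap_id)
   then show "F (t \<circ> \<pi>) = - F \<pi>" by (simp add: F_def vt)
  qed
  finally have "sum F {\<pi>. \<pi> permutes {..<k}} = - sum F {\<pi>. \<pi> permutes {..<k}}" by (simp add: sum_negf)
  then have "2 * sum F {\<pi>. \<pi> permutes {..<k}} = 0" unfolding mult_2 by (metis add.right_inverse)
  then show ?thesis using vs by (simp add: wedge_def F_def k_def)
 qed
qed

lemma wedge_dual:
 assumes "length vs = length \<alpha>s"
  and "!!a b. a < length \<alpha>s ==> b < length \<alpha>s ==> (\<alpha>s ! a) p [vs ! b] = (if a = b then 1 else 0 :: 'k)"
 shows "wedge \<alpha>s p vs = 1"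
proof -
 have "wedge \<alpha>s p vs = (\<Sum>\<pi> | \<pi> permutes {..<length \<alpha>s}.
   of_int (sign \<pi>) * (\<Prod>a<length \<alpha>s. (\<alpha>s ! a) p [vs ! \<pi> a]))"
  using assms(1) by (simp add: wedge_def)
 also have "... = (\<Sum>\<pi> | \<pi> permutes {..<length \<alpha>s}. if \<pi> = id then 1 else 0)"
 proof (rule sum.cong[OF refl])
  fix \<pi> assume "\<pi> : {\<pi>. \<pi> permutes {..<length \<alpha>s}}"
  then have \<pi>: "\<pi> permutes {..<length \<alpha>s}" by simp
  have in': "\<pi> a < length \<alpha>s" if "a < length \<alpha>s" for a using permutes_in_image[OF \<pi>, of a] that by simp
  show "of_int (sign \<pi>) * (\<Prod>a<length \<alpha>s. (\<alpha>s ! a) p [vs ! \<pi> a]) = (if \<pi> = id then 1 else 0)"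
  proof (cases "\<pi> = id")
   case False
   then obtain a where a: "\<pi> a ~= a" by (auto simp: fun_eq_iff)
   then have "a < length \<alpha>s" using \<pi> by (metis lessThan_iff permutes_not_in)
   then have "(\<Prod>a<length \<alpha>s. (\<alpha>s ! a) p [vs ! \<pi> a]) = 0"
    using a assms(2)[of a "\<pi> a"] in' by (intro prod_zero bexI[of _ a]) auto
   then show ?thesis using False by simp
  qed (use assms(2) in \<open>simp add: sign_id\<close>)
 qed
 also have "... = 1" by (simp add: finite_permutations permutes_id)
 finally show ?thesis .
qed

section \<open>Tensorial operators on vector fields\<close>

text \<open>An operator on lists of vector fields that is linear over functions and alternating at a point is
 evaluation of a form there: expand every argument in a frame.\<close>

lemma tensorial:
 fixes \<Phi> :: "('a => ('a, 'k) tvec) list => 'k"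
 assumes N: "open N" "p : N"
  and lin: "!!O' Ys j I g Z Y. open O' ==> p : O' ==> O' \<subseteq> N ==> length Ys = k ==>
   (!!Y. Y : set Ys ==> vf O' Y) ==> vf O' Y ==> j < k ==> finite I ==> (!!m. m : I ==> vf O' (Z m)) ==>
   (!!m q. m : I ==> q : O' ==> an q (g m)) ==>
   (!!q. q : O' ==> Y q = (\<Sum>m\<in>I. fscale (g m q) (Z m q))) ==>
   \<Phi> (Ys[j := Y]) = (\<Sum>m\<in>(I::nat set). g m p * \<Phi> (Ys[j := Z m]))"
  and alternating: "!!O' Ys i j. open O' ==> p : O' ==> O' \<subseteq> N ==> length Ys = k ==>
   (!!Y. Y : set Ys ==> vf O' Y) ==> i < j ==> j < k ==> Ys ! i = Ys ! j ==> \<Phi> Ys = 0"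
 obtains h where "h : alt k p"
  "!!O' Ys. open O' ==> p : O' ==> O' \<subseteq> N ==> length Ys = k ==> (!!Y. Y : set Ys ==> vf O' Y) ==>
   \<Phi> Ys = h (map (%Y. Y p) Ys)"
proof -
 obtain M V where M: "p : M" "M \<subseteq> N" and V: "frame M V" using frame_exists[OF N] .
 note oM = frame_open[OF V] and b = frame_basis[OF V M(1)]
 define ext where "ext u q = (\<Sum>m=1..nn. fscale (fco V p u m) (V m q))" for u q
 have ext_vf: "vf M (ext u)" for u
  unfolding ext_def by (intro vf_sum vf_fscale oM an_const frame_vf[OF V])
 have ext_p: "ext u p = u" if "u : TS p" for u
  unfolding ext_def by (rule frame_coeff_expand[OF b that, symmetric])
 define h where "h vs = (if length vs = k & set vs \<subseteq> TS p then \<Phi> (map ext vs) else 0)" for vs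
 have up: "length (vs[i := x]) = k & set (vs[i := x]) \<subseteq> TS p" if "length vs = k" "set vs \<subseteq> TS p" "x : TS p" for vs i x
  using that set_update_subset_insert[of vs i x] by auto
 have h: "h : alt k p"
 proof (rule altI)
  fix vs i x y assume vs: "length vs = k" "set vs \<subseteq> TS p" "i < k" "x : TS p" "y : TS p"
  have "\<Phi> ((map ext vs)[i := ext (x + y)])
    = (\<Sum>m\<in>{0,1::nat}. 1 * \<Phi> ((map ext vs)[i := (if m = 0 then ext x else ext y)]))"
  proof (rule lin[OF oM M, where g = "%m q. 1" and Z = "%m. if m = 0 then ext x else ext y"])
   show "ext (x + y) q = (\<Sum>m\<in>{0,1::nat}. fscale 1 ((if m = 0 then ext x else ext y) q))" for q
    by (simp add: fun_eq_iff ext_def sum_fun_apply frame_coeff_add[OF b vs(4,5)] distrib_right sum.distrib)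
  qed (use vs ext_vf in auto)
  then show "h (vs[i := x + y]) = h (vs[i := x]) + h (vs[i := y])"
   using up[OF vs(1,2)] vs ts_add[OF vs(4,5)] by (simp add: h_def map_update)
 next
  fix vs i x c assume vs: "length vs = k" "set vs \<subseteq> TS p" "i < k" "x : TS p"
  have "\<Phi> ((map ext vs)[i := ext (fscale c x)]) = (\<Sum>m\<in>{0::nat}. c * \<Phi> ((map ext vs)[i := ext x]))"
  proof (rule lin[OF oM M, where g = "%m q. c" and Z = "%m. ext x"])
   show "ext (fscale c x) q = (\<Sum>m\<in>{0::nat}. fscale c (ext x q))" for q
    by (simp add: fun_eq_iff ext_def sum_fun_apply frame_coeff_fscale[OF b vs(4)] sum_distrib_left mult.assoc)
  qed (use vs ext_vf in auto)
  then show "h (vs[i := fscale c x]) = c * h (vs[i := x])"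
   using up[OF vs(1,2)] vs ts_fscale[OF vs(4)] by (simp add: h_def map_update)
 next
  fix vs i j assume "length vs = k" "set vs \<subseteq> TS p" "i < j" "j < k" "vs ! i = vs ! j"
  then show "h vs = 0"
   unfolding h_def using alternating[OF oM M, of "map ext vs" i j] ext_vf by auto
 qed (auto simp: h_def)
 moreover have "\<Phi> Ys = h (map (%Y. Y p) Ys)"
  if O': "open O'" "p : O'" "O' \<subseteq> N" and Ys: "length Ys = k" "!!Y. Y : set Ys ==> vf O' Y" for O' Ys
 proof -
  define S where "S = O' \<inter> M"
  have S: "open S" "p : S" "S \<subseteq> N" "S \<subseteq> O'" "S \<subseteq> M" using O' M oM by (auto simp: S_def)
  have ts: "Y p : TS p" if "Y : set Ys" for Y using vf_ts[OF Ys(2)[OF that] O'(2)] .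
  define E where "E = map (%Y. ext (Y p)) Ys"
  define H where "H j = take j E @ drop j Ys" for j
  have H_len: "length (H j) = k" if "j \<le> k" for j using Ys that by (simp add: H_def E_def)
  have H_vf: "vf S Z" if "Z : set (H j)" for Z j
  proof -
   have "Z : set E \<or> Z : set Ys" using that by (auto simp: H_def dest: in_set_takeD in_set_dropD)
   then show ?thesis
    using vf_subset[OF ext_vf S(5)] vf_subset[OF Ys(2) S(4)] by (auto simp: E_def)
  qed
  have step: "\<Phi> (H j) = \<Phi> (H (Suc j))" if j: "j < k" for j
  proof -
   define Y where "Y = Ys ! j"
   have Y: "Y : set Ys" using j Ys by (simp add: Y_def)
   have u1: "(H j)[j := Y] = H j"
    using j Ys by (simp add: H_def E_def Y_def list_update_append nth_append list_update_same_conv)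
   have u2: "(H j)[j := ext (Y p)] = H (Suc j)"
    using j Ys by (simp add: H_def E_def Y_def list_update_append take_Suc_conv_app_nth
      Cons_nth_drop_Suc[symmetric] del: take_map)
   have vY: "vf S Y" using vf_subset[OF Ys(2)[OF Y] S(4)] .
   have "\<Phi> ((H j)[j := Y]) = (\<Sum>m\<in>{1..nn}. fco V p (Y p) m * \<Phi> ((H j)[j := V m]))"
   proof (rule lin[OF S(1-3) H_len H_vf vY j, where g = "%m q. fco V q (Y q) m" and Z = V])
    show "an q (%q. fco V q (Y q) m)" if "q : S" for q m
     by (rule frame_coeff_an[OF V vY S(1,5) that])
    show "Y q = (\<Sum>m = 1..nn. fscale (fco V q (Y q) m) (V m q))" if "q : S" for q
     by (rule frame_coeff_expand[OF frame_basis[OF V] vf_ts[OF vY that]]) (use that S in auto)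
   qed (use j vf_subset[OF frame_vf[OF V] S(5)] in auto)
   also have "... = \<Phi> ((H j)[j := ext (Y p)])"
   proof (rule lin[OF S(1-3) H_len H_vf _ j, where g = "%m q. fco V p (Y p) m" and Z = V, symmetric])
    show "vf S (ext (Y p))" by (rule vf_subset[OF ext_vf S(5)])
    show "ext (Y p) q = (\<Sum>m = 1..nn. fscale (fco V p (Y p) m) (V m q))" for q
     by (simp add: ext_def)
   qed (use j vf_subset[OF frame_vf[OF V] S(5)] in auto)
   finally show ?thesis unfolding u1 u2 .
  qed
  have "\<Phi> (H 0) = \<Phi> (H j)" if "j \<le> k" for j
   using that by (induction j) (use step in auto)
  from this[of k] have "\<Phi> Ys = \<Phi> E" using Ys by (simp add: H_def E_def)
  also have "E = map ext (map (%Y. Y p) Ys)" by (simp add: E_def)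
  finally show ?thesis using Ys ts unfolding h_def by auto
 qed
 ultimately show thesis by (rule that)
qed

end

section \<open>Differential forms\<close>

context manifold
begin

lemma form_on_alt: "fon k N et ==> p : N ==> et p : alt k p"
 and form_on_outside: "fon k N et ==> p \<notin> N ==> et p = 0"
 by (simp_all add: form_on_def)

lemma form_on_an:
 assumes "fon k N et" "open O'" "O' \<subseteq> N" "length Xs = k" "!!X. X : set Xs ==> vf O' X" "p : O'"
 shows "an p (%p. et p (map (%X. X p) Xs))"
 using assms unfolding form_on_def mfd_analytic_def by blast

lemma form_onI:
 assumes "!!p. p : N ==> et p : alt k p" "!!p. p \<notin> N ==> et p = 0"
  "!!O' Xs p. open O' ==> O' \<subseteq> N ==> length Xs = k ==> (!!X. X : set Xs ==> vf O' X) ==> p : O' ==>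
   an p (%p. et p (map (%X. X p) Xs))"
 shows "fon k N et"
 unfolding form_on_def mfd_analytic_def using assms by simp

lemma form_on_local:
 assumes loc: "!!p. p : N ==> \<exists>M et'. open M & p : M & fon k M et' & (\<forall>q\<in>M. et q = et' q)"
  and out: "!!p. p \<notin> N ==> et p = 0"
 shows "fon k N et"
proof (rule form_onI)
 fix p assume "p : N"
 then obtain M et' where M: "open M" "p : M" "fon k M et'" "\<forall>q\<in>M. et q = et' q" using loc by blast
 then show "et p : alt k p" using form_on_alt[OF M(3,2)] by simp
next
 fix O' p and Xs :: "('a => ('a, 'k) tvec) list"
 assume O': "open O'" "O' \<subseteq> N" "length Xs = k" "!!X. X : set Xs ==> vf O' X" "p : O'"
 have "p : N" using O'(2,5) by blast
 from loc[OF this] obtain M et' where M: "open M" "p : M" "fon k M et'" "\<forall>q\<in>M. et q = et' q"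
  by blast
 have o: "open (O' \<inter> M)" using O'(1) M(1) by auto
 have "an p (%p. et' p (map (%X. X p) Xs))"
  by (rule form_on_an[OF M(3) o _ O'(3)]) (use M O' vf_subset[OF O'(4), of _ "O' \<inter> M"] in auto)
 then show "an p (%p. et p (map (%X. X p) Xs))"
  by (rule an_cong) (use eventually_nhds_in_open[OF M(1,2)] M(4) in \<open>auto elim!: eventually_mono\<close>)
qed (rule out)

lemma form_on_restrict:
 assumes "fon k N et" "M \<subseteq> N"
 shows "fon k M (%p. if p : M then et p else 0)"
proof (rule form_onI)
 show "(if p : M then et p else 0) : alt k p" if "p : M" for p using form_on_alt[OF assms(1)] that assms(2) by auto
 fix O' p and Xs :: "('a => ('a, 'k) tvec) list"
 assume O': "open O'" "O' \<subseteq> M" "length Xs = k" "!!X. X : set Xs ==> vf O' X" "p : O'"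
 then have "an p (%p. et p (map (%X. X p) Xs))"
  by (intro form_on_an[OF assms(1) O'(1) _ O'(3)]) (use assms(2) in auto)
 then show "an p (%p. (if p : M then et p else 0) (map (%X. X p) Xs))"
  by (rule an_cong) (use eventually_nhds_in_open[OF O'(1,5)] O'(2) in \<open>auto elim!: eventually_mono\<close>)
qed simp

lemma alt_eqI:
 assumes "h : alt k p" "h' : alt k p" "!!vs. length vs = k ==> set vs \<subseteq> TS p ==> h vs = h' vs"
 shows "h = h'"
proof
 show "h vs = h' vs" for vs
  using assms(3)[of vs] alt_outside[OF assms(1), of vs] alt_outside[OF assms(2), of vs]
  by (cases "length vs = k & set vs \<subseteq> TS p") auto
qed

lemma alt_1:
 assumes h: "h : alt 1 p"
 shows "u : TS p ==> v : TS p ==> h [u + v] = h [u] + h [v]"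
  and "v : TS p ==> h [fscale c v] = c * h [v]"
  and "(!!m. m : I ==> w m : TS p) ==> h [\<Sum>m\<in>I. fscale (d m) (w m)] = (\<Sum>m\<in>I. d m * h [w m])"
  and "h [0] = 0" and "v : TS p ==> h [- v] = - h [v]"
proof -
 show a: "h [u + v] = h [u] + h [v]" if "u : TS p" "v : TS p" for u v
  using alt_slot[OF h, of "[u]" 0 u v] that by simp
 show b: "h [fscale c v] = c * h [v]" if "v : TS p" for c v
  using alt_slot[OF h, of "[v]" 0 v v] that by simp
 show z: "h [0] = 0" using b[OF ts_0, of 0] by (simp add: fscale_def zero_fun_def)
 show "h [- v] = - h [v]" if "v : TS p" using b[OF that, of "- 1"] by (simp add: fscale_minus_1)
 show "h [\<Sum>m\<in>I. fscale (d m) (w m)] = (\<Sum>m\<in>I. d m * h [w m])" if "!!m. m : I ==> w m : TS p"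
  using alt_sum_slot[OF h, of "[0]" 0 I w d] that by simp
qed

lemma vf_extend_list:
 assumes N: "open N" "p : N" and vs: "set vs \<subseteq> TS p"
 shows "\<exists>O' Ys. open O' & p : O' & O' \<subseteq> N & (\<forall>Y\<in>set Ys. vf O' Y) & map (%Y. Y p) Ys = vs"
 using vs
proof (induction vs)
 case Nil
 then show ?case using N by (intro exI[of _ N] exI[of _ "[]"]) auto
next
 case (Cons v vs)
 then obtain O' Ys where O': "open O'" "p : O'" "O' \<subseteq> N" "\<forall>Y\<in>set Ys. vf O' Y" "map (%Y. Y p) Ys = vs" by auto
 obtain M X where M: "open M" "p : M" "M \<subseteq> O'" "vf M X" "X p = v"
  using vf_extend[of v p O'] Cons.prems O' by auto
 show ?case
  using M O' vf_subset by (intro exI[of _ M] exI[of _ "X # Ys"]) auto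
qed

lemma lie_expand:
 assumes O': "open O'" "p : O'" and X: "vf O' X" and Y: "vf O' Y" and I: "finite I"
  and Z: "!!m. m : I ==> vf O' (Z m)" and g: "!!m q. m : I ==> q : O' ==> an q (g m)"
  and eq: "!!q. q : O' ==> Y q = (\<Sum>m\<in>I. fscale (g m q) (Z m q))"
 shows "lie X Y p
   = (\<Sum>m\<in>I. fscale (g m p) (lie X (Z m) p)) + (\<Sum>m\<in>I. fscale (X p (g m)) (Z m p))"
proof -
 have "lie X Y p = lie X (%q. \<Sum>m\<in>I. fscale (g m q) (Z m q)) p"
  by (rule lie_cong[OF X Y O']) (use eq eventually_nhds_in_open[OF O'] in \<open>auto elim!: eventually_mono\<close>)
 also have "... = (\<Sum>m\<in>I. lie X (%q. fscale (g m q) (Z m q)) p)"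
  by (rule lie_sum_right[OF X _ O']) (use vf_fscale[OF O'(1) Z g] in auto)
 also have "... = (\<Sum>m\<in>I. fscale (g m p) (lie X (Z m) p) + fscale (X p (g m)) (Z m p))"
  by (rule sum.cong[OF refl]) (rule lie_fscale_right[OF X Z O' g], use O' in auto)
 finally show ?thesis by (simp only: sum.distrib)
qed

section \<open>The exterior derivative of a one-form\<close>

text \<open>Cartan's formula, before it is known to be tensorial.\<close>

definition ext_op :: "('a, 'k) dform => ('a => ('a, 'k) tvec) => ('a => ('a, 'k) tvec) => 'a => 'k" where
 "ext_op \<gamma> X Y p = X p (%q. \<gamma> q [Y q]) - Y p (%q. \<gamma> q [X q]) - \<gamma> p [lie X Y p]"

context
 fixes N \<gamma> assumes N: "open N" and \<gamma>: "fon 1 N \<gamma>"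
begin

lemma one_form_an: "open O' ==> O' \<subseteq> N ==> vf O' X ==> p : O' ==> an p (%q. \<gamma> q [X q])"
 using form_on_an[OF \<gamma>, of O' "[X]" p] by simp

lemma ext_op_antisym:
 assumes "open O'" "p : O'" "O' \<subseteq> N" "vf O' X" "vf O' Y"
 shows "ext_op \<gamma> Y X p = - ext_op \<gamma> X Y p"
 using alt_1(5)[OF form_on_alt[OF \<gamma>] lie_ts[OF assms(4,5,1,2)]] assms
 unfolding ext_op_def lie_antisym[of Y X] by auto

lemma ext_op_expand:
 assumes O': "open O'" "p : O'" "O' \<subseteq> N" and X: "vf O' X" and Y: "vf O' Y" and I: "finite I"
  and Z: "!!m. m : I ==> vf O' (Z m)" and g: "!!m q. m : I ==> q : O' ==> an q (g m)"
  and eq: "!!q. q : O' ==> Y q = (\<Sum>m\<in>I. fscale (g m q) (Z m q))"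
 shows "ext_op \<gamma> X Y p = (\<Sum>m\<in>I. g m p * ext_op \<gamma> X (Z m) p)"
proof -
 note x = vf_ts[OF X O'(2)]
 have al: "\<gamma> q : alt 1 q" if "q : O'" for q using form_on_alt[OF \<gamma>] that O'(3) by blast
 have gp: "an p (g m)" if "m : I" for m using g[OF that O'(2)] .
 have zp: "an p (%q. \<gamma> q [Z m q])" if "m : I" for m by (rule one_form_an[OF O'(1,3) Z[OF that] O'(2)])
 have "X p (%q. \<gamma> q [Y q]) = X p (%q. \<Sum>m\<in>I. g m q * \<gamma> q [Z m q])"
 proof (rule tv_cong[OF x one_form_an[OF O'(1,3) Y O'(2)]])
  show "\<forall>\<^sub>F q in nhds p. \<gamma> q [Y q] = (\<Sum>m\<in>I. g m q * \<gamma> q [Z m q])"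
   using eventually_nhds_in_open[OF O'(1,2)]
  proof eventually_elim
   case (elim q)
   show ?case unfolding eq[OF elim] by (rule alt_1(3)[OF al[OF elim]]) (rule vf_ts[OF Z elim])
  qed
 qed
 also have "... = (\<Sum>m\<in>I. X p (%q. g m q * \<gamma> q [Z m q]))"
  by (rule tv_sum[OF x]) (rule an_mult[OF gp zp])
 also have "... = (\<Sum>m\<in>I. g m p * X p (%q. \<gamma> q [Z m q]) + \<gamma> p [Z m p] * X p (g m))"
  by (rule sum.cong[OF refl]) (rule tv_mult[OF x gp zp])
 finally have 1: "X p (%q. \<gamma> q [Y q]) = (\<Sum>m\<in>I. g m p * X p (%q. \<gamma> q [Z m q])) + (\<Sum>m\<in>I. X p (g m) * \<gamma> p [Z m p])"
  by (simp add: sum.distrib mult.commute)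
 have 2: "Y p (%q. \<gamma> q [X q]) = (\<Sum>m\<in>I. g m p * Z m p (%q. \<gamma> q [X q]))"
  unfolding eq[OF O'(2)] by (simp add: sum_fun_apply)
 have lt: "lie X (Z m) p : TS p" if "m : I" for m by (rule lie_ts[OF X Z[OF that] O'(1,2)])
 have zt: "Z m p : TS p" if "m : I" for m by (rule vf_ts[OF Z[OF that] O'(2)])
 have L: "lie X Y p
   = (\<Sum>m\<in>I. fscale (g m p) (lie X (Z m) p)) + (\<Sum>m\<in>I. fscale (X p (g m)) (Z m p))"
  by (rule lie_expand[OF O'(1,2) X Y I Z g eq])
 have "\<gamma> p [lie X Y p] = \<gamma> p [\<Sum>m\<in>I. fscale (g m p) (lie X (Z m) p)]
   + \<gamma> p [\<Sum>m\<in>I. fscale (X p (g m)) (Z m p)]"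
  unfolding L
  by (rule alt_1(1)[OF al[OF O'(2)]]) (auto intro!: ts_sum ts_fscale lt zt)
 then have 3: "\<gamma> p [lie X Y p] = (\<Sum>m\<in>I. g m p * \<gamma> p [lie X (Z m) p]) + (\<Sum>m\<in>I. X p (g m) * \<gamma> p [Z m p])"
  using alt_1(3)[OF al[OF O'(2)], of I "%m. lie X (Z m) p" "%m. g m p"]
   alt_1(3)[OF al[OF O'(2)], of I "%m. Z m p" "%m. X p (g m)"] lt zt by simp
 show ?thesis
  unfolding ext_op_def 1 2 3 by (simp add: sum_subtractf right_diff_distrib)
qed

lemma ext_op_tensor:
 assumes p: "p : N"
 shows "\<exists>h\<in>alt 2 p. \<forall>O' X Y. open O' --> p : O' --> O' \<subseteq> N --> vf O' X --> vf O' Y -->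
  ext_op \<gamma> X Y p = h [X p, Y p]"
proof (rule tensorial[OF N p, of 2 "%Ys. ext_op \<gamma> (Ys ! 0) (Ys ! 1) p"], goal_cases)
  case (1 O' Ys j I g Z Y)
  have Ys: "vf O' (Ys ! 0)" "vf O' (Ys ! 1)" by (rule 1(5)[OF nth_mem]; use 1(4) in simp)+
  show ?case
  proof (cases "j = 1")
   case True
   then show ?thesis using ext_op_expand[OF 1(1-3) Ys(1) 1(6) 1(8) 1(9) 1(10) 1(11)] 1(4) by simp
  next
   case False
   then have j: "j = 0" using 1(7) by simp
   have "ext_op \<gamma> Y (Ys ! 1) p = - (\<Sum>m\<in>I. g m p * ext_op \<gamma> (Ys ! 1) (Z m) p)"
    using ext_op_antisym[OF 1(1-3) Ys(2) 1(6)] ext_op_expand[OF 1(1-3) Ys(2) 1(6) 1(8) 1(9) 1(10) 1(11)] by simp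
   also have "... = (\<Sum>m\<in>I. g m p * ext_op \<gamma> (Z m) (Ys ! 1) p)"
    using ext_op_antisym[OF 1(1-3) Ys(2) 1(9)] by (simp add: sum_negf)
   finally show ?thesis using j 1(4) by simp
  qed
 next
  case (2 O' Ys i j)
  then have "i = 0" "j = 1" by auto
  then have e: "Ys ! 0 = Ys ! 1" using 2(8) by simp
  show ?case unfolding e ext_op_def using alt_1(4)[OF form_on_alt[OF \<gamma> p]] by simp
 next
  case h: (3 h)
  show ?case
  proof (intro bexI[OF _ h(1)] allI impI)
   fix O' X Y assume "open O'" "p : O'" "O' \<subseteq> N" "vf O' X" "vf O' Y"
   then show "ext_op \<gamma> X Y p = h [X p, Y p]" using h(2)[of O' "[X, Y]"] by auto
  qed
 qed

lemma ext_deriv: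
 "fon 2 N (extd N \<gamma>)"
 "open O' ==> O' \<subseteq> N ==> vf O' X ==> vf O' Y ==> p : O' ==> extd N \<gamma> p [X p, Y p] = ext_op \<gamma> X Y p"
proof -
 let ?P = "%\<Gamma>. fon 2 N \<Gamma> \<and>
  (\<forall>O' X Y. open O' --> O' \<subseteq> N --> vf O' X --> vf O' Y --> (\<forall>p\<in>O'. \<Gamma> p [X p, Y p] = ext_op \<gamma> X Y p))"
 have "\<exists>!\<Gamma>. ?P \<Gamma>"
 proof (rule ex_ex1I)
  have "\<forall>p\<in>N. \<exists>h. h : alt 2 p & (\<forall>O' X Y. open O' --> p : O' --> O' \<subseteq> N --> vf O' X --> vf O' Y -->
    ext_op \<gamma> X Y p = h [X p, Y p])"
   by (intro ballI) (rule ext_op_tensor[unfolded Bex_def])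
  from bchoice[OF this] obtain H where HH: "\<forall>p\<in>N. H p : alt 2 p \<and>
   (\<forall>O' X Y. open O' --> p : O' --> O' \<subseteq> N --> vf O' X --> vf O' Y --> ext_op \<gamma> X Y p = H p [X p, Y p])" ..
  note H = HH[rule_format, THEN conjunct1] HH[rule_format, THEN conjunct2, rule_format]
  define \<Gamma> where "\<Gamma> p = (if p : N then H p else 0)" for p
  have eq: "\<Gamma> p [X p, Y p] = ext_op \<gamma> X Y p"
   if "open O'" "O' \<subseteq> N" "vf O' X" "vf O' Y" "p : O'" for O' X Y p
  proof -
   have "p : N" using that(2,5) by blast
   then show ?thesis using H(2)[OF _ that(1,5,2,3,4)] by (simp add: \<Gamma>_def)
  qed
  have "fon 2 N \<Gamma>"
  proof (rule form_onI)
   fix O' p and Xs :: "('a => ('a, 'k) tvec) list"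
   assume O': "open O'" "O' \<subseteq> N" "length Xs = 2" "!!X. X : set Xs ==> vf O' X" "p : O'"
   obtain X Y where XY: "Xs = [X, Y]" using O'(3) by (auto simp: length_Suc_conv numeral_2_eq_2)
   then have X: "vf O' X" and Y: "vf O' Y" using O'(4) by auto
   have "an p (ext_op \<gamma> X Y)"
    unfolding ext_op_def
    by (intro an_diff vf_an[OF X O'(1,5)] vf_an[OF Y O'(1,5)] one_form_an[OF O'(1,2)] X Y lie_vf[OF X Y O'(1)] O'(5))
   then show "an p (%p. \<Gamma> p (map (%X. X p) Xs))"
    by (rule an_cong) (use eventually_nhds_in_open[OF O'(1,5)] eq[OF O'(1,2) X Y] XY in \<open>auto elim!: eventually_mono\<close>)
  qed (auto simp: \<Gamma>_def H(1))
  then show "\<exists>\<Gamma>. ?P \<Gamma>" by (intro exI[of _ \<Gamma>] conjI allI impI ballI eq)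
 next
  fix \<Gamma> \<Gamma>' assume P: "?P \<Gamma>" "?P \<Gamma>'"
  show "\<Gamma> = \<Gamma>'"
  proof
   fix p
   show "\<Gamma> p = \<Gamma>' p"
   proof (cases "p : N")
    case True
    note f = conjunct1[OF P(1)] conjunct1[OF P(2)]
    show ?thesis
    proof (rule alt_eqI[OF form_on_alt[OF f(1) True] form_on_alt[OF f(2) True]])
     fix vs assume vs: "length vs = 2" "set vs \<subseteq> TS p"
     obtain O' Ys where O': "open O'" "p : O'" "O' \<subseteq> N" "\<forall>Y\<in>set Ys. vf O' Y" "map (%Y. Y p) Ys = vs"
      using vf_extend_list[OF N True vs(2)] by blast
     then obtain X Y where XY: "Ys = [X, Y]" using vs(1) by (auto simp: length_Suc_conv numeral_2_eq_2)
     then have "vs = [X p, Y p]" and XY: "vf O' X" "vf O' Y" using O'(4,5) by auto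
     then show "\<Gamma> p vs = \<Gamma>' p vs"
      using P(1)[THEN conjunct2, rule_format, OF O'(1,3) XY O'(2)]
       P(2)[THEN conjunct2, rule_format, OF O'(1,3) XY O'(2)] by simp
    qed
   next
    case False
    then show ?thesis
     using form_on_outside[OF conjunct1[OF P(1)]] form_on_outside[OF conjunct1[OF P(2)]] by simp
   qed
  qed
 qed
 from theI'[OF this] have P: "?P (extd N \<gamma>)"
  unfolding ext_deriv_def ext_op_def .
 then show "fon 2 N (extd N \<gamma>)" by (rule conjunct1)
 show "extd N \<gamma> p [X p, Y p] = ext_op \<gamma> X Y p"
  if "open O'" "O' \<subseteq> N" "vf O' X" "vf O' Y" "p : O'"
  using P[THEN conjunct2, rule_format, OF that] .
qed

end

text \<open>The defining property of the exterior derivative can be tested on small open sets.\<close>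

lemma ext_deriv_local:
 assumes N: "open N" "fon 1 N \<gamma>" and M: "open M" "fon 1 M \<gamma>'" and p: "p : M" "M \<subseteq> N"
  and eq: "!!q. q : M ==> \<gamma> q = \<gamma>' q"
 shows "extd N \<gamma> p = extd M \<gamma>' p"
proof (rule alt_eqI[OF form_on_alt[OF ext_deriv(1)[OF N]] form_on_alt[OF ext_deriv(1)[OF M] p(1)]])
 show "p : N" using p by blast
 fix vs assume vs: "length vs = 2" "set vs \<subseteq> TS p"
 obtain O' Ys where O': "open O'" "p : O'" "O' \<subseteq> M" "\<forall>Y\<in>set Ys. vf O' Y" "map (%Y. Y p) Ys = vs"
  using vf_extend_list[OF M(1) p(1) vs(2)] by blast
 then obtain X Y where XY: "Ys = [X, Y]" using vs(1) by (auto simp: length_Suc_conv numeral_2_eq_2)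
 then have X: "vf O' X" and Y: "vf O' Y" and vs: "vs = [X p, Y p]" using O' by auto
 have O'N: "O' \<subseteq> N" using O' p by blast
 have ev: "\<forall>\<^sub>F q in nhds p. q : O'" by (rule eventually_nhds_in_open[OF O'(1,2)])
 have *: "w (%q. \<gamma> q [Z q]) = w (%q. \<gamma>' q [Z q])" if "w : TS p" "vf O' Z" for w Z
  by (rule tv_cong[OF that(1) one_form_an[OF N O'(1) O'N that(2) O'(2)]])
   (use ev eq O'(3) in \<open>auto elim!: eventually_mono\<close>)
 have "ext_op \<gamma> X Y p = ext_op \<gamma>' X Y p"
  unfolding ext_op_def
  using *[OF vf_ts[OF X O'(2)] Y] *[OF vf_ts[OF Y O'(2)] X] eq[OF p(1)] by simp
 then show "extd N \<gamma> p vs = extd M \<gamma>' p vs"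
  unfolding vs using ext_deriv(2)[OF N O'(1) O'N X Y O'(2)] ext_deriv(2)[OF M O'(1,3) X Y O'(2)] by simp
qed

section \<open>The Lie derivative\<close>

lemma lie_derivative_slot:
 assumes j: "j < length Ys"
 shows "lieD X et (Ys[j := Y]) p =
  X p (%q. et q ((map (%Y. Y q) Ys)[j := Y q])) - et p ((map (%Y. Y p) Ys)[j := lie X Y p])
  - (\<Sum>i\<in>{..<length Ys} - {j}. et p ((map (%Y. Y p) Ys)[i := lie X (Ys ! i) p, j := Y p]))"
proof -
 let ?T = "%i. et p ((map (%Y. Y p) (Ys[j := Y]))[i := lie X (Ys[j := Y] ! i) p])"
 have "(\<Sum>i<length Ys. ?T i) = ?T j + (\<Sum>i\<in>{..<length Ys} - {j}. ?T i)"
  by (rule sum.remove) (use j in auto)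
 also have "?T j = et p ((map (%Y. Y p) Ys)[j := lie X Y p])"
  using j by (simp add: map_update)
 also have "(\<Sum>i\<in>{..<length Ys} - {j}. ?T i)
   = (\<Sum>i\<in>{..<length Ys} - {j}. et p ((map (%Y. Y p) Ys)[i := lie X (Ys ! i) p, j := Y p]))"
  by (rule sum.cong[OF refl]) (auto simp: map_update list_update_swap)
 finally show ?thesis by (simp add: lie_derivative_def map_update)
qed

text \<open>The derivative is not tensorial in \<open>X\<close>, but it is in the other fields: the terms in which a
 coefficient is differentiated cancel.\<close>

lemma lie_derivative_tensor:
 assumes N: "open N" "p : N" and et: "fon k N et" and X: "vf N X"
 obtains h where "h : alt k p"
  "!!O' Ys. open O' ==> p : O' ==> O' \<subseteq> N ==> length Ys = k ==> (!!Y. Y : set Ys ==> vf O' Y) ==>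
   lieD X et Ys p = h (map (%Y. Y p) Ys)"
proof -
 show thesis
 proof (rule tensorial[OF N, of k "%Ys. lieD X et Ys p"], goal_cases)
 case (1 O' Ys j I g Z Y)
 note O' = 1(1-3) and Ys = 1(4,5) and Y = 1(6) and j = 1(7) and I = 1(8) and Z = 1(9) and g = 1(10) and eq = 1(11)
 have X': "vf O' X" by (rule vf_subset[OF X O'(3)])
 note x = vf_ts[OF X' O'(2)]
 have al: "et q : alt k q" if "q : O'" for q using form_on_alt[OF et] that O'(3) by blast
 define P where "P q = map (%Y. Y q) Ys" for q
 have P: "length (P q) = k" "q : O' ==> set (P q) \<subseteq> TS q" for q
  using Ys vf_ts[OF Ys(2)] by (auto simp: P_def)
 have Pu: "length ((P q)[i := z]) = k" "q : O' ==> z : TS q ==> set ((P q)[i := z]) \<subseteq> TS q" for q i z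
  using P[of q] set_update_subset_insert[of "P q" i z] by auto
 have zt: "Z m q : TS q" if "m : I" "q : O'" for m q by (rule vf_ts[OF Z[OF that(1)] that(2)])
 have lt: "lie X (Z m) p : TS p" if "m : I" for m by (rule lie_ts[OF X' Z[OF that] O'(1,2)])
 have an_slot: "an p (%q. et q ((P q)[j := W q]))" if "vf O' W" for W
 proof -
  have "!!V. V : set (Ys[j := W]) ==> vf O' V" using Ys(2) that set_update_subset_insert[of Ys j W] by blast
  from form_on_an[OF et O'(1,3), of "Ys[j := W]", OF _ this O'(2)] show ?thesis
   using Ys(1) by (simp add: P_def map_update)
 qed
 have gp: "an p (g m)" if "m : I" for m by (rule g[OF that O'(2)])
 let ?S = "\<Sum>m\<in>I. X p (g m) * et p ((P p)[j := Z m p])"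
 have "X p (%q. et q ((P q)[j := Y q])) = X p (%q. \<Sum>m\<in>I. g m q * et q ((P q)[j := Z m q]))"
 proof (rule tv_cong[OF x an_slot[OF Y]])
  show "\<forall>\<^sub>F q in nhds p. et q ((P q)[j := Y q]) = (\<Sum>m\<in>I. g m q * et q ((P q)[j := Z m q]))"
   using eventually_nhds_in_open[OF O'(1,2)]
  proof eventually_elim
   case (elim q)
   show ?case unfolding eq[OF elim]
    by (rule alt_sum_slot[OF al[OF elim] P(1) P(2)[OF elim] j]) (rule zt[OF _ elim])
  qed
 qed
 also have "... = (\<Sum>m\<in>I. X p (%q. g m q * et q ((P q)[j := Z m q])))"
  by (rule tv_sum[OF x]) (rule an_mult[OF gp an_slot[OF Z]])
 also have "... = (\<Sum>m\<in>I. g m p * X p (%q. et q ((P q)[j := Z m q])) + et p ((P p)[j := Z m p]) * X p (g m))"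
  by (rule sum.cong[OF refl]) (rule tv_mult[OF x gp an_slot[OF Z]])
 finally have 1: "X p (%q. et q ((P q)[j := Y q])) = (\<Sum>m\<in>I. g m p * X p (%q. et q ((P q)[j := Z m q]))) + ?S"
  by (simp add: sum.distrib mult.commute)
 note ap = al[OF O'(2)] and Pp = P(1) P(2)[OF O'(2)]
 have L: "lie X Y p
   = (\<Sum>m\<in>I. fscale (g m p) (lie X (Z m) p)) + (\<Sum>m\<in>I. fscale (X p (g m)) (Z m p))"
  by (rule lie_expand[OF O'(1,2) X' Y I Z g eq])
 have "et p ((P p)[j := lie X Y p]) = et p ((P p)[j := \<Sum>m\<in>I. fscale (g m p) (lie X (Z m) p)])
   + et p ((P p)[j := \<Sum>m\<in>I. fscale (X p (g m)) (Z m p)])"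
  unfolding L
  by (rule conjunct1[OF alt_slot[OF ap Pp j]]) (auto intro!: ts_sum ts_fscale lt zt O'(2))
 also have "et p ((P p)[j := \<Sum>m\<in>I. fscale (g m p) (lie X (Z m) p)])
   = (\<Sum>m\<in>I. g m p * et p ((P p)[j := lie X (Z m) p]))"
  by (rule alt_sum_slot[OF ap Pp j lt])
 also have "et p ((P p)[j := \<Sum>m\<in>I. fscale (X p (g m)) (Z m p)]) = ?S"
  by (rule alt_sum_slot[OF ap Pp j zt[OF _ O'(2)]])
 finally have 2: "et p ((P p)[j := lie X Y p]) = (\<Sum>m\<in>I. g m p * et p ((P p)[j := lie X (Z m) p])) + ?S" .
 have "et p ((P p)[i := lie X (Ys ! i) p, j := Y p])
   = (\<Sum>m\<in>I. g m p * et p ((P p)[i := lie X (Ys ! i) p, j := Z m p]))" if "i < k" for i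
  unfolding eq[OF O'(2)]
 proof (rule alt_sum_slot[OF ap Pu(1) Pu(2)[OF O'(2)] j zt[OF _ O'(2)]])
  show "lie X (Ys ! i) p : TS p"
   by (rule lie_ts[OF X' Ys(2)[OF nth_mem] O'(1,2)]) (use that Ys in simp)
 qed
 then have "(\<Sum>i\<in>{..<k} - {j}. et p ((P p)[i := lie X (Ys ! i) p, j := Y p]))
   = (\<Sum>i\<in>{..<k} - {j}. \<Sum>m\<in>I. g m p * et p ((P p)[i := lie X (Ys ! i) p, j := Z m p]))"
  by (intro sum.cong) auto
 also have "... = (\<Sum>m\<in>I. g m p * (\<Sum>i\<in>{..<k} - {j}. et p ((P p)[i := lie X (Ys ! i) p, j := Z m p])))"
  by (subst sum.swap) (simp add: sum_distrib_left)
 finally have 3: "(\<Sum>i\<in>{..<k} - {j}. et p ((P p)[i := lie X (Ys ! i) p, j := Y p])) = ..." .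
 have j': "j < length Ys" using j Ys by simp
 show ?case
  unfolding lie_derivative_slot[OF j'] unfolding P_def[symmetric] Ys(1) 1 2 3
  by (simp add: sum_subtractf right_diff_distrib)
next
 case (2 O' Ys a b)
 note O' = 2(1-3) and Ys = 2(4,5) and ab = 2(6-8)
 have X': "vf O' X" by (rule vf_subset[OF X O'(3)])
 have al: "et q : alt k q" if "q : O'" for q using form_on_alt[OF et] that O'(3) by blast
 define P where "P q = map (%Y. Y q) Ys" for q
 have P: "length (P q) = k" "q : O' ==> set (P q) \<subseteq> TS q" for q
  using Ys vf_ts[OF Ys(2)] by (auto simp: P_def)
 have Pab: "P q ! a = P q ! b" for q using ab Ys by (simp add: P_def)
 define T where "T i = et p ((P p)[i := lie X (Ys ! i) p])" for i
 have "X p (%q. et q (P q)) = X p (%q. 0)"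
 proof (rule tv_cong[OF vf_ts[OF X' O'(2)]])
  show "an p (%q. et q (P q))" unfolding P_def by (rule form_on_an[OF et O'(1,3) Ys O'(2)])
  show "\<forall>\<^sub>F q in nhds p. et q (P q) = 0"
   using eventually_nhds_in_open[OF O'(1,2)]
   by eventually_elim (rule alt_equal[OF al ab(1)], use ab P Pab in auto)
 qed
 also have "... = 0" using vf_ts[OF X' O'(2)] by simp
 finally have 1: "X p (%q. et q (P q)) = 0" .
 have T0: "T i = 0" if "i : {..<k} - {a} - {b}" for i
  unfolding T_def by (rule alt_equal[OF al[OF O'(2)] ab(1)]) (use that ab P Pab[of p] in auto)
 have Lt: "lie X (Ys ! a) p : TS p"
  by (rule lie_ts[OF X' Ys(2)[OF nth_mem] O'(1,2)]) (use ab Ys in simp)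
 have "T a = - T b"
 proof -
  define L where "L = lie X (Ys ! a) p"
  have "P p ! b : TS p" using P(1)[of p] P(2)[OF O'(2)] ab(2) nth_mem[of b "P p"] by auto
  from alt_swap[OF al[OF O'(2)] P(1) P(2)[OF O'(2)] ab(1,2) Lt this]
  have "et p ((P p)[a := L, b := P p ! b]) = - et p ((P p)[a := P p ! b, b := L])"
   by (simp only: L_def)
  moreover have "(P p)[a := L, b := P p ! b] = (P p)[a := L]"
   using ab(1) by (subst list_update_swap) simp_all
  moreover have "(P p)[a := P p ! b] = P p" unfolding Pab[symmetric] by simp
  ultimately show ?thesis unfolding T_def L_def ab(3)[symmetric] by simp
 qed
 moreover have "(\<Sum>i<k. T i) = T a + (T b + (\<Sum>i\<in>{..<k} - {a} - {b}. T i))"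
  using ab by (subst sum.remove[of _ a], simp, simp, subst sum.remove[of _ b]) auto
 ultimately have "(\<Sum>i<k. T i) = 0" using T0 by simp
 then show ?case using 1 Ys(1) by (simp add: lie_derivative_def T_def P_def)
next
 case (3 h)
 then show ?case by (rule that)
 qed
qed

section \<open>Volume form and divergence\<close>

lemma coframe_form: 
 assumes V: "frame N V"
 shows "fon 1 N (cofr N V i)"
proof (rule form_onI)
 fix p assume p: "p : N"
 note b = frame_basis[OF V p]
 show "cofr N V i p : alt 1 p"
 proof (rule altI)
  fix vs :: "('a, 'k) tvec list" and l x y assume "length vs = 1" "l < (1::nat)" "x : TS p" "y : TS p"
  then show "cofr N V i p (vs[l := x + y]) = cofr N V i p (vs[l := x]) + cofr N V i p (vs[l := y])"
   using p ts_add by (auto simp: coframe_def frame_coeff_add[OF b] length_Suc_conv)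
 next
  fix vs :: "('a, 'k) tvec list" and l x c assume "length vs = 1" "l < (1::nat)" "x : TS p"
  then show "cofr N V i p (vs[l := fscale c x]) = c * cofr N V i p (vs[l := x])"
   using p ts_fscale by (auto simp: coframe_def frame_coeff_fscale[OF b] length_Suc_conv)
 qed (auto simp: coframe_def)
next
 fix O' p and Xs :: "('a => ('a, 'k) tvec) list"
 assume O': "open O'" "O' \<subseteq> N" "length Xs = 1" "!!X. X : set Xs ==> vf O' X" "p : O'"
 obtain X where X: "Xs = [X]" using O'(3) by (auto simp: length_Suc_conv)
 then have X': "vf O' X" using O'(4) by auto
 show "an p (%p. cofr N V i p (map (%X. X p) Xs))"
  by (rule an_cong[OF frame_coeff_an[OF V X' O'(1,2,5), of i]])
   (use eventually_nhds_in_open[OF O'(1,5)] vf_ts[OF X'] O'(2) in \<open>auto elim!: eventually_mono simp: coframe_def X\<close>)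
qed (simp add: coframe_def fun_eq_iff)

lemma coframe_apply: "p : N ==> v : TS p ==> cofr N V i p [v] = fco V p v i"
 by (simp add: coframe_def)

lemma wedge_form:
 assumes \<alpha>: "!!\<alpha>. \<alpha> : set \<alpha>s ==> fon 1 N \<alpha>" and ne: "\<alpha>s ~= []"
 shows "fon (length \<alpha>s) N (wedge \<alpha>s)"
proof (rule form_onI)
 show "wedge \<alpha>s p : alt (length \<alpha>s) p" if "p : N" for p
  by (rule wedge_alt) (rule form_on_alt[OF \<alpha> that])
 show "wedge \<alpha>s p = 0" if "p \<notin> N" for p
 proof
  fix vs
  have "(\<Prod>a<length \<alpha>s. (\<alpha>s ! a) p [vs ! \<pi> a]) = 0" for \<pi>
   using form_on_outside[OF \<alpha>[OF nth_mem] that, of 0] ne by (intro prod_zero bexI[of _ 0]) auto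
  then have "(\<Sum>\<pi> | \<pi> permutes {..<length \<alpha>s}. of_int (sign \<pi>) * (\<Prod>a<length \<alpha>s. (\<alpha>s ! a) p [vs ! \<pi> a])) = 0"
   by (intro sum.neutral) simp
  then show "wedge \<alpha>s p vs = 0 vs" by (simp add: wedge_def)
 qed
 fix O' p and Xs :: "('a => ('a, 'k) tvec) list"
 assume O': "open O'" "O' \<subseteq> N" "length Xs = length \<alpha>s" "!!X. X : set Xs ==> vf O' X" "p : O'"
 have 1: "an p (%p. (\<alpha>s ! a) p [(Xs ! b) p])" if "a < length \<alpha>s" "b < length \<alpha>s" for a b
  using form_on_an[OF \<alpha>[OF nth_mem[OF that(1)]] O'(1,2), of "[Xs ! b]" p] O' that by simp
 have "an p (%p. \<Sum>\<pi> | \<pi> permutes {..<length \<alpha>s}.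
   of_int (sign \<pi>) * (\<Prod>a<length \<alpha>s. (\<alpha>s ! a) p [(Xs ! \<pi> a) p]))"
 proof (intro an_sum an_mult an_const an_prod)
  fix \<pi> a assume \<pi>: "\<pi> : {\<pi>. \<pi> permutes {..<length \<alpha>s}}" and a: "a : {..<length \<alpha>s}"
  then have "\<pi> a < length \<alpha>s" using permutes_in_image[of \<pi> "{..<length \<alpha>s}" a] by simp
  then show "an p (%p. (\<alpha>s ! a) p [(Xs ! \<pi> a) p])" using 1 a by simp
 qed
 moreover have "(\<Sum>\<pi> | \<pi> permutes {..<length \<alpha>s}. of_int (sign \<pi>) * (\<Prod>a<length \<alpha>s. (\<alpha>s ! a) q [(Xs ! \<pi> a) q]))
   = wedge \<alpha>s q (map (%X. X q) Xs)" for q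
 proof -
  have "(\<Prod>a<length \<alpha>s. (\<alpha>s ! a) q [(Xs ! \<pi> a) q]) = (\<Prod>a<length \<alpha>s. (\<alpha>s ! a) q [map (%X. X q) Xs ! \<pi> a])"
   if "\<pi> permutes {..<length \<alpha>s}" for \<pi>
   using permutes_in_image[OF that] O'(3) by (intro prod.cong) auto
  then show ?thesis using O'(3) by (simp add: wedge_def)
 qed
 ultimately show "an p (%p. wedge \<alpha>s p (map (%X. X p) Xs))" by simp
qed

definition vol :: "'a set => (nat => 'a => ('a, 'k) tvec) => ('a, 'k) dform" where
 "vol N V = wedge (map (cofr N V) [1..<nn + 1])"

lemma nn_pos: "nn \<ge> 1"
 by (simp add: mdim_def Suc_le_eq card_gt_0_iff)

lemma vol_form: "frame N V ==> fon nn N (vol N V)"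
 using wedge_form[of "map (cofr N V) [1..<nn + 1]" N] coframe_form nn_pos by (auto simp: vol_def)

lemma wedge_coframe_basis:
 assumes V: "frame N V" and p: "p : N" and js: "distinct js" "set js \<subseteq> {1..nn}"
 shows "wedge (map (cofr N V) js) p (map (%k. V k p) js) = 1"
proof (rule wedge_dual)
 fix a b assume ab: "a < length (map (cofr N V) js)" "b < length (map (cofr N V) js)"
 then have "js ! b : {1..nn}" using js(2) by (metis length_map nth_mem subsetD)
 then show "(map (cofr N V) js ! a) p [map (%k. V k p) js ! b] = (if a = b then 1 else 0)"
  using ab p basis_atD[OF frame_basis[OF V p]] frame_coeff_frame[OF frame_basis[OF V p], of "js ! b" "js ! a"]
   nth_eq_iff_index_eq[OF js(1), of a b]
  by (simp add: coframe_apply)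
qed simp

lemma vol_basis: "frame N V ==> p : N ==> vol N V p (map (%k. V k p) [1..<nn + 1]) = 1"
 unfolding vol_def by (rule wedge_coframe_basis) auto

lemma upt_split:
 assumes "i : {1..nn}"
 shows "[1..<nn + 1] = [1..<i] @ i # [i + 1..<nn + 1]"
  and "filter (%j. j ~= i) [1..<nn + 1] = [1..<i] @ [i + 1..<nn + 1]"
proof -
 show 1: "[1..<nn + 1] = [1..<i] @ i # [i + 1..<nn + 1]"
  using assms upt_add_eq_append[of 1 i "nn + 1 - i"] upt_conv_Cons[of i "nn + 1"] by simp
 have "filter (%j. j ~= i) [1..<i] = [1..<i]" "filter (%j. j ~= i) [i + 1..<nn + 1] = [i + 1..<nn + 1]"
  by (auto intro!: filter_True simp del: upt_Suc)
 then show "filter (%j. j ~= i) [1..<nn + 1] = [1..<i] @ [i + 1..<nn + 1]"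
  unfolding 1 by simp
qed

text \<open>The forms \<open>A i\<close> are the contractions of one volume form; this makes all \<open>n + 1\<close> foliations
 play the same role.\<close>

lemma A_form_contract:
 assumes V: "frame N V" and p: "p : N" and i: "i : {1..nn}"
 shows "A_form \<A> N V i p us = vol N V p (V i p # us)"
proof -
 define js where "js = filter (%j. j ~= i) [1..<nn + 1]"
 note b = frame_basis[OF V p]
 have js: "distinct js" "set js \<subseteq> {1..nn}" "i \<notin> set js" by (auto simp: js_def)
 have ljs: "length js = nn - 1" using i unfolding js_def upt_split(2)[OF i] by auto
 define w where "w = wedge (map (cofr N V) js)"
 have cm: "[cofr N V j. j \<leftarrow> xs, j ~= i] = map (cofr N V) (filter (%j. j ~= i) xs)" for xs
  by (induction xs) auto
 have A: "A_form \<A> N V i p us = (- 1) ^ (i + 1) * w p us" for us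
  unfolding A_form_def cm w_def js_def by simp
 have cf: "cofr N V j p : alt 1 p" for j by (rule form_on_alt[OF coframe_form[OF V] p])
 have w: "w p : alt (nn - 1) p"
  using wedge_alt[of "map (cofr N V) js" p] cf ljs by (auto simp: w_def)
 have vol: "vol N V p : alt nn p" by (rule form_on_alt[OF vol_form[OF V] p])
 have c: "(%us. vol N V p (V i p # us)) : alt (nn - 1) p"
  by (rule alt_contract) (use vol nn_pos basis_atD[OF b i] in simp_all)
 define h where "h us = (- 1) ^ (i + 1) * w p us + (- 1) * vol N V p (V i p # us)" for us
 have "h = (%vs. 0)"
 proof (rule alt_codim_1_0[OF _ b i])
  show "h : alt (nn - 1) p" unfolding h_def by (intro alt_add alt_cmult w c)
  show "h (V i p # us) = 0" for us
  proof -
   have "vol N V p (V i p # V i p # us) = 0" by (rule alt_equal[OF vol, of 0 1]) auto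
   moreover have "w p (V i p # us) = 0"
   proof (cases "length us + 1 = length js")
    case True
    have "(\<Prod>a<length js. (map (cofr N V) js ! a) p [(V i p # us) ! \<pi> a]) = 0" if \<pi>: "\<pi> permutes {..<length js}" for \<pi>
    proof (rule prod_zero)
     have l: "inv \<pi> 0 < length js" using permutes_in_image[OF permutes_inv[OF \<pi>], of 0] True by (cases js) auto
     have "js ! inv \<pi> 0 ~= i" using js(3) l by (metis nth_mem)
     then show "\<exists>a\<in>{..<length js}. (map (cofr N V) js ! a) p [(V i p # us) ! \<pi> a] = 0"
      using l p basis_atD[OF b i] frame_coeff_frame[OF b i]
      by (intro bexI[of _ "inv \<pi> 0"]) (auto simp: permutes_inverses(1)[OF \<pi>] coframe_apply)
    qed simp
    then have "(\<Sum>\<pi> | \<pi> permutes {..<length js}. of_int (sign \<pi>) *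
      (\<Prod>a<length js. (map (cofr N V) js ! a) p [(V i p # us) ! \<pi> a])) = 0"
     by (intro sum.neutral ballI) (simp only: mem_Collect_eq mult_zero_right)
    then show ?thesis by (simp add: w_def wedge_def)
   qed (simp add: w_def wedge_def)
   ultimately show ?thesis by (simp add: h_def)
  qed
  have "vol N V p (map (%k. V k p) [1..<nn + 1])
    = (- 1) ^ (i - 1) * vol N V p (V i p # map (%k. V k p) js)"
   unfolding upt_split(1)[OF i] js_def upt_split(2)[OF i]
   using alt_move[OF vol, of "map (%k. V k p) [1..<i]" "V i p" "map (%k. V k p) [i + 1..<nn + 1]"] by simp
  then have "(- 1) ^ (i - 1) * vol N V p (V i p # map (%k. V k p) js) = 1"
   using vol_basis[OF V p] by simp
  then have "vol N V p (V i p # map (%k. V k p) js) = (- 1) ^ (i - 1)"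
  proof -
   assume e: "(- 1) ^ (i - 1) * vol N V p (V i p # map (%k. V k p) js) = 1"
   have "(- 1 :: 'k) ^ (i - 1) * (- 1) ^ (i - 1) = 1" by (simp flip: power_mult_distrib)
   then have "vol N V p (V i p # map (%k. V k p) js)
     = (- 1) ^ (i - 1) * ((- 1) ^ (i - 1) * vol N V p (V i p # map (%k. V k p) js))"
    by (simp only: mult.assoc[symmetric] mult_1_left)
   then show ?thesis by (simp only: e mult_1_right)
  qed
  moreover have "(- 1 :: 'k) ^ (i + 1) = (- 1) ^ (i - 1)" using i by (cases i) auto
  moreover have "w p (map (%k. V k p) js) = 1" unfolding w_def by (rule wedge_coframe_basis[OF V p js(1,2)])
  ultimately show "h (map (%k. V k p) (filter (%j. j ~= i) [1..<nn + 1])) = 0"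
   unfolding js_def[symmetric] h_def by simp
 qed
 then have "h us = 0" by simp
 then show ?thesis unfolding A h_def by simp
qed

text \<open>The divergence with respect to \<open>vol\<close>: the trace of the bracket with \<open>X\<close>, up to sign.\<close>

definition dvg :: "(nat => 'a => ('a, 'k) tvec) => ('a => ('a, 'k) tvec) => 'a => 'k" where
 "dvg V X p = - (\<Sum>j=1..nn. fco V p (lie X (V j) p) j)"

lemma vol_update:
 assumes V: "frame N V" and p: "p : N" and i: "i < nn" and w: "w : TS p"
 shows "vol N V p ((map (%k. V k p) [1..<nn + 1])[i := w]) = fco V p w (Suc i)"
proof -
 define B where "B = map (%k. V k p) [1..<nn + 1]"
 note b = frame_basis[OF V p]
 have vol: "vol N V p : alt nn p" by (rule form_on_alt[OF vol_form[OF V] p])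
 have B: "length B = nn" "set B \<subseteq> TS p" "!!j. j < nn ==> B ! j = V (Suc j) p"
  using basis_atD[OF b] by (auto simp: B_def simp del: upt_Suc)
 have one: "vol N V p (B[i := V m p]) = (if m = Suc i then 1 else 0)" if m: "m : {1..nn}" for m
 proof (cases "m = Suc i")
  case True
  then have "B[i := V m p] = B" using B(3)[OF i] by (metis list_update_id)
  then show ?thesis using True vol_basis[OF V p] by (simp add: B_def)
 next
  case False
  have ne: "m - 1 ~= i" "m - 1 < nn" "Suc (m - 1) = m" using m False by auto
  have "vol N V p (B[i := V m p]) = 0"
  proof (cases "m - 1 < i")
   case True
   then show ?thesis using ne i B by (intro alt_equal[OF vol, of "m - 1" i]) auto
  next
   case False
   then show ?thesis using ne i B by (intro alt_equal[OF vol, of i "m - 1"]) auto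
  qed
  then show ?thesis using False by simp
 qed
 have "vol N V p (B[i := w]) = vol N V p (B[i := \<Sum>m=1..nn. fscale (fco V p w m) (V m p)])"
  by (rule arg_cong[where f = "%z. vol N V p (B[i := z])", OF frame_coeff_expand[OF b w]])
 also have "... = (\<Sum>m=1..nn. fco V p w m * vol N V p (B[i := V m p]))"
  by (rule alt_sum_slot[OF vol B(1,2) i]) (rule basis_atD[OF b])
 also have "... = (\<Sum>m=1..nn. if m = Suc i then fco V p w m else 0)"
  by (rule sum.cong[OF refl]) (simp add: one)
 also have "... = fco V p w (Suc i)" using i by (simp add: sum.delta)
 finally show ?thesis by (simp add: B_def)
qed

text \<open>Both sides are forms of top degree, so that it is enough to evaluate them on the frame, where \<open>vol\<close>
 is constant.\<close>

lemma lie_vol: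
 assumes V: "frame N V" and X: "vf N X" and O': "open O'" "O' \<subseteq> N" "p : O'"
  and Ys: "length Ys = nn" "!!Y. Y : set Ys ==> vf O' Y"
 shows "lieD X (vol N V) Ys p = dvg V X p * vol N V p (map (%Y. Y p) Ys)"
proof -
 have p: "p : N" using O' by blast
 note oN = frame_open[OF V] and b = frame_basis[OF V p]
 obtain h where h: "h : alt nn p"
  "!!O' Ys. open O' ==> p : O' ==> O' \<subseteq> N ==> length Ys = nn ==> (!!Y. Y : set Ys ==> vf O' Y) ==>
   lieD X (vol N V) Ys p = h (map (%Y. Y p) Ys)"
  by (rule lie_derivative_tensor[OF oN p vol_form[OF V] X]) blast
 have vol: "vol N V p : alt nn p" by (rule form_on_alt[OF vol_form[OF V] p])
 define Bs where "Bs = map V [1..<nn + 1]"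
 have Bs: "map (%Y. Y q) Bs = map (%k. V k q) [1..<nn + 1]" "length Bs = nn" for q
  by (simp_all add: Bs_def del: upt_Suc)
 have "h (map (%Y. Y p) Bs) = lieD X (vol N V) Bs p"
  by (rule h(2)[OF oN p order_refl Bs(2), symmetric]) (use frame_vf[OF V] in \<open>auto simp: Bs_def simp del: upt_Suc\<close>)
 also have "... = X p (%q. vol N V q (map (%k. V k q) [1..<nn + 1]))
   - (\<Sum>i<nn. fco V p (lie X (V (Suc i)) p) (Suc i))"
 proof -
  have "vol N V p ((map (%k. V k p) [1..<nn + 1])[i := lie X (Bs ! i) p])
    = fco V p (lie X (V (Suc i)) p) (Suc i)" if i: "i < nn" for i
  proof -
   have "Bs ! i = V (Suc i)" using i by (simp add: Bs_def del: upt_Suc)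
   moreover have "lie X (V (Suc i)) p : TS p"
    by (rule lie_ts[OF X frame_vf[OF V] oN p]) (use i in auto)
   ultimately show ?thesis using vol_update[OF V p i] by simp
  qed
  then show ?thesis unfolding lie_derivative_def Bs by simp
 qed
 also have "X p (%q. vol N V q (map (%k. V k q) [1..<nn + 1])) = X p (%q. 1)"
  by (rule tv_cong[OF vf_ts[OF X p] an_const, symmetric])
   (use eventually_nhds_in_open[OF oN p] vol_basis[OF V] in \<open>auto elim!: eventually_mono simp del: upt_Suc\<close>)
 also have "X p (%q. 1) = 0" using vf_ts[OF X p] by simp
 also have "(\<Sum>i<nn. fco V p (lie X (V (Suc i)) p) (Suc i))
   = (\<Sum>j=1..nn. fco V p (lie X (V j) p) j)"
  by (rule sum.reindex_bij_witness[of _ "%j. j - 1" Suc]) auto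
 finally have hB: "h (map (%k. V k p) [1..<nn + 1]) = dvg V X p" by (simp add: Bs dvg_def)
 have "(%vs. h vs + (- dvg V X p) * vol N V p vs) = (%vs. 0)"
  by (rule alt_top_0[OF alt_add[OF h(1) alt_cmult[OF vol]] b]) (simp only: hB vol_basis[OF V p], simp)
 from fun_cong[OF this, of "map (%Y. Y p) Ys"]
 have "h (map (%Y. Y p) Ys) = dvg V X p * vol N V p (map (%Y. Y p) Ys)" by simp
 with h(2)[OF O'(1,3,2) Ys] show ?thesis by simp
qed

lemma dvg_cong:
 assumes "vf O' X" "open O'" "p : O'" "!!q. q : O' ==> X q = Y q" and V: "frame O' V"
 shows "dvg V X p = dvg V Y p"
proof -
 have "lie X (V j) p = lie Y (V j) p" if "j : {1..nn}" for j
  by (rule lie_cong[OF assms(1) frame_vf[OF V that] assms(2,3)])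
   (use eventually_nhds_in_open[OF assms(2,3)] assms(4) in \<open>auto elim!: eventually_mono\<close>)
 then show ?thesis by (simp add: dvg_def)
qed

lemma dvg_fscale:
 assumes V: "frame N V" and X: "vf N X" and g: "an p g" and p: "p : N"
 shows "dvg V (%q. fscale (g q) (X q)) p = g p * dvg V X p + X p g"
proof -
 note oN = frame_open[OF V] and b = frame_basis[OF V p]
 note x = vf_ts[OF X p]
 have lt: "lie X (V j) p : TS p" if "j : {1..nn}" for j
  by (rule lie_ts[OF X frame_vf[OF V that] oN p])
 have "fco V p (lie (%q. fscale (g q) (X q)) (V j) p) j
   = g p * fco V p (lie X (V j) p) j - fco V p (X p) j * V j p g"
  if j: "j : {1..nn}" for j
 proof -
  have "lie (%q. fscale (g q) (X q)) (V j) p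
    = fscale (g p) (lie X (V j) p) + fscale (- V j p g) (X p)"
   using lie_fscale_left[OF X frame_vf[OF V j] oN p g] by (simp add: fun_eq_iff)
  then show ?thesis
   using frame_coeff_add[OF b ts_fscale[OF lt[OF j]] ts_fscale[OF x]] frame_coeff_fscale[OF b lt[OF j]]
    frame_coeff_fscale[OF b x] by simp
 qed
 then have "(\<Sum>j=1..nn. fco V p (lie (%q. fscale (g q) (X q)) (V j) p) j)
   = g p * (\<Sum>j=1..nn. fco V p (lie X (V j) p) j) - (\<Sum>j=1..nn. fco V p (X p) j * V j p g)"
  by (simp add: sum_subtractf sum_distrib_left)
 also have "(\<Sum>j=1..nn. fco V p (X p) j * V j p g) = X p g"
  using fun_cong[OF frame_coeff_expand[OF b x], of g] by (simp only: sum_fun_apply fscale_apply)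
 finally have S: "(\<Sum>j=1..nn. fco V p (lie (%q. fscale (g q) (X q)) (V j) p) j)
   = g p * (\<Sum>j=1..nn. fco V p (lie X (V j) p) j) - X p g" .
 show ?thesis unfolding dvg_def S by simp
qed

lemma dvg_sum:
 assumes V: "frame N V" and X: "!!i. i : I ==> vf N (X i)" and p: "p : N"
 shows "dvg V (%q. - (\<Sum>i\<in>I. X i q)) p = - (\<Sum>i\<in>I. dvg V (X i) p)"
proof -
 note oN = frame_open[OF V] and b = frame_basis[OF V p]
 have lt: "lie (X i) (V j) p : TS p" if "i : I" "j : {1..nn}" for i j
  by (rule lie_ts[OF X[OF that(1)] frame_vf[OF V that(2)] oN p])
 have "fco V p (lie (%q. - (\<Sum>i\<in>I. X i q)) (V j) p) j
   = - (\<Sum>i\<in>I. fco V p (lie (X i) (V j) p) j)" if j: "j : {1..nn}" for j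
 proof -
  have "lie (%q. - (\<Sum>i\<in>I. X i q)) (V j) p = - lie (V j) (%q. - (\<Sum>i\<in>I. X i q)) p"
   by (rule lie_antisym)
  also have "lie (V j) (%q. - (\<Sum>i\<in>I. X i q)) p
    = lie (V j) (%q. fscale (- 1) (\<Sum>i\<in>I. X i q)) p" by (simp only: fscale_minus_1)
  also have "... = fscale (- 1) (lie (V j) (%q. \<Sum>i\<in>I. X i q) p) + fscale (V j p (%q. - 1)) (\<Sum>i\<in>I. X i p)"
   by (rule lie_fscale_right[OF frame_vf[OF V j] vf_sum[OF oN X] oN p an_const])
  also have "V j p (%q. - 1) = 0" by (rule tv_const[OF vf_ts[OF frame_vf[OF V j] p]])
  also have "lie (V j) (%q. \<Sum>i\<in>I. X i q) p = (\<Sum>i\<in>I. lie (V j) (X i) p)"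
   by (rule lie_sum_right[OF frame_vf[OF V j] X oN p])
  also have "... = (\<Sum>i\<in>I. - lie (X i) (V j) p)"
   by (rule sum.cong[OF refl]) (rule lie_antisym)
  also have "- (fscale (- 1) (\<Sum>i\<in>I. - lie (X i) (V j) p) + fscale 0 (\<Sum>i\<in>I. X i p))
    = fscale (- 1) (\<Sum>i\<in>I. lie (X i) (V j) p)"
   by (simp add: fun_eq_iff sum_fun_apply sum_negf)
  finally have L: "lie (%q. - (\<Sum>i\<in>I. X i q)) (V j) p = fscale (- 1) (\<Sum>i\<in>I. lie (X i) (V j) p)" .
  have "fco V p (fscale (- 1) (\<Sum>i\<in>I. lie (X i) (V j) p)) j
    = - 1 * fco V p (\<Sum>i\<in>I. lie (X i) (V j) p) j"
   by (rule frame_coeff_fscale[OF b ts_sum[OF lt[OF _ j]]])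
  also have "fco V p (\<Sum>i\<in>I. lie (X i) (V j) p) j
    = (\<Sum>i\<in>I. fco V p (lie (X i) (V j) p) j)"
   by (rule frame_coeff_sum[OF b lt[OF _ j]])
  finally show ?thesis unfolding L mult_minus1 .
 qed
 then have "(\<Sum>j=1..nn. fco V p (lie (%q. - (\<Sum>i\<in>I. X i q)) (V j) p) j)
   = (\<Sum>j=1..nn. - (\<Sum>i\<in>I. fco V p (lie (X i) (V j) p) j))"
  by (intro sum.cong refl)
 also have "... = - (\<Sum>i\<in>I. \<Sum>j=1..nn. fco V p (lie (X i) (V j) p) j)"
  unfolding sum_negf by (subst sum.swap) simp
 finally have S: "(\<Sum>j=1..nn. fco V p (lie (%q. - (\<Sum>i\<in>I. X i q)) (V j) p) j)
   = - (\<Sum>i\<in>I. \<Sum>j=1..nn. fco V p (lie (X i) (V j) p) j)" .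
 show ?thesis unfolding dvg_def S by (simp add: sum_negf)
qed

end

section \<open>Families of vector fields with sum zero\<close>

context manifold
begin

text \<open>The families \<open>(V 1, ..., V (n + 1))\<close> that come from a nowhere vanishing section of \<open>E\<close>.\<close>

definition wframe :: "'a set => (nat => 'a => ('a, 'k) tvec) => bool" where
 "wframe N V \<longleftrightarrow> frame N V & vf N (V (nn + 1)) & (\<forall>p\<in>N. V (nn + 1) p = - (\<Sum>k=1..nn. V k p))"

lemma wframe_frame: "wframe N V ==> frame N V"
 and wframe_last: "wframe N V ==> p : N ==> V (nn + 1) p = - (\<Sum>k=1..nn. V k p)"
 by (simp_all add: wframe_def)

lemma wframe_vf:
 assumes V: "wframe N V" and mm: "mm : {1..nn + 1}"
 shows "vf N (V mm)"
proof (cases "mm = nn + 1")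
 case True
 then show ?thesis using V unfolding wframe_def by (elim conjE) (simp only:)
next
 case False
 then have "mm : {1..nn}" using mm by auto
 then show ?thesis by (rule frame_vf[OF wframe_frame[OF V]])
qed

lemma wframe_subset:
 assumes "wframe N V" "open O'" "O' \<subseteq> N"
 shows "wframe O' V"
 unfolding wframe_def
proof (intro conjI ballI)
 show "frame O' V" by (rule frame_subset[OF wframe_frame[OF assms(1)] assms(2,3)])
 show "vf O' (V (nn + 1))" by (rule vf_subset[OF wframe_vf[OF assms(1)] assms(3)]) simp
 show "V (nn + 1) p = - (\<Sum>k=1..nn. V k p)" if "p : O'" for p
  by (rule wframe_last[OF assms(1)]) (use that assms(3) in blast)
qed

lemma wframe_ts: "wframe N V ==> mm : {1..nn + 1} ==> p : N ==> V mm p : TS p"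
 by (rule vf_ts[OF wframe_vf])

text \<open>The coefficients of \<open>V 1, ..., V (n + 1)\<close> in the frame \<open>V 1, ..., V n\<close>.\<close>

definition cst :: "nat => nat => 'k" where
 "cst k mm = (if mm = nn + 1 then - 1 else if k = mm then 1 else 0)"

lemma frame_coeff_wframe:
 assumes V: "wframe N V" and p: "p : N" and mm: "mm : {1..nn + 1}" and k: "k : {1..nn}"
 shows "fco V p (V mm p) k = cst k mm"
proof -
 note b = frame_basis[OF wframe_frame[OF V] p]
 show ?thesis
 proof (cases "mm = nn + 1")
  case True
  have "fco V p (V mm p) k = fco V p (fscale (- 1) (\<Sum>j=1..nn. V j p)) k"
   unfolding True wframe_last[OF V p] fscale_minus_1 ..
  also have "... = - 1 * fco V p (\<Sum>j=1..nn. V j p) k"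
   by (rule frame_coeff_fscale[OF b ts_sum]) (rule basis_atD[OF b])
  also have "fco V p (\<Sum>j=1..nn. V j p) k = (\<Sum>j=1..nn. fco V p (V j p) k)"
   by (rule frame_coeff_sum[OF b]) (rule basis_atD[OF b])
  also have "... = (\<Sum>j=1..nn. if j = k then 1 else 0)"
   by (rule sum.cong[OF refl], subst frame_coeff_frame[OF b]) auto
  also have "... = 1" using k by (simp add: sum.delta)
  finally show ?thesis using True by (simp add: cst_def)
 next
  case False
  then have "mm : {1..nn}" using mm by auto
  then show ?thesis using frame_coeff_frame[OF b, of mm k] False by (simp add: cst_def)
 qed
qed

text \<open>The coordinate on the line spanned by \<open>V mm\<close>.\<close>

definition lc :: "(nat => 'a => ('a, 'k) tvec) => nat => 'a => ('a, 'k) tvec => 'k" where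
 "lc V mm p w = (if mm = nn + 1 then - fco V p w 1 else fco V p w mm)"

lemma lc_fscale:
 assumes V: "wframe N V" and p: "p : N" and mm: "mm : {1..nn + 1}"
 shows "lc V mm p (fscale c (V mm p)) = c"
proof -
 note b = frame_basis[OF wframe_frame[OF V] p]
 have 1: "fco V p (fscale c (V mm p)) k = c * cst k mm" if "k : {1..nn}" for k
  using frame_coeff_fscale[OF b wframe_ts[OF V mm p], of c k] frame_coeff_wframe[OF V p mm that] by (simp only:)
 show ?thesis
 proof (cases "mm = nn + 1")
  case True
  have "1 : {1..nn}" using nn_pos by simp
  from 1[OF this] True show ?thesis by (simp only: lc_def cst_def) simp
 next
  case False
  then have "mm : {1..nn}" using mm by auto
  from 1[OF this] False show ?thesis by (simp only: lc_def cst_def) simp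
 qed
qed

lemma wframe_nonzero:
 assumes V: "wframe N V" and p: "p : N" and mm: "mm : {1..nn + 1}"
 shows "V mm p ~= 0"
proof
 assume 0: "V mm p = 0"
 have "fscale 1 (V mm p) = fscale 0 (V mm p)" unfolding 0 by (simp add: fun_eq_iff)
 then show False using lc_fscale[OF V p mm, of 1] lc_fscale[OF V p mm, of 0] by simp
qed

lemma line_field:
 assumes V: "wframe N V" and mm: "mm : {1..nn + 1}" and O': "open O'" "O' \<subseteq> N" and v: "vf O' v"
  and line: "!!q. q : O' ==> v q : range (%c. fscale c (V mm q))"
 obtains g where "!!q. q : O' ==> an q g" "!!q. q : O' ==> v q = fscale (g q) (V mm q)"
proof (rule that)
 show "an q (%q. lc V mm q (v q))" if "q : O'" for q
  using frame_coeff_an[OF wframe_frame[OF V] v O'(1,2) that] unfolding lc_def by (cases "mm = nn + 1") auto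
 show "v q = fscale (lc V mm q (v q)) (V mm q)" if q: "q : O'" for q
 proof -
  obtain c where c: "v q = fscale c (V mm q)" using line[OF q] by blast
  show ?thesis unfolding c using lc_fscale[OF V _ mm, of q c] q O'(2) by auto
 qed
qed

section \<open>The form \<open>\<omega>\<close>\<close>

abbreviation om :: "'a set => (nat => 'a => ('a, 'k) tvec) => ('a, 'k) dform" where
 "om \<equiv> omega_form \<A>"

lemma om_apply:
 "p : N ==> v : TS p ==> om N V p [v] = (\<Sum>i=1..nn. phic V i p * fco V p v i)"
 by (simp add: omega_form_def sum_fun_apply coframe_apply)

lemma phi_dvg:
 assumes V: "frame N V" and p: "p : N" and i: "i : {1..nn}"
 shows "phic V i p = dvg V (V i) p"
proof -
 note b = frame_basis[OF V p]
 define G where "G j = fco V p (lie (V i) (V j) p) j" for j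
 have "fco V p (lie (V j) (V i) p) j = - G j" if j: "j : {1..nn}" for j
 proof -
  have "lie (V j) (V i) p = fscale (- 1) (lie (V i) (V j) p)"
   unfolding fscale_minus_1 by (rule lie_antisym)
  then have "fco V p (lie (V j) (V i) p) j = - 1 * G j"
   unfolding G_def
   using frame_coeff_fscale[OF b lie_ts[OF frame_vf[OF V i] frame_vf[OF V j] frame_open[OF V] p], of "- 1" j]
   by (simp only:)
  then show ?thesis by simp
 qed
 then have 1: "(\<Sum>j\<in>{1..<i}. structure_coeff \<A> V j i j p) = - (\<Sum>j\<in>{1..<i}. G j)"
  using i by (simp add: structure_coeff_def sum_negf[symmetric])
 have 2: "(\<Sum>j\<in>{i<..nn}. structure_coeff \<A> V i j j p) = (\<Sum>j\<in>{i<..nn}. G j)"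
  by (simp add: structure_coeff_def G_def)
 have 3: "G i = 0"
  using frame_coeff_sum[OF b, of "{} :: nat set" "%i. 0" i] by (simp add: G_def)
 have "{1..nn} = {1..<i} \<union> ({i} \<union> {i<..nn})" using i by auto
 then have "(\<Sum>j=1..nn. G j) = (\<Sum>j\<in>{1..<i}. G j) + (G i + (\<Sum>j\<in>{i<..nn}. G j))"
  by (simp only:) (subst sum.union_disjoint, auto)
 then show ?thesis unfolding phi_coeff_def 1 2 dvg_def G_def[symmetric] using 3 by simp
qed

text \<open>For the first \<open>n\<close> fields this is the definition of \<open>ph\<close>; the last one is minus their sum, and the
 divergence of a sum is the sum of the divergences.\<close>

lemma om_wframe:
 assumes V: "wframe N V" and p: "p : N" and mm: "mm : {1..nn + 1}"
 shows "om N V p [V mm p] = dvg V (V mm) p"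
proof -
 note F = wframe_frame[OF V]
 have "om N V p [V mm p] = (\<Sum>i=1..nn. dvg V (V i) p * cst i mm)"
  unfolding om_apply[OF p wframe_ts[OF V mm p]]
  by (rule sum.cong[OF refl]) (simp only: phi_dvg[OF F p] frame_coeff_wframe[OF V p mm])
 also have "... = dvg V (V mm) p"
 proof (cases "mm = nn + 1")
  case True
  have "dvg V (V mm) p = dvg V (%q. - (\<Sum>k=1..nn. V k q)) p"
   unfolding True by (rule dvg_cong[OF wframe_vf[OF V] frame_open[OF F] p wframe_last[OF V] F]) simp
  also have "... = - (\<Sum>k=1..nn. dvg V (V k) p)"
   by (rule dvg_sum[OF F frame_vf[OF F] p])
  finally show ?thesis using True by (simp add: cst_def sum_negf)
 next
  case False
  then have "(\<Sum>i=1..nn. dvg V (V i) p * cst i mm) = (\<Sum>i=1..nn. if i = mm then dvg V (V i) p else 0)"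
   by (intro sum.cong) (auto simp: cst_def)
  then show ?thesis using False mm by (simp add: sum.delta)
 qed
 finally show ?thesis .
qed

lemma alt_fsum:
 "(!!i. i : I ==> h i : alt k p) ==> (%vs. \<Sum>i\<in>I. h i vs) : alt k p"
 by (induction I rule: infinite_finite_induct) (simp_all add: alt_0 alt_add)

lemma om_form:
 assumes V: "frame N V"
 shows "fon 1 N (om N V)"
proof (rule form_onI)
 have om: "om N V p = (%vs. \<Sum>i=1..nn. phic V i p * cofr N V i p vs)" for p
  by (simp add: omega_form_def fun_eq_iff sum_fun_apply)
 note cf = coframe_form[OF V]
 show "om N V p : alt 1 p" if "p : N" for p
  unfolding om by (intro alt_fsum alt_cmult form_on_alt[OF cf that])
 show "om N V p = 0" if "p \<notin> N" for p
  unfolding om by (simp add: form_on_outside[OF cf that] zero_fun_def)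
 fix O' p and Xs :: "('a => ('a, 'k) tvec) list"
 assume O': "open O'" "O' \<subseteq> N" "length Xs = 1" "!!X. X : set Xs ==> vf O' X" "p : O'"
 have p: "p : N" using O' by blast
 have "an p (%p. phic V i p)" if i: "i : {1..nn}" for i
  unfolding phi_coeff_def structure_coeff_def
 proof (intro an_diff an_sum)
  show "an p (%p. fco V p (lie (V j) (V i) p) j)" if "j : {1..<i}" for j
   by (rule frame_coeff_an[OF V lie_vf[OF frame_vf[OF V] frame_vf[OF V i] frame_open[OF V]] frame_open[OF V] order_refl p])
    (use that i in auto)
  show "an p (%p. fco V p (lie (V i) (V j) p) j)" if "j : {i<..nn}" for j
   by (rule frame_coeff_an[OF V lie_vf[OF frame_vf[OF V i] frame_vf[OF V] frame_open[OF V]] frame_open[OF V] order_refl p])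
    (use that i in auto)
 qed
 then show "an p (%p. om N V p (map (%X. X p) Xs))"
  unfolding om by (intro an_sum an_mult form_on_an[OF cf O'])
qed

lemma om_restrict: "p : O' ==> O' \<subseteq> N ==> om O' V p = om N V p"
 by (auto simp: omega_form_def coframe_def fun_eq_iff sum_fun_apply)

section \<open>Abelian relations and the equation \<open>df = - f \<omega>\<close>\<close>

lemma vol_alt: "frame N V ==> p : N ==> vol N V p : alt nn p"
 by (rule form_on_alt[OF vol_form])

lemma contract_alt:
 assumes "h : alt nn p" "v : TS p"
 shows "(%us. h (v # us)) : alt (nn - 1) p"
 by (rule alt_contract) (use assms nn_pos in simp_all)

lemma vol_sum_slot:
 assumes h: "h : alt nn p" and v: "!!k. k : I ==> v k : TS p"
 shows "h ((\<Sum>k\<in>I. fscale (c k) (v k)) # us) = (\<Sum>k\<in>I. c k * h (v k # us))"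
proof (cases "length us = nn - 1 & set us \<subseteq> TS p")
 case True
 then show ?thesis
  using alt_sum_slot[OF h, of "0 # us" 0 I v c] nn_pos v by simp
next
 case False
 have "h (w # us) = 0" for w
  by (rule alt_outside[OF h]) (use False in auto)
 then show ?thesis by simp
qed

lemma minus_sum_fscale: "- (\<Sum>k\<in>I. v k) = (\<Sum>k\<in>I. fscale (- 1) (v k :: ('a, 'k) tvec))"
 unfolding fscale_minus_1 by (simp add: sum_negf)

lemma abelian_relation_of_eq:
 assumes V: "wframe N V" and p: "p : N" and mm: "mm : {1..nn + 1}"
 shows "arel N V f mm p us = f p * vol N V p (V mm p # us)"
proof (cases "mm = nn + 1")
 case True
 note F = wframe_frame[OF V] and b = frame_basis[OF wframe_frame[OF V] p]
 have "vol N V p (V mm p # us) = (\<Sum>k=1..nn. - 1 * vol N V p (V k p # us))"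
  unfolding True wframe_last[OF V p] minus_sum_fscale
  by (rule vol_sum_slot[OF vol_alt[OF F p]]) (rule basis_atD[OF b])
 then have "f p * vol N V p (V mm p # us) = - (\<Sum>k=1..nn. f p * vol N V p (V k p # us))"
  by (simp add: sum_negf sum_distrib_left)
 also have "(\<Sum>k=1..nn. f p * vol N V p (V k p # us)) = (\<Sum>k=1..nn. f p * A_form \<A> N V k p us)"
  by (rule sum.cong[OF refl]) (simp only: A_form_contract[OF F p])
 finally show ?thesis using True by (simp add: abelian_relation_of_def sum_fun_apply)
next
 case False
 then have "mm : {1..nn}" using mm by auto
 then show ?thesis using A_form_contract[OF wframe_frame[OF V] p] by (simp add: abelian_relation_of_def)
qed

lemma abelian_relation_of_outside:
 assumes V: "frame N V" and p: "p \<notin> N" and n2: "nn \<ge> 2"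
 shows "arel N V f mm p = 0"
proof -
 have cf: "cofr N V j p = 0" for j by (rule form_on_outside[OF coframe_form[OF V] p])
 have "A_form \<A> N V i p = 0" if i: "i : {1..nn}" for i
 proof -
  define \<alpha>s where "\<alpha>s = map (cofr N V) (filter (%j. j ~= i) [1..<nn + 1])"
  have cm: "[cofr N V j. j \<leftarrow> xs, j ~= i] = map (cofr N V) (filter (%j. j ~= i) xs)" for xs
   by (induction xs) auto
  have "length \<alpha>s = nn - 1" using i unfolding \<alpha>s_def upt_split(2)[OF i] by auto
  then have "\<alpha>s ~= []" using n2 by auto
  moreover have "fon 1 N \<alpha>" if "\<alpha> : set \<alpha>s" for \<alpha>
   using that coframe_form[OF V] unfolding \<alpha>s_def set_map by blast
  ultimately have "wedge \<alpha>s p = 0" using form_on_outside[OF wedge_form p, of \<alpha>s] by blast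
  then show ?thesis unfolding A_form_def cm \<alpha>s_def by (simp add: fun_eq_iff)
 qed
 then show ?thesis by (simp add: abelian_relation_of_def fun_eq_iff sum_fun_apply)
qed

lemma contraction_an:
 assumes F: "frame N V" and X: "vf O' X" and O': "open O'" "O' \<subseteq> N" "p : O'"
  and Ys: "length Ys = nn - 1" "!!Y. Y : set Ys ==> vf O' Y"
 shows "an p (%q. vol N V q (X q # map (%Y. Y q) Ys))"
 using form_on_an[OF vol_form[OF F] O'(1,2) _ _ O'(3), of "X # Ys"] X Ys nn_pos by auto

lemma abelian_relation_of_form:
 assumes V: "wframe N V" and n2: "nn \<ge> 2" and f: "!!p. p : N ==> an p f" and mm: "mm : {1..nn + 1}"
 shows "fon (nn - 1) N (arel N V f mm)"
proof (rule form_onI)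
 note F = wframe_frame[OF V]
 show "arel N V f mm p : alt (nn - 1) p" if p: "p : N" for p
 proof -
  have "arel N V f mm p = (%us. f p * vol N V p (V mm p # us))"
   by (rule ext) (rule abelian_relation_of_eq[OF V p mm])
  then show ?thesis
   using alt_cmult[OF contract_alt[OF vol_alt[OF F p] wframe_ts[OF V mm p]], of "f p"] by (simp only:)
 qed
 show "arel N V f mm p = 0" if "p \<notin> N" for p
  by (rule abelian_relation_of_outside[OF F that n2])
 fix O' p and Ys :: "('a => ('a, 'k) tvec) list"
 assume O': "open O'" "O' \<subseteq> N" "length Ys = nn - 1" "!!X. X : set Ys ==> vf O' X" "p : O'"
 have "an p (%q. f q * vol N V q (V mm q # map (%Y. Y q) Ys))"
  by (intro an_mult f contraction_an[OF F vf_subset[OF wframe_vf[OF V mm] O'(2)] O'(1,2,5,3,4)]) (use O' in blast)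
 then show "an p (%q. arel N V f mm q (map (%X. X q) Ys))"
 proof (rule an_cong)
  show "\<forall>\<^sub>F q in nhds p. f q * vol N V q (V mm q # map (%Y. Y q) Ys) = arel N V f mm q (map (%X. X q) Ys)"
   using eventually_nhds_in_open[OF O'(1,5)]
   by eventually_elim (use abelian_relation_of_eq[OF V _ mm] O'(2) in auto)
 qed
qed

text \<open>Differentiating \<open>f\<close> times the contraction of the volume form along the foliation itself: the
 divergence of \<open>V mm\<close> is \<open>\<omega>(V mm)\<close> for all \<open>n + 1\<close> indices.\<close>

lemma lie_derivative_relation:
 assumes V: "wframe N V" and mm: "mm : {1..nn + 1}" and f: "!!q. q : N ==> an q f"
  and O': "open O'" "O' \<subseteq> N" "p : O'" and v: "vf O' v"
  and line: "!!q. q : O' ==> v q : range (%c. fscale c (V mm q))"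
  and Ys: "length Ys = nn - 1" "!!Y. Y : set Ys ==> vf O' Y"
  and et: "!!q us. q : O' ==> et q us = f q * vol N V q (V mm q # us)"
 shows "lieD v et Ys p = vol N V p (V mm p # map (%Y. Y p) Ys) * (v p f + f p * om N V p [v p])"
proof -
 note F = frame_subset[OF wframe_frame[OF V] O'(1,2)]
 have F': "frame N V" by (rule wframe_frame[OF V])
 have p: "p : N" using O' by blast
 note b = frame_basis[OF F' p]
 have X: "vf O' (V mm)" by (rule vf_subset[OF wframe_vf[OF V mm] O'(2)])
 obtain g where g: "!!q. q : O' ==> an q g" "!!q. q : O' ==> v q = fscale (g q) (V mm q)"
  using line_field[OF V mm O'(1,2) v line] by blast
 note vp = vf_ts[OF v O'(3)] and Xp = wframe_ts[OF V mm p]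
 let ?Y = "map (%Y. Y p) Ys"
 define L where "L = vol N V p (V mm p # ?Y)"
 have al: "vol N V p : alt nn p" by (rule vol_alt[OF F' p])
 have voleq: "vol O' V q us = vol N V q us" if "q : O'" for q us
 proof -
  have "cofr O' V i q = cofr N V i q" for i
   using that O'(2) by (auto simp: coframe_def fun_eq_iff)
  then show ?thesis by (simp add: vol_def wedge_def)
 qed
 have a: "an p (%q. vol N V q (V mm q # map (%Y. Y q) Ys))"
  by (rule contraction_an[OF F' X O' Ys])
 have "v p (%q. et q (map (%Y. Y q) Ys)) = v p (%q. f q * vol N V q (V mm q # map (%Y. Y q) Ys))"
  by (rule tv_cong[OF vp an_mult[OF f[OF p] a], symmetric])
   (use eventually_nhds_in_open[OF O'(1,3)] et in \<open>auto elim!: eventually_mono\<close>)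
 also have "... = f p * v p (%q. vol N V q (V mm q # map (%Y. Y q) Ys)) + L * v p f"
  unfolding L_def by (rule tv_mult[OF vp f[OF p] a])
 finally have 1: "v p (%q. et q (map (%Y. Y q) Ys)) = ..." .
 let ?S = "\<Sum>i<length Ys. vol N V p (V mm p # ?Y[i := lie v (Ys ! i) p])"
 have 2: "lieD v et Ys p = f p * v p (%q. vol N V q (V mm q # map (%Y. Y q) Ys)) + L * v p f - f p * ?S"
  unfolding lie_derivative_def 1 et[OF O'(3)] by (simp add: sum_distrib_left)
 have "lieD v (vol N V) (V mm # Ys) p = v p (%q. vol N V q (V mm q # map (%Y. Y q) Ys))
   - (vol N V p (lie v (V mm) p # ?Y) + ?S)"
  unfolding lie_derivative_def by (simp add: sum.lessThan_Suc_shift del: sum.lessThan_Suc)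
 moreover have "lieD v (vol N V) (V mm # Ys) p = dvg V v p * L"
 proof -
  have "lieD v (vol O' V) (V mm # Ys) p = dvg V v p * vol O' V p (map (%Y. Y p) (V mm # Ys))"
   by (rule lie_vol[OF F v O'(1) order_refl O'(3)]) (use Ys X nn_pos in auto)
  moreover have "v p (%q. vol N V q (map (%Y. Y q) (V mm # Ys))) = v p (%q. vol O' V q (map (%Y. Y q) (V mm # Ys)))"
   by (rule tv_cong[OF vp])
    (use a eventually_nhds_in_open[OF O'(1,3)] voleq in \<open>auto elim!: eventually_mono\<close>)
  ultimately show ?thesis
   unfolding lie_derivative_def voleq[OF O'(3)] L_def by simp
 qed
 ultimately have 3: "v p (%q. vol N V q (V mm q # map (%Y. Y q) Ys)) - ?S
   = dvg V v p * L + vol N V p (lie v (V mm) p # ?Y)" by (simp add: algebra_simps)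
 have "dvg V v p = dvg V (%q. fscale (g q) (V mm q)) p"
  by (rule dvg_cong[OF v O'(1,3) g(2) F])
 also have "... = g p * dvg V (V mm) p + V mm p g"
  by (rule dvg_fscale[OF F X g(1)[OF O'(3)] O'(3)])
 finally have 4: "dvg V v p = g p * dvg V (V mm) p + V mm p g" .
 have "lie v (V mm) p = lie (%q. fscale (g q) (V mm q)) (V mm) p"
  by (rule lie_cong[OF v X O'(1,3)]) (use eventually_nhds_in_open[OF O'(1,3)] g(2) in \<open>auto elim!: eventually_mono\<close>)
 also have "... = fscale (g p) (lie (V mm) (V mm) p) - fscale (V mm p g) (V mm p)"
  by (rule lie_fscale_left[OF X X O'(1,3) g(1)[OF O'(3)]])
 also have "... = fscale (- V mm p g) (V mm p)" unfolding lie_self by (simp add: fun_eq_iff)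
 finally have lb: "lie v (V mm) p = fscale (- V mm p g) (V mm p)" .
 have one: "vol N V p (fscale c (V mm p) # us) = c * vol N V p (V mm p # us)" for c us
  using vol_sum_slot[OF al, of "{0::nat}" "%_. V mm p" "%_. c" us] Xp by simp
 have 5: "vol N V p (lie v (V mm) p # ?Y) = - V mm p g * L"
  unfolding lb one L_def ..
 have 6: "om N V p [v p] = g p * dvg V (V mm) p"
  unfolding g(2)[OF O'(3)] using alt_1(2)[OF form_on_alt[OF om_form[OF F'] p] Xp, of "g p"] om_wframe[OF V p mm]
  by (simp only:)
 have "lieD v et Ys p = f p * (v p (%q. vol N V q (V mm q # map (%Y. Y q) Ys)) - ?S) + L * v p f"
  unfolding 2 by (simp only: right_diff_distrib add_diff_eq) (simp add: algebra_simps)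
 also have "... = L * (v p f + f p * om N V p [v p])"
  unfolding 3 4 5 6 by (simp add: algebra_simps)
 finally show ?thesis by (simp only: L_def)
qed

text \<open>Solutions of \<open>df = - f \<omega>\<close>, including the zero function.\<close>

definition solutions :: "'a set => (nat => 'a => ('a, 'k) tvec) => ('a => 'k) set" where
 "solutions N V = {f. (\<forall>p\<in>N. an p f) & (\<forall>p. p \<notin> N --> f p = 0) \<and>
  (\<forall>p\<in>N. \<forall>v\<in>TS p. v f = - f p * om N V p [v])}"

lemma potentials_eq: "pots N V = {f : solutions N V. \<forall>p\<in>N. f p ~= 0}"
 by (auto simp: potentials_def solutions_def mfd_analytic_def)

definition spans :: "'a set => (nat => 'a => ('a, 'k) tvec) => (nat => 'a => ('a, 'k) tvec set) => bool" where
 "spans N V F \<longleftrightarrow> (\<forall>p\<in>N. \<forall>mm\<in>{1..nn + 1}. F mm p = range (%c. fscale c (V mm p)))"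

lemma spansD: "spans N V F ==> p : N ==> mm : {1..nn + 1} ==> F mm p = range (%c. fscale c (V mm p))"
 by (simp add: spans_def)

lemma relation_of_solution:
 assumes V: "wframe N V" and n2: "nn \<ge> 2" and F: "spans N V F" and f: "f : solutions N V"
 shows "arel N V f : Arels N F"
proof -
 have fan: "an p f" if "p : N" for p using f that by (simp add: solutions_def)
 have fd: "v f = - f p * om N V p [v]" if "p : N" "v : TS p" for p v using f that by (simp add: solutions_def)
 have "basic_form \<A> (nn - 1) N (F mm) (arel N V f mm)" if mm: "mm : {1..nn + 1}" for mm
  unfolding basic_form_def
 proof (intro allI impI ballI conjI)
  fix O' v p us assume O': "open O'" "O' \<subseteq> N" "vf O' v" "\<forall>p\<in>O'. v p : F mm p" "p : O'"
  then have p: "p : N" by blast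
  obtain c where c: "v p = fscale c (V mm p)" using O'(4,5) spansD[OF F p mm] by blast
  note al = vol_alt[OF wframe_frame[OF V] p]
  have "vol N V p (V mm p # v p # us) = - vol N V p (v p # V mm p # us)"
   using alt_adjacent[OF al, of "[]" "V mm p" "v p" us] by (simp only: append_Nil)
  also have "vol N V p (v p # V mm p # us) = c * vol N V p (V mm p # V mm p # us)"
   using vol_sum_slot[OF al, of "{0::nat}" "%_. V mm p" "%_. c" "V mm p # us"] wframe_ts[OF V mm p] c by simp
  also have "vol N V p (V mm p # V mm p # us) = 0" by (rule alt_equal[OF al, of 0 1]) auto
  finally show "arel N V f mm p (v p # us) = 0"
   unfolding abelian_relation_of_eq[OF V p mm] by simp
 next
  fix O' v Ys p
  assume O': "open O'" "O' \<subseteq> N" "vf O' v" "\<forall>p\<in>O'. v p : F mm p"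
   and Ys: "length Ys = nn - 1" "\<forall>Y\<in>set Ys. vf O' Y" and p: "p : O'"
  have pN: "p : N" using O' p by blast
  have "lieD v (arel N V f mm) Ys p
    = vol N V p (V mm p # map (%Y. Y p) Ys) * (v p f + f p * om N V p [v p])"
  proof (rule lie_derivative_relation[OF V mm fan O'(1,2) p O'(3)])
   show "v q : range (%c. fscale c (V mm q))" if "q : O'" for q
    using O'(2,4) that spansD[OF F _ mm, of q] by blast
   show "arel N V f mm q us = f q * vol N V q (V mm q # us)" if "q : O'" for q us
    by (rule abelian_relation_of_eq[OF V _ mm]) (use that O'(2) in blast)
  qed (use Ys in auto)
  then show "lieD v (arel N V f mm) Ys p = 0"
   using fd[OF pN vf_ts[OF O'(3) p]] by simp
 qed
 moreover have "(\<Sum>mm=1..nn + 1. arel N V f mm) = 0"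
 proof -
  have "(\<Sum>mm=1..nn. arel N V f mm) = (\<Sum>mm=1..nn. (%p. fscale (f p) (A_form \<A> N V mm p)))"
   by (rule sum.cong[OF refl]) (simp only: abelian_relation_of_def if_True)
  moreover have "arel N V f (nn + 1) = - (\<Sum>mm=1..nn. (%p. fscale (f p) (A_form \<A> N V mm p)))"
   by (simp add: abelian_relation_of_def fun_eq_iff sum_fun_apply)
  moreover have "(\<Sum>mm=1..nn + 1. arel N V f mm)
    = (\<Sum>mm=1..nn. arel N V f mm) + arel N V f (nn + 1)" by simp
  ultimately show ?thesis by (simp only: add.right_inverse)
 qed
 moreover have "arel N V f mm = 0" if "mm \<notin> {1..nn + 1}" for mm
  using that by (auto simp: abelian_relation_of_def)
 ultimately show ?thesis
  unfolding abelian_relations_def mem_Collect_eq using abelian_relation_of_form[OF V n2 fan] by blast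
qed

lemma vol_distinct_nonzero:
 assumes F: "frame N V" and p: "p : N" and js: "distinct js" "set js = {1..nn}"
 shows "vol N V p (map (%k. V k p) js) ~= 0"
 using alt_sort[OF vol_alt[OF F p], of "[]" "%k. V k p" js] vol_basis[OF F p] sort_eq_upt[OF js]
 by (simp del: upt_Suc)

text \<open>The linear algebra at one point: \<open>n + 1\<close> forms of degree \<open>n - 1\<close> with sum zero, annihilated by
 \<open>n + 1\<close> vectors in general position with sum zero, have a common coefficient.\<close>

lemma relation_at_point:
 assumes V: "wframe N V" and n2: "nn \<ge> 2" and p: "p : N"
  and et: "!!mm. mm : {1..nn + 1} ==> et mm : alt (nn - 1) p"
  and kill: "!!mm us. mm : {1..nn + 1} ==> et mm (V mm p # us) = 0"
  and sum: "!!us. (\<Sum>mm=1..nn + 1. et mm us) = 0" and mm: "mm : {1..nn + 1}"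
 shows "et mm us = et 1 (map (%k. V k p) [2..<nn + 1]) * vol N V p (V mm p # us)"
proof -
 note F = wframe_frame[OF V] and b = frame_basis[OF wframe_frame[OF V] p]
 note al = vol_alt[OF F p]
 let ?b = "%k. V k p"
 define js where "js i = filter (%j. j ~= i) [1..<nn + 1]" for i
 have js: "distinct (i # js i)" "set (i # js i) = {1..nn}" if "i : {1..nn}" for i
  using that by (auto simp: js_def simp del: upt_Suc)
 define c where "c i = et i (map ?b (js i)) / vol N V p (map ?b (i # js i))" for i
 have A: "et i us = c i * vol N V p (V i p # us)" if i: "i : {1..nn}" for i us
 proof -
  have i': "i : {1..nn + 1}" using i by auto
  have "(%us. et i us + (- c i) * vol N V p (V i p # us)) = (%us. 0)"
  proof (rule alt_codim_1_0[OF alt_add[OF et[OF i'] alt_cmult[OF contract_alt[OF al basis_atD[OF b i]]]] b i])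
   show "et i (V i p # us) + (- c i) * vol N V p (V i p # V i p # us) = 0" for us
    using kill[OF i'] alt_equal[OF al, of 0 1 "V i p # V i p # us"] by simp
   show "et i (map ?b (filter (%j. j ~= i) [1..<nn + 1])) + (- c i) * vol N V p (V i p # map ?b (filter (%j. j ~= i) [1..<nn + 1])) = 0"
    using vol_distinct_nonzero[OF F p js[OF i]] unfolding js_def[symmetric] c_def by simp
  qed
  from fun_cong[OF this, of us] show ?thesis by simp
 qed
 have Vl: "vol N V p (V (nn + 1) p # us) = - (\<Sum>k=1..nn. vol N V p (V k p # us))" for us
 proof -
  have "vol N V p (V (nn + 1) p # us) = (\<Sum>k=1..nn. - 1 * vol N V p (V k p # us))"
   unfolding wframe_last[OF V p] minus_sum_fscale
   by (rule vol_sum_slot[OF al]) (rule basis_atD[OF b])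
  then show ?thesis by (simp only: mult_minus1 sum_negf)
 qed
 have last: "et (nn + 1) us = - (\<Sum>k=1..nn. c k * vol N V p (V k p # us))" for us
 proof -
  have "(\<Sum>mm=1..nn. et mm us) + et (nn + 1) us = 0" using sum[of us] by simp
  moreover have "(\<Sum>mm=1..nn. et mm us) = (\<Sum>k=1..nn. c k * vol N V p (V k p # us))"
   by (rule sum.cong[OF refl]) (rule A)
  ultimately show ?thesis by (simp add: add_eq_0_iff)
 qed
 have one: "1 : {1..nn}" using nn_pos by simp
 have eq: "c i = c 1" if i: "i : {1..nn}" for i
 proof (cases "i = 1")
  case False
  define ks where "ks = filter (%j. j ~= 1 & j ~= i) [1..<nn + 1]"
  have ks: "distinct (1 # i # ks)" "set (1 # i # ks) = {1..nn}"
   using i one False by (auto simp: ks_def simp del: upt_Suc)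
  have sk: "set ks = {1..nn} - {1, i}" by (auto simp: ks_def simp del: upt_Suc)
  define us where "us = map ?b ks"
  have rep: "vol N V p (V k p # x # us) = 0" if k: "k : {1..nn}" "k ~= 1" "k ~= i" for k x
  proof -
   have "V k p : set us" using k sk by (auto simp: us_def)
   then obtain a where a: "a < length us" "us ! a = V k p" by (auto simp: in_set_conv_nth)
   show ?thesis by (rule alt_equal[OF al, of 0 "Suc (Suc a)"]) (use a in auto)
  qed
  have sw: "vol N V p (x # y # us) = - vol N V p (y # x # us)" for x y
   using alt_adjacent[OF al, of "[]" x y us] by simp
  have vl: "vol N V p (V k p # V (nn + 1) p # us) = - (\<Sum>l=1..nn. vol N V p (V k p # V l p # us))"
   if "k : {1..nn}" for k
  proof -
   have "(\<Sum>l=1..nn. vol N V p (V l p # V k p # us)) = (\<Sum>l=1..nn. - vol N V p (V k p # V l p # us))"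
    by (rule sum.cong[OF refl]) (rule sw)
   then show ?thesis unfolding sw[of "V k p" "V (nn + 1) p"] Vl by (simp only: minus_minus sum_negf)
  qed
  define K where "K = vol N V p (V 1 p # V i p # us)"
  have nz: "K ~= 0" using vol_distinct_nonzero[OF F p ks] by (simp add: K_def us_def)
  have d0: "vol N V p (x # x # us) = 0" for x by (rule alt_equal[OF al, of 0 1]) auto
  have S1: "(\<Sum>l=1..nn. vol N V p (V 1 p # V l p # us)) = K"
  proof -
   have "vol N V p (V 1 p # V l p # us) = (if l = i then K else 0)" if "l : {1..nn}" for l
    using rep[OF that, of "V 1 p"] sw[of "V 1 p" "V l p"] d0 False by (auto simp: K_def)
   then have "(\<Sum>l=1..nn. vol N V p (V 1 p # V l p # us)) = (\<Sum>l=1..nn. if l = i then K else 0)"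
    by (intro sum.cong refl)
   then show ?thesis using i by (simp add: sum.delta)
  qed
  have S2: "(\<Sum>l=1..nn. vol N V p (V i p # V l p # us)) = - K"
  proof -
   have "vol N V p (V i p # V l p # us) = (if l = 1 then - K else 0)" if "l : {1..nn}" for l
    using rep[OF that, of "V i p"] sw[of "V i p" "V l p"] d0 False by (auto simp: K_def)
   then have "(\<Sum>l=1..nn. vol N V p (V i p # V l p # us)) = (\<Sum>l=1..nn. if l = 1 then - K else 0)"
    by (intro sum.cong refl)
   then show ?thesis using one by (simp add: sum.delta)
  qed
  have "0 = - et (nn + 1) (V (nn + 1) p # us)" using kill by simp
  also have "... = (\<Sum>k=1..nn. c k * vol N V p (V k p # V (nn + 1) p # us))" unfolding last by simp
  also have "... = (\<Sum>k=1..nn. (if k = 1 then - c 1 * K else 0) + (if k = i then c i * K else 0))"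
  proof (rule sum.cong[OF refl])
   fix k assume k: "k : {1..nn}"
   show "c k * vol N V p (V k p # V (nn + 1) p # us) = (if k = 1 then - c 1 * K else 0) + (if k = i then c i * K else 0)"
    using rep[OF k, of "V (nn + 1) p"] vl[OF k] S1 S2 False by auto
  qed
  also have "... = c i * K - c 1 * K" using one i by (simp add: sum.distrib sum.delta)
  finally show ?thesis using nz by simp
 qed simp
 have c1: "c 1 = et 1 (map ?b [2..<nn + 1])"
 proof -
  have "js 1 = [2..<nn + 1]" unfolding js_def upt_split(2)[OF one] by (simp add: numeral_2_eq_2)
  moreover have "1 # js 1 = [1..<nn + 1]" unfolding js_def upt_split(2)[OF one] using upt_split(1)[OF one] by simp
  ultimately show ?thesis using vol_basis[OF F p] by (simp add: c_def del: upt_Suc list.map)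
 qed
 show ?thesis
 proof (cases "mm = nn + 1")
  case True
  have "et mm us = - (\<Sum>k=1..nn. c 1 * vol N V p (V k p # us))"
   unfolding True last by (intro arg_cong[where f = uminus] sum.cong refl) (simp only: eq)
  also have "... = c 1 * vol N V p (V (nn + 1) p # us)"
   unfolding Vl by (simp add: sum_distrib_left)
  finally show ?thesis unfolding True c1 .
 next
  case False
  then have "mm : {1..nn}" using mm by auto
  from A[OF this, of us] eq[OF this] show ?thesis unfolding c1 by simp
 qed
qed

end

section \<open>Solutions of \<open>df = - f \<omega>\<close>\<close>

context manifold
begin

lemma solutionsD:
 assumes "f : solutions N V"
 shows "p : N ==> an p f" "p \<notin> N ==> f p = 0" "p : N ==> v : TS p ==> v f = - f p * om N V p [v]"
 using assms by (simp_all add: solutions_def)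

lemma solutionsI:
 assumes F: "frame N V" and f: "!!p. p : N ==> an p f" "!!p. p \<notin> N ==> f p = 0"
  and d: "!!p k. p : N ==> k : {1..nn} ==> V k p f = - f p * om N V p [V k p]"
 shows "f : solutions N V"
 unfolding solutions_def mem_Collect_eq
proof (intro conjI ballI allI impI f)
 fix p v assume p: "p : N" and v: "v : TS p"
 note b = frame_basis[OF F p]
 have al: "om N V p : alt 1 p" by (rule form_on_alt[OF om_form[OF F] p])
 have "v f = (\<Sum>k=1..nn. fscale (fco V p v k) (V k p)) f"
  by (rule fun_cong[OF frame_coeff_expand[OF b v]])
 also have "... = (\<Sum>k=1..nn. fco V p v k * V k p f)" by (simp add: sum_fun_apply)
 also have "... = (\<Sum>k=1..nn. - f p * (fco V p v k * om N V p [V k p]))"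
  by (rule sum.cong[OF refl]) (simp add: d[OF p])
 also have "... = - f p * (\<Sum>k=1..nn. fco V p v k * om N V p [V k p])"
  by (simp add: sum_distrib_left)
 also have "(\<Sum>k=1..nn. fco V p v k * om N V p [V k p])
   = om N V p [\<Sum>k=1..nn. fscale (fco V p v k) (V k p)]"
  by (rule alt_1(3)[OF al, symmetric]) (rule basis_atD[OF b])
 also have "(\<Sum>k=1..nn. fscale (fco V p v k) (V k p)) = v"
  by (rule frame_coeff_expand[OF b v, symmetric])
 finally show "v f = - f p * om N V p [v]" .
qed

lemma abelian_relationsD:
 assumes "et : Arels N F"
 shows "mm : {1..nn + 1} ==> fon (nn - 1) N (et mm)"
  and "mm : {1..nn + 1} ==> basic_form \<A> (nn - 1) N (F mm) (et mm)"
  and "mm \<notin> {1..nn + 1} ==> et mm = 0" and "(\<Sum>mm=1..nn + 1. et mm) = 0"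
 using assms unfolding abelian_relations_def mem_Collect_eq by blast+

lemma basic_formD:
 assumes "basic_form \<A> k N L et" "open O'" "O' \<subseteq> N" "vf O' v" "!!p. p : O' ==> v p : L p" "p : O'"
 shows "et p (v p # us) = 0"
  and "length Ys = k ==> (!!Y. Y : set Ys ==> vf O' Y) ==> lieD v et Ys p = 0"
 using assms unfolding basic_form_def by simp_all

text \<open>The function is the coefficient found at each point by linear algebra; analyticity comes from
 evaluating \<open>et 1\<close> on the other fields, the differential equation from the Lie derivatives.\<close>

lemma solution_of_relation:
 assumes V: "wframe N V" and n2: "nn \<ge> 2" and F: "spans N V F" and et: "et : Arels N F"
 obtains f where "f : solutions N V" "et = arel N V f"
  "!!p. p : N ==> f p = et 1 p (map (%k. V k p) [2..<nn + 1])"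
proof -
 note Fr = wframe_frame[OF V] and oN = frame_open[OF wframe_frame[OF V]]
 define f where "f p = (if p : N then et 1 p (map (%k. V k p) [2..<nn + 1]) else 0)" for p
 have VF: "V mm p : F mm p" if "mm : {1..nn + 1}" "p : N" for mm p
  unfolding spansD[OF F that(2,1)] by (rule range_eqI[of _ _ 1]) (simp add: fun_eq_iff)
 have one: "1 : {1..nn + 1}" by simp
 have eq: "et mm p us = f p * vol N V p (V mm p # us)" if p: "p : N" and mm: "mm : {1..nn + 1}" for p mm us
 proof -
  have "et mm p us = et 1 p (map (%k. V k p) [2..<nn + 1]) * vol N V p (V mm p # us)"
  proof (rule relation_at_point[OF V n2 p, of "%mm. et mm p"])
   show "et mm p : alt (nn - 1) p" if "mm : {1..nn + 1}" for mm
    by (rule form_on_alt[OF abelian_relationsD(1)[OF et that] p])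
   show "et mm p (V mm p # us) = 0" if "mm : {1..nn + 1}" for mm us
    by (rule basic_formD(1)[OF abelian_relationsD(2)[OF et that] oN order_refl wframe_vf[OF V that] VF[OF that] p])
   show "(\<Sum>mm=1..nn + 1. et mm p us) = 0" for us
    using fun_cong[OF fun_cong[OF abelian_relationsD(4)[OF et], of p], of us]
    by (simp only: sum_fun_apply zero_fun_apply)
  qed (rule mm)
  then show ?thesis using p by (simp add: f_def)
 qed
 have fan: "an p f" if p: "p : N" for p
 proof -
  have "an p (%p. et 1 p (map (%X. X p) (map V [2..<nn + 1])))"
   by (rule form_on_an[OF abelian_relationsD(1)[OF et one] oN order_refl _ _ p])
    (use frame_vf[OF Fr] in \<open>auto simp del: upt_Suc\<close>)
  then show ?thesis
   by (rule an_cong) (use eventually_nhds_in_open[OF oN p] in \<open>auto elim!: eventually_mono simp: f_def o_def\<close>)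
 qed
 have "V k p f = - f p * om N V p [V k p]" if p: "p : N" and k: "k : {1..nn}" for p k
 proof -
  have k': "k : {1..nn + 1}" using k by auto
  define js where "js = filter (%j. j ~= k) [1..<nn + 1]"
  have js: "distinct (k # js)" "set (k # js) = {1..nn}" using k by (auto simp: js_def simp del: upt_Suc)
  have ljs: "length js = nn - 1" using k unfolding js_def upt_split(2)[OF k] by auto
  have vj: "vf N Y" if "Y : set (map V js)" for Y
  proof -
   obtain j where j: "j : set js" "Y = V j" using \<open>Y : set (map V js)\<close> unfolding set_map by blast
   from js(2) j(1) have "j : {1..nn}" by auto
   then show ?thesis unfolding j(2) by (rule frame_vf[OF Fr])
  qed
  have "0 = lieD (V k) (et k) (map V js) p"
   by (rule basic_formD(2)[OF abelian_relationsD(2)[OF et k'] oN order_refl wframe_vf[OF V k'] VF[OF k'] p _ vj, symmetric])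
    (simp_all only: length_map ljs)
  also have "... = vol N V p (V k p # map (%Y. Y p) (map V js)) * (V k p f + f p * om N V p [V k p])"
  proof (rule lie_derivative_relation[OF V k' fan oN order_refl p wframe_vf[OF V k'] _ _ vj eq[OF _ k']])
   show "V k q : range (%c. fscale c (V k q))" for q
    by (rule range_eqI[of _ _ 1]) (simp add: fun_eq_iff)
  qed (use ljs in auto)
  finally have "V k p f + f p * om N V p [V k p] = 0"
   using vol_distinct_nonzero[OF Fr p js] by (simp add: o_def)
  then show ?thesis by (simp add: eq_neg_iff_add_eq_0)
 qed
 then have sol: "f : solutions N V"
  by (intro solutionsI[OF Fr fan]) (auto simp: f_def)
 have "et mm p = arel N V f mm p" for mm p
 proof (cases "mm : {1..nn + 1}")
  case True
  show ?thesis
  proof (cases "p : N")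
   case p: True
   show ?thesis by (rule ext) (simp only: eq[OF p True] abelian_relation_of_eq[OF V p True])
  next
   case False
   then show ?thesis
    using form_on_outside[OF abelian_relationsD(1)[OF et True] False] abelian_relation_of_outside[OF Fr False n2]
    by (simp only:)
  qed
 next
  case False
  then show ?thesis using abelian_relationsD(3)[OF et False] by (auto simp: abelian_relation_of_def)
 qed
 then have "et = arel N V f" by (intro ext) (simp only:)
 with sol show thesis by (rule that) (simp add: f_def)
qed

lemma relation_coefficient:
 assumes V: "wframe N V" and p: "p : N"
 shows "arel N V f 1 p (map (%k. V k p) [2..<nn + 1]) = f p"
proof -
 have one: "1 : {1..nn + 1}" by simp
 have "V 1 p # map (%k. V k p) [2..<nn + 1] = map (%k. V k p) [1..<nn + 1]"
  using nn_pos upt_conv_Cons[of 1 "nn + 1"] by (simp add: numeral_2_eq_2 del: upt_Suc)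
 then show ?thesis
  unfolding abelian_relation_of_eq[OF V p one] using vol_basis[OF wframe_frame[OF V] p] by (simp only: mult_1_right)
qed

text \<open>All iterated derivatives of \<open>f\<close> are multiples of \<open>f\<close>, hence vanish where \<open>f\<close> does.\<close>

lemma solution_eventually_0:
 assumes F: "frame N V" and f: "f : solutions N V" and p: "p : N" "f p = 0"
 shows "\<forall>\<^sub>F q in nhds p. f q = 0"
proof -
 obtain D ph where c: "(D, ph) : \<A>" "p : D" by (rule chart_exists)
 note oN = frame_open[OF F]
 define S where "S = {g. \<exists>u. an p u & g = (%q. f q * u q)}"
 show ?thesis
 proof (rule deriv_closed_eventually_0[OF c, of S])
  show "an p g" "g p = 0" if "g : S" for g
   using that solutionsD(1)[OF f p(1)] p(2) by (auto simp: S_def)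
  show "f : S" unfolding S_def using an_const[of p 1] by force
  fix g i assume "g : S"
  then obtain u where u: "an p u" "g = (%q. f q * u q)" by (auto simp: S_def)
  let ?X = "coord_field D ph i"
  have o: "open (D \<inter> N)" using chart_open(1)[OF c(1)] oN by auto
  have X: "vf (D \<inter> N) ?X" by (rule vf_subset[OF coord_field_vf[OF c(1)]]) auto
  have pn: "p : D \<inter> N" using c p by auto
  define u' where "u' q = ?X q u - u q * om N V q [?X q]" for q
  have "an p u'"
   unfolding u'_def
   by (intro an_diff an_mult vf_an[OF X o pn] u(1) one_form_an[OF oN om_form[OF F] o _ X pn]) auto
  moreover have "\<forall>\<^sub>F q in nhds p. ?X q g = f q * u' q"
   using eventually_conj[OF eventually_nhds_in_open[OF o pn] an_eventually[OF u(1)]]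
  proof eventually_elim
   case (elim q)
   then have q: "q : N" "?X q : TS q" "an q u" using vf_ts[OF X] by auto
   show ?case
    unfolding u(2) tv_mult[OF q(2) solutionsD(1)[OF f q(1)] q(3)] solutionsD(3)[OF f q(1,2)] u'_def
    by (simp add: algebra_simps)
  qed
  ultimately show "\<exists>h\<in>S. \<forall>\<^sub>F q in nhds p. ?X q g = h q"
   by (intro bexI[of _ "%q. f q * u' q"]) (auto simp: S_def)
 qed
qed

text \<open>The zeros of \<open>f\<close> form a set that is closed by continuity and open by \<open>solution_eventually_0\<close>.\<close>

lemma solution_dichotomy:
 assumes F: "frame N V" and N: "connected N" and f: "f : solutions N V" and p: "p : N" "f p = 0"
 shows "f q = 0"
proof (cases "q : N")
 case q: True
 define A where "A = {x : N. f x = 0}"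
 define B where "B = {x : N. f x ~= 0}"
 note oN = frame_open[OF F]
 have "open A"
  unfolding open_subopen[of A]
 proof
  fix x assume "x : A"
  then have x: "x : N" "f x = 0" by (auto simp: A_def)
  from eventually_conj[OF solution_eventually_0[OF F f x] eventually_nhds_in_open[OF oN x(1)]]
  show "\<exists>T. open T & x : T & T \<subseteq> A" unfolding eventually_nhds A_def by blast
 qed
 moreover have "open B"
  unfolding open_subopen[of B]
 proof
  fix x assume "x : B"
  then have x: "x : N" "f x ~= 0" by (auto simp: B_def)
  from eventually_conj[OF an_eventually_nonzero[OF solutionsD(1)[OF f x(1)] x(2)] eventually_nhds_in_open[OF oN x(1)]]
  show "\<exists>T. open T & x : T & T \<subseteq> B" unfolding eventually_nhds B_def by blast
 qed
 ultimately have "B \<inter> N = {}"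
  using connectedD[OF N, of A B] p by (auto simp: A_def B_def)
 then show ?thesis using q by (auto simp: B_def)
qed (rule solutionsD(2)[OF f])

lemma relations_bij:
 assumes V: "wframe N V" and n2: "nn \<ge> 2" and F: "spans N V F" and N: "connected N" "N ~= {}"
 shows "bij_betw (arel N V) (pots N V) (Arels N F - {0})"
proof (rule bij_betwI')
 note Fr = wframe_frame[OF V]
 fix f f' assume f: "f : pots N V" "f' : pots N V"
 then have s: "f : solutions N V" "f' : solutions N V" by (simp_all add: potentials_eq)
 show "arel N V f = arel N V f' \<longleftrightarrow> f = f'"
 proof
  assume e: "arel N V f = arel N V f'"
  show "f = f'"
  proof
   fix p
   show "f p = f' p"
    using relation_coefficient[OF V, of p f] relation_coefficient[OF V, of p f'] e
     solutionsD(2)[OF s(1), of p] solutionsD(2)[OF s(2), of p]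
    by (cases "p : N") simp_all
  qed
 qed simp
next
 fix f assume f: "f : pots N V"
 then have s: "f : solutions N V" by (simp add: potentials_eq)
 obtain p where p: "p : N" using N by blast
 have "arel N V f ~= 0"
  using relation_coefficient[OF V p, of f] f p by (auto simp: potentials_eq)
 with relation_of_solution[OF V n2 F s]
 show "arel N V f : Arels N F - {0}" by blast
next
 fix et assume et: "et : Arels N F - {0}"
 obtain f where f: "f : solutions N V" "et = arel N V f"
  by (rule solution_of_relation[OF V n2 F, of et]) (use et in blast)+
 have "f q ~= 0" if "q : N" for q
 proof
  assume "f q = 0"
  then have "f = (%q. 0)" using solution_dichotomy[OF wframe_frame[OF V] N(1) f(1) that] by blast
  then have "et = 0" unfolding f(2) by (auto simp: abelian_relation_of_def fun_eq_iff sum_fun_apply)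
  then show False using et by blast
 qed
 then have "f : pots N V" using f(1) by (simp add: potentials_eq)
 then show "\<exists>f\<in>pots N V. et = arel N V f" using f(2) by blast
qed

section \<open>The curvature \<open>\<Omega> = d\<omega>\<close>\<close>

lemma Omega:
 assumes F: "frame N V"
 shows "fon 2 N (Omf N V)"
  "open O' ==> O' \<subseteq> N ==> vf O' X ==> vf O' Y ==> p : O' ==> Omf N V p [X p, Y p] = ext_op (om N V) X Y p"
 using ext_deriv[OF frame_open[OF F] om_form[OF F]] by (simp_all add: Omega_form_def)

lemma Omega_restrict:
 assumes F: "frame N V" and O': "open O'" "O' \<subseteq> N" and p: "p : O'"
 shows "Omf N V p = Omf O' V p"
 unfolding Omega_form_def
 by (rule ext_deriv_local[OF frame_open[OF F] om_form[OF F] O'(1) om_form[OF frame_subset[OF F O']] p O'(2)])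
  (rule om_restrict[symmetric, OF _ O'(2)])

lemma two_form_eqI:
 assumes h: "h : alt 2 p" "h' : alt 2 p" and N: "open N" "p : N"
  and eq: "!!O' X Y. open O' ==> p : O' ==> O' \<subseteq> N ==> vf O' X ==> vf O' Y ==> h [X p, Y p] = h' [X p, Y p]"
 shows "h = h'"
proof (rule alt_eqI[OF h])
 fix vs assume vs: "length vs = 2" "set vs \<subseteq> TS p"
 obtain O' Ys where O': "open O'" "p : O'" "O' \<subseteq> N" "\<forall>Y\<in>set Ys. vf O' Y" "map (%Y. Y p) Ys = vs"
  using vf_extend_list[OF N vs(2)] by blast
 then obtain X Y where XY: "Ys = [X, Y]" using vs(1) by (auto simp: length_Suc_conv numeral_2_eq_2)
 then have "vs = [X p, Y p]" and XY: "vf O' X" "vf O' Y" using O'(4,5) by auto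
 then show "h vs = h' vs" using eq[OF O'(1-3) XY] by simp
qed

text \<open>Expand \<open>[X, Y] f = X (Y f) - Y (X f)\<close> with the equation for \<open>f\<close> and divide by \<open>f\<close>.\<close>

lemma solution_flat:
 assumes F: "frame N V" and f: "f : solutions N V" and p: "p : N" "f p ~= 0"
 shows "Omf N V p = 0"
proof -
 note oN = frame_open[OF F]
 have fan: "an p f" by (rule solutionsD(1)[OF f p(1)])
 have "Omf N V p = (%vs. 0)"
 proof (rule two_form_eqI[OF form_on_alt[OF Omega(1)[OF F] p(1)] alt_0 oN p(1)])
  fix O' X Y assume O': "open O'" "p : O'" "O' \<subseteq> N" and X: "vf O' X" and Y: "vf O' Y"
  note x = vf_ts[OF X O'(2)] and y = vf_ts[OF Y O'(2)]
  have oa: "an p (%q. om N V q [Z q])" if "vf O' Z" for Z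
   by (rule one_form_an[OF oN om_form[OF F] O'(1,3) that O'(2)])
  have *: "w (%q. Z q f) = - (f p * w (%q. om N V q [Z q]) + om N V p [Z p] * w f)"
   if w: "w : TS p" and Z: "vf O' Z" for w Z
  proof -
   have "w (%q. Z q f) = w (%q. - (f q * om N V q [Z q]))"
   proof (rule tv_cong[OF w vf_an[OF Z O'(1,2) fan]])
    show "\<forall>\<^sub>F q in nhds p. Z q f = - (f q * om N V q [Z q])"
     using eventually_nhds_in_open[OF O'(1,2)]
    proof eventually_elim
     case (elim q)
     then have "q : N" using O'(3) by blast
     from solutionsD(3)[OF f this vf_ts[OF Z elim]] show ?case by simp
    qed
   qed
   then show ?thesis
    using tv_uminus[OF w an_mult[OF fan oa[OF Z]]] tv_mult[OF w fan oa[OF Z]] by simp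
  qed
  have "lie X Y p f = - f p * om N V p [lie X Y p]"
   by (rule solutionsD(3)[OF f p(1) lie_ts[OF X Y O'(1,2)]])
  then have "f p * ext_op (om N V) X Y p = 0"
   unfolding lie_apply[OF fan] *[OF x Y] *[OF y X] solutionsD(3)[OF f p(1) x] solutionsD(3)[OF f p(1) y] ext_op_def
   by (simp add: algebra_simps)
  then show "Omf N V p [X p, Y p] = 0"
   using Omega(2)[OF F O'(1,3) X Y O'(2)] p(2) by simp
 qed
 then show ?thesis by (simp add: zero_fun_def)
qed

text \<open>If \<open>h\<close> is a primitive of \<open>\<omega>\<close>, then \<open>exp (- h)\<close> is a solution.\<close>

lemma flat_solution:
 assumes F: "frame N V" and p: "p : N" and 0: "!!q. q : N ==> Omf N V q = 0"
 obtains O' f where "open O'" "p : O'" "O' \<subseteq> N" "f : solutions O' V" "!!q. q : O' ==> f q ~= 0"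
proof -
 note oN = frame_open[OF F]
 have al: "om N V q : alt 1 q" if "q : N" for q by (rule form_on_alt[OF om_form[OF F] that])
 obtain h where h: "an p h" "\<forall>\<^sub>F q in nhds p. \<forall>v\<in>TS q. v h = - om N V q [v]"
 proof (rule closed_form_exact[OF oN p, of "%q v. - om N V q [v]"])
  show "an q (%q. - om N V q [X q])" if "open O'" "O' \<subseteq> N" "vf O' X" "q : O'" for O' X q
   by (rule an_uminus[OF one_form_an[OF oN om_form[OF F] that]])
  show "- om N V q [u + v] = - om N V q [u] + - om N V q [v]" if "q : N" "u : TS q" "v : TS q" for q u v
   using alt_1(1)[OF al[OF that(1)] that(2,3)] by (simp only: minus_add_distrib)
  show "- om N V q [fscale c v] = c * - om N V q [v]" if "q : N" "v : TS q" for q c v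
   using alt_1(2)[OF al[OF that(1)] that(2)] by (simp only: mult_minus_right)
  fix O' X Y q assume O': "open O'" "O' \<subseteq> N" "vf O' X" "vf O' Y" "q : O'"
  have q: "q : N" using O' by blast
  have a: "an q (%q. om N V q [Z q])" if "vf O' Z" for Z
   by (rule one_form_an[OF oN om_form[OF F] O'(1,2) that O'(5)])
  have "ext_op (om N V) X Y q = 0" using Omega(2)[OF F O'] 0[OF q] by simp
  then show "X q (%q. - om N V q [Y q]) - Y q (%q. - om N V q [X q]) - - om N V q [lie X Y q] = 0"
   using tv_uminus[OF vf_ts[OF O'(3,5)] a[OF O'(4)]] tv_uminus[OF vf_ts[OF O'(4,5)] a[OF O'(3)]]
   by (simp add: ext_op_def algebra_simps)
 qed blast
 obtain M where M: "open M" "p : M" "\<forall>q\<in>M. (\<forall>v\<in>TS q. v h = - om N V q [v]) & an q h & q : N"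
  using eventually_conj[OF h(2) eventually_conj[OF an_eventually[OF h(1)] eventually_nhds_in_open[OF oN p]]]
  unfolding eventually_nhds by blast
 have MN: "M \<subseteq> N" using M by blast
 define f where "f q = (if q : M then exp (h q) else 0)" for q
 have ev: "\<forall>\<^sub>F x in nhds q. exp (h x) = f x" if "q : M" for q
  using eventually_nhds_in_open[OF M(1) that] by (auto elim!: eventually_mono simp: f_def)
 have "f : solutions M V"
  unfolding solutions_def mem_Collect_eq
 proof (intro conjI ballI allI impI)
  fix q assume q: "q : M"
  have e: "an q (%q. exp (h q))" by (rule an_exp(1)) (use M q in blast)
  show "an q f" by (rule an_cong[OF e ev[OF q]])
  fix v assume v: "v : TS q"
  have "v f = v (%q. exp (h q))" by (rule tv_cong[OF v e ev[OF q], symmetric])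
  also have "... = exp (h q) * v h" by (rule an_exp(2)[OF _ v]) (use M q in blast)
  also have "v h = - om N V q [v]" using M q v by blast
  finally have "v f = exp (h q) * - om N V q [v]" .
  moreover have "f q = exp (h q)" using q by (simp add: f_def)
  ultimately show "v f = - f q * om M V q [v]" using om_restrict[OF q MN, of V] by simp
 qed (simp add: f_def)
 then show thesis by (rule that[OF M(1,2) MN]) (simp add: f_def)
qed

section \<open>Change of the section and of the ordering\<close>

lemma coframe_wframe:
 assumes V: "wframe N V" and p: "p : N" and mm: "mm : {1..nn + 1}" and k: "k : {1..nn}"
 shows "cofr N V k p [V mm p] = cst k mm"
 by (rule trans[OF coframe_apply[OF p wframe_ts[OF V mm p]] frame_coeff_wframe[OF V p mm k]])

text \<open>On families with constant coefficients the volume form is constant.\<close>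

lemma vol_constant:
 assumes V: "wframe N V" and pq: "p : N" "q : N" and \<pi>: "!!k. k : {1..nn} ==> \<pi> k : {1..nn + 1}"
 shows "vol N V p (map (%k. V (\<pi> k) p) [1..<nn + 1]) = vol N V q (map (%k. V (\<pi> k) q) [1..<nn + 1])"
proof -
 have "vol N V x (map (%k. V (\<pi> k) x) [1..<nn + 1])
   = (\<Sum>\<tau> | \<tau> permutes {..<nn}. of_int (sign \<tau>) * (\<Prod>a<nn. cst (Suc a) (\<pi> (Suc (\<tau> a)))))" if x: "x : N" for x
 proof -
  have "(\<Prod>a<nn. (map (cofr N V) [1..<nn + 1] ! a) x [map (%k. V (\<pi> k) x) [1..<nn + 1] ! \<tau> a])
    = (\<Prod>a<nn. cst (Suc a) (\<pi> (Suc (\<tau> a))))" if \<tau>: "\<tau> permutes {..<nn}" for \<tau>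
  proof (rule prod.cong[OF refl])
   fix a assume a: "a : {..<nn}"
   then have t: "\<tau> a < nn" using permutes_in_image[OF \<tau>, of a] by simp
   then have "Suc (\<tau> a) : {1..nn}" "Suc a : {1..nn}" using a by auto
   from coframe_wframe[OF V x \<pi>[OF this(1)] this(2)]
   show "(map (cofr N V) [1..<nn + 1] ! a) x [map (%k. V (\<pi> k) x) [1..<nn + 1] ! \<tau> a] = cst (Suc a) (\<pi> (Suc (\<tau> a)))"
    using a t by (simp del: upt_Suc)
  qed
  then show ?thesis unfolding vol_def wedge_def by (simp del: upt_Suc)
 qed
 from this[OF pq(1)] this[OF pq(2)] show ?thesis by simp
qed

lemma alt_fscale_all:
 assumes h: "h : alt k p" and us: "set us \<subseteq> TS p"
 shows "length us = k ==> h (map (fscale c) us) = c ^ k * h us"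
proof -
 have "j \<le> k ==> length us = k ==> h (map (fscale c) (take j us) @ drop j us) = c ^ j * h us" for j
 proof (induction j)
  case (Suc j)
  define w where "w = map (fscale c) (take j us) @ drop j us"
  have w: "length w = k" "set w \<subseteq> TS p" "j < k"
   using Suc.prems us by (auto simp: w_def dest: in_set_takeD in_set_dropD intro!: ts_fscale)
  have uj: "us ! j : TS p" using us Suc.prems by (simp add: subset_iff)
  have "map (fscale c) (take (Suc j) us) @ drop (Suc j) us = w[j := fscale c (us ! j)]"
   using Suc.prems by (simp add: w_def list_update_append take_Suc_conv_app_nth Cons_nth_drop_Suc[symmetric])
  then have "h (map (fscale c) (take (Suc j) us) @ drop (Suc j) us) = c * h (w[j := us ! j])"
   using conjunct2[OF alt_slot[OF h w uj uj, of c]] by (simp only:)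
  also have "w[j := us ! j] = w"
   using Suc.prems by (simp add: w_def list_update_append nth_append list_update_same_conv)
  also have "h w = c ^ j * h us"
   unfolding w_def by (rule Suc.IH) (use Suc.prems in simp_all)
  finally show ?case by (simp only: power_Suc mult.assoc)
 qed simp
 from this[of k] show "length us = k ==> h (map (fscale c) us) = c ^ k * h us" by simp
qed

text \<open>Two volume forms differ by a factor \<open>u\<close>, and divergences by its logarithmic derivative.  For the
 volume form of \<open>g V\<close>, in any order, \<open>u\<close> is a constant times \<open>g ^ - n\<close>; together with
 \<open>div (g X) = g div X + X g\<close> this leaves \<open>- (n - 1) dg / g\<close>.\<close>

lemma om_change:
 assumes V: "wframe N V" and V': "wframe N V'" and \<pi>: "!!mm. mm : {1..nn + 1} ==> \<pi> mm : {1..nn + 1}"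
  and g: "!!q. q : N ==> an q g" "!!q. q : N ==> g q ~= 0"
  and eq: "!!q mm. q : N ==> mm : {1..nn + 1} ==> V' mm q = fscale (g q) (V (\<pi> mm) q)"
  and p: "p : N" and v: "v : TS p"
 shows "om N V' p [v] = om N V p [v] - of_nat (nn - 1) * v g / g p"
proof -
 note F = wframe_frame[OF V] and F' = wframe_frame[OF V'] and oN = frame_open[OF wframe_frame[OF V]]
 define B where "B q = map (%k. V k q) [1..<nn + 1]" for q
 define u where "u q = vol N V' q (B q)" for q
 have volu: "vol N V' q us = u q * vol N V q us" if q: "q : N" for q us
 proof -
  have "(%us. vol N V' q us + (- u q) * vol N V q us) = (%us. 0)"
  proof (rule alt_top_0[OF alt_add[OF vol_alt[OF F' q] alt_cmult[OF vol_alt[OF F q]]] frame_basis[OF F q]])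
   show "vol N V' q (map (%k. V k q) [1..<nn + 1]) + - u q * vol N V q (map (%k. V k q) [1..<nn + 1]) = 0"
    unfolding vol_basis[OF F q] unfolding u_def B_def by simp
  qed
  from fun_cong[OF this, of us] show ?thesis by simp
 qed
 have uan: "an q u" if q: "q : N" for q
 proof -
  have "an q (%q. vol N V' q (map (%X. X q) (map V [1..<nn + 1])))"
   by (rule form_on_an[OF vol_form[OF F'] oN order_refl _ _ q]) (use frame_vf[OF F] in \<open>auto simp del: upt_Suc\<close>)
  then show ?thesis by (simp add: u_def[abs_def] B_def o_def del: upt_Suc)
 qed
 define c where "c = vol N V p (map (%k. V (\<pi> k) p) [1..<nn + 1])"
 have ugc: "g q ^ nn * u q * c = 1" if q: "q : N" for q
 proof -
  have in': "\<pi> k : {1..nn + 1}" if "k : {1..nn}" for k using \<pi>[of k] that by auto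
  have "map (%k. V' k q) [1..<nn + 1] = map (fscale (g q)) (map (%k. V (\<pi> k) q) [1..<nn + 1])"
   unfolding map_map o_def by (rule map_cong[OF refl], rule eq[OF q]) (auto simp del: upt_Suc)
  then have "1 = vol N V' q (map (fscale (g q)) (map (%k. V (\<pi> k) q) [1..<nn + 1]))"
   using vol_basis[OF F' q] by (simp only:)
  also have "... = g q ^ nn * vol N V' q (map (%k. V (\<pi> k) q) [1..<nn + 1])"
   by (rule alt_fscale_all[OF vol_alt[OF F' q]]) (use wframe_ts[OF V in' q] in \<open>auto simp del: upt_Suc\<close>)
  also have "vol N V' q (map (%k. V (\<pi> k) q) [1..<nn + 1]) = u q * c"
   unfolding volu[OF q] c_def using vol_constant[OF V q p in'] by simp
  finally show ?thesis by (simp add: mult.assoc)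
 qed
 have nz: "c ~= 0" "u p ~= 0" "g p ~= 0"
  using ugc[OF p] g(2)[OF p] by auto
 have du: "w u * g p = - of_nat nn * u p * w g" if w: "w : TS p" for w
 proof -
  obtain m where m: "nn = Suc m" using nn_pos by (cases nn) auto
  have "w (%q. g q ^ nn * u q) = w (%q. inverse c)"
  proof (rule tv_cong[OF w an_mult[OF an_power[OF g(1)[OF p]] uan[OF p]]])
   show "\<forall>\<^sub>F q in nhds p. g q ^ nn * u q = inverse c"
    using eventually_nhds_in_open[OF oN p]
    by eventually_elim (use ugc nz(1) in \<open>simp add: field_simps\<close>)
  qed
  then have "g p ^ nn * w u + u p * (of_nat (Suc m) * g p ^ m * w g) = 0"
   using tv_mult[OF w an_power[OF g(1)[OF p]] uan[OF p], of nn] tv_const[OF w] tv_power[OF w g(1)[OF p], of m]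
   unfolding m by simp
  then have "g p ^ m * (w u * g p + of_nat nn * u p * w g) = 0"
   unfolding m by (simp add: algebra_simps)
  then have "w u * g p + of_nat nn * u p * w g = 0" using nz(3) by simp
  then show ?thesis by (simp add: add_eq_0_iff2)
 qed
 have dv: "u p * dvg V' X p = u p * dvg V X p + X p u" if X: "vf N X" for X
 proof -
  note x = vf_ts[OF X p]
  define Bs where "Bs = map V [1..<nn + 1]"
  have Bs: "map (%Y. Y q) Bs = B q" "length Bs = nn" "!!Y. Y : set Bs ==> vf N Y" for q
   using frame_vf[OF F] by (auto simp: Bs_def B_def simp del: upt_Suc)
  have one: "vol N V q (B q) = 1" if "q : N" for q unfolding B_def by (rule vol_basis[OF F that])
  let ?S = "\<Sum>i<length Bs. vol N V p ((B p)[i := lie X (Bs ! i) p])"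
  have "X p (%q. vol N V q (B q)) = X p (%q. 1)"
   by (rule tv_cong[OF x an_const, symmetric]) (use eventually_nhds_in_open[OF oN p] one in \<open>auto elim!: eventually_mono\<close>)
  then have 1: "dvg V X p = - ?S"
   using lie_vol[OF F X oN order_refl p Bs(2,3)] tv_const[OF x] unfolding lie_derivative_def Bs(1) one[OF p] by simp
  have "dvg V' X p * (u p * 1) = X p u - u p * ?S"
   using lie_vol[OF F' X oN order_refl p Bs(2,3)]
   unfolding lie_derivative_def Bs(1) u_def[symmetric] volu[OF p] one[OF p] by (simp add: sum_distrib_left)
  then show ?thesis using 1 by (simp add: algebra_simps)
 qed
 have on_frame: "om N V' p [V' mm p] = om N V p [V' mm p] - of_nat (nn - 1) * V' mm p g / g p" if mm: "mm : {1..nn + 1}" for mm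
 proof -
  define X where "X = V (\<pi> mm)"
  have X: "vf N X" unfolding X_def by (rule wframe_vf[OF V \<pi>[OF mm]])
  note V'mm = wframe_vf[OF V' mm]
  have e: "V' mm p = fscale (g p) (X p)" unfolding X_def by (rule eq[OF p mm])
  have eg: "V' mm p f = g p * X p f" for f unfolding e by simp
  have "dvg V (V' mm) p = dvg V (%q. fscale (g q) (X q)) p"
   unfolding X_def by (rule dvg_cong[OF V'mm oN p eq[OF _ mm] F])
  also have "... = g p * dvg V X p + X p g" by (rule dvg_fscale[OF F X g(1)[OF p] p])
  finally have 1: "dvg V (V' mm) p = g p * dvg V X p + X p g" .
  have "om N V p [V' mm p] = g p * dvg V X p"
   unfolding e using alt_1(2)[OF form_on_alt[OF om_form[OF F] p] vf_ts[OF X p], of "g p"]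
    om_wframe[OF V p \<pi>[OF mm]] by (simp only: X_def)
  moreover have "om N V' p [V' mm p] = dvg V' (V' mm) p" by (rule om_wframe[OF V' p mm])
  moreover have "u p * dvg V' (V' mm) p = u p * (g p * dvg V X p + X p g) + g p * X p u"
   using dv[OF V'mm] unfolding 1 eg .
  ultimately have "u p * (om N V' p [V' mm p] - om N V p [V' mm p]) = u p * X p g + X p u * g p"
   by (simp add: algebra_simps)
  also have "... = - u p * (of_nat nn - 1) * X p g"
   unfolding du[OF vf_ts[OF X p]] by (simp add: algebra_simps)
  also have "of_nat nn - 1 = (of_nat (nn - 1) :: 'k)" using nn_pos by (simp add: of_nat_diff)
  finally have "u p * (om N V' p [V' mm p] - om N V p [V' mm p]) = u p * (- of_nat (nn - 1) * X p g)"
   by (simp only: mult.assoc mult_minus_left mult_minus_right)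
  then have "om N V' p [V' mm p] - om N V p [V' mm p] = - of_nat (nn - 1) * X p g"
   by (rule mult_left_cancel[OF nz(2), THEN iffD1])
  then show ?thesis unfolding eg using nz(3) by (simp add: algebra_simps)
 qed
 note b' = frame_basis[OF F' p]
 let ?c = "fco V' p v"
 have ex: "v = (\<Sum>k=1..nn. fscale (?c k) (V' k p))" by (rule frame_coeff_expand[OF b' v])
 have lin: "om N W p [v] = (\<Sum>k=1..nn. ?c k * om N W p [V' k p])" if "frame N W" for W
  using alt_1(3)[OF form_on_alt[OF om_form[OF that] p], of "{1..nn}" "%k. V' k p" ?c] basis_atD[OF b'] ex by simp
 have vg: "v g = (\<Sum>k=1..nn. ?c k * V' k p g)"
  using fun_cong[OF ex, of g] by (simp only: sum_fun_apply fscale_apply)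
 have "om N V' p [v] = (\<Sum>k=1..nn. ?c k * om N V p [V' k p] - of_nat (nn - 1) * (?c k * V' k p g) / g p)"
  unfolding lin[OF F'] by (rule sum.cong[OF refl]) (simp add: on_frame algebra_simps)
 also have "... = om N V p [v] - of_nat (nn - 1) * v g / g p"
  unfolding lin[OF F] vg by (simp add: sum_subtractf sum_distrib_left sum_divide_distrib)
 finally show ?thesis .
qed

section \<open>The identity theorem for forms\<close>

text \<open>The interior of the zero set is closed: at a limit point the coefficients in a frame vanish with all
 their derivatives.\<close>

lemma form_identity:
 assumes K: "fon k UNIV K" and conn: "connected (UNIV :: 'a set)"
  and M: "open M" "M ~= {}" "!!q. q : M ==> K q = 0"
 shows "K = 0"
proof -
 define Z where "Z = {p. \<forall>\<^sub>F q in nhds p. K q = 0}"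
 have oZ: "open Z"
  unfolding open_subopen[of Z]
 proof
  fix p assume "p : Z"
  then have "\<forall>\<^sub>F q in nhds p. \<forall>\<^sub>F x in nhds q. K x = 0" unfolding Z_def by (simp add: eventually_eventually)
  then show "\<exists>T. open T & p : T & T \<subseteq> Z" unfolding Z_def eventually_nhds[of _ p] by blast
 qed
 have "open (- Z)"
  unfolding open_subopen[of "- Z"]
 proof (rule ccontr)
  assume "\<not> (\<forall>p\<in>- Z. \<exists>T. open T & p : T & T \<subseteq> - Z)"
  then obtain p where p0: "p : - Z" "\<not> (\<exists>T. open T & p : T & T \<subseteq> - Z)" by blast
  have p: "p \<notin> Z" using p0(1) by simp
  have acc: "\<exists>q\<in>T. q : Z" if "open T" "p : T" for T using p0(2) that by blast
  obtain D ph where c: "(D, ph) : \<A>" "p : D" by (rule chart_exists)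
  obtain M V where M: "p : M" "M \<subseteq> UNIV" and V: "frame M V" using frame_exists[OF open_UNIV UNIV_I[of p]] .
  note oM = frame_open[OF V]
  define S where "S = {g. an p g & (\<forall>\<^sub>F q in nhds p. q : Z --> g q = 0)}"
  have S0: "\<forall>\<^sub>F q in nhds p. g q = 0" if "g : S" for g
  proof (rule deriv_closed_eventually_0[OF c, of S])
   show "an p g" if "g : S" for g using that by (simp add: S_def)
   show "g p = 0" if "g : S" for g
   proof (rule an_limit_0)
    show "an p g" using that by (simp add: S_def)
    fix O' assume O': "open O'" "p : O'"
    obtain T where T: "open T" "p : T" "\<forall>q\<in>T. q : Z --> g q = 0"
     using \<open>g : S\<close> unfolding S_def eventually_nhds by blast
    then show "\<exists>q\<in>O'. g q = 0" using acc[of "O' \<inter> T"] O' by blast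
   qed
   fix g i assume g: "g : S"
   let ?X = "coord_field D ph i"
   have "an p (%q. ?X q g)"
    by (rule vf_an[OF coord_field_vf[OF c(1)] chart_open(1)[OF c(1)] c(2)]) (use g in \<open>simp add: S_def\<close>)
   moreover have "\<forall>\<^sub>F q in nhds p. q : Z --> ?X q g = 0"
   proof -
    have "\<forall>\<^sub>F q in nhds p. \<forall>\<^sub>F x in nhds q. x : Z --> g x = 0"
     using g by (simp add: S_def eventually_eventually)
    from eventually_conj[OF this eventually_in_chart[OF c]] show ?thesis
    proof eventually_elim
     case (elim q)
     show ?case
     proof
      assume "q : Z"
      from eventually_conj[OF conjunct1[OF elim] eventually_nhds_in_open[OF oZ this]]
      have "\<forall>\<^sub>F x in nhds q. 0 = g x" by (rule eventually_mono) auto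
      from tv_cong[OF coord_field_ts[OF c(1) conjunct2[OF elim]] an_const this, of i]
      show "?X q g = 0" using tv_const[OF coord_field_ts[OF c(1) conjunct2[OF elim]], of i 0] by simp
     qed
    qed
   qed
   ultimately show "\<exists>h\<in>S. \<forall>\<^sub>F q in nhds p. ?X q g = h q"
    by (intro bexI[of _ "%q. ?X q g"]) (auto simp: S_def)
  qed (rule that)
  have "\<forall>\<^sub>F q in nhds p. K q (map (%k. V k q) is) = 0" if "is : {is. set is \<subseteq> {1..nn} & length is = k}" for "is"
  proof (rule S0)
   have "an p (%q. K q (map (%X. X q) (map V is)))"
    by (rule form_on_an[OF K oM _ _ _ M(1)]) (use that frame_vf[OF V] in auto)
   moreover have "K q (map (%k. V k q) is) = 0" if "q : Z" for q
    using eventually_nhds_x_imp_x[of "%q. K q = 0" q] that by (simp add: Z_def)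
   ultimately show "(%q. K q (map (%k. V k q) is)) : S" by (simp add: S_def o_def)
  qed
  then have "\<forall>\<^sub>F q in nhds p. \<forall>is\<in>{is. set is \<subseteq> {1..nn} & length is = k}. K q (map (%k. V k q) is) = 0"
   by (subst eventually_ball_finite_distrib) (auto intro: finite_lists_length_eq)
  from eventually_conj[OF this eventually_nhds_in_open[OF oM M(1)]]
  have "\<forall>\<^sub>F q in nhds p. K q = 0"
  proof eventually_elim
   case (elim q)
   have "K q = (%vs. 0)"
    by (rule alt_basis_ext[OF form_on_alt[OF K UNIV_I] frame_basis[OF V conjunct2[OF elim]]]) (use elim in blast)
   then show ?case by (simp add: zero_fun_def)
  qed
  then show False using p by (simp add: Z_def)
 qed
 moreover have "Z ~= {}"
 proof -
  obtain p where p: "p : M" using M(2) by blast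
  have "p : Z" unfolding Z_def using eventually_nhds_in_open[OF M(1) p] M(3) by (auto elim!: eventually_mono)
  then show ?thesis by blast
 qed
 ultimately have "Z = UNIV" using connectedD[OF conn oZ, of "- Z"] by auto
 then have "K p = 0" for p
  using eventually_nhds_x_imp_x[of "%q. K q = 0" p] by (auto simp: Z_def)
 then show ?thesis by (simp add: fun_eq_iff)
qed

end

section \<open>Webs and the line bundle \<open>E\<close>\<close>

lemma fscale2_apply: "fscale2 c s L = fscale c (s L)"
 by (simp add: fscale2_def)

lemma fscale_fscale: "fscale c (fscale d v) = fscale (c * d) (v :: 'x => 'k::comm_ring_1)"
 by (rule ext) (simp add: fscale_def mult.assoc)

lemma fscale_1: "fscale 1 (v :: 'x => 'k::comm_ring_1) = v"
 by (rule ext) (simp add: fscale_def)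

lemma fscale_0: "fscale 0 (v :: 'x => 'k::comm_ring_1) = 0" "fscale c (0 :: 'x => 'k) = 0"
 by (rule ext, simp add: fscale_def)+

lemma range_fscale:
 assumes "(a :: 'k::field) ~= 0"
 shows "range (%c. fscale c (fscale a v)) = range (%c. fscale c v)"
proof (intro set_eqI iffI)
 fix w assume "w : range (%c. fscale c v)"
 then obtain c where "w = fscale c v" by blast
 then have "w = fscale (c / a) (fscale a v)" using assms by (simp only: fscale_fscale) simp
 then show "w : range (%c. fscale c (fscale a v))" by (rule range_eqI)
next
 fix w assume "w : range (%c. fscale c (fscale a v))"
 then obtain c where "w = fscale c (fscale a v)" by blast
 then have "w = fscale (c * a) v" by (simp only: fscale_fscale)
 then show "w : range (%c. fscale c v)" by (rule range_eqI)
qed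

locale web = manifold \<A>
 for \<A> :: "('a::{t2_space,second_countable_topology}, 'k::{real_normed_field,euclidean_space}, 'n::finite) atlas" +
 fixes W :: "'a => ('a, 'k) tvec set set"
 assumes n2: "mdim \<A> \<ge> 2" and web: "web_of_curves \<A> W" and conn: "connected (UNIV :: 'a set)"
begin

abbreviation "tsec \<equiv> tensor_section \<A> W"
abbreviation "lfr \<equiv> local_frame \<A> W"
abbreviation "glob \<equiv> global_connection \<A> W"
abbreviation "lcon \<equiv> local_connection \<A> W"
abbreviation "Efib \<equiv> E_fibre W"
abbreviation "dpow \<equiv> dual_power W"
abbreviation "Esec \<equiv> E_section \<A> W"
abbreviation "tfib \<equiv> tensor_fibre W"

abbreviation lo :: "'a set => (nat => 'a => ('a, 'k) tvec set) => bool" where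
 "lo \<equiv> local_ordering \<A> W"

lemma loD:
 assumes "lo N F"
 shows "open N" "mm : {1..nn + 1} ==> foliation \<A> N (F mm)" "general_position \<A> N F"
  "p : N ==> W p = (%mm. F mm p) ` {1..nn + 1}"
 using assms unfolding local_ordering_def by simp_all

lemma lo_subset:
 assumes F: "lo N F" and O': "open O'" "O' \<subseteq> N"
 shows "lo O' F"
 unfolding local_ordering_def
proof (intro conjI ballI O'(1))
 fix mm assume mm: "mm : {1..nn + 1}"
 show "foliation \<A> O' (F mm)"
  unfolding foliation_def
 proof
  fix p assume p: "p : O'"
  then have "p : N" using O' by blast
  from bspec[OF loD(2)[OF F mm, unfolded foliation_def] this]
  obtain M v where M: "open M" "p : M" "M \<subseteq> N" "vf M v"
   "\<forall>q\<in>M. v q ~= 0 & F mm q = range (%c. fscale c (v q))"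
   by (elim exE conjE)
  show "\<exists>M v. open M & p : M & M \<subseteq> O' & vf M v & (\<forall>q\<in>M. v q ~= 0 & F mm q = range (%c. fscale c (v q)))"
  proof (intro exI[of _ "M \<inter> O'"] exI[of _ v] conjI)
   show "open (M \<inter> O')" using M(1) O'(1) by auto
   show "vf (M \<inter> O') v" by (rule vf_subset[OF M(4)]) blast
   show "p : M \<inter> O'" using M(2) p by (rule IntI)
   show "M \<inter> O' \<subseteq> O'" by blast
   show "\<forall>q\<in>M \<inter> O'. v q ~= 0 & F mm q = range (%c. fscale c (v q))"
    by (intro ballI) (rule bspec[OF M(5)], blast)
  qed
 qed
next
 show "general_position \<A> O' F"
  unfolding general_position_def
 proof
  fix p assume "p : O'"
  then have "p : N" using O' by blast
  from bspec[OF loD(3)[OF F, unfolded general_position_def] this]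
  show "\<forall>v. (\<forall>mm\<in>{1..nn + 1}. F mm p = range (%c. fscale c (v mm))) -->
    (\<forall>I \<subseteq> {1..nn + 1}. card I = nn --> (\<forall>c. (\<Sum>mm\<in>I. fscale (c mm) (v mm)) = 0 --> (\<forall>mm\<in>I. c mm = 0)))" .
 qed
 show "W p = (%mm. F mm p) ` {1..nn + 1}" if "p : O'" for p
  by (rule loD(4)[OF F]) (use that O' in blast)
qed

lemma lo_exists: obtains N F where "p : N" "lo N F"
 using web unfolding web_of_curves_def by blast

text \<open>Rescale generators of the foliations so that their sum vanishes.\<close>

lemma local_wframe:
 assumes F: "lo N F" and p: "p : N"
 obtains O' V where "p : O'" "O' \<subseteq> N" "wframe O' V" "spans O' V F"
proof -
 have "\<forall>mm\<in>{1..nn + 1}. \<exists>M v. open M & p : M & M \<subseteq> N & vf M v \<and>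
   (\<forall>q\<in>M. v q ~= 0 & F mm q = range (%c. fscale c (v q)))"
  by (intro ballI) (rule bspec[OF loD(2)[OF F, unfolded foliation_def] p])
 from bchoice[OF this] obtain M where "\<forall>mm\<in>{1..nn + 1}. \<exists>v. open (M mm) & p : M mm & M mm \<subseteq> N & vf (M mm) v \<and>
   (\<forall>q\<in>M mm. v q ~= 0 & F mm q = range (%c. fscale c (v q)))" ..
 from bchoice[OF this] obtain v where v: "\<forall>mm\<in>{1..nn + 1}. open (M mm) & p : M mm & M mm \<subseteq> N & vf (M mm) (v mm) \<and>
   (\<forall>q\<in>M mm. v mm q ~= 0 & F mm q = range (%c. fscale c (v mm q)))" ..
 define O' where "O' = (\<Inter>mm\<in>{1..nn + 1}. M mm)"
 have one: "1 : {1..nn + 1}" by simp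
 have O': "open O'" "p : O'" "O' \<subseteq> N" "!!mm. mm : {1..nn + 1} ==> O' \<subseteq> M mm"
 proof -
  show "open O'" unfolding O'_def by (rule open_INT) (use v in auto)
  show "p : O'" unfolding O'_def using v by blast
  show s: "O' \<subseteq> M mm" if "mm : {1..nn + 1}" for mm unfolding O'_def using that by blast
  show "O' \<subseteq> N" using s[OF one] v one by blast
 qed
 have vv: "vf O' (v mm)" if "mm : {1..nn + 1}" for mm
  by (rule vf_subset[OF _ O'(4)[OF that]]) (use v that in blast)
 have vF: "F mm q = range (%c. fscale c (v mm q))" if "mm : {1..nn + 1}" "q : O'" for mm q
  using v that O'(4)[OF that(1)] by blast
 have gp: "c mm = 0" if q: "q : O'" and I: "I \<subseteq> {1..nn + 1}" "card I = nn" "(\<Sum>mm\<in>I. fscale (c mm) (v mm q)) = 0" "mm : I" for q I c mm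
 proof -
  have "q : N" using q O'(3) by blast
  from loD(3)[OF F, unfolded general_position_def, rule_format, OF this, of "%mm. v mm q" I c mm]
  show ?thesis using vF q I by blast
 qed
 have Fr: "frame O' v"
  unfolding frame_def basis_at_def
 proof (intro conjI ballI allI impI O'(1))
  show "vf O' (v k)" if "k : {1..nn}" for k using that by (intro vv) auto
  show "v k q : TS q" if "q : O'" "k : {1..nn}" for k q
   by (rule vf_ts[OF vv]) (use that in auto)
  show "c k = 0" if "q : O'" "(\<Sum>k=1..nn. fscale (c k) (v k q)) = 0" "k : {1..nn}" for q c k
   by (rule gp[OF that(1), of "{1..nn}"]) (use that in auto)
 qed
 have last: "nn + 1 : {1..nn + 1}" by simp
 define a where "a k q = fco v q (v (nn + 1) q) k" for k q
 have a_an: "an q (a k)" if "q : O'" for k q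
  unfolding a_def by (rule frame_coeff_an[OF Fr vv[OF last] O'(1) order_refl that])
 have ex: "v (nn + 1) q = (\<Sum>k=1..nn. fscale (a k q) (v k q))" if "q : O'" for q
  unfolding a_def by (rule frame_coeff_expand[OF frame_basis[OF Fr that] vf_ts[OF vv[OF last] that]])
 have a0: "a j q ~= 0" if q: "q : O'" and j: "j : {1..nn}" for j q
 proof
  assume 0: "a j q = 0"
  define c where "c mm = (if mm = nn + 1 then - 1 else a mm q)" for mm
  let ?I = "insert (nn + 1) ({1..nn} - {j})"
  have "(\<Sum>mm\<in>?I. fscale (c mm) (v mm q)) = fscale (c (nn + 1)) (v (nn + 1) q) + (\<Sum>mm\<in>{1..nn} - {j}. fscale (c mm) (v mm q))"
   by (rule sum.insert) auto
  also have "(\<Sum>mm\<in>{1..nn} - {j}. fscale (c mm) (v mm q)) = (\<Sum>mm\<in>{1..nn} - {j}. fscale (a mm q) (v mm q))"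
   by (rule sum.cong[OF refl]) (auto simp: c_def)
  also have "... = (\<Sum>mm=1..nn. fscale (a mm q) (v mm q))"
   using sum.remove[of "{1..nn}" j "%mm. fscale (a mm q) (v mm q)"] j 0 by (simp only: fscale_0(1)) simp
  also have "... = v (nn + 1) q" by (rule ex[OF q, symmetric])
  also have "fscale (c (nn + 1)) (v (nn + 1) q) + v (nn + 1) q = 0"
   by (simp only: c_def simp_thms if_True fscale_minus_1 left_minus)
  finally have "(\<Sum>mm\<in>?I. fscale (c mm) (v mm q)) = 0" .
  have "?I \<subseteq> {1..nn + 1}" by auto
  moreover have "card ?I = nn" using j by simp
  ultimately have "c (nn + 1) = 0" by (rule gp[OF q _ _ \<open>(\<Sum>mm\<in>?I. fscale (c mm) (v mm q)) = 0\<close>]) simp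
  then show False by (simp add: c_def)
 qed
 define V where "V mm q = (if mm = nn + 1 then fscale (- 1) (v mm q) else fscale (a mm q) (v mm q))" for mm q
 have Vk: "V k = (%q. fscale (a k q) (v k q))" if "k : {1..nn}" for k
  using that by (intro ext) (simp only: V_def, auto)
 have Vl: "V (nn + 1) = (%q. fscale (- 1) (v (nn + 1) q))"
  by (intro ext) (simp only: V_def simp_thms if_True)
 have "wframe O' V"
  unfolding wframe_def
 proof (intro conjI ballI)
  show "frame O' V"
   unfolding frame_def basis_at_def
  proof (intro conjI ballI allI impI O'(1))
   show vk: "vf O' (V k)" if "k : {1..nn}" for k
    unfolding Vk[OF that] by (rule vf_fscale[OF O'(1) vv a_an]) (use that in auto)
   show "V k q : TS q" if "q : O'" "k : {1..nn}" for k q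
    by (rule vf_ts[OF vk]) (use that in auto)
   fix q c k assume q: "q : O'" and 0: "(\<Sum>k=1..nn. fscale (c k) (V k q)) = 0" and k: "k : {1..nn}"
   have "(\<Sum>k=1..nn. fscale (c k * a k q) (v k q)) = (\<Sum>k=1..nn. fscale (c k) (V k q))"
    by (rule sum.cong[OF refl]) (simp only: Vk fscale_fscale)
   also have "... = 0" by (rule 0)
   finally have "c k * a k q = 0"
    using frame_basis[OF Fr q] k unfolding basis_at_def by (elim conjE allE[of _ "%k. c k * a k q"]) simp
   then show "c k = 0" using a0[OF q k] by simp
  qed
  show "vf O' (V (nn + 1))" unfolding Vl by (rule vf_fscale[OF O'(1) vv[OF last] an_const])
  show "V (nn + 1) q = - (\<Sum>k=1..nn. V k q)" if "q : O'" for q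
  proof -
   have "(\<Sum>k=1..nn. V k q) = (\<Sum>k=1..nn. fscale (a k q) (v k q))"
    by (rule sum.cong[OF refl]) (simp only: Vk)
   then show ?thesis unfolding Vl fscale_minus_1 using ex[OF that] by simp
  qed
 qed
 moreover have "spans O' V F"
  unfolding spans_def
 proof (intro ballI)
  fix q mm assume q: "q : O'" and mm: "mm : {1..nn + 1}"
  have "\<exists>b. b ~= 0 & V mm q = fscale b (v mm q)"
  proof (cases "mm = nn + 1")
   case True
   then show ?thesis unfolding V_def by (intro exI[of _ "- 1"]) simp
  next
   case False
   then have "mm : {1..nn}" using mm by auto
   from a0[OF q this] Vk[OF this] show ?thesis by (intro exI[of _ "a mm q"]) simp
  qed
  then obtain b where b: "b ~= 0" "V mm q = fscale b (v mm q)" by (elim exE conjE)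
  show "F mm q = range (%c. fscale c (V mm q))" unfolding vF[OF mm q] b(2) by (rule range_fscale[OF b(1), symmetric])
 qed
 ultimately show thesis by (intro that[OF O'(2,3)])
qed

text \<open>Membership in a line, as the vanishing of functions that are analytic along a vector field.\<close>

lemma line_membership:
 assumes V: "wframe N V" and F: "spans N V F" and p: "p : N" and mm: "mm : {1..nn + 1}" and w: "w : TS p"
 shows "w : F mm p \<longleftrightarrow> (\<forall>k\<in>{1..nn}. fco V p w k - lc V mm p w * cst k mm = 0)"
proof
 note b = frame_basis[OF wframe_frame[OF V] p]
 assume "w : F mm p"
 then obtain c where c: "w = fscale c (V mm p)" using spansD[OF F p mm] by blast
 show "\<forall>k\<in>{1..nn}. fco V p w k - lc V mm p w * cst k mm = 0"
 proof
  fix k assume k: "k : {1..nn}"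
  have "fco V p w k = c * cst k mm"
   unfolding c using frame_coeff_fscale[OF b wframe_ts[OF V mm p]] frame_coeff_wframe[OF V p mm k] by simp
  moreover have "lc V mm p w = c" unfolding c by (rule lc_fscale[OF V p mm])
  ultimately show "fco V p w k - lc V mm p w * cst k mm = 0" by simp
 qed
next
 note b = frame_basis[OF wframe_frame[OF V] p]
 assume eq: "\<forall>k\<in>{1..nn}. fco V p w k - lc V mm p w * cst k mm = 0"
 have "w = (\<Sum>k=1..nn. fscale (fco V p w k) (V k p))" by (rule frame_coeff_expand[OF b w])
 also have "... = (\<Sum>k=1..nn. fscale (lc V mm p w) (fscale (cst k mm) (V k p)))"
  by (rule sum.cong[OF refl]) (use eq in \<open>simp only: fscale_fscale, simp\<close>)
 also have "... = fscale (lc V mm p w) (\<Sum>k=1..nn. fscale (cst k mm) (V k p))"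
  by (rule ext) (simp add: sum_fun_apply sum_distrib_left)
 also have "(\<Sum>k=1..nn. fscale (cst k mm) (V k p)) = V mm p"
 proof -
  have "V mm p = (\<Sum>k=1..nn. fscale (fco V p (V mm p) k) (V k p))"
   by (rule frame_coeff_expand[OF b wframe_ts[OF V mm p]])
  also have "... = (\<Sum>k=1..nn. fscale (cst k mm) (V k p))"
   by (rule sum.cong[OF refl]) (simp only: frame_coeff_wframe[OF V p mm])
  finally show ?thesis ..
 qed
 finally show "w : F mm p" unfolding spansD[OF F p mm] by (rule range_eqI)
qed

lemma other_index: "\<exists>k\<in>{1..nn}. k ~= mm"
 by (rule bexI[of _ "if mm = 1 then 2 else 1"]) (use n2 in auto)

lemma lines_distinct:
 assumes V: "wframe N V" and F: "spans N V F" and p: "p : N"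
 shows "inj_on (%mm. F mm p) {1..nn + 1}"
proof (rule inj_onI)
 fix mm \<nu> assume mm: "mm : {1..nn + 1}" and \<nu>: "\<nu> : {1..nn + 1}" and eq: "F mm p = F \<nu> p"
 have "V mm p : F \<nu> p" unfolding eq[symmetric] spansD[OF F p mm] by (rule range_eqI[of _ _ 1]) (simp only: fscale_1)
 then have *: "cst k mm = lc V \<nu> p (V mm p) * cst k \<nu>" if "k : {1..nn}" for k
  using line_membership[OF V F p \<nu> wframe_ts[OF V mm p]] frame_coeff_wframe[OF V p mm that] that by simp
 show "mm = \<nu>"
 proof (rule ccontr)
  assume ne: "mm ~= \<nu>"
  define c where "c = lc V \<nu> p (V mm p)"
  consider "mm : {1..nn}" "\<nu> : {1..nn}" | "mm : {1..nn}" "\<nu> = nn + 1" | "mm = nn + 1" "\<nu> : {1..nn}"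
   using mm \<nu> ne by fastforce
  then show False
  proof cases
   case 1
   then show ?thesis using *[of mm] ne by (auto simp: cst_def)
  next
   case 2
   obtain k where k: "k : {1..nn}" "k ~= mm"
    using other_index[of mm] by (elim bexE)
   have "c = 0" using *[OF k(1)] k 2 by (auto simp: cst_def c_def)
   then show ?thesis using *[OF 2(1)] 2 by (auto simp: cst_def c_def)
  next
   case 3
   obtain k where k: "k : {1..nn}" "k ~= \<nu>"
    using other_index[of \<nu>] by (elim bexE)
   then show ?thesis using *[OF k(1)] 3 by (auto simp: cst_def)
  qed
 qed
qed

text \<open>Two orderings of the web differ near a point by a fixed permutation: a line depends continuously
 on the point and the \<open>n + 1\<close> lines stay distinct.\<close>

lemma ordering_change:
 assumes F: "lo N F" and F': "lo N' F'" and p: "p : N" "p : N'"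
 obtains O' \<pi> where "open O'" "p : O'" "O' \<subseteq> N \<inter> N'" "!!mm. mm : {1..nn + 1} ==> \<pi> mm : {1..nn + 1}"
  "!!mm q. mm : {1..nn + 1} ==> q : O' ==> F' mm q = F (\<pi> mm) q"
proof -
 obtain M V where M: "p : M" "M \<subseteq> N" and V: "wframe M V" "spans M V F" by (rule local_wframe[OF F p(1)])
 obtain M' V' where M': "p : M'" "M' \<subseteq> N'" and V': "wframe M' V'" "spans M' V' F'" by (rule local_wframe[OF F' p(2)])
 note oM = frame_open[OF wframe_frame[OF V(1)]] and oM' = frame_open[OF wframe_frame[OF V'(1)]]
 let ?J = "{1..nn + 1}"
 have same: "(%mm. F' mm q) ` ?J = (%mm. F mm q) ` ?J" if "q : N" "q : N'" for q
  using loD(4)[OF F that(1)] loD(4)[OF F' that(2)] by simp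
 have "\<forall>mm\<in>?J. \<exists>\<nu>. \<nu> : ?J & F' mm p = F \<nu> p"
 proof
  fix mm assume "mm : ?J"
  then have "F' mm p : (%mm. F mm p) ` ?J" unfolding same[OF p, symmetric] by (rule imageI)
  then show "\<exists>\<nu>. \<nu> : ?J & F' mm p = F \<nu> p" by blast
 qed
 from bchoice[OF this] obtain \<pi> where \<pi>: "\<forall>mm\<in>?J. \<pi> mm : ?J & F' mm p = F (\<pi> mm) p" ..
 have o: "open (M \<inter> M')" "p : M \<inter> M'" using oM oM' M(1) M'(1) by auto
 have own: "V' mm q : F' mm q" if "mm : ?J" "q : M'" for mm q
  unfolding spansD[OF V'(2) that(2,1)] by (rule range_eqI[of _ _ 1]) (simp only: fscale_1)
 have "\<forall>\<^sub>F q in nhds p. V' mm q \<notin> F \<nu> q" if mm: "mm : ?J" and \<nu>: "\<nu> : ?J" "\<nu> ~= \<pi> mm" for mm \<nu>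
 proof -
  have v': "vf (M \<inter> M') (V' mm)" by (rule vf_subset[OF wframe_vf[OF V'(1) mm]]) blast
  have "V' mm p \<notin> F \<nu> p"
  proof
   assume in\<nu>: "V' mm p : F \<nu> p"
   have in\<pi>: "V' mm p : F (\<pi> mm) p" using own[OF mm M'(1)] \<pi> mm by simp
   have \<pi>mm: "\<pi> mm : ?J" using \<pi> mm by blast
   obtain c d where c: "V' mm p = fscale c (V \<nu> p)" and d: "V' mm p = fscale d (V (\<pi> mm) p)"
    using in\<nu> in\<pi> spansD[OF V(2) M(1) \<nu>(1)] spansD[OF V(2) M(1) \<pi>mm] by blast
   have nz: "c ~= 0" "d ~= 0"
    using wframe_nonzero[OF V'(1) M'(1) mm] c d fscale_0(1) by metis+
   have "F \<nu> p = range (%e. fscale e (V' mm p))"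
    unfolding spansD[OF V(2) M(1) \<nu>(1)] c by (rule range_fscale[OF nz(1), symmetric])
   also have "... = F (\<pi> mm) p"
    unfolding spansD[OF V(2) M(1) \<pi>mm] d by (rule range_fscale[OF nz(2)])
   finally show False using inj_onD[OF lines_distinct[OF V M(1)] _ \<nu>(1) \<pi>mm] \<nu>(2) by blast
  qed
  then obtain k where k: "k : {1..nn}" "fco V p (V' mm p) k - lc V \<nu> p (V' mm p) * cst k \<nu> ~= 0"
   using line_membership[OF V M(1) \<nu>(1) wframe_ts[OF V'(1) mm M'(1)]] by blast
  have fc: "an p (%q. fco V q (V' mm q) k)" for k
   by (rule frame_coeff_an[OF wframe_frame[OF V(1)] v' o(1) _ o(2)]) blast
  have "an p (%q. lc V \<nu> q (V' mm q))"
   unfolding lc_def using fc[of 1] fc[of \<nu>] by (cases "\<nu> = nn + 1") (simp_all add: an_uminus)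
  then have "an p (%q. fco V q (V' mm q) k - lc V \<nu> q (V' mm q) * cst k \<nu>)"
   by (intro an_diff an_mult an_const fc)
  from eventually_conj[OF an_eventually_nonzero[OF this k(2)] eventually_nhds_in_open[OF o]]
  show ?thesis
  proof eventually_elim
   case (elim q)
   then have q: "q : M" "q : M'" by auto
   show ?case using line_membership[OF V q(1) \<nu>(1) wframe_ts[OF V'(1) mm q(2)]] k(1) elim by blast
  qed
 qed
 then have "\<forall>\<^sub>F q in nhds p. \<nu> ~= \<pi> mm --> V' mm q \<notin> F \<nu> q" if "mm : ?J" "\<nu> : ?J" for mm \<nu>
  using that by (cases "\<nu> = \<pi> mm") simp_all
 then have "\<forall>\<^sub>F q in nhds p. \<forall>mm\<in>?J. \<forall>\<nu>\<in>?J. \<nu> ~= \<pi> mm --> V' mm q \<notin> F \<nu> q"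
  by (intro eventually_ball_finite finite_atLeastAtMost ballI)
 from eventually_conj[OF this eventually_nhds_in_open[OF o]]
 obtain O' where O': "open O'" "p : O'" "\<forall>q\<in>O'. (\<forall>mm\<in>?J. \<forall>\<nu>\<in>?J. \<nu> ~= \<pi> mm --> V' mm q \<notin> F \<nu> q) & q : M \<inter> M'"
  unfolding eventually_nhds by blast
 show thesis
 proof (rule that[OF O'(1,2), of \<pi>])
  show "O' \<subseteq> N \<inter> N'" using O'(3) M(2) M'(2) by blast
  show "\<pi> mm : ?J" if "mm : ?J" for mm using \<pi> that by blast
  fix mm q assume mm: "mm : ?J" and q: "q : O'"
  have qM: "q : M" "q : M'" using O'(3) q by auto
  have "F' mm q : (%mm. F mm q) ` ?J"
   unfolding same[OF subsetD[OF M(2) qM(1)] subsetD[OF M'(2) qM(2)], symmetric] using mm by (rule imageI)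
  then obtain \<nu> where \<nu>: "\<nu> : ?J" "F' mm q = F \<nu> q" by blast
  have "V' mm q : F \<nu> q" unfolding \<nu>(2)[symmetric] by (rule own[OF mm qM(2)])
  then have "\<nu> = \<pi> mm" using O'(3) q mm \<nu>(1) by blast
  then show "F' mm q = F (\<pi> mm) q" using \<nu>(2) by simp
 qed
qed

lemma E_fibreD:
 assumes "s : Efib p"
 shows "L : W p ==> s L : L" "L \<notin> W p ==> s L = 0" "(\<Sum>L\<in>W p. s L) = 0"
 using assms unfolding E_fibre_def by simp_all

definition sec :: "(nat => 'a => ('a, 'k) tvec set) => (nat => 'a => ('a, 'k) tvec) => 'a => ('a, 'k) evec" where
 "sec F V p L = (if L : (%mm. F mm p) ` {1..nn + 1} then V (inv_into {1..nn + 1} (%mm. F mm p) L) p else 0)"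

context
 fixes M V N F assumes V: "wframe M V" "spans M V F" and F: "lo N F" and MN: "M \<subseteq> N"
begin

lemma sec_line: "p : M ==> mm : {1..nn + 1} ==> sec F V p (F mm p) = V mm p"
 unfolding sec_def using inv_into_f_f[OF lines_distinct[OF V]] by simp

lemma sum_over_lines:
 assumes p: "p : M"
 shows "(\<Sum>L\<in>W p. s L) = (\<Sum>mm=1..nn + 1. s (F mm p))"
proof -
 have pN: "p : N" using p MN by blast
 show ?thesis unfolding loD(4)[OF F pN] by (rule sum.reindex_cong[OF lines_distinct[OF V p]]) simp_all
qed

lemma sec_E_fibre:
 assumes p: "p : M"
 shows "sec F V p : Efib p"
proof -
 have pN: "p : N" using p MN by blast
 have "(\<Sum>L\<in>W p. sec F V p L) = (\<Sum>mm=1..nn + 1. V mm p)"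
  unfolding sum_over_lines[OF p] by (rule sum.cong[OF refl]) (rule sec_line[OF p])
 also have "... = 0" using wframe_last[OF V(1) p] by simp
 finally have "(\<Sum>L\<in>W p. sec F V p L) = 0" .
 moreover have "sec F V p L : L" if L: "L : W p" for L
 proof -
  obtain mm where mm: "mm : {1..nn + 1}" "L = F mm p" using L unfolding loD(4)[OF F pN] by blast
  show ?thesis unfolding mm(2) sec_line[OF p mm(1)] unfolding spansD[OF V(2) p mm(1)]
   by (rule range_eqI[of _ _ 1]) (simp only: fscale_1)
 qed
 moreover have "sec F V p L = 0" if "L \<notin> W p" for L
  unfolding sec_def loD(4)[OF F pN, symmetric] by (rule if_not_P[OF that])
 ultimately show ?thesis unfolding E_fibre_def by blast
qed

text \<open>Linear relations among \<open>V 1, ..., V (n + 1)\<close> are multiples of the one with coefficients 1.\<close>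

lemma E_fibre_wframe:
 assumes p: "p : M"
 shows "Efib p = range (%c. fscale2 c (sec F V p))"
proof (intro set_eqI iffI)
 have pN: "p : N" using p MN by blast
 note b = frame_basis[OF wframe_frame[OF V(1)] p]
 fix s assume s: "s : Efib p"
 have "\<forall>mm\<in>{1..nn + 1}. \<exists>c. s (F mm p) = fscale c (V mm p)"
 proof
  fix mm assume mm: "mm : {1..nn + 1}"
  have "F mm p : W p" unfolding loD(4)[OF F pN] using mm by (rule imageI)
  from E_fibreD(1)[OF s this] show "\<exists>c. s (F mm p) = fscale c (V mm p)" unfolding spansD[OF V(2) p mm] by blast
 qed
 from bchoice[OF this] obtain c where c: "\<forall>mm\<in>{1..nn + 1}. s (F mm p) = fscale (c mm) (V mm p)" ..
 define d where "d = c (nn + 1)"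
 have "0 = (\<Sum>mm=1..nn + 1. s (F mm p))" using E_fibreD(3)[OF s] unfolding sum_over_lines[OF p] ..
 also have "... = (\<Sum>mm=1..nn. s (F mm p)) + s (F (nn + 1) p)" by simp
 also have "(\<Sum>mm=1..nn. s (F mm p)) = (\<Sum>mm=1..nn. fscale (c mm) (V mm p))"
  by (rule sum.cong[OF refl]) (use c in auto)
 also have "s (F (nn + 1) p) = fscale d (V (nn + 1) p)" using c by (simp add: d_def)
 also have "... = - (\<Sum>mm=1..nn. fscale d (V mm p))"
  unfolding wframe_last[OF V(1) p] by (rule ext) (simp add: sum_fun_apply sum_distrib_left)
 finally have "(\<Sum>mm=1..nn. fscale (c mm) (V mm p)) = (\<Sum>mm=1..nn. fscale d (V mm p))"
  by (simp only: add_uminus_conv_diff eq_commute[of 0] right_minus_eq)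
 from basis_unique[OF b this] have cd: "c mm = d" if "mm : {1..nn + 1}" for mm
  using that by (cases "mm = nn + 1") (auto simp: d_def)
 have "s = fscale2 d (sec F V p)"
 proof
  fix L
  show "s L = fscale2 d (sec F V p) L"
  proof (cases "L : W p")
   case True
   then obtain mm where mm: "mm : {1..nn + 1}" "L = F mm p" unfolding loD(4)[OF F pN] by blast
   show ?thesis unfolding mm(2) fscale2_apply sec_line[OF p mm(1)] using c cd mm(1) by simp
  next
   case False
   show ?thesis
    unfolding fscale2_apply E_fibreD(2)[OF s False] E_fibreD(2)[OF sec_E_fibre[OF p] False] fscale_0(2) ..
  qed
 qed
 then show "s : range (%c. fscale2 c (sec F V p))" by (rule range_eqI)
next
 fix s assume "s : range (%c. fscale2 c (sec F V p))"
 then obtain c where s: "s = fscale2 c (sec F V p)" by blast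
 have pN: "p : N" using p MN by blast
 note sf = sec_E_fibre[OF p]
 have "(\<Sum>L\<in>W p. s L) = fscale c (\<Sum>L\<in>W p. sec F V p L)"
  unfolding s fscale2_apply by (rule ext) (simp add: sum_fun_apply sum_distrib_left)
 then have "(\<Sum>L\<in>W p. s L) = 0" unfolding E_fibreD(3)[OF sf] fscale_0(2) .
 moreover have "s L : L" if L: "L : W p" for L
 proof -
  obtain mm where mm: "mm : {1..nn + 1}" "L = F mm p" using L unfolding loD(4)[OF F pN] by blast
  show ?thesis unfolding mm(2) s fscale2_apply sec_line[OF p mm(1)] unfolding spansD[OF V(2) p mm(1)] by (rule rangeI)
 qed
 moreover have "s L = 0" if "L \<notin> W p" for L
  unfolding s fscale2_apply E_fibreD(2)[OF sf that] fscale_0(2) ..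
 ultimately show "s : Efib p" unfolding E_fibre_def by blast
qed

lemma sec_nonzero: "p : M ==> sec F V p ~= 0"
proof
 assume p: "p : M" and 0: "sec F V p = 0"
 have one: "1 : {1..nn + 1}" by simp
 show False using sec_line[OF p one] wframe_nonzero[OF V(1) p one] unfolding 0 by simp
qed

text \<open>One ordering suffices, because any other one is locally a permutation of it.\<close>

lemma E_section_criterion:
 assumes s: "!!p. p : M ==> s p : Efib p" and vf: "!!mm. mm : {1..nn + 1} ==> vf M (%p. s p (F mm p))"
 shows "Esec M s"
 unfolding E_section_def
proof (intro conjI ballI allI impI s)
 fix O' F' mm assume O': "O' \<subseteq> M" and F': "lo O' F'" and mm: "mm : {1..nn + 1}"
 show "vf O' (cfs F' s mm)"
 proof (rule vf_local)
  fix p assume p: "p : O'"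
  then have pN: "p : N" using O' MN by blast
  obtain Q \<pi> where Q: "open Q" "p : Q" "Q \<subseteq> N \<inter> O'" "!!mm. mm : {1..nn + 1} ==> \<pi> mm : {1..nn + 1}"
   "!!mm q. mm : {1..nn + 1} ==> q : Q ==> F' mm q = F (\<pi> mm) q"
   by (rule ordering_change[OF F F' pN p]) blast
  show "\<exists>Q Y. open Q & p : Q & vf Q Y & (\<forall>q\<in>Q. cfs F' s mm q = Y q)"
  proof (intro exI conjI ballI)
   show "vf Q (%p. s p (F (\<pi> mm) p))" by (rule vf_subset[OF vf[OF Q(4)[OF mm]]]) (use Q(3) O' in blast)
   show "cfs F' s mm q = s q (F (\<pi> mm) q)" if "q : Q" for q
    unfolding component_fields_def Q(5)[OF mm that] ..
  qed (rule Q(1,2))+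
 qed
qed

lemma sec_E_section: "Esec M (sec F V)"
proof (rule E_section_criterion[OF sec_E_fibre])
 fix mm assume mm: "mm : {1..nn + 1}"
 note oM = frame_open[OF wframe_frame[OF V(1)]]
 show "vf M (%p. sec F V p (F mm p))"
 proof (rule vf_local)
  fix p assume p: "p : M"
  show "\<exists>O' Y. open O' & p : O' & vf O' Y & (\<forall>q\<in>O'. sec F V q (F mm q) = Y q)"
   by (intro exI[of _ M] exI[of _ "V mm"] conjI ballI oM p wframe_vf[OF V(1) mm] sec_line[OF _ mm])
 qed
qed

end

lemma local_frameD:
 assumes "lfr N F sg"
 shows "open N" "connected N" "N ~= {}" "lo N F" "Esec N sg" "p : N ==> sg p ~= 0"
 using assms unfolding local_frame_def by simp_all

lemma E_sectionD:
 assumes "Esec N s"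
 shows "p : N ==> s p : Efib p"
  "O' \<subseteq> N ==> lo O' F ==> mm : {1..nn + 1} ==> vf O' (cfs F s mm)"
 using assms unfolding E_section_def by simp_all

lemma E_section_subset:
 assumes s: "Esec N s" and O': "O' \<subseteq> N"
 shows "Esec O' s"
 unfolding E_section_def
proof (intro conjI ballI allI impI)
 show "s p : Efib p" if "p : O'" for p by (rule E_sectionD(1)[OF s subsetD[OF O' that]])
 fix M F mm assume M: "M \<subseteq> O'" and F: "lo M F" and mm: "mm : {1..nn + 1}"
 show "vf M (cfs F s mm)" by (rule E_sectionD(2)[OF s order_trans[OF M O'] F mm])
qed

lemma local_frame_subset:
 assumes lf: "lfr N F sg" and O': "open O'" "connected O'" "O' ~= {}" "O' \<subseteq> N"
 shows "lfr O' F sg"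
 unfolding local_frame_def
proof (intro conjI ballI O'(1-3))
 show "lo O' F" by (rule lo_subset[OF local_frameD(4)[OF lf] O'(1,4)])
 show "Esec O' sg" by (rule E_section_subset[OF local_frameD(5)[OF lf] O'(4)])
 show "sg p ~= 0" if "p : O'" for p by (rule local_frameD(6)[OF lf subsetD[OF O'(4) that]])
qed

lemma local_frame_exists:
 assumes F: "lo N F" and p: "p : N"
 obtains O' sg where "p : O'" "O' \<subseteq> N" "lfr O' F sg"
proof -
 obtain M V where M: "p : M" "M \<subseteq> N" and V: "wframe M V" "spans M V F" by (rule local_wframe[OF F p])
 obtain O' where O': "open O'" "connected O'" "p : O'" "O' \<subseteq> M"
  by (rule connected_nhd[OF frame_open[OF wframe_frame[OF V(1)]] M(1)])
 have "O' \<subseteq> N" using O'(4) M(2) by blast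
 moreover have "lfr O' F (sec F V)"
  unfolding local_frame_def
 proof (intro conjI ballI O'(1,2))
  show "O' ~= {}" using O'(3) by blast
  show "lo O' F" by (rule lo_subset[OF F O'(1) \<open>O' \<subseteq> N\<close>])
  show "Esec O' (sec F V)" by (rule E_section_subset[OF sec_E_section[OF V F M(2)] O'(4)])
  show "sec F V q ~= 0" if "q : O'" for q by (rule sec_nonzero[OF V F M(2)]) (use that O'(4) in blast)
 qed
 ultimately show thesis by (rule that[OF O'(3)])
qed

lemma local_frame_wframe:
 assumes lf: "lfr N F sg"
 shows "wframe N (cfs F sg)" "spans N (cfs F sg) F"
  "!!p. p : N ==> Efib p = range (%c. fscale2 c (sg p))"
proof -
 note F = local_frameD(4)[OF lf] and oN = local_frameD(1)[OF lf] and sg = local_frameD(5)[OF lf]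
 let ?V = "cfs F sg"
 have loc: "\<exists>M U c. p : M & M \<subseteq> N & wframe M U & spans M U F & c ~= 0 & sg p = fscale2 c (sec F U p) \<and>
   (\<forall>mm\<in>{1..nn + 1}. ?V mm p = fscale c (U mm p))" if p: "p : N" for p
 proof -
  obtain M U where M: "p : M" "M \<subseteq> N" and U: "wframe M U" "spans M U F" by (rule local_wframe[OF F p])
  obtain c where c: "sg p = fscale2 c (sec F U p)"
   using E_sectionD(1)[OF sg p] unfolding E_fibre_wframe[OF U F M(2,1)] by blast
  have "c ~= 0"
  proof
   assume "c = 0"
   then have "sg p = 0" unfolding c by (intro ext) (simp add: fscale2_apply fscale_0)
   then show False using local_frameD(6)[OF lf p] by blast
  qed
  moreover have "?V mm p = fscale c (U mm p)" if "mm : {1..nn + 1}" for mm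
   unfolding component_fields_def c fscale2_apply sec_line[OF U F M(2,1) that] ..
  ultimately show ?thesis
   by (intro exI[of _ M] exI[of _ U] exI[of _ c] conjI ballI M U c)
 qed
 have vf: "vf N (?V mm)" if "mm : {1..nn + 1}" for mm by (rule E_sectionD(2)[OF sg order_refl F that])
 show "spans N ?V F"
  unfolding spans_def
 proof (intro ballI)
  fix p mm assume p: "p : N" and mm: "mm : {1..nn + 1}"
  obtain M U c where M: "p : M" "spans M U F" "c ~= 0" "\<forall>mm\<in>{1..nn + 1}. ?V mm p = fscale c (U mm p)"
   using loc[OF p] by (elim exE conjE)
  have e: "?V mm p = fscale c (U mm p)" using M(4) mm by blast
  show "F mm p = range (%c. fscale c (?V mm p))"
   unfolding spansD[OF M(2,1) mm] e by (rule range_fscale[OF M(3), symmetric])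
 qed
 show "Efib p = range (%c. fscale2 c (sg p))" if p: "p : N" for p
 proof -
  obtain M U c where M: "p : M" "M \<subseteq> N" "wframe M U" "spans M U F" "c ~= 0" "sg p = fscale2 c (sec F U p)"
   using loc[OF p] by (elim exE conjE)
  have f2: "fscale2 a (fscale2 c s) = fscale2 (a * c) s" for a and s :: "('a, 'k) evec"
   by (rule ext) (simp only: fscale2_apply fscale_fscale)
  show ?thesis
   unfolding E_fibre_wframe[OF M(3,4) F M(2,1)] M(6) f2
  proof (intro set_eqI iffI)
   fix s assume "s : range (%a. fscale2 a (sec F U p))"
   then obtain a where "s = fscale2 a (sec F U p)" by blast
   then have "s = fscale2 (a / c * c) (sec F U p)" using M(5) by simp
   then show "s : range (%a. fscale2 (a * c) (sec F U p))" by (rule range_eqI)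
  qed blast
 qed
 show "wframe N ?V"
  unfolding wframe_def frame_def basis_at_def
 proof (intro conjI ballI allI impI oN)
  show "vf N (?V k)" if "k : {1..nn}" for k by (rule vf) (use that in auto)
  show "vf N (?V (nn + 1))" by (rule vf) simp
  show "?V k p : TS p" if "p : N" "k : {1..nn}" for p k by (rule vf_ts[OF vf]) (use that in auto)
  fix p assume p: "p : N"
  obtain M U c where M: "p : M" "wframe M U" "c ~= 0" "\<forall>mm\<in>{1..nn + 1}. ?V mm p = fscale c (U mm p)"
   using loc[OF p] by (elim exE conjE)
  have e: "?V k p = fscale c (U k p)" if "k : {1..nn}" for k using M(4) that by auto
  show "?V (nn + 1) p = - (\<Sum>k=1..nn. ?V k p)"
  proof -
   have "?V (nn + 1) p = fscale c (U (nn + 1) p)" using M(4) by simp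
   also have "... = - (\<Sum>k=1..nn. fscale c (U k p))"
    unfolding wframe_last[OF M(2,1)] by (rule ext) (simp add: sum_fun_apply sum_distrib_left)
   also have "(\<Sum>k=1..nn. fscale c (U k p)) = (\<Sum>k=1..nn. ?V k p)"
    by (rule sum.cong[OF refl]) (rule e[symmetric])
   finally show ?thesis .
  qed
  fix d k assume 0: "(\<Sum>k=1..nn. fscale (d k) (?V k p)) = 0" and k: "k : {1..nn}"
  have "(\<Sum>k=1..nn. fscale (d k * c) (U k p)) = (\<Sum>k=1..nn. fscale (d k) (?V k p))"
   by (rule sum.cong[OF refl]) (simp only: e fscale_fscale)
  then have s0: "(\<Sum>k=1..nn. fscale (d k * c) (U k p)) = 0" unfolding 0 .
  have "d k * c = 0"
   by (rule bspec[OF mp[OF spec[OF conjunct2[OF frame_basis[OF wframe_frame[OF M(2)] M(1), unfolded basis_at_def]],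
       of "%k. d k * c"] s0] k])
  then show "d k = 0" using M(3) by simp
 qed
qed

section \<open>Tensor powers of the dual bundle\<close>

text \<open>The coordinate of an element of the fibre with respect to the section \<open>sg\<close>.\<close>

definition ec :: "(nat => 'a => ('a, 'k) tvec set) => ('a => ('a, 'k) evec) => 'a => ('a, 'k) evec => 'k" where
 "ec F sg p s = lc (cfs F sg) 1 p (s (F 1 p))"

lemma tensor_fibreD:
 assumes "h : tfib k p"
 shows "(\<forall>vs i x y c. length vs = k --> set vs \<subseteq> Efib p --> i < k --> x : Efib p --> y : Efib p -->
    h (vs[i := x + y]) = h (vs[i := x]) + h (vs[i := y]) \<and>
    h (vs[i := fscale2 c x]) = c * h (vs[i := x])) \<and>
  (\<forall>vs. \<not> (length vs = k & set vs \<subseteq> Efib p) --> h vs = 0)"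
 using assms unfolding tensor_fibre_def multilinear_on_def by simp

lemmas tensor_slot = tensor_fibreD[THEN conjunct1, rule_format]
lemmas tensor_outside = tensor_fibreD[THEN conjunct2, rule_format]

lemma tensor_fibre_fscale:
 assumes h: "h : tfib k p"
 shows "fscale c h : tfib k p"
 unfolding tensor_fibre_def multilinear_on_def mem_Collect_eq
proof (intro conjI allI impI)
 fix vs i x y d
 assume *: "length vs = k" "set vs \<subseteq> Efib p" "i < k" "x : Efib p" "y : Efib p"
 show "fscale c h (vs[i := x + y]) = fscale c h (vs[i := x]) + fscale c h (vs[i := y])"
  unfolding fscale_apply conjunct1[OF tensor_slot[OF h *]] by (rule distrib_left)
 show "fscale c h (vs[i := fscale2 d x]) = d * fscale c h (vs[i := x])"
  unfolding fscale_apply conjunct2[OF tensor_slot[OF h *]] by (rule mult.left_commute)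
next
 fix vs :: "('a, 'k) evec list" assume "\<not> (length vs = k & set vs \<subseteq> Efib p)"
 then show "fscale c h vs = 0" unfolding fscale_apply by (subst tensor_outside[OF h]) simp_all
qed

lemma tensor_sectionD:
 assumes "tsec k N h"
 shows "p : N ==> h p : tfib k p" "p \<notin> N ==> h p = 0"
  "open O' ==> O' \<subseteq> N ==> length ss = k ==> (!!s. s : set ss ==> Esec O' s) ==> p : O' ==>
   an p (%p. h p (map (%s. s p) ss))"
 using assms unfolding tensor_section_def mfd_analytic_def by simp_all

context
 fixes N F sg assumes lf: "lfr N F sg"
begin

lemma ec_fscale2:
 assumes p: "p : N"
 shows "ec F sg p (fscale2 c (sg p)) = c"
proof -
 have one: "1 : {1..nn + 1}" by simp
 have "fscale2 c (sg p) (F 1 p) = fscale c (cfs F sg 1 p)"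
  by (simp only: fscale2_apply component_fields_def)
 then show ?thesis unfolding ec_def using lc_fscale[OF local_frame_wframe(1)[OF lf] p one] by (simp only:)
qed

lemma ec_expand:
 assumes p: "p : N" and s: "s : Efib p"
 shows "s = fscale2 (ec F sg p s) (sg p)"
proof -
 obtain c where c: "s = fscale2 c (sg p)" using s local_frame_wframe(3)[OF lf p] by blast
 show ?thesis unfolding c ec_fscale2[OF p] ..
qed

lemma frame_in_E: "p : N ==> sg p : Efib p"
 by (rule E_sectionD(1)[OF local_frameD(5)[OF lf]])

lemma E_fibre_closed:
 assumes p: "p : N" and s: "s : Efib p" "t : Efib p"
 shows "s + t : Efib p" "fscale2 c s : Efib p"
  "ec F sg p (s + t) = ec F sg p s + ec F sg p t" "ec F sg p (fscale2 c s) = c * ec F sg p s"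
proof -
 have a: "s + t = fscale2 (ec F sg p s + ec F sg p t) (sg p)"
 proof -
  have "s + t = fscale2 (ec F sg p s) (sg p) + fscale2 (ec F sg p t) (sg p)"
   by (rule arg_cong2[where f = "(+)", OF ec_expand[OF p s(1)] ec_expand[OF p s(2)]])
  then show ?thesis by (simp only: fun_eq_iff fscale2_apply plus_fun_apply fscale_apply distrib_right) simp
 qed
 have b: "fscale2 c s = fscale2 (c * ec F sg p s) (sg p)"
 proof -
  have "fscale2 c s = fscale2 c (fscale2 (ec F sg p s) (sg p))"
   by (rule arg_cong[where f = "fscale2 c", OF ec_expand[OF p s(1)]])
  then show ?thesis by (simp only: fun_eq_iff fscale2_apply fscale_apply mult.assoc) simp
 qed
 show "s + t : Efib p" unfolding a local_frame_wframe(3)[OF lf p] by (rule rangeI)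
 show "fscale2 c s : Efib p" unfolding b local_frame_wframe(3)[OF lf p] by (rule rangeI)
 show "ec F sg p (s + t) = ec F sg p s + ec F sg p t" unfolding a by (rule ec_fscale2[OF p])
 show "ec F sg p (fscale2 c s) = c * ec F sg p s" unfolding b by (rule ec_fscale2[OF p])
qed

lemma ec_prod_tensor:
 assumes p: "p : N"
 shows "(%xs. if length xs = k & set xs \<subseteq> Efib p then \<Prod>x\<leftarrow>xs. ec F sg p x else 0) : tfib k p"
  (is "?h : _")
 unfolding tensor_fibre_def multilinear_on_def mem_Collect_eq
proof (intro conjI allI impI)
 fix vs i x y c
 assume vs: "length vs = k" "set vs \<subseteq> Efib p" "i < k" "x : Efib p" "y : Efib p"
 have up: "?h (vs[i := z]) = (\<Prod>x\<leftarrow>take i vs. ec F sg p x) * (ec F sg p z * (\<Prod>x\<leftarrow>drop (Suc i) vs. ec F sg p x))"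
  if z: "z : Efib p" for z
 proof -
  have "set (vs[i := z]) \<subseteq> Efib p" using set_update_subset_insert[of vs i z] vs(2) z by blast
  then show ?thesis using vs(1,3) by (simp add: upd_conv_take_nth_drop)
 qed
 show "?h (vs[i := x + y]) = ?h (vs[i := x]) + ?h (vs[i := y])"
  unfolding up[OF vs(4)] up[OF vs(5)] up[OF E_fibre_closed(1)[OF p vs(4,5)]] E_fibre_closed(3)[OF p vs(4,5)]
  by (simp only: distrib_left distrib_right)
 show "?h (vs[i := fscale2 c x]) = c * ?h (vs[i := x])"
  unfolding up[OF vs(4)] up[OF E_fibre_closed(2)[OF p vs(4,4)]] E_fibre_closed(4)[OF p vs(4,4)]
  by (simp only: mult_ac)
qed (rule if_not_P)

text \<open>The fibre of \<open>E\<close> is a line, so a multilinear form on it is determined by one value.\<close>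

lemma tensor_rep:
 assumes p: "p : N" and h: "h : tfib k p" and xs: "length xs = k" "set xs \<subseteq> Efib p"
 shows "h xs = (\<Prod>x\<leftarrow>xs. ec F sg p x) * h (replicate k (sg p))"
proof -
 have "j \<le> k ==> h xs = (\<Prod>x\<leftarrow>take j xs. ec F sg p x) * h (replicate j (sg p) @ drop j xs)" for j
 proof (induction j)
  case (Suc j)
  define w where "w = replicate j (sg p) @ drop j xs"
  have xj: "xs ! j : Efib p" using Suc.prems xs nth_mem[of j xs] by auto
  have w: "length w = k" "set w \<subseteq> Efib p" "j < k"
   using Suc.prems xs frame_in_E[OF p] by (auto simp: w_def dest: in_set_dropD)
  have dr: "drop j xs = xs ! j # drop (Suc j) xs" by (rule Cons_nth_drop_Suc[symmetric]) (use Suc.prems xs in simp)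
  have wj: "w ! j = xs ! j" using Suc.prems xs by (simp add: w_def nth_append)
  have "fscale2 (ec F sg p (xs ! j)) (sg p) = w ! j"
   by (rule trans[OF ec_expand[OF p xj, symmetric] wj[symmetric]])
  then have "h w = h (w[j := fscale2 (ec F sg p (xs ! j)) (sg p)])" by simp
  also have "... = ec F sg p (xs ! j) * h (w[j := sg p])"
   by (rule conjunct2[OF tensor_slot[OF h w frame_in_E[OF p] frame_in_E[OF p]]])
  also have "w[j := sg p] = replicate (Suc j) (sg p) @ drop (Suc j) xs"
   unfolding w_def dr by (simp add: list_update_append replicate_append_same[symmetric])
  finally have "h w = ec F sg p (xs ! j) * h (replicate (Suc j) (sg p) @ drop (Suc j) xs)" .
  moreover have "take (Suc j) xs = take j xs @ [xs ! j]"
   by (rule take_Suc_conv_app_nth) (use Suc.prems xs in simp)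
  moreover have "h xs = (\<Prod>x\<leftarrow>take j xs. ec F sg p x) * h w"
   unfolding w_def by (rule Suc.IH) (use Suc.prems in simp)
  ultimately show ?case by (simp only: map_append prod_list.append list.map prod_list.Nil prod_list.Cons mult_1_right mult.assoc)
 qed simp
 from this[of k] show ?thesis using xs(1) by simp
qed

lemma dual_section_eq:
 assumes p: "p : N" and s: "s : Efib p"
 shows "dual_section W sg p [s] = ec F sg p s"
proof -
 let ?h = "%xs. if length xs = 1 & set xs \<subseteq> Efib p then \<Prod>x\<leftarrow>xs. ec F sg p x else 0"
 have e1: "ec F sg p (sg p) = 1"
 proof -
  have "sg p = fscale2 1 (sg p)" by (rule ext) (simp only: fscale2_apply fscale_1)
  then show ?thesis using ec_fscale2[OF p, of 1] by simp
 qed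
 have "dual_section W sg p = ?h"
  unfolding dual_section_def
 proof (rule the_equality)
  show "?h : tfib 1 p & ?h [sg p] = 1"
   using ec_prod_tensor[OF p, of 1] frame_in_E[OF p] e1 by simp
  fix h assume h: "h : tfib 1 p & h [sg p] = 1"
  show "h = ?h"
  proof
   fix xs
   show "h xs = ?h xs"
    using tensor_rep[OF p conjunct1[OF h], of xs] tensor_outside[OF conjunct1[OF h], of xs] h
    by (cases "length xs = 1 & set xs \<subseteq> Efib p") auto
  qed
 qed
 then show ?thesis using s by simp
qed

lemma dual_power_eq:
 assumes p: "p : O'" "O' \<subseteq> N"
 shows "dpow k O' sg p = (%xs. if length xs = k & set xs \<subseteq> Efib p then \<Prod>x\<leftarrow>xs. ec F sg p x else 0)"
proof
 fix xs
 have pN: "p : N" using p by blast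
 have "(\<Prod>x\<leftarrow>xs. dual_section W sg p [x]) = (\<Prod>x\<leftarrow>xs. ec F sg p x)" if "set xs \<subseteq> Efib p"
  using that by (induction xs) (simp_all add: dual_section_eq[OF pN])
 then show "dpow k O' sg p xs = (if length xs = k & set xs \<subseteq> Efib p then \<Prod>x\<leftarrow>xs. ec F sg p x else 0)"
  using p(1) unfolding dual_power_def by simp
qed

lemma dual_power_frame:
 assumes p: "p : N"
 shows "dpow k N sg p (replicate k (sg p)) = 1"
proof -
 have "ec F sg p (sg p) = 1"
 proof -
  have "sg p = fscale2 1 (sg p)" by (rule ext) (simp only: fscale2_apply fscale_1)
  then show ?thesis using ec_fscale2[OF p, of 1] by simp
 qed
 then show ?thesis
  unfolding dual_power_eq[OF p order_refl] using frame_in_E[OF p] by (simp add: set_replicate_conv_if)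
qed

lemma tensor_eq_dual_power:
 assumes p: "p : N" and h: "h : tfib k p"
 shows "h = fscale (h (replicate k (sg p))) (dpow k N sg p)"
proof
 fix xs
 show "h xs = fscale (h (replicate k (sg p))) (dpow k N sg p) xs"
  unfolding dual_power_eq[OF p order_refl] fscale_apply
  using tensor_rep[OF p h, of xs] tensor_outside[OF h, of xs] by (auto simp: mult.commute)
qed

lemma ec_an:
 assumes O': "open O'" "O' \<subseteq> N" "p : O'" and s: "Esec O' s"
 shows "an p (%q. ec F sg q (s q))"
proof -
 have one: "1 : {1..nn + 1}" by simp
 have v: "vf O' (cfs F s 1)"
  by (rule E_sectionD(2)[OF s order_refl lo_subset[OF local_frameD(4)[OF lf] O'(1,2)] one])
 have "an p (%q. fco (cfs F sg) q (cfs F s 1 q) 1)"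
  by (rule frame_coeff_an[OF wframe_frame[OF local_frame_wframe(1)[OF lf]] v O'])
 then show ?thesis
  unfolding ec_def lc_def component_fields_def[of F s, symmetric] using nn_pos by simp
qed

lemma scaled_dual_power_section:
 assumes O': "open O'" "O' \<subseteq> N" and f: "!!p. p : O' ==> an p f"
 shows "tsec k O' (%p. fscale (f p) (dpow k O' sg p))"
 unfolding tensor_section_def mfd_analytic_def
proof (intro conjI ballI allI impI)
 show "fscale (f p) (dpow k O' sg p) : tfib k p" if p: "p : O'" for p
 proof -
  have pN: "p : N" using p O' by blast
  show ?thesis
   unfolding dual_power_eq[OF p O'(2)] by (rule tensor_fibre_fscale[OF ec_prod_tensor[OF pN]])
 qed
 show "fscale (f p) (dpow k O' sg p) = 0" if "p \<notin> O'" for p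
  using that by (intro ext) (simp add: dual_power_def)
 fix Q ss p assume Q: "open Q" "Q \<subseteq> O'" "length ss = k" "\<forall>s\<in>set ss. Esec Q s" "p : Q"
 have QN: "Q \<subseteq> N" using Q(2) O'(2) by blast
 have "an p (%q. f q * (\<Prod>s\<leftarrow>ss. ec F sg q (s q)))"
 proof (rule an_mult)
  show "an p f" by (rule f) (use Q in blast)
  show "an p (%q. \<Prod>s\<leftarrow>ss. ec F sg q (s q))"
   using Q(4)
  proof (induction ss)
   case (Cons s ss)
   have "an p (%q. ec F sg q (s q) * (\<Prod>s\<leftarrow>ss. ec F sg q (s q)))"
    by (rule an_mult[OF ec_an[OF Q(1) QN Q(5)] Cons.IH]) (use Cons.prems in auto)
   then show ?case by simp
  qed simp
 qed
 then show "an p (%q. fscale (f q) (dpow k O' sg q) (map (%s. s q) ss))"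
 proof (rule an_cong)
  show "\<forall>\<^sub>F q in nhds p. f q * (\<Prod>s\<leftarrow>ss. ec F sg q (s q)) = fscale (f q) (dpow k O' sg q) (map (%s. s q) ss)"
   using eventually_nhds_in_open[OF Q(1,5)]
  proof eventually_elim
   case (elim q)
   then have qO: "q : O'" using Q(2) by blast
   have "set (map (%s. s q) ss) \<subseteq> Efib q" using E_sectionD(1)[OF _ elim] Q(4) by auto
   then show ?case unfolding dual_power_eq[OF qO O'(2)] fscale_apply using Q(3) by (simp add: o_def)
  qed
 qed
qed

lemma tensor_coeff_an:
 assumes h: "tsec k O' h" and O': "open O'" and p: "p : O'" "p : N"
 shows "an p (%q. h q (replicate k (sg q)))"
proof -
 have o: "open (O' \<inter> N)" using O' local_frameD(1)[OF lf] by auto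
 have s: "Esec (O' \<inter> N) s" if "s : set (replicate k sg)" for s
 proof -
  have "s = sg" using that by (cases k) auto
  then show ?thesis using E_section_subset[OF local_frameD(5)[OF lf], of "O' \<inter> N"] by simp
 qed
 have "an p (%q. h q (map (%s. s q) (replicate k sg)))"
  by (rule tensor_sectionD(3)[OF h o Int_lower1 length_replicate s]) (use p in auto)
 then show ?thesis by simp
qed

end

end

section \<open>The connection\<close>

context web
begin

abbreviation kk :: nat where
 "kk \<equiv> nn - 1"

definition coef :: "('a => ('a, 'k) evec) => ('a, 'k) tsection => 'a => 'k" where
 "coef sg h q = h q (replicate kk (sg q))"

text \<open>The derivative of \<open>h = f d\<close>, with \<open>d\<close> the power of the dual of \<open>sg\<close> and \<open>f = coef sg h\<close>, is
 \<open>(df + f \<omega>) d\<close>.\<close>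

definition covD :: "'a set => (nat => 'a => ('a, 'k) tvec set) => ('a => ('a, 'k) evec) => ('a, 'k) conn" where
 "covD N F sg p v h =
  fscale (v (coef sg h) + coef sg h p * om N (cfs F sg) p [v]) (dpow kk N sg p)"

lemma tensor_sectionI:
 assumes "!!p. p : N ==> h p : tfib k p" "!!p. p \<notin> N ==> h p = 0"
  "!!O' ss p. open O' ==> O' \<subseteq> N ==> length ss = k ==> (!!s. s : set ss ==> Esec O' s) ==> p : O' ==>
   an p (%p. h p (map (%s. s p) ss))"
 shows "tsec k N h"
 unfolding tensor_section_def mfd_analytic_def using assms(1,2) by (auto intro!: assms(3))

lemma tensor_fibre_add: "h : tfib k p ==> h' : tfib k p ==> h + h' : tfib k p"
 unfolding tensor_fibre_def multilinear_on_def mem_Collect_eq by (simp add: algebra_simps)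

lemma tensor_section_add:
 assumes "tsec k N h" "tsec k N h'"
 shows "tsec k N (h + h')"
proof (rule tensor_sectionI)
 have e: "(h + h') p = h p + h' p" for p by simp
 show "(h + h') p : tfib k p" if "p : N" for p
  unfolding e by (rule tensor_fibre_add[OF tensor_sectionD(1)[OF assms(1) that] tensor_sectionD(1)[OF assms(2) that]])
 show "(h + h') p = 0" if "p \<notin> N" for p
  unfolding e tensor_sectionD(2)[OF assms(1) that] tensor_sectionD(2)[OF assms(2) that] by (rule add_0_left)
 fix O' ss p assume *: "open O'" "O' \<subseteq> N" "length ss = k" "!!s. s : set ss ==> Esec O' s" "p : O'"
 show "an p (%p. (h + h') p (map (%s. s p) ss))"
  unfolding plus_fun_apply by (rule an_add[OF tensor_sectionD(3)[OF assms(1) *] tensor_sectionD(3)[OF assms(2) *]])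
qed

lemma tensor_section_fscale:
 assumes h: "tsec k N h" and f: "!!p. p : N ==> an p f"
 shows "tsec k N (%q. fscale (f q) (h q))"
proof (rule tensor_sectionI)
 show "fscale (f p) (h p) : tfib k p" if "p : N" for p
  by (rule tensor_fibre_fscale[OF tensor_sectionD(1)[OF h that]])
 show "fscale (f p) (h p) = 0" if "p \<notin> N" for p
  unfolding tensor_sectionD(2)[OF h that] by (rule fscale_0)
 fix O' ss p assume *: "open O'" "O' \<subseteq> N" "length ss = k" "!!s. s : set ss ==> Esec O' s" "p : O'"
 show "an p (%p. fscale (f p) (h p) (map (%s. s p) ss))"
  unfolding fscale_apply
  by (rule an_mult[OF f tensor_sectionD(3)[OF h *]]) (use * in auto)
qed

lemma tensor_section_local:
 assumes loc: "!!p. p : N ==> \<exists>M h'. open M & p : M & tsec k M h' & (\<forall>q\<in>M. h q = h' q)"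
  and out: "!!p. p \<notin> N ==> h p = 0"
 shows "tsec k N h"
proof (rule tensor_sectionI)
 show "h p : tfib k p" if p: "p : N" for p
 proof -
  obtain M h' where M: "p : M" "tsec k M h'" "\<forall>q\<in>M. h q = h' q" using loc[OF p] by blast
  show ?thesis using tensor_sectionD(1)[OF M(2,1)] M(1,3) by simp
 qed
 show "h p = 0" if "p \<notin> N" for p by (rule out[OF that])
 fix O' ss p assume *: "open O'" "O' \<subseteq> N" "length ss = k" "!!s. s : set ss ==> Esec O' s" "p : O'"
 have p: "p : N" using * by blast
 obtain M h' where M: "open M" "p : M" "tsec k M h'" "\<forall>q\<in>M. h q = h' q" using loc[OF p] by blast
 have o: "open (M \<inter> O')" "p : M \<inter> O'" using M * by auto
 have "an p (%p. h' p (map (%s. s p) ss))"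
  by (rule tensor_sectionD(3)[OF M(3) o(1) _ *(3) E_section_subset[OF *(4)] o(2)]) auto
 then show "an p (%p. h p (map (%s. s p) ss))"
 proof (rule an_cong)
  show "\<forall>\<^sub>F q in nhds p. h' q (map (%s. s q) ss) = h q (map (%s. s q) ss)"
   using eventually_nhds_in_open[OF M(1,2)] by eventually_elim (use M(4) in simp)
 qed
qed

lemma tensor_section_restrict:
 assumes h: "tsec k N h" and M: "M \<subseteq> N"
 shows "tsec k M (%p. if p : M then h p else 0)"
proof (rule tensor_sectionI)
 show "(if p : M then h p else 0) : tfib k p" if "p : M" for p
  using tensor_sectionD(1)[OF h, of p] that M by auto
 fix O' ss p assume *: "open O'" "O' \<subseteq> M" "length ss = k" "!!s. s : set ss ==> Esec O' s" "p : O'"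
 have "O' \<subseteq> N" using * M by blast
 from tensor_sectionD(3)[OF h *(1) this *(3-5)]
 show "an p (%p. (if p : M then h p else 0) (map (%s. s p) ss))"
 proof (rule an_cong)
  show "\<forall>\<^sub>F q in nhds p. h q (map (%s. s q) ss) = (if q : M then h q else 0) (map (%s. s q) ss)"
   using eventually_nhds_in_open[OF *(1,5)] by eventually_elim (use *(2) in auto)
 qed
qed simp

lemma frame_at: obtains N F sg where "lfr N F sg" "p : N"
proof -
 obtain N0 F where F: "p : N0" "lo N0 F" by (rule lo_exists)
 obtain N sg where "p : N" "N \<subseteq> N0" "lfr N F sg" by (rule local_frame_exists[OF F(2,1)])
 then show thesis by (intro that)
qed

lemma frame_change:
 assumes lf: "lfr N F sg" and lf': "lfr N' F' sg'" and p: "p : N" "p : N'"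
 obtains Q g where "open Q" "p : Q" "Q \<subseteq> N \<inter> N'" "!!q. q : Q ==> an q g" "!!q. q : Q ==> g q ~= 0"
  "!!q. q : Q ==> sg' q = fscale2 (g q) (sg q)" "!!q. q : Q ==> ec F sg q (sg' q) = g q"
  "!!q v. q : Q ==> v : TS q ==> om N' (cfs F' sg') q [v] =
   om N (cfs F sg) q [v] - of_nat kk * v g / g q"
proof -
 obtain Q \<pi> where Q: "open Q" "p : Q" "Q \<subseteq> N \<inter> N'" "!!mm. mm : {1..nn + 1} ==> \<pi> mm : {1..nn + 1}"
  "!!mm q. mm : {1..nn + 1} ==> q : Q ==> F' mm q = F (\<pi> mm) q"
  by (rule ordering_change[OF local_frameD(4)[OF lf] local_frameD(4)[OF lf'] p]) blast
 have QN: "Q \<subseteq> N" "Q \<subseteq> N'" using Q(3) by auto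
 define g where "g q = ec F sg q (sg' q)" for q
 have g: "an q g" if "q : Q" for q
  unfolding g_def by (rule ec_an[OF lf Q(1) QN(1) that E_section_subset[OF local_frameD(5)[OF lf'] QN(2)]])
 have e: "sg' q = fscale2 (g q) (sg q)" if "q : Q" for q
  unfolding g_def by (rule ec_expand[OF lf _ frame_in_E[OF lf']]) (use that QN in auto)
 have g0: "g q ~= 0" if "q : Q" for q
 proof
  assume "g q = 0"
  then have "sg' q = 0" unfolding e[OF that] by (intro ext) (simp add: fscale2_apply fscale_0)
  then show False using local_frameD(6)[OF lf'] that QN by blast
 qed
 let ?V = "cfs F sg" and ?V' = "cfs F' sg'"
 have V: "wframe Q ?V" and V': "wframe Q ?V'"
  by (rule wframe_subset[OF local_frame_wframe(1)[OF lf] Q(1) QN(1)],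
    rule wframe_subset[OF local_frame_wframe(1)[OF lf'] Q(1) QN(2)])
 have eq: "?V' mm q = fscale (g q) (?V (\<pi> mm) q)" if "q : Q" "mm : {1..nn + 1}" for q mm
  unfolding component_fields_def Q(5)[OF that(2,1)] e[OF that(1)] fscale2_apply ..
 have "om N' ?V' q [v] = om N ?V q [v] - of_nat kk * v g / g q" if q: "q : Q" and v: "v : TS q" for q v
 proof -
  have "om Q ?V' q [v] = om Q ?V q [v] - of_nat kk * v g / g q" by (rule om_change[OF V V' Q(4) g g0 eq q v])
  then show ?thesis unfolding om_restrict[OF q QN(1), where V = ?V] om_restrict[OF q QN(2), where V = ?V'] .
 qed
 note omq = this
 show thesis by (rule that[OF Q(1-3) g g0 e g_def[symmetric] omq])
qed

lemma kk_Suc: "kk = Suc (kk - 1)"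
 using n2 by simp

text \<open>Rescaling \<open>sg\<close> by \<open>g\<close> multiplies the coordinate of a section by \<open>g\<^sup>n\<^sup>-\<^sup>1\<close>, and the new
 term in its derivative cancels the term \<open>- (n - 1) dg / g\<close> that \<open>\<omega>\<close> acquires.\<close>

lemma covD_independent:
 assumes lf: "lfr N F sg" and lf': "lfr N' F' sg'" and p: "p : N" "p : N'"
  and h: "tsec kk O' h" "open O'" "p : O'" and v: "v : TS p"
 shows "covD N' F' sg' p v h = covD N F sg p v h"
proof -
 obtain Q g where Q: "open Q" "p : Q" "Q \<subseteq> N \<inter> N'" and g: "!!q. q : Q ==> an q g" "!!q. q : Q ==> g q ~= 0"
  and e: "!!q. q : Q ==> sg' q = fscale2 (g q) (sg q)" "!!q. q : Q ==> ec F sg q (sg' q) = g q"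
  and om: "!!q v. q : Q ==> v : TS q ==> om N' (cfs F' sg') q [v] =
   om N (cfs F sg) q [v] - of_nat kk * v g / g q"
  by (rule frame_change[OF lf lf' p]) blast
 let ?f = "coef sg h" and ?f' = "coef sg' h"
 have pw: "t (replicate kk (sg' q)) = g q ^ kk * t (replicate kk (sg q))"
  if q: "q : Q" and t: "t : tfib kk q" for q t
 proof -
  have qN: "q : N" "q : N'" using q Q by auto
  have "t (replicate kk (sg' q)) = (\<Prod>x\<leftarrow>replicate kk (sg' q). ec F sg q x) * t (replicate kk (sg q))"
   by (rule tensor_rep[OF lf qN(1) t]) (use frame_in_E[OF lf' qN(2)] in auto)
  then show ?thesis by (simp only: map_replicate prod_list_replicate e(2)[OF q])
 qed
 have f'f: "?f' q = g q ^ kk * ?f q" if "q : Q" "q : O'" for q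
  unfolding coef_def by (rule pw[OF that(1) tensor_sectionD(1)[OF h(1) that(2)]])
 have fan: "an p ?f" unfolding coef_def[abs_def] by (rule tensor_coeff_an[OF lf h p(1)])
 have gk: "an p (%q. g q ^ kk)" by (rule an_power[OF g(1)[OF Q(2)]])
 have "v (%q. g q ^ kk * ?f q) = v ?f'"
 proof (rule tv_cong[OF v an_mult[OF gk fan]])
  show "\<forall>\<^sub>F q in nhds p. g q ^ kk * ?f q = ?f' q"
   using eventually_nhds_in_open[OF Q(1,2)] eventually_nhds_in_open[OF h(2,3)]
   by eventually_elim (rule f'f[symmetric])
 qed
 then have vf': "v ?f' = g p ^ kk * v ?f + ?f p * (of_nat kk * g p ^ (kk - 1) * v g)"
  using tv_mult[OF v gk fan] tv_power[OF v g(1)[OF Q(2)], of "kk - 1"] unfolding kk_Suc[symmetric] by simp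
 have gp: "g p ^ kk = g p * g p ^ (kk - 1)" by (subst kk_Suc) simp
 define d where "d = dpow kk N sg p"
 define d' where "d' = dpow kk N' sg' p"
 have d: "d : tfib kk p"
  unfolding d_def dual_power_eq[OF lf p(1) order_refl] by (rule ec_prod_tensor[OF lf p(1)])
 have "d = fscale (d (replicate kk (sg' p))) d'" unfolding d'_def by (rule tensor_eq_dual_power[OF lf' p(2) d])
 also have "d (replicate kk (sg' p)) = g p ^ kk"
  unfolding pw[OF Q(2) d] using dual_power_frame[OF lf p(1), of kk] unfolding d_def by simp
 finally have dd: "d = fscale (g p ^ kk) d'" .
 have alg: "x * A * a + F * (K * A * b) + x * A * F * (w - K * b / x) = (a + F * w) * (x * A)"
  if "x ~= 0" for a F w x A K b :: 'k
  using that by (simp add: field_simps)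
 show ?thesis
  unfolding covD_def d_def[symmetric] d'_def[symmetric] dd fscale_fscale vf' f'f[OF Q(2) h(3)] om[OF Q(2) v] gp
  by (rule arg_cong[where f = "%c. fscale c d'"]) (rule alg[OF g(2)[OF Q(2)]])
qed

text \<open>The frame is chosen at each point; \<open>G_eq\<close> removes the dependence on the choice.\<close>

definition G :: "('a, 'k) conn" where
 "G p v h = (let (N, F, sg) = SOME (N, F, sg). lfr N F sg & p : N in covD N F sg p v h)"

lemma G_eq:
 assumes lf: "lfr N F sg" "p : N" and h: "tsec kk O' h" "open O'" "p : O'" and v: "v : TS p"
 shows "G p v h = covD N F sg p v h"
proof -
 let ?P = "%(N, F, sg). lfr N F sg & p : N"
 obtain M H s where e: "(SOME x. ?P x) = (M, H, s)" by (cases "SOME x. ?P x") auto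
 have "?P (N, F, sg)" using lf by simp
 from someI[of ?P, OF this] have "lfr M H s & p : M" unfolding e by simp
 then show ?thesis unfolding G_def e Let_def prod.case using covD_independent[OF lf(1) _ lf(2) _ h v] by blast
qed

lemma covD_fibre: "lfr N F sg ==> p : N ==> covD N F sg p v h : tfib kk p"
 unfolding covD_def dual_power_eq[OF _ _ order_refl] by (rule tensor_fibre_fscale[OF ec_prod_tensor])

lemma covD_local:
 assumes lf: "lfr N F sg" and p: "p : N" "p : O''" and O'': "open O''"
  and h: "tsec kk O' h" "open O'" "p : O'" and eq: "!!q. q : O'' ==> h'' q = h q" and v: "v : TS p"
 shows "covD N F sg p v h'' = covD N F sg p v h"
proof -
 have fan: "an p (coef sg h)" unfolding coef_def[abs_def] by (rule tensor_coeff_an[OF lf h p(1)])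
 have "v (coef sg h) = v (coef sg h'')"
  by (rule tv_cong[OF v fan]) (use eventually_nhds_in_open[OF O'' p(2)] in \<open>eventually_elim, simp add: coef_def eq\<close>)
 then show ?thesis unfolding covD_def using eq[OF p(2)] by (simp add: coef_def)
qed

lemma coef_covD: "lfr N F sg ==> p : N ==>
  covD N F sg p v h (replicate kk (sg p)) = v (coef sg h) + coef sg h p * om N (cfs F sg) p [v]"
 unfolding covD_def fscale_apply using dual_power_frame by simp

lemma covariant_an:
 assumes lf: "lfr N F sg" and p: "p : N" "p : O'" and h: "tsec kk O' h" "open O'"
  and X: "vf O' X"
 shows "an p (%q. X q (coef sg h) + coef sg h q * om N (cfs F sg) q [X q])"
proof -
 note oN = local_frameD(1)[OF lf]
 have fan: "an p (coef sg h)" unfolding coef_def[abs_def] by (rule tensor_coeff_an[OF lf h(1,2) p(2,1)])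
 have o: "open (O' \<inter> N)" "p : O' \<inter> N" using oN h p by auto
 have "an p (%q. om N (cfs F sg) q [X q])"
  by (rule one_form_an[OF oN om_form[OF wframe_frame[OF local_frame_wframe(1)[OF lf]]] o(1) _ vf_subset[OF X] o(2)]) auto
 then show ?thesis by (intro an_add an_mult fan vf_an[OF X h(2) p(2) fan])
qed

lemma G_connection: "connection_on \<A> W kk UNIV G"
 unfolding connection_on_def
proof (intro allI impI conjI ballI)
 fix O' h p v assume O': "open O'" and h: "tsec kk O' h" and p: "p : O'" and v: "v : TS p"
 obtain N F sg where lf: "lfr N F sg" "p : N" by (rule frame_at)
 note G = G_eq[OF lf _ O' p]
 have fan: "an p (coef sg h)" if "tsec kk O' h" for h
  unfolding coef_def[abs_def] by (rule tensor_coeff_an[OF lf(1) that O' p lf(2)])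
 have o1: "om N (cfs F sg) p : alt 1 p"
  by (rule form_on_alt[OF om_form[OF wframe_frame[OF local_frame_wframe(1)[OF lf(1)]]] lf(2)])
 let ?d = "dpow kk N sg p"
 have fa: "fscale (a + b) t = fscale a t + fscale b t" for a b and t :: "('a, 'k) evec list => 'k"
  by (rule ext) (simp add: distrib_right)
 show "G p v h : tfib kk p" unfolding G[OF h v] by (rule covD_fibre[OF lf])
 show "G p (u + v) h = G p u h + G p v h" if u: "u : TS p" for u
  unfolding G[OF h v] G[OF h u] G[OF h ts_add[OF u v]] covD_def fa[symmetric] alt_1(1)[OF o1 u v]
  by (rule arg_cong[where f = "%c. fscale c ?d"]) (simp add: algebra_simps)
 show "G p (fscale c v) h = fscale c (G p v h)" for c
  unfolding G[OF h v] G[OF h ts_fscale[OF v]] covD_def fscale_fscale alt_1(2)[OF o1 v]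
  by (rule arg_cong[where f = "%c. fscale c ?d"]) (simp add: algebra_simps)
 show "G p v (h + h') = G p v h + G p v h'" if h': "tsec kk O' h'" for h'
 proof -
  have "coef sg (h + h') = (%q. coef sg h q + coef sg h' q)" by (rule ext) (simp add: coef_def)
  then show ?thesis
   unfolding G[OF h v] G[OF h' v] G[OF tensor_section_add[OF h h'] v] covD_def fa[symmetric]
   by (intro arg_cong[where f = "%c. fscale c ?d"])
    (simp only: tv_add[OF v fan[OF h] fan[OF h']], simp add: algebra_simps)
 qed
 show "G p v (%q. fscale (f q) (h q)) = fscale (v f) (h p) + fscale (f p) (G p v h)" if f: "mfd_analytic \<A> O' f" for f
 proof -
  have c: "coef sg (%q. fscale (f q) (h q)) = (%q. f q * coef sg h q)" by (rule ext) (simp add: coef_def)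
  have hp: "h p = fscale (coef sg h p) ?d"
   unfolding coef_def by (rule tensor_eq_dual_power[OF lf(1,2) tensor_sectionD(1)[OF h p]])
  have "fscale (v f) (h p) + fscale (f p) (covD N F sg p v h) = fscale (v f) (fscale (coef sg h p) ?d) + fscale (f p) (covD N F sg p v h)"
   by (rule arg_cong[OF hp])
  also have "... = covD N F sg p v (%q. fscale (f q) (h q))"
   unfolding covD_def fscale_fscale fa[symmetric] c tv_mult[OF v mfd_analyticD[OF f p] fan[OF h]]
   by (rule arg_cong[where f = "%c. fscale c ?d"]) (simp add: algebra_simps)
  finally have "fscale (v f) (h p) + fscale (f p) (covD N F sg p v h) = covD N F sg p v (%q. fscale (f q) (h q))" .
  moreover have "G p v (%q. fscale (f q) (h q)) = covD N F sg p v (%q. fscale (f q) (h q))"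
   by (rule G[OF tensor_section_fscale[OF h mfd_analyticD[OF f]] v])
  ultimately show ?thesis unfolding G[OF h v] by (simp only:)
 qed
 show "G p v h'' = G p v h" if O'': "open O''" "p : O''" "O'' \<subseteq> O'" and h'': "tsec kk O'' h''" "\<forall>q\<in>O''. h'' q = h q"
  for O'' h''
  unfolding G[OF h v] G_eq[OF lf h''(1) O''(1,2) v]
  by (rule covD_local[OF lf O''(2,1) h O' p _ v]) (use h''(2) in blast)
next
 fix O' h X assume O': "open O'" and h: "tsec kk O' h" and X: "vf O' X"
 show "tsec kk O' (covariant G O' X h)"
 proof (rule tensor_section_local)
  show "covariant G O' X h p = 0" if "p \<notin> O'" for p using that by (simp add: covariant_def)
  fix p assume p: "p : O'"
  obtain N F sg where lf: "lfr N F sg" "p : N" by (rule frame_at)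
  have o: "open (O' \<inter> N)" "p : O' \<inter> N" using local_frameD(1)[OF lf(1)] O' p lf(2) by auto
  define c where "c q = X q (coef sg h) + coef sg h q * om N (cfs F sg) q [X q]" for q
  have c_an: "an q c" if "q : O' \<inter> N" for q
   unfolding c_def by (rule covariant_an[OF lf(1) _ _ h O' X]) (use that in auto)
  have ts: "tsec kk (O' \<inter> N) (%q. fscale (c q) (dpow kk (O' \<inter> N) sg q))"
   by (rule scaled_dual_power_section[OF lf(1) o(1) _ c_an]) auto
  show "\<exists>M h'. open M & p : M & tsec kk M h' & (\<forall>q\<in>M. covariant G O' X h q = h' q)"
  proof (intro exI conjI ballI)
   fix q assume q: "q : O' \<inter> N"
   have "covariant G O' X h q = covD N F sg q (X q) h"
    unfolding covariant_def using q G_eq[OF lf(1) _ h O' _ vf_ts[OF X]] by simp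
   also have "... = fscale (c q) (dpow kk N sg q)" unfolding covD_def c_def ..
   also have "dpow kk N sg q = dpow kk (O' \<inter> N) sg q"
    using q by (intro ext) (simp add: dual_power_def)
   finally show "covariant G O' X h q = fscale (c q) (dpow kk (O' \<inter> N) sg q)" .
  qed (rule o ts)+
 qed
qed

lemma connection_subset: "connection_on \<A> W k N D ==> M \<subseteq> N ==> connection_on \<A> W k M D"
 unfolding connection_on_def by (elim all_forward imp_forward) auto

lemma dual_power_section:
 assumes lf: "lfr N F sg" and O': "open O'" "O' \<subseteq> N"
 shows "tsec k O' (dpow k O' sg)"
 using scaled_dual_power_section[OF lf O', of "%_. 1" k] unfolding fscale_1 by simp

lemma G_local_connection:
 assumes lf: "lfr N F sg"
 shows "lcon N F sg G"
 unfolding local_connection_def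
proof (intro conjI ballI)
 show "connection_on \<A> W kk N G" by (rule connection_subset[OF G_connection subset_UNIV])
 fix p v assume p: "p : N" and v: "v : TS p"
 note oN = local_frameD(1)[OF lf]
 let ?h = "dpow kk N sg"
 have c1: "coef sg ?h q = 1" if "q : N" for q unfolding coef_def by (rule dual_power_frame[OF lf that])
 have "v (%q. 1) = v (coef sg ?h)"
  by (rule tv_cong[OF v an_const]) (use eventually_nhds_in_open[OF oN p] in \<open>eventually_elim, simp only: c1\<close>)
 then have "v (coef sg ?h) = 0" using v by simp
 then show "G p v ?h = fscale (om N (cfs F sg) p [v]) (?h p)"
  unfolding G_eq[OF lf p dual_power_section[OF lf oN order_refl] oN p v] covD_def c1[OF p] by simp
qed

lemma G_global: "glob G"
 unfolding global_connection_def using G_connection G_local_connection by simp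

lemma connectionD:
 assumes D: "connection_on \<A> W k N D" and O': "open O'" "O' \<subseteq> N" and h: "tsec k O' h"
  and p: "p : O'" and v: "v : TS p"
 shows "mfd_analytic \<A> O' f ==> D p v (%q. fscale (f q) (h q)) = fscale (v f) (h p) + fscale (f p) (D p v h)"
  and "open O'' ==> p : O'' ==> O'' \<subseteq> O' ==> tsec k O'' h'' ==>
   (!!q. q : O'' ==> h'' q = h q) ==> D p v h'' = D p v h"
proof -
 note C = bspec[OF bspec[OF conjunct1[OF mp[OF mp[OF mp[OF spec[OF spec[OF D[unfolded connection_on_def], of O'], of h]
   O'(1)] O'(2)] h]] p] v, THEN conjunct2, THEN conjunct2, THEN conjunct2, THEN conjunct2]
 show "mfd_analytic \<A> O' f ==> D p v (%q. fscale (f q) (h q)) = fscale (v f) (h p) + fscale (f p) (D p v h)"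
  by (rule C[THEN conjunct1, rule_format])
 show "open O'' ==> p : O'' ==> O'' \<subseteq> O' ==> tsec k O'' h'' ==>
   (!!q. q : O'' ==> h'' q = h q) ==> D p v h'' = D p v h"
  by (rule C[THEN conjunct2, rule_format])
qed

lemma covariant_section:
 "connection_on \<A> W k N D ==> open O' ==> O' \<subseteq> N ==> tsec k O' h ==> vf O' X ==>
  tsec k O' (covariant D O' X h)"
 unfolding connection_on_def by simp

text \<open>The Leibniz rule leaves no choice for the derivative of \<open>f sg\<^sup>*\<close>.\<close>

lemma local_connection_eq:
 assumes lf: "lfr N F sg" and D: "lcon N F sg D"
  and h: "tsec kk O' h" and O': "open O'" "O' \<subseteq> N" and p: "p : O'" and v: "v : TS p"
 shows "D p v h = covD N F sg p v h"
proof -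
 note oN = local_frameD(1)[OF lf]
 have pN: "p : N" using p O' by blast
 have D1: "connection_on \<A> W kk N D"
  and D2: "D p v (dpow kk N sg) = fscale (om N (cfs F sg) p [v]) (dpow kk N sg p)"
  using D pN v unfolding local_connection_def by simp_all
 let ?h1 = "dpow kk O' sg" and ?d = "dpow kk N sg p"
 have e1: "?h1 q = dpow kk N sg q" if "q : O'" for q
  using that O' by (intro ext) (simp add: dual_power_def subset_iff)
 have h1: "tsec kk O' ?h1" by (rule dual_power_section[OF lf O'])
 have fan: "mfd_analytic \<A> O' (coef sg h)"
  unfolding mfd_analytic_def coef_def[abs_def]
 proof
  fix q assume q: "q : O'"
  show "an q (%q. h q (replicate kk (sg q)))" by (rule tensor_coeff_an[OF lf h O'(1) q]) (use q O' in blast)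
 qed
 have he: "h = (%q. fscale (coef sg h q) (?h1 q))"
 proof
  fix q
  show "h q = fscale (coef sg h q) (?h1 q)"
  proof (cases "q : O'")
   case True
   then have qN: "q : N" using O' by blast
   show ?thesis unfolding e1[OF True] coef_def by (rule tensor_eq_dual_power[OF lf qN tensor_sectionD(1)[OF h True]])
  next
   case False
   have "?h1 q = 0" by (rule tensor_sectionD(2)[OF h1 False])
   then show ?thesis using tensor_sectionD(2)[OF h False] fscale_0(2) by simp
  qed
 qed
 have "D p v h = D p v (%q. fscale (coef sg h q) (?h1 q))" by (rule arg_cong[OF he])
 also have "... = fscale (v (coef sg h)) (?h1 p) + fscale (coef sg h p) (D p v ?h1)"
  by (rule connectionD(1)[OF D1 O' h1 p v fan])
 also have "D p v ?h1 = D p v (dpow kk N sg)"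
  by (rule connectionD(2)[OF D1 oN order_refl dual_power_section[OF lf oN order_refl] pN v O'(1) p O'(2) h1 e1])
 also have "fscale (v (coef sg h)) (?h1 p) + fscale (coef sg h p) (D p v (dpow kk N sg)) = covD N F sg p v h"
  unfolding D2 e1[OF p] covD_def by (rule ext) (simp add: algebra_simps)
 finally show ?thesis .
qed

lemma local_connections_agree:
 assumes lf: "lfr N F sg" "lcon N F sg D"
  and lf': "lfr N' F' sg'" "lcon N' F' sg' D'"
 shows "connections_agree \<A> W kk (N \<inter> N') D D'"
 unfolding connections_agree_def
proof (intro allI impI ballI)
 fix O' h p v assume O': "open O'" "O' \<subseteq> N \<inter> N'" and h: "tsec kk O' h" and p: "p : O'" and v: "v : TS p"
 have i: "O' \<subseteq> N" "O' \<subseteq> N'" "p : N" "p : N'" using O' p by auto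
 have "D p v h = covD N F sg p v h" by (rule local_connection_eq[OF lf h O'(1) i(1) p v])
 also have "... = covD N' F' sg' p v h" by (rule covD_independent[OF lf'(1) lf(1) i(4,3) h O'(1) p v])
 also have "... = D' p v h" by (rule local_connection_eq[OF lf' h O'(1) i(2) p v, symmetric])
 finally show "D p v h = D' p v h" .
qed

lemma globalD:
 assumes "glob D"
 shows "connection_on \<A> W kk UNIV D" "lfr N F sg ==> lcon N F sg D"
 using assms unfolding global_connection_def by simp_all

lemma global_eq:
 assumes D: "glob D" and lf: "lfr N F sg" and p: "p : N" "p : O'"
  and h: "tsec kk O' h" "open O'" and v: "v : TS p"
 shows "D p v h = covD N F sg p v h"
proof -
 let ?Q = "O' \<inter> N" and ?h = "%q. if q : O' \<inter> N then h q else 0"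
 have o: "open ?Q" "p : ?Q" "?Q \<subseteq> O'" "?Q \<subseteq> N" using local_frameD(1)[OF lf] h(2) p by auto
 have h': "tsec kk ?Q ?h" by (rule tensor_section_restrict[OF h(1) o(3)])
 have "D p v h = D p v ?h"
  by (rule connectionD(2)[OF globalD(1)[OF D] h(2) subset_UNIV h(1) p(2) v o(1-3) h', symmetric]) simp
 also have "... = covD N F sg p v ?h" by (rule local_connection_eq[OF lf globalD(2)[OF D lf] h' o(1,4,2) v])
 also have "... = covD N F sg p v h" by (rule covD_local[OF lf p(1) o(2,1) h p(2) _ v]) simp
 finally show ?thesis .
qed

lemma global_connections_agree:
 assumes "glob D" "glob D'"
 shows "connections_agree \<A> W kk UNIV D D'"
 unfolding connections_agree_def
proof (intro allI impI ballI)
 fix O' h p v assume O': "open O'" and h: "tsec kk O' h" and p: "p : O'" and v: "v : TS p"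
 obtain N F sg where lf: "lfr N F sg" "p : N" by (rule frame_at)
 show "D p v h = D' p v h"
  unfolding global_eq[OF assms(1) lf p h O' v] global_eq[OF assms(2) lf p h O' v] ..
qed

section \<open>The curvature\<close>

text \<open>Apply \<open>d + \<omega>\<close> twice to the coordinate of \<open>h\<close>: all derivatives of the coordinate cancel, and
 Cartan's formula for \<open>d\<omega>\<close> remains.\<close>

lemma curvature_compute:
 assumes D: "glob D" and lf: "lfr N F sg" and O': "open O'"
  and X: "vf O' X" and Y: "vf O' Y" and h: "tsec kk O' h" and p: "p : O'" "p : N"
 shows "D p (X p) (covariant D O' Y h) - D p (Y p) (covariant D O' X h) - D p (lie X Y p) h
  = fscale (Omf N (cfs F sg) p [X p, Y p]) (h p)"
proof -
 note oN = local_frameD(1)[OF lf]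
 let ?V = "cfs F sg" let ?f = "coef sg h" and ?o = "om N ?V" and ?d = "dpow kk N sg p"
 note Fr = wframe_frame[OF local_frame_wframe(1)[OF lf]]
 note C = globalD(1)[OF D]
 have o: "open (O' \<inter> N)" "O' \<inter> N \<subseteq> N" "O' \<inter> N \<subseteq> O'" "p : O' \<inter> N" using oN O' p by auto
 have fan: "an q ?f" if "q : O' \<inter> N" for q
  unfolding coef_def[abs_def] by (rule tensor_coeff_an[OF lf h O']) (use that in auto)
 have oan: "an p (%q. ?o q [Z q])" if "vf O' Z" for Z
  by (rule one_form_an[OF oN om_form[OF Fr] o(1,2) vf_subset[OF that o(3)] o(4)])
 have step: "D p (X p) (covariant D O' Y h) = fscale (X p (%q. Y q ?f) + (?f p * X p (%q. ?o q [Y q]) + ?o p [Y p] * X p ?f)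
   + (Y p ?f + ?f p * ?o p [Y p]) * ?o p [X p]) ?d" if X: "vf O' X" and Y: "vf O' Y" for X Y
 proof -
  note Xp = vf_ts[OF X p(1)]
  have c: "coef sg (covariant D O' Y h) q = Y q ?f + ?f q * ?o q [Y q]" if q: "q : O' \<inter> N" for q
  proof -
   have "covariant D O' Y h q = covD N F sg q (Y q) h"
    unfolding covariant_def using q global_eq[OF D lf _ _ h O' vf_ts[OF Y]] by simp
   then show ?thesis unfolding coef_def[of _ "covariant D O' Y h"] using coef_covD[OF lf, of q] q by simp
  qed
  have Yf: "an p (%q. Y q ?f)" by (rule vf_an[OF Y O' p(1) fan[OF o(4)]])
  have prod: "an p (%q. ?f q * ?o q [Y q])" by (rule an_mult[OF fan[OF o(4)] oan[OF Y]])
  have "X p (%q. Y q ?f + ?f q * ?o q [Y q]) = X p (coef sg (covariant D O' Y h))"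
  proof (rule tv_cong[OF Xp an_add[OF Yf prod]])
   show "\<forall>\<^sub>F q in nhds p. Y q ?f + ?f q * ?o q [Y q] = coef sg (covariant D O' Y h) q"
    using eventually_nhds_in_open[OF o(1,4)] by eventually_elim (rule c[symmetric])
  qed
  then have "X p (coef sg (covariant D O' Y h)) = X p (%q. Y q ?f) + (?f p * X p (%q. ?o q [Y q]) + ?o p [Y p] * X p ?f)"
   unfolding tv_add[OF Xp Yf prod] tv_mult[OF Xp fan[OF o(4)] oan[OF Y]] by (rule sym)
  then show ?thesis
   unfolding global_eq[OF D lf p(2,1) covariant_section[OF C O' subset_UNIV h Y] O' Xp] covD_def c[OF o(4)] by (simp only:)
 qed
 have L: "D p (lie X Y p) h = fscale (X p (%q. Y q ?f) - Y p (%q. X q ?f) + ?f p * ?o p [lie X Y p]) ?d"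
  unfolding global_eq[OF D lf p(2,1) h O' lie_ts[OF X Y O' p(1)]] covD_def lie_apply[OF fan[OF o(4)]] ..
 have Om: "Omf N ?V p [X p, Y p] = X p (%q. ?o q [Y q]) - Y p (%q. ?o q [X q]) - ?o p [lie X Y p]"
  using Omega(2)[OF Fr o(1,2) vf_subset[OF X o(3)] vf_subset[OF Y o(3)] o(4)] unfolding ext_op_def .
 have hp: "h p = fscale (?f p) ?d"
  unfolding coef_def by (rule tensor_eq_dual_power[OF lf p(2) tensor_sectionD(1)[OF h p(1)]])
 have fd: "fscale a t - fscale b t = fscale (a - b) t" for a b and t :: "('a, 'k) evec list => 'k"
  by (rule ext) (simp add: left_diff_distrib)
 have "D p (X p) (covariant D O' Y h) - D p (Y p) (covariant D O' X h) - D p (lie X Y p) h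
   = fscale (Omf N ?V p [X p, Y p]) (fscale (?f p) ?d)"
  unfolding step[OF X Y] step[OF Y X] L Om fscale_fscale fd
  by (rule arg_cong[where f = "%c. fscale c ?d"]) (simp add: algebra_simps)
 also have "... = fscale (Omf N ?V p [X p, Y p]) (h p)" by (rule arg_cong[OF hp[symmetric]])
 finally show ?thesis .
qed

lemma Omega_form_on: "lfr N F sg ==> fon 2 N (Omf N (cfs F sg))"
 by (rule Omega(1)[OF wframe_frame[OF local_frame_wframe(1)]])

lemma curvature_unique:
 assumes D: "glob D" and K: "curvature_form \<A> W kk N0 D K"
  and lf: "lfr N F sg" and p: "p : N" "N \<subseteq> N0"
 shows "K p = Omf N (cfs F sg) p"
proof (rule two_form_eqI[OF _ _ local_frameD(1)[OF lf] p(1)])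
 have K1: "fon 2 N0 K" using K unfolding curvature_form_def by blast
 show "K p : alt 2 p" by (rule form_on_alt[OF K1]) (use p in blast)
 show "Omf N (cfs F sg) p : alt 2 p" by (rule form_on_alt[OF Omega_form_on[OF lf] p(1)])
 fix O' X Y assume O': "open O'" "p : O'" "O' \<subseteq> N" and XY: "vf O' X" "vf O' Y"
 let ?h = "dpow kk O' sg"
 have h: "tsec kk O' ?h" by (rule dual_power_section[OF lf O'(1,3)])
 have "O' \<subseteq> N0" using O' p by blast
 then have "D p (X p) (covariant D O' Y ?h) - D p (Y p) (covariant D O' X ?h) - D p (lie X Y p) ?h
  = fscale (K p [X p, Y p]) (?h p)"
  using K O'(1,2) XY h unfolding curvature_form_def by simp
 then have "fscale (K p [X p, Y p]) (?h p) = fscale (Omf N (cfs F sg) p [X p, Y p]) (?h p)"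
  unfolding curvature_compute[OF D lf O'(1) XY h O'(2) p(1)] by (rule sym)
 then have "K p [X p, Y p] * ?h p (replicate kk (sg p)) =
   Omf N (cfs F sg) p [X p, Y p] * ?h p (replicate kk (sg p))"
  unfolding fscale_def by (rule fun_cong)
 moreover have "?h p (replicate kk (sg p)) = 1"
  using dual_power_frame[OF lf p(1), of kk] O'(2) p(1) by (simp add: dual_power_def)
 ultimately show "K p [X p, Y p] = Omf N (cfs F sg) p [X p, Y p]" by simp
qed

text \<open>Both forms satisfy the equation that characterizes the curvature of the connection.\<close>

lemma Omega_independent:
 assumes lf: "lfr N F sg" and lf': "lfr N' F' sg'" and p: "p : N" "p : N'"
 shows "Omf N' (cfs F' sg') p = Omf N (cfs F sg) p"
proof -
 obtain M where M: "open M" "connected M" "p : M" "M \<subseteq> N \<inter> N'"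
  by (rule connected_nhd[of "N \<inter> N'" p]) (use local_frameD(1)[OF lf] local_frameD(1)[OF lf'] p in auto)
 have MN: "M \<subseteq> N" "M \<subseteq> N'" "M ~= {}" using M by auto
 have lfM: "lfr M F sg" by (rule local_frame_subset[OF lf M(1,2) MN(3,1)])
 have "curvature_form \<A> W kk M G (Omf M (cfs F sg))"
  unfolding curvature_form_def
 proof (intro conjI allI impI ballI)
  show "fon 2 M (Omf M (cfs F sg))" by (rule Omega_form_on[OF lfM])
  fix O' X Y h q assume *: "open O'" "O' \<subseteq> M" "vf O' X" "vf O' Y" "tsec kk O' h" "q : O'"
  show "G q (X q) (covariant G O' Y h) - G q (Y q) (covariant G O' X h) - G q (lie X Y q) h =
   fscale (Omf M (cfs F sg) q [X q, Y q]) (h q)"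
   by (rule curvature_compute[OF G_global lfM *(1,3-6)]) (use * in blast)
 qed
 from curvature_unique[OF G_global this local_frame_subset[OF lf' M(1,2) MN(3,2)] M(3) order_refl]
 have "Omf M (cfs F sg) p = Omf M (cfs F' sg') p" .
 then show ?thesis
  using Omega_restrict[OF wframe_frame[OF local_frame_wframe(1)[OF lf]] M(1) MN(1) M(3)]
   Omega_restrict[OF wframe_frame[OF local_frame_wframe(1)[OF lf']] M(1) MN(2) M(3)] by simp
qed

text \<open>The curvature of the connection of the web; the frame is chosen at each point, see \<open>K0_eq\<close>.\<close>

definition K0 :: "('a, 'k) dform" where
 "K0 p = (let (N, F, sg) = SOME (N, F, sg). lfr N F sg & p : N in Omf N (cfs F sg) p)"

lemma K0_eq:
 assumes lf: "lfr N F sg" "p : N"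
 shows "K0 p = Omf N (cfs F sg) p"
proof -
 let ?P = "%(N, F, sg). lfr N F sg & p : N"
 obtain M H s where e: "(SOME x. ?P x) = (M, H, s)" by (cases "SOME x. ?P x") auto
 have "?P (N, F, sg)" using lf by simp
 from someI[of ?P, OF this] have "lfr M H s & p : M" unfolding e by simp
 then show ?thesis unfolding K0_def e Let_def prod.case using Omega_independent[OF lf(1) _ lf(2)] by blast
qed

lemma K0_form: "fon 2 UNIV K0"
proof (rule form_on_local)
 fix p
 obtain N F sg where lf: "lfr N F sg" "p : N" by (rule frame_at)
 show "\<exists>M et'. open M & p : M & fon 2 M et' & (\<forall>q\<in>M. K0 q = et' q)"
  by (intro exI[of _ N] exI[of _ "Omf N (cfs F sg)"] conjI ballI
    local_frameD(1)[OF lf(1)] lf(2) Omega_form_on[OF lf(1)] K0_eq[OF lf(1)])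
qed simp

lemma K0_curvature:
 assumes D: "glob D"
 shows "curvature_form \<A> W kk UNIV D K0"
 unfolding curvature_form_def
proof (intro conjI allI impI ballI K0_form)
 fix O' X Y h p assume *: "open O'" "vf O' X" "vf O' Y" "tsec kk O' h" "p : O'"
 obtain N F sg where lf: "lfr N F sg" "p : N" by (rule frame_at)
 show "D p (X p) (covariant D O' Y h) - D p (Y p) (covariant D O' X h) - D p (lie X Y p) h =
  fscale (K0 p [X p, Y p]) (h p)"
  unfolding K0_eq[OF lf] by (rule curvature_compute[OF D lf(1) * lf(2)])
qed

lemma curvature_K0:
 assumes D: "glob D" and K: "curvature_form \<A> W kk UNIV D K"
 shows "K = K0"
proof
 fix p
 obtain N F sg where lf: "lfr N F sg" "p : N" by (rule frame_at)
 show "K p = K0 p" unfolding curvature_unique[OF D K lf(1,2) subset_UNIV] K0_eq[OF lf] ..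
qed

lemma K0_zero:
 assumes lf: "lfr N F sg"
 shows "K0 = 0 \<longleftrightarrow> Omf N (cfs F sg) = 0"
proof
 assume K: "K0 = 0"
 show "Omf N (cfs F sg) = 0"
 proof
  fix p
  show "Omf N (cfs F sg) p = 0 p"
  proof (cases "p : N")
   case True
   show ?thesis using K0_eq[OF lf True] K by simp
  next
   case False
   show ?thesis using form_on_outside[OF Omega_form_on[OF lf] False] by simp
  qed
 qed
next
 assume 0: "Omf N (cfs F sg) = 0"
 show "K0 = 0"
 proof (rule form_identity[OF K0_form conn local_frameD(1)[OF lf] local_frameD(3)[OF lf]])
  show "K0 q = 0" if "q : N" for q using K0_eq[OF lf that] 0 by simp
 qed
qed

end

section \<open>Relations over the open sets of an ordering\<close>

context web
begin

lemma lie_derivative_cong: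
 assumes v: "v p : TS p" and an: "an p (%q. et' q (map (%Y. Y q) Ys))" and eq: "\<forall>\<^sub>F q in nhds p. et q = et' q"
 shows "lieD v et Ys p = lieD v et' Ys p"
proof -
 have "v p (%q. et' q (map (%Y. Y q) Ys)) = v p (%q. et q (map (%Y. Y q) Ys))"
  by (rule tv_cong[OF v an]) (use eq in \<open>eventually_elim, simp\<close>)
 then show ?thesis unfolding lie_derivative_def eventually_nhds_x_imp_x[OF eq] by simp
qed

text \<open>Needed in both directions: to restrict relations, and to glue those found over small frames.\<close>

lemma relation_local:
 assumes loc: "!!p. p : M ==> \<exists>O' N et'. open O' & p : O' & O' \<subseteq> M \<inter> N & et' : Arels N F \<and>
   (\<forall>q\<in>O'. \<forall>mm. et mm q = et' mm q)"
  and out: "!!p mm. p \<notin> M ==> et mm p = 0"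
 shows "et : Arels M F"
 unfolding abelian_relations_def mem_Collect_eq
proof (intro conjI ballI allI impI)
 fix mm assume mm: "mm : {1..nn + 1}"
 show "fon (nn - 1) M (et mm)"
 proof (rule form_on_local)
  fix p assume "p : M"
  from loc[OF this] obtain O' N et' where *: "open O'" "p : O'" "O' \<subseteq> M \<inter> N" "et' : Arels N F"
   "\<forall>q\<in>O'. \<forall>mm. et mm q = et' mm q" by (elim exE conjE)
  have ON: "O' \<subseteq> N" using *(3) by blast
  show "\<exists>M \<zeta>. open M & p : M & fon (nn - 1) M \<zeta> & (\<forall>q\<in>M. et mm q = \<zeta> q)"
   by (intro exI[of _ O'] exI[of _ "%q. if q : O' then et' mm q else 0"] conjI ballI *(1,2)
     form_on_restrict[OF abelian_relationsD(1)[OF *(4) mm] ON]) (simp add: *(5))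
 qed (rule out)
 show "basic_form \<A> (nn - 1) M (F mm) (et mm)"
  unfolding basic_form_def
 proof (intro allI impI ballI)
  fix Q v assume Q: "open Q" "Q \<subseteq> M" "vf Q v" "\<forall>p\<in>Q. v p : F mm p"
  have "et mm p (v p # us) = 0 & (length Ys = nn - 1 --> (\<forall>Y\<in>set Ys. vf Q Y) --> lieD v (et mm) Ys p = 0)"
   if p: "p : Q" for p us Ys
  proof -
   have "p : M" using p Q by blast
   from loc[OF this] obtain O' N et' where *: "open O'" "p : O'" "O' \<subseteq> M \<inter> N" "et' : Arels N F"
    "\<forall>q\<in>O'. \<forall>mm. et mm q = et' mm q" by (elim exE conjE)
   have o: "open (O' \<inter> Q)" "O' \<inter> Q \<subseteq> N" "p : O' \<inter> Q" "O' \<inter> Q \<subseteq> Q" using * Q(1) p by auto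
   note v = vf_subset[OF Q(3) o(4)]
   have vF: "v q : F mm q" if "q : O' \<inter> Q" for q using Q(4) that by blast
   note b = basic_formD[OF abelian_relationsD(2)[OF *(4) mm] o(1,2) v vF o(3)]
   have eqp: "et mm p = et' mm p" using *(2,5) by simp
   have "lieD v (et mm) Ys p = 0" if Ys: "length Ys = nn - 1" "\<forall>Y\<in>set Ys. vf Q Y"
   proof -
    have Y: "vf (O' \<inter> Q) Y" if "Y : set Ys" for Y
     by (rule vf_subset[OF bspec[OF Ys(2) that] o(4)])
    have "lieD v (et mm) Ys p = lieD v (et' mm) Ys p"
    proof (rule lie_derivative_cong[where v = v and p = p])
     show "v p : TS p" by (rule vf_ts[OF Q(3) p])
     show "an p (%q. et' mm q (map (%Y. Y q) Ys))"
      by (rule form_on_an[OF abelian_relationsD(1)[OF *(4) mm] o(1,2) Ys(1) Y o(3)])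
     show "\<forall>\<^sub>F q in nhds p. et mm q = et' mm q"
      using eventually_nhds_in_open[OF *(1,2)] by eventually_elim (simp add: *(5))
    qed
    also have "... = 0" by (rule b(2)) (use vF Ys(1) Y in auto)
    finally show ?thesis .
   qed
   then show ?thesis using b(1)[of us] unfolding eqp by simp
  qed
  then show "(\<forall>p\<in>Q. \<forall>us. et mm p (v p # us) = 0) \<and>
    (\<forall>Ys. length Ys = nn - 1 --> (\<forall>Y\<in>set Ys. vf Q Y) --> (\<forall>p\<in>Q. lieD v (et mm) Ys p = 0))"
   by simp
 qed
next
 have loc': "\<exists>N et'. et' : Arels N F & (\<forall>mm. et mm p = et' mm p)" if p: "p : M" for p
 proof -
  from loc[OF p] obtain O' N et' where *: "p : O'" "et' : Arels N F"
   "\<forall>q\<in>O'. \<forall>mm. et mm q = et' mm q" by (elim exE conjE)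
  show ?thesis by (rule exI[of _ N], rule exI[of _ et'], rule conjI[OF *(2) bspec[OF *(3,1)]])
 qed
 show "et mm = 0" if mm: "mm \<notin> {1..nn + 1}" for mm
 proof
  fix p
  show "et mm p = 0 p"
  proof (cases "p : M")
   case True
   from loc'[OF this] obtain N et' where *: "et' : Arels N F" "\<forall>mm. et mm p = et' mm p" by (elim exE conjE)
   show ?thesis using *(2) abelian_relationsD(3)[OF *(1) mm] by simp
  qed (simp add: out)
 qed
 show "(\<Sum>mm=1..nn + 1. et mm) = 0"
 proof
  fix p
  show "(\<Sum>mm=1..nn + 1. et mm) p = 0 p"
  proof (cases "p : M")
   case True
   from loc'[OF this] obtain N et' where *: "et' : Arels N F" "\<forall>mm. et mm p = et' mm p" by (elim exE conjE)
   have "(\<Sum>mm=1..nn + 1. et mm) p = (\<Sum>mm=1..nn + 1. et' mm) p"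
    by (rule ext) (simp only: sum_fun_apply spec[OF *(2)])
   then show ?thesis unfolding abelian_relationsD(4)[OF *(1)] .
  qed (simp add: sum_fun_apply out)
 qed
qed

lemma relation_restrict:
 assumes et: "et : Arels N F" and M: "open M" "M \<subseteq> N"
 shows "(%mm q. if q : M then et mm q else 0) : Arels M F"
proof (rule relation_local)
 show "\<exists>O' N et'. open O' & p : O' & O' \<subseteq> M \<inter> N & et' : Arels N F \<and>
   (\<forall>q\<in>O'. \<forall>mm. (if q : M then et mm q else 0) = et' mm q)" if p: "p : M" for p
  by (intro exI[of _ M] exI[of _ N] exI[of _ et] conjI M(1) p et) (use M in auto)
qed simp

lemma relation_on_frame:
 assumes lf: "lfr M F sg" and M: "M \<subseteq> N" and et: "et : Arels N F"
 obtains f where "f : solutions M (cfs F sg)"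
  "!!q mm. q : M ==> et mm q = arel M (cfs F sg) f mm q"
  "!!q. q : M ==> f q = et 1 q (map (%k. cfs F sg k q) [2..<nn + 1])"
proof -
 note r = relation_restrict[OF et local_frameD(1)[OF lf] M]
 obtain f where f: "f : solutions M (cfs F sg)"
  "(%mm q. if q : M then et mm q else 0) = arel M (cfs F sg) f"
  "!!p. p : M ==> f p = (if p : M then et 1 p else 0) (map (%k. cfs F sg k p) [2..<nn + 1])"
  by (rule solution_of_relation[OF local_frame_wframe(1)[OF lf] n2 local_frame_wframe(2)[OF lf] r]) blast
 show thesis
 proof (rule that[OF f(1)])
  show "et mm q = arel M (cfs F sg) f mm q" if "q : M" for q mm
   using fun_cong[OF fun_cong[OF f(2), of mm], of q] that by simp
  show "f q = et 1 q (map (%k. cfs F sg k q) [2..<nn + 1])" if "q : M" for q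
   using f(3)[OF that] that by simp
 qed
qed

lemma relation_of_0: "arel N V f mm p = 0" if "f p = 0"
 unfolding abelian_relation_of_def using that by (auto simp: fscale_0 fun_eq_iff sum_fun_apply)

lemma relation_of_cong: "f p = g p ==> arel N V f mm p = arel N V g mm p"
 unfolding abelian_relation_of_def by simp

lemma solutions_combination:
 assumes F: "frame N V" and f: "f : solutions N V" and g: "g : solutions N V"
 shows "(%q. a * f q + b * g q) : solutions N V"
proof (rule solutionsI[OF F])
 show "an p (%q. a * f q + b * g q)" if "p : N" for p
  by (intro an_add an_mult an_const solutionsD(1)[OF f that] solutionsD(1)[OF g that])
 show "a * f p + b * g p = 0" if "p \<notin> N" for p
  using solutionsD(2)[OF f that] solutionsD(2)[OF g that] by simp
 fix p k assume p: "p : N" and k: "k : {1..nn}"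
 note v = vf_ts[OF frame_vf[OF F k] p]
 note fa = solutionsD(1)[OF f p] and ga = solutionsD(1)[OF g p]
 show "V k p (%q. a * f q + b * g q) = - (a * f p + b * g p) * om N V p [V k p]"
  unfolding tv_add[OF v an_mult[OF an_const fa] an_mult[OF an_const ga]] tv_cmult[OF v fa] tv_cmult[OF v ga]
   solutionsD(3)[OF f p v] solutionsD(3)[OF g p v] by (simp add: algebra_simps)
qed

section \<open>The rank\<close>

definition independent_germs :: "'a => nat => bool" where
 "independent_germs p m \<longleftrightarrow> (\<exists>N F et. p : N & lo N F & (\<forall>i<m. et i : Arels N F) \<and>
   (\<forall>c. (\<forall>\<^sub>F q in nhds p. \<forall>mm. (\<Sum>i<m. fscale (c i) (et i mm q)) = 0) --> (\<forall>i<m. c i = (0 :: 'k))))"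

lemma germ_dim_eq: "germ_dim \<A> W p = Sup {enat m | m. independent_germs p m}"
 unfolding germ_dim_def independent_germs_def ..

lemma germ_dim_le: "(!!m. independent_germs p m ==> m \<le> b) ==> germ_dim \<A> W p \<le> enat b"
 unfolding germ_dim_eq by (rule Sup_least) auto

lemma germ_dim_ge: "independent_germs p m ==> enat m \<le> germ_dim \<A> W p"
 unfolding germ_dim_eq by (rule Sup_upper) auto

lemma first_coefficients:
 fixes x :: "nat => 'x => 'k"
 assumes "2 \<le> m"
 shows "(\<Sum>i<m. fscale (if i = 0 then a else if i = 1 then b else 0) (x i)) = fscale a (x 0) + fscale b (x 1)"
proof -
 have "(\<Sum>i<m. fscale (if i = 0 then a else if i = 1 then b else 0) (x i))
   = (\<Sum>i\<in>{0, 1}. fscale (if i = 0 then a else if i = 1 then b else 0) (x i))"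
  by (rule sum.mono_neutral_right) (use assms in \<open>auto simp: fscale_0\<close>)
 then show ?thesis by simp
qed

text \<open>A relation is determined near \<open>p\<close> by the value at \<open>p\<close> of the function that it corresponds to.\<close>

lemma germs_le_1:
 assumes "independent_germs p m"
 shows "m \<le> 1"
proof (rule ccontr)
 assume "\<not> m \<le> 1"
 then have m: "2 \<le> m" by simp
 from assms obtain N F et where p: "p : N" and F: "lo N F" and et: "\<forall>i<m. et i : Arels N F"
  and ind: "\<forall>c. (\<forall>\<^sub>F q in nhds p. \<forall>mm. (\<Sum>i<m. fscale (c i) (et i mm q)) = 0) --> (\<forall>i<m. c i = (0 :: 'k))"
  unfolding independent_germs_def by (elim exE conjE)
 obtain M sg where M: "p : M" "M \<subseteq> N" and lf: "lfr M F sg" by (rule local_frame_exists[OF F p])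
 let ?V = "cfs F sg"
 note Fr = wframe_frame[OF local_frame_wframe(1)[OF lf]] and cM = local_frameD(2)[OF lf] and oM = local_frameD(1)[OF lf]
 have et0: "et 0 : Arels N F" and et1: "et 1 : Arels N F" using et m by auto
 obtain f where f: "f : solutions M ?V" "!!q mm. q : M ==> et 0 mm q = arel M ?V f mm q"
  by (rule relation_on_frame[OF lf M(2) et0]) blast
 obtain g where g: "g : solutions M ?V" "!!q mm. q : M ==> et 1 mm q = arel M ?V g mm q"
  by (rule relation_on_frame[OF lf M(2) et1]) blast
 have key: "a = 0 & b = 0" if ab: "a * f p + b * g p = 0" for a b
 proof -
  let ?c = "%i::nat. if i = 0 then a else if i = 1 then b else 0"
  have 0: "a * f q + b * g q = 0" if "q : M" for q
   by (rule solution_dichotomy[OF Fr cM solutions_combination[OF Fr f(1) g(1)] M(1) ab])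
  have "(\<Sum>i<m. fscale (?c i) (et i mm q)) = 0" if q: "q : M" for q mm
  proof -
   have "(\<Sum>i<m. fscale (?c i) (et i mm q)) = fscale a (et 0 mm q) + fscale b (et 1 mm q)"
    by (rule first_coefficients[OF m])
   also have "... = arel M ?V (%q. a * f q + b * g q) mm q"
    unfolding f(2)[OF q] g(2)[OF q] abelian_relation_of_def
    by (rule ext) (simp add: sum_fun_apply algebra_simps sum_distrib_left sum.distrib)
   also have "... = 0" by (rule relation_of_0) (rule 0[OF q])
   finally show ?thesis .
  qed
  then have "\<forall>\<^sub>F q in nhds p. \<forall>mm. (\<Sum>i<m. fscale (?c i) (et i mm q)) = 0"
   using eventually_nhds_in_open[OF oM M(1)] by (auto elim!: eventually_mono)
  from mp[OF spec[OF ind, of ?c] this] have c: "\<forall>i<m. ?c i = 0" .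
  show ?thesis using c[rule_format, of 0] c[rule_format, of 1] m by simp
 qed
 show False using key[of "g p" "- f p"] key[of 1 0] by (auto simp: mult.commute)
qed

lemma rank_le_1: "web_rank \<A> W \<le> 1"
 unfolding web_rank_def one_enat_def by (rule SUP_least) (rule germ_dim_le[OF germs_le_1])

text \<open>A nonzero relation gives a nowhere vanishing solution on a small frame, hence zero curvature there; the
 identity theorem spreads this over the manifold.\<close>

lemma germ_flat:
 assumes m: "independent_germs p m" "m > 0"
 shows "K0 = 0"
proof -
 from m(1) obtain N F et where p: "p : N" and F: "lo N F" and et: "\<forall>i<m. et i : Arels N F"
  and ind: "\<forall>c. (\<forall>\<^sub>F q in nhds p. \<forall>mm. (\<Sum>i<m. fscale (c i) (et i mm q)) = 0) --> (\<forall>i<m. c i = (0 :: 'k))"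
  unfolding independent_germs_def by (elim exE conjE)
 obtain M sg where M: "p : M" "M \<subseteq> N" and lf: "lfr M F sg" by (rule local_frame_exists[OF F p])
 let ?V = "cfs F sg"
 note Fr = wframe_frame[OF local_frame_wframe(1)[OF lf]] and cM = local_frameD(2)[OF lf] and oM = local_frameD(1)[OF lf]
 have et0: "et 0 : Arels N F" using et m by auto
 obtain f where f: "f : solutions M ?V" "!!q mm. q : M ==> et 0 mm q = arel M ?V f mm q"
  by (rule relation_on_frame[OF lf M(2) et0]) blast
 have nz: "f q ~= 0" if q: "q : M" for q
 proof
  assume 0: "f q = 0"
  let ?c = "%i::nat. if i = 0 then 1 else (0::'k)"
  have "(\<Sum>i<m. fscale (?c i) (et i mm x)) = 0" if x: "x : M" for x mm
  proof (rule sum.neutral, rule ballI)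
   fix i
   have "et 0 mm x = 0" unfolding f(2)[OF x] by (rule relation_of_0[OF solution_dichotomy[OF Fr cM f(1) q 0]])
   then show "fscale (?c i) (et i mm x) = 0" by (simp add: fscale_0)
  qed
  then have "\<forall>\<^sub>F q in nhds p. \<forall>mm. (\<Sum>i<m. fscale (?c i) (et i mm q)) = 0"
   using eventually_nhds_in_open[OF oM M(1)] by (auto elim!: eventually_mono)
  from mp[OF spec[OF ind, of ?c] this] have "\<forall>i<m. ?c i = 0" .
  then show False using m(2) by auto
 qed
 show ?thesis
 proof (rule form_identity[OF K0_form conn oM local_frameD(3)[OF lf]])
  show "K0 q = 0" if q: "q : M" for q unfolding K0_eq[OF lf q] by (rule solution_flat[OF Fr f(1) q nz[OF q]])
 qed
qed

lemma rank_0: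
 assumes "K0 ~= 0"
 shows "web_rank \<A> W = 0"
proof -
 have "web_rank \<A> W \<le> enat 0"
  unfolding web_rank_def
 proof (rule SUP_least, rule germ_dim_le)
  show "m \<le> 0" if "independent_germs p m" for p m using germ_flat[OF that] assms by (cases m) auto
 qed
 then show ?thesis by (simp add: zero_enat_def[symmetric])
qed

lemma rank_1:
 assumes K: "K0 = 0"
 shows "web_rank \<A> W = 1"
proof -
 define p :: 'a where "p = undefined"
 obtain N F sg where lf: "lfr N F sg" "p : N" by (rule frame_at)
 let ?V = "cfs F sg"
 note w = local_frame_wframe(1)[OF lf(1)]
 have 0: "Omf N ?V q = 0" if "q : N" for q using K0_eq[OF lf(1) that] K by simp
 show ?thesis
 proof (rule flat_solution[OF wframe_frame[OF w] lf(2) 0])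
 fix O' f assume O': "open O'" "p : O'" "O' \<subseteq> N" and f: "f : solutions O' ?V" "!!q. q : O' ==> f q ~= 0"
 note w' = wframe_subset[OF w O'(1,3)]
 have sp: "spans O' ?V F" using local_frame_wframe(2)[OF lf(1)] O'(3) unfolding spans_def by blast
 let ?et = "arel O' ?V f"
 have "independent_germs p 1"
  unfolding independent_germs_def
 proof (intro exI[of _ O'] exI[of _ F] exI[of _ "%_. ?et"] conjI allI impI)
  show "p : O'" by (rule O'(2))
  show "lo O' F" by (rule lo_subset[OF local_frameD(4)[OF lf(1)] O'(1,3)])
  show "?et : Arels O' F" for i :: nat by (rule relation_of_solution[OF w' n2 sp f(1)])
  fix c :: "nat => 'k" and i :: nat assume ev: "\<forall>\<^sub>F q in nhds p. \<forall>mm. (\<Sum>i<1. fscale (c i) (?et mm q)) = 0" and i: "i < 1"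
  have "(\<Sum>i<1. fscale (c i) (?et 1 p)) = 0" using eventually_nhds_x_imp_x[OF ev] by (rule spec)
  then have "fscale (c 0) (?et 1 p) (map (%k. ?V k p) [2..<nn + 1]) = 0" by simp
  then have "c 0 * f p = 0" unfolding fscale_apply relation_coefficient[OF w' O'(2)] .
  then show "c i = 0" using f(2)[OF O'(2)] i by simp
 qed
 from germ_dim_ge[OF this] have "1 \<le> germ_dim \<A> W p" by (simp add: one_enat_def)
 also have "... \<le> web_rank \<A> W" unfolding web_rank_def by (rule SUP_upper) simp
 finally show "web_rank \<A> W = 1" using rank_le_1 by (rule antisym[rotated])
 qed
qed

section \<open>Abelian relations as flat sections\<close>

text \<open>The value on \<open>sg \<otimes> ... \<otimes> sg\<close> is \<open>et\<^sub>1 (V\<^sub>2, ..., V\<^sub>n)\<close>, the function that \<open>et\<close> corresponds to.\<close>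

definition relation_section ::
 "'a set => (nat => 'a => ('a, 'k) tvec set) => (nat => ('a, 'k) dform) => ('a, 'k) tsection" where
 "relation_section N F et p xs =
  (if p : N & length xs = kk & set xs \<subseteq> Efib p
   then et 1 p (map (%i. (xs ! i) (F (i + 2) p)) [0..<kk]) else 0)"

lemma alt_fscale_each:
 assumes h: "h : alt k p" and w: "!!i. i < k ==> w i : TS p"
 shows "h (map (%i. fscale (e i) (w i)) [0..<k]) = (\<Prod>i<k. e i) * h (map w [0..<k])"
proof -
 have "j \<le> k ==> h (map (%i. if i < j then fscale (e i) (w i) else w i) [0..<k]) = (\<Prod>i<j. e i) * h (map w [0..<k])" for j
 proof (induction j)
  case 0
  have "map (%i. if i < 0 then fscale (e i) (w i) else w i) [0..<k] = map w [0..<k]" by (rule nth_equalityI) simp_all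
  then show ?case by simp
 next
  case (Suc j)
  define xs where "xs = map (%i. if i < j then fscale (e i) (w i) else w i) [0..<k]"
  have j: "j < k" using Suc.prems by simp
  have len: "length xs = k" by (simp add: xs_def)
  have xs: "set xs \<subseteq> TS p"
  proof
   fix x assume "x : set xs"
   then obtain i where i: "i < k" "x = (if i < j then fscale (e i) (w i) else w i)" by (auto simp: xs_def)
   show "x : TS p" using i(2) w[OF i(1)] ts_fscale[OF w[OF i(1)], of "e i"] by (cases "i < j") (simp_all only: if_True if_False)
  qed
  have "map (%i. if i < Suc j then fscale (e i) (w i) else w i) [0..<k] = xs[j := fscale (e j) (w j)]"
  proof (rule nth_equalityI)
   fix i assume "i < length (map (%i. if i < Suc j then fscale (e i) (w i) else w i) [0..<k])"
   then have i: "i < k" by simp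
   show "map (%i. if i < Suc j then fscale (e i) (w i) else w i) [0..<k] ! i = xs[j := fscale (e j) (w j)] ! i"
    using i j by (cases "i = j") (simp_all add: xs_def less_Suc_eq)
  qed (simp add: xs_def)
  then have "h (map (%i. if i < Suc j then fscale (e i) (w i) else w i) [0..<k]) = e j * h (xs[j := w j])"
   using conjunct2[OF alt_slot[OF h len xs j w[OF j] w[OF j]], of "e j"] by simp
  also have "xs[j := w j] = xs" by (rule list_update_same_conv[THEN iffD2]) (use j in \<open>simp_all add: xs_def\<close>)
  also have "h xs = (\<Prod>i<j. e i) * h (map w [0..<k])" unfolding xs_def using Suc by simp
  finally show ?case by (simp add: mult_ac)
 qed
 from this[of k] have "h (map (%i. if i < k then fscale (e i) (w i) else w i) [0..<k]) = (\<Prod>i<k. e i) * h (map w [0..<k])" by simp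
 moreover have "map (%i. if i < k then fscale (e i) (w i) else w i) [0..<k] = map (%i. fscale (e i) (w i)) [0..<k]"
  by (rule map_cong[OF refl]) simp
 ultimately show ?thesis by (simp only:)
qed

lemma relation_section_frame:
 assumes lf: "lfr M F sg" and M: "M \<subseteq> N" and et: "et : Arels N F" and p: "p : M"
  and c: "c = et 1 p (map (%k. cfs F sg k p) [2..<nn + 1])"
 shows "relation_section N F et p = fscale c (dpow kk M sg p)"
proof
 fix xs
 have pN: "p : N" using p M by blast
 have one: "1 : {1..nn + 1}" by simp
 show "relation_section N F et p xs = fscale c (dpow kk M sg p) xs"
 proof (cases "length xs = kk & set xs \<subseteq> Efib p")
  case True
  let ?e = "%i. ec F sg p (xs ! i)" and ?w = "%i. cfs F sg (i + 2) p"
  have "(xs ! i) (F (i + 2) p) = fscale (?e i) (?w i)" if "i < kk" for i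
  proof -
   have "xs ! i : Efib p" using True that by auto
   from fun_cong[OF ec_expand[OF lf p this], of "F (i + 2) p"] show ?thesis
    unfolding fscale2_apply component_fields_def .
  qed
  then have 1: "map (%i. (xs ! i) (F (i + 2) p)) [0..<kk] = map (%i. fscale (?e i) (?w i)) [0..<kk]"
   by (intro map_cong refl) (simp only: set_upt atLeastLessThan_iff)
  have 2: "et 1 p (map (%i. fscale (?e i) (?w i)) [0..<kk]) = (\<Prod>i<kk. ?e i) * et 1 p (map ?w [0..<kk])"
  proof (rule alt_fscale_each[OF form_on_alt[OF abelian_relationsD(1)[OF et one] pN]])
   show "?w i : TS p" if "i < kk" for i
    by (rule wframe_ts[OF local_frame_wframe(1)[OF lf] _ p]) (use that in auto)
  qed
  have 3: "map ?w [0..<kk] = map (%k. cfs F sg k p) [2..<nn + 1]"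
   by (rule nth_equalityI) (auto simp del: upt_Suc simp: add.commute)
  have 4: "(\<Prod>i<kk. ?e i) = (\<Prod>x\<leftarrow>xs. ec F sg p x)"
   using True by (simp add: prod.list_conv_set_nth lessThan_atLeast0)
  have "relation_section N F et p xs = et 1 p (map (%i. (xs ! i) (F (i + 2) p)) [0..<kk])"
   unfolding relation_section_def by (rule if_P) (rule conjI[OF pN True])
  also have "... = (\<Prod>x\<leftarrow>xs. ec F sg p x) * c" unfolding 1 2 3 4 c ..
  finally show ?thesis
   unfolding dual_power_eq[OF lf p order_refl] fscale_apply if_P[OF True] by (simp only: mult.commute)
 next
  case False
  then show ?thesis unfolding relation_section_def dual_power_eq[OF lf p order_refl] by auto
 qed
qed

context
 fixes D assumes D: "glob D"
begin

lemma relation_section_flat: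
 assumes F: "lo N F" and et: "et : Arels N F"
 shows "relation_section N F et : flat_sections \<A> W kk N D"
 unfolding flat_sections_def mem_Collect_eq
proof (intro conjI ballI)
 show ts: "tsec kk N (relation_section N F et)"
 proof (rule tensor_section_local)
  fix p assume p: "p : N"
  obtain M sg where M: "p : M" "M \<subseteq> N" and lf: "lfr M F sg" by (rule local_frame_exists[OF F p])
  obtain f where f: "f : solutions M (cfs F sg)"
   "!!q mm. q : M ==> et mm q = arel M (cfs F sg) f mm q"
   "!!q. q : M ==> f q = et 1 q (map (%k. cfs F sg k q) [2..<nn + 1])"
   by (rule relation_on_frame[OF lf M(2) et]) blast
  note oM = local_frameD(1)[OF lf]
  show "\<exists>M h'. open M & p : M & tsec kk M h' & (\<forall>q\<in>M. relation_section N F et q = h' q)"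
   by (intro exI[of _ M] exI[of _ "%q. fscale (f q) (dpow kk M sg q)"] conjI ballI oM M(1)
     scaled_dual_power_section[OF lf oM order_refl solutionsD(1)[OF f(1)]]
     relation_section_frame[OF lf M(2) et _ f(3)])
 next
  show "relation_section N F et p = 0" if "p \<notin> N" for p
   using that by (intro ext) (simp add: relation_section_def)
 qed
 fix p v assume p: "p : N" and v: "v : TS p"
 obtain M sg where M: "p : M" "M \<subseteq> N" and lf: "lfr M F sg" by (rule local_frame_exists[OF F p])
 obtain f where f: "f : solutions M (cfs F sg)"
  "!!q mm. q : M ==> et mm q = arel M (cfs F sg) f mm q"
  "!!q. q : M ==> f q = et 1 q (map (%k. cfs F sg k q) [2..<nn + 1])"
  by (rule relation_on_frame[OF lf M(2) et]) blast
 have c: "coef sg (relation_section N F et) q = f q" if q: "q : M" for q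
  unfolding coef_def relation_section_frame[OF lf M(2) et q f(3)[OF q]] fscale_apply dual_power_frame[OF lf q] by simp
 have "v f = v (coef sg (relation_section N F et))"
  by (rule tv_cong[OF v solutionsD(1)[OF f(1) M(1)]])
   (use eventually_nhds_in_open[OF local_frameD(1)[OF lf] M(1)] in \<open>eventually_elim, simp add: c\<close>)
 then have "v (coef sg (relation_section N F et)) + coef sg (relation_section N F et) p * om M (cfs F sg) p [v] = 0"
  unfolding solutionsD(3)[OF f(1) M(1) v] c[OF M(1)] by (simp add: eq_commute[of "- _"])
 then show "D p v (relation_section N F et) = 0"
  unfolding global_eq[OF D lf M(1) p ts loD(1)[OF F] v] covD_def by (simp only: fscale_0)
qed

text \<open>The value of the section is that of the function \<open>f\<close>, which fixes all the forms.\<close>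

lemma relation_section_determines:
 assumes F: "lo M F" and et: "et : Arels N F" "et' : Arels N' F" and M: "M \<subseteq> N" "M \<subseteq> N'" and p: "p : M"
  and eq: "relation_section N F et p = relation_section N' F et' p"
 shows "et mm p = et' mm p"
proof -
 obtain Q sg where Q: "p : Q" "Q \<subseteq> M" and lf: "lfr Q F sg" by (rule local_frame_exists[OF F p])
 have QN: "Q \<subseteq> N" "Q \<subseteq> N'" using Q M by auto
 let ?V = "cfs F sg"
 obtain f where f: "f : solutions Q ?V" "!!q mm. q : Q ==> et mm q = arel Q ?V f mm q"
  "!!q. q : Q ==> f q = et 1 q (map (%k. ?V k q) [2..<nn + 1])"
  by (rule relation_on_frame[OF lf QN(1) et(1)]) blast
 obtain g where g: "g : solutions Q ?V" "!!q mm. q : Q ==> et' mm q = arel Q ?V g mm q"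
  "!!q. q : Q ==> g q = et' 1 q (map (%k. ?V k q) [2..<nn + 1])"
  by (rule relation_on_frame[OF lf QN(2) et(2)]) blast
 have "fscale (f p) (dpow kk Q sg p) = fscale (g p) (dpow kk Q sg p)"
  using eq unfolding relation_section_frame[OF lf QN(1) et(1) Q(1) f(3)[OF Q(1)]]
   relation_section_frame[OF lf QN(2) et(2) Q(1) g(3)[OF Q(1)]] .
 from fun_cong[OF this, of "replicate kk (sg p)"] have "f p = g p"
  unfolding fscale_apply dual_power_frame[OF lf Q(1)] by simp
 then show ?thesis unfolding f(2)[OF Q(1)] g(2)[OF Q(1)] by (rule relation_of_cong)
qed

lemma flat_section_local_relation:
 assumes lf: "lfr M F sg" and M: "M \<subseteq> N" and N: "open N" and h: "h : flat_sections \<A> W kk N D"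
 shows "\<exists>et\<in>Arels M F. \<forall>q\<in>M. relation_section M F et q = h q"
proof -
 let ?V = "cfs F sg"
 note w = local_frame_wframe(1)[OF lf] and sp = local_frame_wframe(2)[OF lf]
 have ts: "tsec kk N h" and flat: "!!p v. p : N ==> v : TS p ==> D p v h = 0"
  using h unfolding flat_sections_def by simp_all
 define f where "f q = (if q : M then coef sg h q else 0)" for q
 have fan: "an p (coef sg h)" if "p : M" for p
  unfolding coef_def[abs_def] by (rule tensor_coeff_an[OF lf ts N _ that]) (use that M in blast)
 have ev: "\<forall>\<^sub>F q in nhds p. coef sg h q = f q" if "p : M" for p
  using eventually_nhds_in_open[OF local_frameD(1)[OF lf] that] by eventually_elim (simp add: f_def)
 have f: "f : solutions M ?V"
 proof (rule solutionsI[OF wframe_frame[OF w]])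
  show "an p f" if "p : M" for p by (rule an_cong[OF fan[OF that] ev[OF that]])
  show "f p = 0" if "p \<notin> M" for p using that by (simp add: f_def)
  fix p k assume p: "p : M" and k: "k : {1..nn}"
  have pN: "p : N" using p M by blast
  note v = vf_ts[OF frame_vf[OF wframe_frame[OF w] k] p]
  have "covD M F sg p (?V k p) h = 0" unfolding global_eq[OF D lf p pN ts N v, symmetric] by (rule flat[OF pN v])
  then have "?V k p (coef sg h) + coef sg h p * om M ?V p [?V k p] = 0"
   unfolding coef_covD[OF lf p, symmetric] by simp
  then show "?V k p f = - f p * om M ?V p [?V k p]"
   unfolding tv_cong[OF v fan[OF p] ev[OF p], symmetric] using p by (simp add: f_def add_eq_0_iff2)
 qed
 note et = relation_of_solution[OF w n2 sp f]
 have "relation_section M F (arel M ?V f) q = h q" if q: "q : M" for q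
 proof -
  have qN: "q : N" using q M by blast
  have "relation_section M F (arel M ?V f) q = fscale (f q) (dpow kk M sg q)"
   by (rule relation_section_frame[OF lf order_refl et q relation_coefficient[OF w q, symmetric]])
  also have "f q = h q (replicate kk (sg q))" using q by (simp add: f_def coef_def)
  also have "fscale (h q (replicate kk (sg q))) (dpow kk M sg q) = h q"
   by (rule tensor_eq_dual_power[OF lf q tensor_sectionD(1)[OF ts qN], symmetric])
  finally show ?thesis .
 qed
 with et show ?thesis by (intro bexI ballI)
qed

text \<open>Over a frame a flat section gives a solution \<open>f\<close> and so a relation.  Relations with the same
 section agree at each point, so the local ones glue.\<close>

lemma relation_section_bij:
 assumes F: "lo N F"
 shows "bij_betw (relation_section N F) (Arels N F) (flat_sections \<A> W kk N D)"
 unfolding bij_betw_def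
proof
 note oN = loD(1)[OF F]
 show "inj_on (relation_section N F) (Arels N F)"
 proof (rule inj_onI)
  fix et et' assume et: "et : Arels N F" "et' : Arels N F"
   and eq: "relation_section N F et = relation_section N F et'"
  have e: "et mm p = et' mm p" for mm p
  proof (cases "p : N")
   case True
   show ?thesis by (rule relation_section_determines[OF F et order_refl order_refl True fun_cong[OF eq]])
  next
   case False
   have "\<zeta> mm p = 0" if \<zeta>: "\<zeta> : Arels N F" for \<zeta>
   proof (cases "mm : {1..nn + 1}")
    case True
    show ?thesis by (rule form_on_outside[OF abelian_relationsD(1)[OF \<zeta> True] False])
   next
    case False
    show ?thesis unfolding abelian_relationsD(3)[OF \<zeta> False] by simp
   qed
   from this[OF et(1)] this[OF et(2)] show ?thesis by simp
  qed
  show "et = et'" by (rule ext, rule ext, rule e)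
 qed
 show "relation_section N F ` Arels N F = flat_sections \<A> W kk N D"
 proof
  show "relation_section N F ` Arels N F \<subseteq> flat_sections \<A> W kk N D"
   using relation_section_flat[OF F] by blast
  show "flat_sections \<A> W kk N D \<subseteq> relation_section N F ` Arels N F"
  proof
   fix h assume h: "h : flat_sections \<A> W kk N D"
   then have ts: "tsec kk N h" unfolding flat_sections_def by simp
   define R where "R M \<zeta> \<longleftrightarrow> open M & M \<subseteq> N & \<zeta> : Arels M F & (\<forall>q\<in>M. relation_section M F \<zeta> q = h q)"
    for M and \<zeta> :: "nat => ('a, 'k) dform"
   have ex: "\<exists>M \<zeta>. p : M & R M \<zeta>" if p: "p : N" for p
   proof -
    obtain M sg where M: "p : M" "M \<subseteq> N" and lf: "lfr M F sg" by (rule local_frame_exists[OF F p])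
    from flat_section_local_relation[OF lf M(2) oN h] obtain \<zeta> where "\<zeta> : Arels M F"
     "\<forall>q\<in>M. relation_section M F \<zeta> q = h q" by (elim bexE)
    then show ?thesis unfolding R_def
     by (intro exI[of _ M] exI[of _ \<zeta>] conjI) (rule M local_frameD(1)[OF lf] | assumption)+
   qed
   have uniq: "\<zeta> mm p = \<zeta>' mm p" if "R M \<zeta>" "p : M" "R M' \<zeta>'" "p : M'" for M \<zeta> M' \<zeta>' p mm
   proof -
    note R = \<open>R M \<zeta>\<close>[unfolded R_def] \<open>R M' \<zeta>'\<close>[unfolded R_def]
    have F': "lo (M \<inter> M') F" by (rule lo_subset[OF F]) (use R in auto)
    show ?thesis
    proof (rule relation_section_determines[OF F'])
     show "\<zeta> : Arels M F" "\<zeta>' : Arels M' F" using R by blast+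
     show "relation_section M F \<zeta> p = relation_section M' F \<zeta>' p" using R that by simp
    qed (use that in auto)
   qed
   define et where "et mm p = (if p : N then SOME e. \<exists>M \<zeta>. p : M & R M \<zeta> & e = \<zeta> mm p else 0)" for mm p
   have et: "et mm p = \<zeta> mm p" if "R M \<zeta>" "p : M" for M \<zeta> mm p
   proof -
    have pN: "p : N" using that(1)[unfolded R_def, THEN conjunct2, THEN conjunct1] that(2) by (rule subsetD)
    have "\<exists>M' \<zeta>'. p : M' & R M' \<zeta>' & et mm p = \<zeta>' mm p"
     unfolding et_def if_P[OF pN]
     by (rule someI[of "%e. \<exists>M \<zeta>. p : M & R M \<zeta> & e = \<zeta> mm p" "\<zeta> mm p"]) (intro exI[of _ M] exI[of _ \<zeta>] conjI that refl)
    then obtain M' \<zeta>' where "p : M'" "R M' \<zeta>'" "et mm p = \<zeta>' mm p" by (elim exE conjE)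
    then show ?thesis using uniq[OF that] by simp
   qed
   have etr: "et : Arels N F"
   proof (rule relation_local)
    show "et mm p = 0" if "p \<notin> N" for p mm using that by (simp add: et_def)
    fix p assume "p : N"
    from ex[OF this] obtain M \<zeta> where M: "p : M" "R M \<zeta>" by (elim exE conjE)
    show "\<exists>O' N' \<zeta>. open O' & p : O' & O' \<subseteq> N \<inter> N' & \<zeta> : Arels N' F & (\<forall>q\<in>O'. \<forall>mm. et mm q = \<zeta> mm q)"
     by (intro exI[of _ M] exI[of _ \<zeta>] conjI ballI allI et[OF M(2)] M(1)) (use M(2) in \<open>auto simp: R_def\<close>)
   qed
   have "relation_section N F et = h"
   proof
    fix p
    show "relation_section N F et p = h p"
    proof (cases "p : N")
     case True
     from ex[OF this] obtain M \<zeta> where M: "p : M" "R M \<zeta>" by (elim exE conjE)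
     have "relation_section N F et p = relation_section M F \<zeta> p"
      by (rule ext) (simp only: relation_section_def et[OF M(2,1)] True M(1) simp_thms)
     then show ?thesis using M unfolding R_def by simp
    next
     case False
     then show ?thesis using tensor_sectionD(2)[OF ts False] by (intro ext) (simp add: relation_section_def)
    qed
   qed
   then show "h : relation_section N F ` Arels N F" using etr by (intro image_eqI) simp_all
  qed
 qed
qed

end

end

section \<open>The Blaschke curvature of a three-web\<close>

lemma wedge_pair: "wedge [\<alpha>, \<beta>] p [v, w] = \<alpha> p [v] * \<beta> p [w] - \<alpha> p [w] * (\<beta> p [v] :: 'k::comm_ring_1)"
proof -
 have "{\<pi>. \<pi> permutes {Suc 0, 0}} = {id, Transposition.transpose (Suc 0) 0}"
  by (auto simp: permutes_doubleton_iff)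
 moreover have "id ~= Transposition.transpose (Suc 0) 0"
  by (metis id_apply transpose_apply_first n_not_Suc_n)
 ultimately show ?thesis
  unfolding wedge_def by (simp add: sign_swap_id sign_id lessThan_Suc)
qed

lemma numeral_intervals:
 "{1..2 :: nat} = {1, 2}" "{1..3 :: nat} = {1, 2, 3}" "[1..<3] = [1, 2 :: nat]"
 "{Suc 0..2} = {1, 2}" "{Suc 0..3} = {1, 2, 3}" "[Suc 0..<3] = [1, 2]"
 by (auto simp: upt_rec)

context web
begin

context
 assumes n: "nn = 2"
begin

abbreviation standard_coframe :: "'a set => (nat => 'a => ('a, 'k) tvec) => nat => ('a, 'k) dform" where
 "standard_coframe N V \<equiv> arel N V (%_. 1)"

lemma indices: "mm : {1..3} ==> mm : {1..nn + 1}" "1 : {1..nn}" "2 : {1..nn}" "1 : {1..nn + 1}" "2 : {1..nn + 1}" "3 : {1..nn + 1}"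
 using n by auto

lemma third_field: "wframe N V ==> p : N ==> V 3 p = fscale (- 1) (V 1 p + V 2 p)"
 using wframe_last[of N V p] unfolding fscale_minus_1 n by (simp add: numeral_intervals)

text \<open>The kernels and the vanishing of the sum leave one free parameter, the value of \<open>t 1\<close> on \<open>V 2\<close>.\<close>

lemma triple_values:
 assumes V: "wframe N V" and p: "p : N" and t: "!!mm. mm : {1..3} ==> t mm : alt 1 p"
  and 0: "!!mm. mm : {1..3} ==> t mm [V mm p] = 0" and s: "!!v. t 1 [v] + t 2 [v] + t 3 [v] = 0" and u: "t 1 [V 2 p] = 1"
 shows "t 1 [V 1 p] = 0" "t 1 [V 2 p] = 1" "t 2 [V 1 p] = - 1" "t 2 [V 2 p] = 0" "t 3 [V 1 p] = 1" "t 3 [V 2 p] = - 1"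
proof -
 have z: "t 1 [V 1 p] = 0" "t 2 [V 2 p] = 0" "t 3 [V 3 p] = 0" by (rule 0, simp)+
 note v1 = wframe_ts[OF V indices(4) p] and v2 = wframe_ts[OF V indices(5) p]
 have t3: "t 3 : alt 1 p" by (rule t) simp
 have "t 3 [V 3 p] = - (t 3 [V 1 p] + t 3 [V 2 p])"
  unfolding third_field[OF V p] alt_1(2)[OF t3 ts_add[OF v1 v2]] alt_1(1)[OF t3 v1 v2] by simp
 from trans[OF sym[OF this] z(3)] have a: "t 3 [V 1 p] + t 3 [V 2 p] = 0" by (rule neg_equal_0_iff_equal[THEN iffD1])
 have "1 + t 3 [V 2 p] = 0" using s[of "V 2 p"] unfolding u z(2) by (simp only: add_0_right)
 then have b: "t 3 [V 2 p] = - 1" by (rule add_eq_0_iff[THEN iffD1])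
 have c: "t 3 [V 1 p] = 1" using a b by simp
 have "t 2 [V 1 p] + 1 = 0" using s[of "V 1 p"] unfolding z(1) c by (simp only: add_0_left)
 then have d: "t 2 [V 1 p] = - 1" by (rule add_eq_0_iff2[THEN iffD1])
 show "t 1 [V 1 p] = 0" "t 1 [V 2 p] = 1" "t 2 [V 1 p] = - 1" "t 2 [V 2 p] = 0" "t 3 [V 1 p] = 1" "t 3 [V 2 p] = - 1"
  by (rule z(1) u d z(2) c b)+
qed

lemma one_form_eq:
 assumes V: "wframe N V" and p: "p : N" and h: "h : alt 1 p" "h' : alt 1 p"
  and eq: "h [V 1 p] = h' [V 1 p]" "h [V 2 p] = h' [V 2 p]"
 shows "h = h'"
proof -
 have "(%vs. h vs + - 1 * h' vs) = (%vs. 0)"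
 proof (rule alt_basis_ext[OF alt_add[OF h(1) alt_cmult[OF h(2)]] frame_basis[OF wframe_frame[OF V] p]])
  fix "is" :: "nat list" assume i: "length is = 1" "set is \<subseteq> {1..nn}"
  from i(1) obtain j where j: "is = [j]" by (cases "is") auto
  have "1 \<le> j & j \<le> 2" using i(2) n unfolding j by simp
  then have "j = 1 \<or> j = 2" by arith
  then show "h (map (%k. V k p) is) + - 1 * h' (map (%k. V k p) is) = 0" using eq unfolding j by auto
 qed
 then have "h vs + - 1 * h' vs = 0" for vs by (rule fun_cong)
 then show ?thesis by (intro ext) (simp add: add_eq_0_iff2)
qed

lemma standard_coframe_alt:
 assumes V: "wframe N V" and mm: "mm : {1..3}"
 shows "fon 1 N (standard_coframe N V mm)"
proof -
 have "fon (nn - 1) N (standard_coframe N V mm)"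
  by (rule abelian_relation_of_form[OF V n2 an_const indices(1)[OF mm]])
 then show ?thesis unfolding n by simp
qed

lemma standard_coframe_sum: "standard_coframe N V 1 p vs + standard_coframe N V 2 p vs + standard_coframe N V 3 p vs = 0"
 by (simp add: abelian_relation_of_def n numeral_intervals)

lemma standard_coframe_apply:
 assumes V: "wframe N V" and p: "p : N" and mm: "mm : {1..3}"
 shows "standard_coframe N V mm p us = vol N V p (V mm p # us)"
 unfolding abelian_relation_of_eq[OF V p indices(1)[OF mm]] by simp

lemma standard_coframe_kernel:
 assumes V: "wframe N V" and p: "p : N" and mm: "mm : {1..3}"
 shows "standard_coframe N V mm p [V mm p] = 0"
 unfolding standard_coframe_apply[OF V p mm]
 by (rule alt_equal[OF vol_alt[OF wframe_frame[OF V] p], of 0 1]) simp_all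

lemma standard_coframe_values:
 assumes V: "wframe N V" and p: "p : N"
 shows "standard_coframe N V 1 p [V 1 p] = 0" "standard_coframe N V 1 p [V 2 p] = 1"
  "standard_coframe N V 2 p [V 1 p] = - 1" "standard_coframe N V 2 p [V 2 p] = 0"
  "standard_coframe N V 3 p [V 1 p] = 1" "standard_coframe N V 3 p [V 2 p] = - 1"
proof -
 have one: "1 : {1..3::nat}" by simp
 have "standard_coframe N V 1 p [V 2 p] = 1"
  using vol_basis[OF wframe_frame[OF V] p] unfolding standard_coframe_apply[OF V p one] n
  by (simp add: numeral_intervals del: upt_Suc)
 note tv = triple_values[where t = "%mm. standard_coframe N V mm p",
   OF V p form_on_alt[OF standard_coframe_alt[OF V] p] standard_coframe_kernel[OF V p] standard_coframe_sum this]
 show "standard_coframe N V 1 p [V 1 p] = 0" "standard_coframe N V 1 p [V 2 p] = 1"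
  "standard_coframe N V 2 p [V 1 p] = - 1" "standard_coframe N V 2 p [V 2 p] = 0"
  "standard_coframe N V 3 p [V 1 p] = 1" "standard_coframe N V 3 p [V 2 p] = - 1" by (simp_all only: tv)
qed

lemma two_form_zero:
 assumes V: "wframe N V" and p: "p : N" and h: "h : alt 2 p" and mm: "mm : {1..3}"
  and 0: "h [V mm p, V 1 p] = 0" "h [V mm p, V 2 p] = 0"
 shows "h = (%vs. 0)"
proof (rule alt_top_0[of h p V])
 note v1 = wframe_ts[OF V indices(4) p] and v2 = wframe_ts[OF V indices(5) p]
 have vs: "length [V 1 p, V 2 p] = 2" "set [V 1 p, V 2 p] \<subseteq> TS p" using v1 v2 by auto
 have e: "h [V 2 p, V 2 p] = 0" by (rule alt_equal[OF h, of 0 1]) simp_all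
 have sw: "h [V 1 p, V 2 p] = - h [V 2 p, V 1 p]"
  using alt_swap[OF h vs, of 0 1 "V 1 p" "V 2 p"] v1 v2 by simp
 have "mm = 1 \<or> mm = 2 \<or> mm = 3" using mm by (auto simp: numeral_intervals)
 then have "h [V 1 p, V 2 p] = 0"
 proof (elim disjE)
  assume "mm = 3"
  have "h [V 3 p, V 2 p] = - 1 * h [V 1 p + V 2 p, V 2 p]"
   using conjunct2[OF alt_slot[OF h vs, of 0 "V 1 p + V 2 p" "V 1 p" "- 1"]] ts_add[OF v1 v2] v1
   unfolding third_field[OF V p] by simp
  also have "h [V 1 p + V 2 p, V 2 p] = h [V 1 p, V 2 p]"
   using conjunct1[OF alt_slot[OF h vs, of 0 "V 1 p" "V 2 p"]] v1 v2 e by simp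
  finally show ?thesis using 0(2) \<open>mm = 3\<close> by simp
 qed (use 0 sw in simp_all)
 then show "h (map (%k. V k p) [1..<nn + 1]) = 0" unfolding n by (simp add: numeral_intervals del: upt_Suc)
 show "h : alt nn p" unfolding n by (rule h)
 show "basis_at V p" by (rule frame_basis[OF wframe_frame[OF V] p])
qed

text \<open>Contract both sides with \<open>V mm\<close>, which in dimension two determines them: the left side becomes the
 Lie derivative, that is, \<open>div V mm\<close> times the form, and \<open>div V mm = \<omega>(V mm)\<close>.\<close>

lemma standard_coframe_deriv:
 assumes V: "wframe N V" and p: "p : N" and mm: "mm : {1..3}"
 shows "extd N (standard_coframe N V mm) p = wedge [om N V, standard_coframe N V mm] p"
proof -
 note Fr = wframe_frame[OF V] note oN = frame_open[OF Fr]
 let ?b = "standard_coframe N V mm"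
 note b = standard_coframe_alt[OF V mm] and X = wframe_vf[OF V indices(1)[OF mm]]
 have om1: "fon 1 N (om N V)" by (rule om_form[OF Fr])
 have w2: "fon 2 N (wedge [om N V, ?b])"
 proof -
  have "fon (length [om N V, ?b]) N (wedge [om N V, ?b])"
   by (rule wedge_form) (use om1 b in auto)
  then show ?thesis by (simp add: numeral_2_eq_2)
 qed
 let ?h = "%vs. extd N ?b p vs + - 1 * wedge [om N V, ?b] p vs"
 have h: "?h : alt 2 p"
  by (rule alt_add[OF form_on_alt[OF ext_deriv(1)[OF oN b] p] alt_cmult[OF form_on_alt[OF w2 p]]])
 have val: "?h [V mm p, Y p] = 0" if Y: "vf N Y" for Y
 proof -
  have k0: "?b q [V mm q] = 0" if "q : N" for q by (rule standard_coframe_kernel[OF V that mm])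
  have "Y p (%q. 0) = Y p (%q. ?b q [V mm q])"
   by (rule tv_cong[OF vf_ts[OF Y p] an_const]) (use eventually_nhds_in_open[OF oN p] in \<open>eventually_elim, simp add: k0\<close>)
  then have Y0: "Y p (%q. ?b q [V mm q]) = 0" using vf_ts[OF Y p] by simp
  have "lieD (V mm) ?b [Y] p = vol N V p (V mm p # map (%Y. Y p) [Y]) * (V mm p (%_. 1) + 1 * om N V p [V mm p])"
  proof (rule lie_derivative_relation[OF V indices(1)[OF mm] an_const oN order_refl p X])
   show "V mm q : range (%c. fscale c (V mm q))" for q by (rule range_eqI[of _ _ 1]) (simp only: fscale_1)
   show "?b q us = 1 * vol N V q (V mm q # us)" if "q : N" for q us
    unfolding standard_coframe_apply[OF V that mm] by simp
  qed (use Y n in auto)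
  then have L: "V mm p (%q. ?b q [Y q]) - ?b p [lie (V mm) Y p] = ?b p [Y p] * om N V p [V mm p]"
   unfolding lie_derivative_def using vf_ts[OF X p] standard_coframe_apply[OF V p mm] by simp
  have "extd N ?b p [V mm p, Y p] = ?b p [Y p] * om N V p [V mm p]"
   unfolding ext_deriv(2)[OF oN b oN order_refl X Y p] ext_op_def Y0 using L by simp
  then show ?thesis unfolding wedge_pair k0[OF p] by simp
 qed
 have "?h = (%vs. 0)"
  by (rule two_form_zero[OF V p h mm val[OF wframe_vf[OF V indices(4)]] val[OF wframe_vf[OF V indices(5)]]])
 then have "?h vs = 0" for vs by (rule fun_cong)
 then show ?thesis by (intro ext) (simp add: add_eq_0_iff2)
qed

lemma wedge_determines:
 assumes V: "wframe N V" and p: "p : N" and g: "g p : alt 1 p" "g' p : alt 1 p"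
  and t: "!!mm. mm : {1..3} ==> \<theta> mm p = standard_coframe N V mm p"
  and eq: "!!mm. mm : {1..3} ==> wedge [g, \<theta> mm] p = wedge [g', \<theta> mm] p"
 shows "g p = g' p"
proof -
 note val = standard_coframe_values[OF V p]
 have t1: "\<theta> 1 p = standard_coframe N V 1 p" and t2: "\<theta> 2 p = standard_coframe N V 2 p" by (rule t, simp)+
 have "wedge [g, \<theta> 1] p [V 1 p, V 2 p] = wedge [g', \<theta> 1] p [V 1 p, V 2 p]" by (rule fun_cong[OF eq]) simp
 then have 1: "g p [V 1 p] = g' p [V 1 p]" unfolding wedge_pair t1 val by simp
 have "wedge [g, \<theta> 2] p [V 1 p, V 2 p] = wedge [g', \<theta> 2] p [V 1 p, V 2 p]" by (rule fun_cong[OF eq]) simp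
 then have "g p [V 2 p] = g' p [V 2 p]" unfolding wedge_pair t2 val by simp
 with 1 show ?thesis by (rule one_form_eq[OF V p g])
qed

context
 fixes N \<theta> F
 assumes F: "lo N F" and \<theta>: "!!mm. mm : {1..3} ==> fon 1 N (\<theta> mm)"
  and ker: "!!mm p. mm : {1..3} ==> p : N ==> {v : TS p. \<theta> mm p [v] = 0} = F mm p"
  and sum0: "(\<Sum>mm=1..3. \<theta> mm) = 0"
begin

text \<open>After rescaling, \<open>sg\<close> is related to the coframe by \<open>\<theta>\<^sub>1 (V\<^sub>2) = 1\<close>.\<close>

lemma normal_frame:
 assumes p: "p : N"
 obtains M sg where "p : M" "M \<subseteq> N" "lfr M F sg"
  "\<forall>q\<in>M. \<forall>mm\<in>{1..3}. \<theta> mm q = standard_coframe M (cfs F sg) mm q"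
proof -
 obtain M s where M: "p : M" "M \<subseteq> N" and lf: "lfr M F s" by (rule local_frame_exists[OF F p])
 let ?U = "cfs F s"
 note w = local_frame_wframe(1)[OF lf] and sp = local_frame_wframe(2)[OF lf] and oM = local_frameD(1)[OF lf]
 have one: "1 : {1..3::nat}" by simp
 define u where "u q = \<theta> 1 q [?U 2 q]" for q
 have u_an: "an q u" if "q : M" for q
  unfolding u_def by (rule one_form_an[OF loD(1)[OF F] \<theta>[OF one] oM M(2) wframe_vf[OF w indices(5)] that])
 have u0: "u q ~= 0" if q: "q : M" for q
 proof
  assume "u q = 0"
  then have "?U 2 q : F 1 q"
   using ker[OF one subsetD[OF M(2) q]] wframe_ts[OF w indices(5) q] unfolding u_def by blast
  then obtain c where c: "?U 2 q = fscale c (?U 1 q)" unfolding spansD[OF sp q indices(4)] by (rule rangeE)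
  have "c ~= 0"
  proof
   assume "c = 0"
   then show False using wframe_nonzero[OF w q indices(5)] c fscale_0(1)[of "?U 1 q"] by simp
  qed
  then have "F 2 q = F 1 q"
   unfolding spansD[OF sp q indices(4)] spansD[OF sp q indices(5)] c by (rule range_fscale)
  from inj_onD[OF lines_distinct[OF w sp q] this indices(5,4)] show False by simp
 qed
 define sg where "sg q = fscale2 (1 / u q) (s q)" for q
 let ?V = "cfs F sg"
 have VU: "?V mm q = fscale (1 / u q) (?U mm q)" for mm q
  unfolding component_fields_def sg_def fscale2_apply ..
 have lf': "lfr M F sg"
  unfolding local_frame_def
 proof (intro conjI ballI oM local_frameD(2,3,4)[OF lf])
  show "Esec M sg"
  proof (rule E_section_criterion[OF w sp local_frameD(4)[OF lf] order_refl])
   show "sg q : Efib q" if "q : M" for q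
    unfolding sg_def local_frame_wframe(3)[OF lf that] by (rule rangeI)
   show "vf M (%q. sg q (F mm q))" if "mm : {1..nn + 1}" for mm
    unfolding component_fields_def[of F sg, symmetric] VU
    by (rule vf_fscale[OF oM wframe_vf[OF w that]]) (intro an_divide an_const u_an u0)
  qed
  fix q assume q: "q : M"
  show "sg q ~= 0"
  proof
   assume "sg q = 0"
   then have "(1 / u q) * s q L f = 0" for L f
    using fun_cong[OF fun_cong[of "sg q" 0 L], of f] unfolding sg_def fscale2_apply fscale_apply by simp
   then have "s q = 0" using u0[OF q] by (intro ext) simp
   then show False using local_frameD(6)[OF lf q] by blast
  qed
 qed
 note w' = local_frame_wframe(1)[OF lf'] and sp' = local_frame_wframe(2)[OF lf']
 have "\<theta> mm q = standard_coframe M ?V mm q" if q: "q : M" and mm: "mm : {1..3}" for q mm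
 proof -
  have qN: "q : N" using q M by blast
  have al: "\<theta> mm q : alt 1 q" if "mm : {1..3}" for mm by (rule form_on_alt[OF \<theta>[OF that] qN])
  have k: "\<theta> mm q [?V mm q] = 0" if "mm : {1..3}" for mm
  proof -
   have "?V mm q : F mm q"
    unfolding spansD[OF sp' q indices(1)[OF that]] by (rule range_eqI[of _ _ 1]) (simp only: fscale_1)
   then show ?thesis unfolding ker[OF that qN, symmetric] by simp
  qed
  have s0: "\<theta> 1 q [v] + \<theta> 2 q [v] + \<theta> 3 q [v] = 0" for v
   using fun_cong[OF fun_cong[OF sum0, of q], of "[v]"] by (simp add: numeral_intervals add.assoc)
  have one1: "\<theta> 1 q [?V 2 q] = 1"
   unfolding VU alt_1(2)[OF al[OF one] wframe_ts[OF w indices(5) q]] using u0[OF q] by (simp add: u_def)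
  note tv = triple_values[OF w' q al k s0 one1] and sv = standard_coframe_values[OF w' q]
  show ?thesis
  proof (rule one_form_eq[OF w' q al[OF mm] form_on_alt[OF standard_coframe_alt[OF w' mm] q]])
   have "mm = 1 \<or> mm = 2 \<or> mm = 3" using mm by (auto simp: numeral_intervals)
   then show "\<theta> mm q [?V 1 q] = standard_coframe M ?V mm q [?V 1 q]"
    "\<theta> mm q [?V 2 q] = standard_coframe M ?V mm q [?V 2 q]"
    by (elim disjE; simp only: tv sv)+
  qed
 qed
 then show thesis by (intro that[OF M lf'] ballI)
qed

text \<open>Over a normalized frame \<open>\<gamma>\<close> is \<open>\<omega>\<close>.  It is determined at each point by its wedge products with
 \<open>\<theta> 1\<close> and \<open>\<theta> 2\<close>, so these forms glue.\<close>

lemma blaschke_gluing: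
 "\<exists>\<gamma>. fon 1 N \<gamma> & (\<forall>mm\<in>{1..3}. extd N (\<theta> mm) = wedge [\<gamma>, \<theta> mm]) \<and>
  (\<forall>p\<in>N. \<forall>\<gamma>'. fon 1 N \<gamma>' --> (\<forall>mm\<in>{1..3}. extd N (\<theta> mm) = wedge [\<gamma>', \<theta> mm]) --> \<gamma>' p = \<gamma> p) \<and>
  (\<forall>p\<in>N. K0 p = extd N \<gamma> p)"
proof -
 note oN = loD(1)[OF F]
 define P where "P p M sg \<longleftrightarrow> p : M & M \<subseteq> N & lfr M F sg \<and>
  (\<forall>q\<in>M. \<forall>mm\<in>{1..3}. \<theta> mm q = standard_coframe M (cfs F sg) mm q)" for p M sg
 have ex: "\<exists>M sg. P p M sg" if p: "p : N" for p
 proof -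
  obtain M sg where "p : M" "M \<subseteq> N" "lfr M F sg"
   "\<forall>q\<in>M. \<forall>mm\<in>{1..3}. \<theta> mm q = standard_coframe M (cfs F sg) mm q" by (rule normal_frame[OF p])
  then show ?thesis unfolding P_def by (intro exI conjI)
 qed
 have PD: "p : M" "M \<subseteq> N" "lfr M F sg" "mm : {1..3} ==> q : M ==> \<theta> mm q = standard_coframe M (cfs F sg) mm q"
  if "P p M sg" for p M sg q mm using that unfolding P_def by simp_all
 have P_at: "P q M sg" if "P p M sg" "q : M" for p q M sg using that unfolding P_def by simp
 define omq where "omq M sg = om M (cfs F sg)" for M sg
 have wf: "wframe M (cfs F sg)" if "P p M sg" for p M sg by (rule local_frame_wframe(1)[OF PD(3)[OF that]])
 have o_form: "fon 1 M (omq M sg)" if "P p M sg" for p M sg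
  unfolding omq_def by (rule om_form[OF wframe_frame[OF wf[OF that]]])
 have wcong: "wedge [\<alpha>, \<beta>] p = wedge [\<alpha>', \<beta>'] p" if "\<alpha> p = \<alpha>' p" "\<beta> p = \<beta>' p"
  for p :: 'a and \<alpha> \<beta> \<alpha>' \<beta>' :: "('a, 'k) dform"
 proof
  fix vs
  have P: "(\<Prod>a<length [\<alpha>, \<beta>]. ([\<alpha>, \<beta>] ! a) p [vs ! \<pi> a]) = (\<Prod>a<length [\<alpha>', \<beta>']. ([\<alpha>', \<beta>'] ! a) p [vs ! \<pi> a])" for \<pi>
   using that by (simp add: lessThan_Suc)
  show "wedge [\<alpha>, \<beta>] p vs = wedge [\<alpha>', \<beta>'] p vs" unfolding wedge_def P by simp
 qed
 have deriv: "extd N (\<theta> mm) p = wedge [omq M sg, \<theta> mm] p" if P: "P p M sg" and mm: "mm : {1..3}" for p M sg mm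
 proof -
  note p = PD(1)[OF P] and w = wf[OF P]
  have "extd N (\<theta> mm) p = extd M (standard_coframe M (cfs F sg) mm) p"
   by (rule ext_deriv_local[OF oN \<theta>[OF mm] local_frameD(1)[OF PD(3)[OF P]] standard_coframe_alt[OF w mm] p PD(2)[OF P]])
    (rule PD(4)[OF P mm])
  also have "... = wedge [omq M sg, standard_coframe M (cfs F sg) mm] p"
   unfolding omq_def by (rule standard_coframe_deriv[OF w p mm])
  also have "... = wedge [omq M sg, \<theta> mm] p" by (rule wcong, rule refl, rule PD(4)[OF P mm p, symmetric])
  finally show ?thesis .
 qed
 have uniq: "\<gamma>' p = omq M sg p" if P: "P p M sg" and g: "\<gamma>' p : alt 1 p"
  and e: "!!mm. mm : {1..3} ==> extd N (\<theta> mm) p = wedge [\<gamma>', \<theta> mm] p" for p M sg and \<gamma>' :: "('a, 'k) dform"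
 proof (rule wedge_determines[where g = \<gamma>' and g' = "omq M sg" and p = p, OF wf[OF P] PD(1)[OF P] g form_on_alt[OF o_form[OF P] PD(1)[OF P]]])
  show "\<theta> mm p = standard_coframe M (cfs F sg) mm p" if "mm : {1..3}" for mm by (rule PD(4)[OF P that PD(1)[OF P]])
  show "wedge [\<gamma>', \<theta> mm] p = wedge [omq M sg, \<theta> mm] p" if "mm : {1..3}" for mm
   using e[OF that] deriv[OF P that] by simp
 qed
 define \<gamma> where "\<gamma> p = (if p : N then SOME e. \<exists>M sg. P p M sg & e = omq M sg p else 0)" for p
 have \<gamma>: "\<gamma> p = omq M sg p" if P: "P p M sg" for p M sg
 proof -
  have pN: "p : N" using PD(1,2)[OF P] by blast
  have "\<exists>M' sg'. P p M' sg' & \<gamma> p = omq M' sg' p"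
   unfolding \<gamma>_def if_P[OF pN] 
   by (rule someI[of "%e. \<exists>M sg. P p M sg & e = omq M sg p" "omq M sg p"]) (intro exI[of _ M] exI[of _ sg] conjI P refl)
  then obtain M' sg' where P': "P p M' sg'" and e: "\<gamma> p = omq M' sg' p" by (elim exE conjE)
  show ?thesis
   unfolding e by (rule uniq[where \<gamma>' = "omq M' sg'" and p = p, OF P form_on_alt[OF o_form[OF P'] PD(1)[OF P']] deriv[OF P']])
 qed
 have \<gamma>_form: "fon 1 N \<gamma>"
 proof (rule form_on_local)
  show "\<gamma> p = 0" if "p \<notin> N" for p using that by (simp add: \<gamma>_def)
  fix p assume "p : N"
  from ex[OF this] obtain M sg where P: "P p M sg" by (elim exE)
  show "\<exists>M et'. open M & p : M & fon 1 M et' & (\<forall>q\<in>M. \<gamma> q = et' q)"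
   by (intro exI[of _ M] exI[of _ "omq M sg"] conjI ballI local_frameD(1)[OF PD(3)[OF P]] PD(1)[OF P] o_form[OF P]
     \<gamma>[OF P_at[OF P]])
 qed
 show ?thesis
 proof (intro exI[of _ \<gamma>] conjI ballI allI impI \<gamma>_form)
  fix mm :: nat assume mm: "mm : {1..3}"
  have "fon (length [\<gamma>, \<theta> mm]) N (wedge [\<gamma>, \<theta> mm])"
   by (rule wedge_form) (use \<gamma>_form \<theta>[OF mm] in auto)
  note wo = form_on_outside[OF this]
  show "extd N (\<theta> mm) = wedge [\<gamma>, \<theta> mm]"
  proof
   fix p
   show "extd N (\<theta> mm) p = wedge [\<gamma>, \<theta> mm] p"
   proof (cases "p : N")
    case True
    from ex[OF this] obtain M sg where P: "P p M sg" by (elim exE)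
    show ?thesis unfolding deriv[OF P mm] by (rule wcong, rule \<gamma>[OF P, symmetric], rule refl)
   next
    case False
    show ?thesis unfolding wo[OF False] by (rule form_on_outside[OF ext_deriv(1)[OF oN \<theta>[OF mm]] False])
   qed
  qed
 next
  fix p \<gamma>' assume p: "p : N" and g: "fon 1 N \<gamma>'" and e: "\<forall>mm\<in>{1..3}. extd N (\<theta> mm) = wedge [\<gamma>', \<theta> mm]"
  from ex[OF p] obtain M sg where P: "P p M sg" by (elim exE)
  show "\<gamma>' p = \<gamma> p"
   unfolding \<gamma>[OF P] by (rule uniq[where \<gamma>' = \<gamma>' and p = p, OF P form_on_alt[OF g p]]) (simp add: e)
 next
  fix p assume p: "p : N"
  from ex[OF p] obtain M sg where P: "P p M sg" by (elim exE)
  have "extd N \<gamma> p = extd M (omq M sg) p"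
   by (rule ext_deriv_local[OF oN \<gamma>_form local_frameD(1)[OF PD(3)[OF P]] o_form[OF P] PD(1,2)[OF P]])
    (rule \<gamma>[OF P_at[OF P]])
  then show "K0 p = extd N \<gamma> p"
   unfolding K0_eq[OF PD(3)[OF P] PD(1)[OF P]] Omega_form_def omq_def ..
 qed
qed

lemma blaschke_eq: "p : N ==> K0 p = extd N (blaschke_form \<A> N \<theta>) p"
proof -
 assume p: "p : N"
 obtain \<gamma> where g: "fon 1 N \<gamma>" "\<forall>mm\<in>{1..3}. extd N (\<theta> mm) = wedge [\<gamma>, \<theta> mm]"
  and u: "\<forall>p\<in>N. \<forall>\<gamma>'. fon 1 N \<gamma>' --> (\<forall>mm\<in>{1..3}. extd N (\<theta> mm) = wedge [\<gamma>', \<theta> mm]) --> \<gamma>' p = \<gamma> p"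
  and K: "\<forall>p\<in>N. K0 p = extd N \<gamma> p"
  using blaschke_gluing by (elim exE conjE)
 have "blaschke_form \<A> N \<theta> = \<gamma>"
  unfolding blaschke_form_def
 proof (rule the_equality)
  show "fon 1 N \<gamma> & (\<forall>mm\<in>{1..3}. extd N (\<theta> mm) = wedge [\<gamma>, \<theta> mm])" by (rule conjI[OF g])
  fix \<gamma>' assume g': "fon 1 N \<gamma>' & (\<forall>mm\<in>{1..3}. extd N (\<theta> mm) = wedge [\<gamma>', \<theta> mm])"
  show "\<gamma>' = \<gamma>"
  proof
   fix p
   show "\<gamma>' p = \<gamma> p"
   proof (cases "p : N")
    case True
    show ?thesis by (rule mp[OF mp[OF spec[OF bspec[OF u True]] conjunct1[OF g']] conjunct2[OF g']])
   next
    case False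
    show ?thesis using form_on_outside[OF g(1) False] form_on_outside[OF conjunct1[OF g'] False] by simp
   qed
  qed
 qed
 then show ?thesis using bspec[OF K p] by simp
qed

end

lemma blaschke: "blaschke_curvature \<A> W K0"
 unfolding blaschke_curvature_def
proof (intro conjI allI impI ballI K0_form)
 fix p
 obtain N F sg where lf: "lfr N F sg" "p : N" by (rule frame_at)
 let ?V = "cfs F sg"
 note w = local_frame_wframe(1)[OF lf(1)] and sp = local_frame_wframe(2)[OF lf(1)]
 have ker: "{v : TS q. standard_coframe N ?V mm q [v] = 0} = F mm q" if q: "q : N" and mm: "mm : {1..3}" for q mm
 proof (intro set_eqI iffI)
  fix v assume "v : F mm q"
  then obtain c where c: "v = fscale c (?V mm q)" unfolding spansD[OF sp q indices(1)[OF mm]] by (rule rangeE)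
  note t = wframe_ts[OF w indices(1)[OF mm] q]
  have "standard_coframe N ?V mm q [v] = 0"
   unfolding c alt_1(2)[OF form_on_alt[OF standard_coframe_alt[OF w mm] q] t] standard_coframe_kernel[OF w q mm] by simp
  then show "v : {v : TS q. standard_coframe N ?V mm q [v] = 0}" unfolding c using ts_fscale[OF t] by blast
 next
  fix v assume "v : {v : TS q. standard_coframe N ?V mm q [v] = 0}"
  then have v: "v : TS q" and 0: "standard_coframe N ?V mm q [v] = 0" by auto
  let ?a = "fco ?V q v 1" and ?b = "fco ?V q v 2"
  have "v = (\<Sum>k=1..nn. fscale (fco ?V q v k) (?V k q))"
   by (rule frame_coeff_expand[OF frame_basis[OF wframe_frame[OF w] q] v])
  also have "... = fscale ?a (?V 1 q) + fscale ?b (?V 2 q)" unfolding n by (simp only: numeral_intervals) simp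
  finally have e: "v = fscale ?a (?V 1 q) + fscale ?b (?V 2 q)" .
  have al: "standard_coframe N ?V mm q : alt 1 q" by (rule form_on_alt[OF standard_coframe_alt[OF w mm] q])
  note t1 = wframe_ts[OF w indices(4) q] and t2 = wframe_ts[OF w indices(5) q]
  have "standard_coframe N ?V mm q [v] = standard_coframe N ?V mm q [fscale ?a (?V 1 q) + fscale ?b (?V 2 q)]"
   by (rule arg_cong[OF e])
  also have "... = ?a * standard_coframe N ?V mm q [?V 1 q] + ?b * standard_coframe N ?V mm q [?V 2 q]"
   unfolding alt_1(1)[OF al ts_fscale[OF t1] ts_fscale[OF t2]] alt_1(2)[OF al t1] alt_1(2)[OF al t2] ..
  finally have z: "?a * standard_coframe N ?V mm q [?V 1 q] + ?b * standard_coframe N ?V mm q [?V 2 q] = 0"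
   unfolding 0 by (rule sym)
  have "mm = 1 \<or> mm = 2 \<or> mm = 3" using mm by (auto simp: numeral_intervals)
  then have "\<exists>c. fscale ?a (?V 1 q) + fscale ?b (?V 2 q) = fscale c (?V mm q)"
  proof (elim disjE)
   assume m: "mm = 1"
   have "?b = 0" using z unfolding m standard_coframe_values[OF w q] by simp
   then show ?thesis unfolding m by (intro exI[of _ ?a]) (simp only: fscale_0 add_0_right)
  next
   assume m: "mm = 2"
   have "?a = 0" using z unfolding m standard_coframe_values[OF w q] by simp
   then show ?thesis unfolding m by (intro exI[of _ ?b]) (simp only: fscale_0 add_0_left)
  next
   assume m: "mm = 3"
   have "?a = ?b" using z unfolding m standard_coframe_values[OF w q] by simp
   then show ?thesis unfolding m third_field[OF w q] fscale_fscale
    by (intro exI[of _ "- ?b"] ext) (simp only: fscale_apply plus_fun_apply, simp add: distrib_left)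
  qed
  then obtain c where "fscale ?a (?V 1 q) + fscale ?b (?V 2 q) = fscale c (?V mm q)" ..
  with e have "v = fscale c (?V mm q)" by (rule trans)
  then show "v : F mm q" unfolding spansD[OF sp q indices(1)[OF mm]] by (rule range_eqI)
 qed
 have "(\<Sum>mm=1..3. standard_coframe N ?V mm) = 0"
  by (intro ext) (simp only: numeral_intervals, use standard_coframe_sum[of N ?V] in \<open>simp add: add.assoc\<close>)
 then have "blaschke_coframe \<A> W N (standard_coframe N ?V)"
  unfolding blaschke_coframe_def
  by (intro conjI exI[of _ F] local_frameD(4)[OF lf(1)] ballI standard_coframe_alt[OF w] ker)
 then show "\<exists>N \<theta>. p : N & blaschke_coframe \<A> W N \<theta>" using lf(2) by (intro exI conjI)
next
 fix N \<theta> p assume c: "blaschke_coframe \<A> W N \<theta>" and p: "p : N"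
 from c obtain F where F: "lo N F" and f: "\<forall>mm\<in>{1..3}. fon 1 N (\<theta> mm) & (\<forall>p\<in>N. {v : TS p. \<theta> mm p [v] = 0} = F mm p)"
  and s: "(\<Sum>mm=1..3. \<theta> mm) = 0" unfolding blaschke_coframe_def by (elim exE conjE)
 show "K0 p = extd N (blaschke_form \<A> N \<theta>) p"
 proof (rule blaschke_eq[OF F _ _ s p])
  show "fon 1 N (\<theta> mm)" if "mm : {1..3}" for mm using bspec[OF f that] by (rule conjunct1)
  show "{v : TS p. \<theta> mm p [v] = 0} = F mm p" if "mm : {1..3}" "p : N" for mm p
   using bspec[OF f that(1)] that(2) by simp
 qed
qed

end

end

theorem mainTheorem1:
  fixes \<A> :: "('a::{t2_space,second_countable_topology},
                'k::{real_normed_field,euclidean_space}, 'n::finite) atlas"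
    and W :: "'a \<Rightarrow> ('a, 'k) tvec set set"
  assumes "analytic_manifold \<A>"
    and "connected (UNIV :: 'a set)"
    and "mdim \<A> \<ge> 2"
    and "web_of_curves \<A> W"
  shows
    "(\<forall>N F \<sigma>. local_frame \<A> W N F \<sigma> \<longrightarrow>
        bij_betw (abelian_relation_of \<A> N (component_fields F \<sigma>))
          (potentials \<A> N (component_fields F \<sigma>)) (abelian_relations \<A> N F - {0}) \<and>
        (Omega_form \<A> N (component_fields F \<sigma>) = 0 \<longrightarrow> web_rank \<A> W = 1) \<and>
        (Omega_form \<A> N (component_fields F \<sigma>) \<noteq> 0 \<longrightarrow> web_rank \<A> W = 0))
   \<and>
     (\<forall>N F \<sigma>. local_frame \<A> W N F \<sigma> \<longrightarrow> (\<exists>D. local_connection \<A> W N F \<sigma> D)) \<and>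
     (\<forall>N F \<sigma> D N' F' \<sigma>' D'.
        local_frame \<A> W N F \<sigma> \<longrightarrow> local_connection \<A> W N F \<sigma> D \<longrightarrow>
        local_frame \<A> W N' F' \<sigma>' \<longrightarrow> local_connection \<A> W N' F' \<sigma>' D' \<longrightarrow>
        connections_agree \<A> W (mdim \<A> - 1) (N \<inter> N') D D') \<and>
     (\<exists>G. global_connection \<A> W G) \<and>
     (\<forall>G G'. global_connection \<A> W G \<longrightarrow> global_connection \<A> W G' \<longrightarrow>
        connections_agree \<A> W (mdim \<A> - 1) UNIV G G') \<and>
     (\<forall>G. global_connection \<A> W G \<longrightarrow>
        (\<forall>N F. local_ordering \<A> W N F \<longrightarrow>
           (\<exists>\<Phi>. bij_betw \<Phi> (abelian_relations \<A> N F) (flat_sections \<A> W (mdim \<A> - 1) N G) \<and>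
              (\<forall>\<eta>\<in>abelian_relations \<A> N F. \<forall>\<eta>'\<in>abelian_relations \<A> N F. \<Phi> (\<eta> + \<eta>') = \<Phi> \<eta> + \<Phi> \<eta>') \<and>
              (\<forall>\<eta>\<in>abelian_relations \<A> N F. \<forall>c. \<Phi> (\<lambda>\<mu>. fscale2 c (\<eta> \<mu>)) = fscale2 c (\<Phi> \<eta>)) \<and>
              (\<forall>O' \<sigma> f. O' \<subseteq> N \<longrightarrow> local_frame \<A> W O' F \<sigma> \<longrightarrow>
                 (\<forall>\<eta>\<in>abelian_relations \<A> N F.
                    (\<forall>p\<in>O'. \<forall>\<mu>. \<eta> \<mu> p = abelian_relation_of \<A> O' (component_fields F \<sigma>) f \<mu> p) \<longrightarrow>
                    (\<forall>p\<in>O'. \<Phi> \<eta> p = fscale (f p) (dual_power W (mdim \<A> - 1) O' \<sigma> p)))))) \<and>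
        (\<exists>!K. curvature_form \<A> W (mdim \<A> - 1) UNIV G K) \<and>
        (\<forall>K. curvature_form \<A> W (mdim \<A> - 1) UNIV G K \<longrightarrow>
           (\<forall>N F \<sigma>. local_frame \<A> W N F \<sigma> \<longrightarrow>
              (\<forall>p\<in>N. K p = Omega_form \<A> N (component_fields F \<sigma>) p)) \<and>
           (K = 0 \<longrightarrow> web_rank \<A> W = 1) \<and> (K \<noteq> 0 \<longrightarrow> web_rank \<A> W = 0)
   \<and>
           (mdim \<A> = 2 \<longrightarrow> blaschke_curvature \<A> W K)))"
  proof -
  interpret web \<A> W
    by unfold_locales (fact assms)+
  show ?thesis
  proof (intro conjI allI impI)
    fix N F \<sigma> assume lf: "local_frame \<A> W N F \<sigma>"
    note w = local_frame_wframe(1)[OF lf] and sp = local_frame_wframe(2)[OF lf]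
    show "bij_betw (abelian_relation_of \<A> N (component_fields F \<sigma>))
          (potentials \<A> N (component_fields F \<sigma>)) (abelian_relations \<A> N F - {0})"
      by (rule relations_bij[OF w n2 sp local_frameD(2,3)[OF lf]])
    show "web_rank \<A> W = 1" if "Omega_form \<A> N (component_fields F \<sigma>) = 0"
      using that K0_zero[OF lf] by (intro rank_1) simp
    show "web_rank \<A> W = 0" if "Omega_form \<A> N (component_fields F \<sigma>) \<noteq> 0"
      using that K0_zero[OF lf] by (intro rank_0) simp
    show "\<exists>D. local_connection \<A> W N F \<sigma> D" by (rule exI[of _ G], rule G_local_connection[OF lf])
  next
    fix N F \<sigma> D N' F' \<sigma>' D'
    assume "local_frame \<A> W N F \<sigma>" "local_connection \<A> W N F \<sigma> D"
      "local_frame \<A> W N' F' \<sigma>'" "local_connection \<A> W N' F' \<sigma>' D'"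
    then show "connections_agree \<A> W (mdim \<A> - 1) (N \<inter> N') D D'" by (rule local_connections_agree)
  next
    show "\<exists>G. global_connection \<A> W G" by (rule exI[of _ G], rule G_global)
  next
    fix D D' assume "global_connection \<A> W D" "global_connection \<A> W D'"
    then show "connections_agree \<A> W (mdim \<A> - 1) UNIV D D'" by (rule global_connections_agree)
  next
    fix D N F assume D: "global_connection \<A> W D" and F: "local_ordering \<A> W N F"
    show "\<exists>\<Phi>. bij_betw \<Phi> (abelian_relations \<A> N F) (flat_sections \<A> W (mdim \<A> - 1) N D) \<and>
        (\<forall>\<eta>\<in>abelian_relations \<A> N F. \<forall>\<eta>'\<in>abelian_relations \<A> N F. \<Phi> (\<eta> + \<eta>') = \<Phi> \<eta> + \<Phi> \<eta>') \<and>
        (\<forall>\<eta>\<in>abelian_relations \<A> N F. \<forall>c. \<Phi> (\<lambda>\<mu>. fscale2 c (\<eta> \<mu>)) = fscale2 c (\<Phi> \<eta>)) \<and>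
        (\<forall>O' \<sigma> f. O' \<subseteq> N \<longrightarrow> local_frame \<A> W O' F \<sigma> \<longrightarrow>
           (\<forall>\<eta>\<in>abelian_relations \<A> N F.
              (\<forall>p\<in>O'. \<forall>\<mu>. \<eta> \<mu> p = abelian_relation_of \<A> O' (component_fields F \<sigma>) f \<mu> p) \<longrightarrow>
              (\<forall>p\<in>O'. \<Phi> \<eta> p = fscale (f p) (dual_power W (mdim \<A> - 1) O' \<sigma> p))))"
    proof (intro exI[of _ "relation_section N F"] conjI ballI allI impI)
      show "bij_betw (relation_section N F) (abelian_relations \<A> N F) (flat_sections \<A> W (mdim \<A> - 1) N D)"
        by (rule relation_section_bij[OF D F])
      show "relation_section N F (\<eta> + \<eta>') = relation_section N F \<eta> + relation_section N F \<eta>'" for \<eta> \<eta>'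
        by (intro ext) (simp add: relation_section_def)
      show "relation_section N F (\<lambda>\<mu>. fscale2 c (\<eta> \<mu>)) = fscale2 c (relation_section N F \<eta>)" for \<eta> c
        by (intro ext) (simp add: relation_section_def fscale2_def)
      fix O' \<sigma> f \<eta> p
      assume O': "O' \<subseteq> N" and lf: "local_frame \<A> W O' F \<sigma>" and \<eta>: "\<eta> \<in> abelian_relations \<A> N F"
        and e: "\<forall>p\<in>O'. \<forall>\<mu>. \<eta> \<mu> p = abelian_relation_of \<A> O' (component_fields F \<sigma>) f \<mu> p" and p: "p \<in> O'"
      show "relation_section N F \<eta> p = fscale (f p) (dual_power W (mdim \<A> - 1) O' \<sigma> p)"
        by (rule relation_section_frame[OF lf O' \<eta> p])
           (simp only: bspec[OF e p, rule_format] relation_coefficient[OF local_frame_wframe(1)[OF lf] p])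
    qed
  next
    fix D assume D: "global_connection \<A> W D"
    show "\<exists>!K. curvature_form \<A> W (mdim \<A> - 1) UNIV D K"
      by (rule ex1I[of _ K0], rule K0_curvature[OF D], rule curvature_K0[OF D])
  next
    fix D K assume D: "global_connection \<A> W D" and "curvature_form \<A> W (mdim \<A> - 1) UNIV D K"
    then have K: "K = K0" by (rule curvature_K0)
    show "\<forall>p\<in>N. K p = Omega_form \<A> N (component_fields F \<sigma>) p" if "local_frame \<A> W N F \<sigma>" for N F \<sigma>
      unfolding K by (intro ballI K0_eq[OF that])
    show "web_rank \<A> W = 1" if "K = 0" using that unfolding K by (rule rank_1)
    show "web_rank \<A> W = 0" if "K \<noteq> 0" using that unfolding K by (rule rank_0)
    show "blaschke_curvature \<A> W K" if "mdim \<A> = 2" unfolding K by (rule blaschke[OF that])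
  qed
qed


end
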